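(* Let $G$ be a finitely generated infinite group with a fixed finite symmetric generating set, and let $f$ be a Floyd function. Let $\mu$ be a probability measure on $G$ whose support generates $G$ as a semigroup and whose random walk is transient. Assume that either (a) the support of $\mu$ is finite, or (b) $\mu$ has superexponential moment and $x^{2+\alpha}f(x)\to0$ as $x\to\infty$ for some $\alpha>0$. Then the identity map on $G$ induces a continuous $G$-equivariant surjection $\pi:\partial_{\mathcal M}G\to\partial_fG$ from the Martin boundary of $(G,\mu)$ to the Floyd boundary of $G$ (that is, whenever a sequence $x_n\in G$ converges to $\alpha\in\partial_{\mathcal M}G$ in the Martin compactification, $x_n$ converges to $\pi(\alpha)$ in the Floyd compactification). Moreover, the preimage under $\pi$ of any conical point of $\partial_fG$ is a single point.
   Context: $d$ is the word metric on $G$ for the fixed finite symmetric generating set, $\|g\|=d(e,g)$, and $o\in G$ is a basepoint. The measure $\mu$ has superexponential moment if $\sum_{g}c^{\|g\|}\mu(g)<\infty$ for every $c>1$. Martin boundary: $\mathcal G(x,y)=\sum_{n\ge0}\mu^{*n}(x^{-1}y)$ (transience: finite for all $x,y$) and $d_{\mathcal G}(x,y)=-\ln\frac{\mathcal G(x,y)}{\mathcal G(e,e)}$. The Martin compactification $\overline G_{\mathcal M}=G\sqcup\partial_{\mathcal M}G$ is the horofunction compactification of $(G,d_{\mathcal G})$: $\partial_{\mathcal M}G$ is the set of functions $h:G\to\mathbb R$ of the form $h(x)=\lim_n (d_{\mathcal G}(x,x_n)-d_{\mathcal G}(o,x_n))$ (for all $x\in G$) for an unbounded sequence $x_n\in G$,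 with the topology of pointwise convergence; an unbounded sequence $x_n$ leaving every finite set converges to $h$ iff this limit holds for all $x$. $G$ acts by the continuous extension of left multiplication. Floyd function: a nonincreasing function $f:[0,\infty)\to(0,\infty)$ with $\sum_{k\ge0}f(k)<\infty$ and such that there is $\kappa\ge1$ with $f(n)/f(n+1)\le\kappa$ for all $n\in\mathbb N$. For a vertex $v$, an edge $\{a,b\}$ of the Cayley graph has $(f,v)$-length $f(\min(d(v,a),d(v,b)))$, and $\delta^f_v(x,y)$ is the minimal total $(f,v)$-length of an edge path from $x$ to $y$. The Floyd compactification $\overline G_f$ is the Cauchy completion of $(G,\delta^f_v)$ (independent of $v$ up to homeomorphism over $G$; left multiplication extends to it by homeomorphisms) and $\partial_fG=\overline G_f\setminus G$. A point $\zeta\in\partial_fG$ is conical if there are a sequence $g_n\in G$ and distinct points $a,b\in\partial_fG$ such that $g_n\zeta\to a$ and $g_n\eta\to b$ for all $\eta\in\overline G_f\setminus\{\zeta\}$. *)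

theory Defs
  imports "HOL-Probability.Probability"
begin

text \<open>
  Groups are written additively and are not assumed to be commutative: they are types of class
  \<^class>\<open>group_add\<close>, so that \<open>x + y\<close> is the product of \<open>x\<close> and \<open>y\<close> in this order, \<open>0\<close> is the
  neutral element \<open>e\<close>, and \<open>- x + y\<close> stands for the product of the inverse of \<open>x\<close> with \<open>y\<close>.
\<close>

section \<open>Word metric\<close>

text \<open>For a symmetric set, being generated as a group and as a monoid is the same thing.\<close>

definition sym_gen_set :: "'a::group_add set \<Rightarrow> bool" where
  "sym_gen_set S \<longleftrightarrow> finite S \<and> (\<forall>s\<in>S. - s \<in> S) \<and> (\<forall>g. \<exists>ws. set ws \<subseteq> S \<and> sum_list ws = g)"

definition semigroup_generates :: "'a::group_add set \<Rightarrow> bool" where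
  "semigroup_generates A \<longleftrightarrow> (\<forall>g. \<exists>ws. ws \<noteq> [] \<and> set ws \<subseteq> A \<and> sum_list ws = g)"

definition word_norm :: "'a::group_add set \<Rightarrow> 'a \<Rightarrow> nat" where
  "word_norm S g = (LEAST n. \<exists>ws. length ws = n \<and> set ws \<subseteq> S \<and> sum_list ws = g)"

definition word_dist :: "'a::group_add set \<Rightarrow> 'a \<Rightarrow> 'a \<Rightarrow> nat" where
  "word_dist S x y = word_norm S (- x + y)"


section \<open>Random walks and the Martin boundary\<close>

primrec conv_power :: "'a::group_add pmf \<Rightarrow> nat \<Rightarrow> 'a pmf" where
  "conv_power \<mu> 0 = return_pmf 0"
| "conv_power \<mu> (Suc n) =
     bind_pmf (conv_power \<mu> n) (\<lambda>x. bind_pmf \<mu> (\<lambda>y. return_pmf (x + y)))"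

definition transient :: "'a::group_add pmf \<Rightarrow> bool" where
  "transient \<mu> \<longleftrightarrow> (\<forall>x y. summable (\<lambda>n. pmf (conv_power \<mu> n) (- x + y)))"

definition superexp_moment :: "'a::group_add set \<Rightarrow> 'a pmf \<Rightarrow> bool" where
  "superexp_moment S \<mu> \<longleftrightarrow>
     (\<forall>c::real. c > 1 \<longrightarrow> (\<lambda>g. c ^ word_norm S g * pmf \<mu> g) summable_on UNIV)"

definition green :: "'a::group_add pmf \<Rightarrow> 'a \<Rightarrow> 'a \<Rightarrow> real" where
  "green \<mu> x y = (\<Sum>n. pmf (conv_power \<mu> n) (- x + y))"

definition green_dist :: "'a::group_add pmf \<Rightarrow> 'a \<Rightarrow> 'a \<Rightarrow> real" where
  "green_dist \<mu> x y = - ln (green \<mu> x y / green \<mu> 0 0)"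

definition martin_limit :: "'a::group_add pmf \<Rightarrow> 'a \<Rightarrow> (nat \<Rightarrow> 'a) \<Rightarrow> ('a \<Rightarrow> real) \<Rightarrow> bool" where
  "martin_limit \<mu> bp x h \<longleftrightarrow>
     (\<forall>z. (\<lambda>n. green_dist \<mu> z (x n) - green_dist \<mu> bp (x n)) \<longlonglongrightarrow> h z)"

text \<open>Unboundedness refers to the word metric; the Green distance may stay bounded along
  sequences leaving every finite set.\<close>

definition martin_boundary ::
    "'a::group_add set \<Rightarrow> 'a pmf \<Rightarrow> 'a \<Rightarrow> ('a \<Rightarrow> real) set" where
  "martin_boundary S \<mu> bp =
     {h. \<exists>x. (\<forall>r. \<exists>n. r < word_dist S bp (x n)) \<and> martin_limit \<mu> bp x h}"

text \<open>The topology of \<^typ>\<open>'a \<Rightarrow> real\<close> is the product topology, i.e. that of pointwise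
  convergence.\<close>

definition martin_topology ::
    "'a::group_add set \<Rightarrow> 'a pmf \<Rightarrow> 'a \<Rightarrow> ('a \<Rightarrow> real) topology" where
  "martin_topology S \<mu> bp = subtopology euclidean (martin_boundary S \<mu> bp)"

definition martin_converges ::
    "'a::group_add pmf \<Rightarrow> 'a \<Rightarrow> (nat \<Rightarrow> 'a) \<Rightarrow> ('a \<Rightarrow> real) \<Rightarrow> bool" where
  "martin_converges \<mu> bp x h \<longleftrightarrow> filterlim x cofinite sequentially \<and> martin_limit \<mu> bp x h"

text \<open>The continuous extension of left multiplication by \<open>g\<close>, see \<open>martin_converges_act\<close>.\<close>

definition martin_act :: "'a::group_add \<Rightarrow> 'a \<Rightarrow> ('a \<Rightarrow> real) \<Rightarrow> ('a \<Rightarrow> real)" where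
  "martin_act bp g h = (\<lambda>z. h (- g + z) - h (- g + bp))"

lemma green_dist_translate: "green_dist \<mu> z (g + x) = green_dist \<mu> (- g + z) x"
  by (simp add: green_dist_def green_def minus_add add.assoc)

lemma martin_converges_act:
  assumes "martin_converges \<mu> bp x h"
  shows "martin_converges \<mu> bp (\<lambda>n. g + x n) (martin_act bp g h)"
proof -
  have "filterlim (\<lambda>n. g + x n) cofinite sequentially"
    unfolding filterlim_iff eventually_cofinite
  proof (intro allI impI)
    fix P :: "'a \<Rightarrow> bool"
    assume fin: "finite {y. \<not> P y}"
    have "{y. \<not> P (g + y)} \<subseteq> (\<lambda>y. - g + y) ` {y. \<not> P y}"
    proof
      fix y assume "y \<in> {y. \<not> P (g + y)}"
      then have "g + y \<in> {y. \<not> P y}" "y = - g + (g + y)" by (simp_all add: add.assoc [symmetric])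
      then show "y \<in> (\<lambda>y. - g + y) ` {y. \<not> P y}" by blast
    qed
    then have "eventually (\<lambda>y. P (g + y)) cofinite"
      unfolding eventually_cofinite using fin finite_subset by blast
    then show "eventually (\<lambda>n. P (g + x n)) sequentially"
      using assms unfolding martin_converges_def filterlim_iff by blast
  qed
  moreover have "martin_limit \<mu> bp (\<lambda>n. g + x n) (martin_act bp g h)"
    unfolding martin_limit_def martin_act_def green_dist_translate
  proof
    fix z
    have "(\<lambda>n. (green_dist \<mu> (- g + z) (x n) - green_dist \<mu> bp (x n))
             - (green_dist \<mu> (- g + bp) (x n) - green_dist \<mu> bp (x n)))
          \<longlonglongrightarrow> h (- g + z) - h (- g + bp)"
      using assms by (intro tendsto_diff) (auto simp: martin_converges_def martin_limit_def)
    then show "(\<lambda>n. green_dist \<mu> (- g + z) (x n) - green_dist \<mu> (- g + bp) (x n))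
          \<longlonglongrightarrow> h (- g + z) - h (- g + bp)"
      by simp
  qed
  ultimately show ?thesis
    by (simp add: martin_converges_def)
qed


section \<open>Floyd compactification\<close>

definition floyd_function :: "(real \<Rightarrow> real) \<Rightarrow> bool" where
  "floyd_function f \<longleftrightarrow>
     (\<forall>x\<ge>0. f x > 0) \<and> (\<forall>x y. 0 \<le> x \<longrightarrow> x \<le> y \<longrightarrow> f y \<le> f x) \<and>
     summable (\<lambda>k. f (real k)) \<and>
     (\<exists>\<kappa>\<ge>1. \<forall>n::nat. f (real n) / f (real (n + 1)) \<le> \<kappa>)"

text \<open>An edge path in the (right) Cayley graph is given by the nonempty list of its vertices.\<close>

definition edge_path :: "'a::group_add set \<Rightarrow> 'a \<Rightarrow> 'a \<Rightarrow> 'a list \<Rightarrow> bool" where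
  "edge_path S x y p \<longleftrightarrow>
     p \<noteq> [] \<and> hd p = x \<and> last p = y \<and> successively (\<lambda>a b. \<exists>s\<in>S. b = a + s) p"

definition floyd_length ::
    "'a::group_add set \<Rightarrow> (real \<Rightarrow> real) \<Rightarrow> 'a \<Rightarrow> 'a list \<Rightarrow> real" where
  "floyd_length S f v p =
     (\<Sum>(a, b)\<leftarrow>zip p (tl p). f (real (min (word_dist S v a) (word_dist S v b))))"

text \<open>The least length need not be attained, hence the infimum.\<close>

definition floyd_dist ::
    "'a::group_add set \<Rightarrow> (real \<Rightarrow> real) \<Rightarrow> 'a \<Rightarrow> 'a \<Rightarrow> 'a \<Rightarrow> real" where
  "floyd_dist S f v x y = Inf (floyd_length S f v ` {p. edge_path S x y p})"

text \<open>The Cauchy completion: classes of Cauchy sequences whose distance tends to \<open>0\<close>.\<close>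

definition floyd_equiv ::
    "'a::group_add set \<Rightarrow> (real \<Rightarrow> real) \<Rightarrow> 'a \<Rightarrow> ((nat \<Rightarrow> 'a) \<times> (nat \<Rightarrow> 'a)) set" where
  "floyd_equiv S f v =
     {(s, t). Metric_space.MCauchy UNIV (floyd_dist S f v) s \<and>
              Metric_space.MCauchy UNIV (floyd_dist S f v) t \<and>
              (\<lambda>n. floyd_dist S f v (s n) (t n)) \<longlonglongrightarrow> 0}"

definition floyd_compactification ::
    "'a::group_add set \<Rightarrow> (real \<Rightarrow> real) \<Rightarrow> 'a \<Rightarrow> (nat \<Rightarrow> 'a) set set" where
  "floyd_compactification S f v =
     {s. Metric_space.MCauchy UNIV (floyd_dist S f v) s} // floyd_equiv S f v"

text \<open>The value \<open>0\<close> off the space is needed because \<^locale>\<open>Metric_space\<close> asks for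
  nonnegativity and symmetry everywhere.\<close>

definition floyd_compactification_dist ::
    "'a::group_add set \<Rightarrow> (real \<Rightarrow> real) \<Rightarrow> 'a \<Rightarrow> (nat \<Rightarrow> 'a) set \<Rightarrow> (nat \<Rightarrow> 'a) set \<Rightarrow> real" where
  "floyd_compactification_dist S f v X Y =
     (if X \<in> floyd_compactification S f v \<and> Y \<in> floyd_compactification S f v
      then THE r. \<exists>s\<in>X. \<exists>t\<in>Y. (\<lambda>n. floyd_dist S f v (s n) (t n)) \<longlonglongrightarrow> r
      else 0)"

definition floyd_topology ::
    "'a::group_add set \<Rightarrow> (real \<Rightarrow> real) \<Rightarrow> 'a \<Rightarrow> (nat \<Rightarrow> 'a) set topology" where
  "floyd_topology S f v =
     Metric_space.mtopology (floyd_compactification S f v) (floyd_compactification_dist S f v)"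

definition floyd_embed ::
    "'a::group_add set \<Rightarrow> (real \<Rightarrow> real) \<Rightarrow> 'a \<Rightarrow> 'a \<Rightarrow> (nat \<Rightarrow> 'a) set" where
  "floyd_embed S f v g = floyd_equiv S f v `` {\<lambda>n. g}"

definition floyd_boundary ::
    "'a::group_add set \<Rightarrow> (real \<Rightarrow> real) \<Rightarrow> 'a \<Rightarrow> (nat \<Rightarrow> 'a) set set" where
  "floyd_boundary S f v = floyd_compactification S f v - range (floyd_embed S f v)"

text \<open>The extension of left multiplication: the class of \<open>s\<close> is sent to the class of the sequence
  \<open>\<lambda>n. g + s n\<close>, see \<open>floyd_act_class\<close>.\<close>

definition floyd_act ::
    "'a::group_add set \<Rightarrow> (real \<Rightarrow> real) \<Rightarrow> 'a \<Rightarrow> 'a \<Rightarrow> (nat \<Rightarrow> 'a) set \<Rightarrow> (nat \<Rightarrow> 'a) set" where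
  "floyd_act S f v g X = floyd_equiv S f v `` ((\<lambda>s n. g + s n) ` X)"

subsection \<open>Well-definedness\<close>

lemma word_norm_witness:
  assumes "sym_gen_set S"
  obtains ws where "length ws = word_norm S g" "set ws \<subseteq> S" "sum_list ws = g"
proof -
  obtain ws where "set ws \<subseteq> S \<and> sum_list ws = g"
    using assms unfolding sym_gen_set_def by blast
  then have "\<exists>n ws. length ws = n \<and> set ws \<subseteq> S \<and> sum_list ws = g" by blast
  from LeastI_ex [OF this] show ?thesis
    unfolding word_norm_def [symmetric] using that by blast
qed

lemma word_norm_add:
  assumes "sym_gen_set S"
  shows "word_norm S (g + h) \<le> word_norm S g + word_norm S h"
proof -
  obtain us where us: "length us = word_norm S g" "set us \<subseteq> S" "sum_list us = g"
    by (rule word_norm_witness [OF assms])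
  obtain ws where ws: "length ws = word_norm S h" "set ws \<subseteq> S" "sum_list ws = h"
    by (rule word_norm_witness [OF assms])
  show ?thesis
    unfolding word_norm_def [of S "g + h"]
    by (rule Least_le) (use us ws in \<open>auto intro!: exI [of _ "us @ ws"]\<close>)
qed

lemma word_dist_triangle:
  assumes "sym_gen_set S"
  shows "word_dist S x z \<le> word_dist S x y + word_dist S y z"
  using word_norm_add [OF assms, of "- x + y" "- y + z"]
  by (simp add: word_dist_def add.assoc)

lemma floyd_length_Cons2:
  "floyd_length S f v (a # b # p) =
     f (real (min (word_dist S v a) (word_dist S v b))) + floyd_length S f v (b # p)"
  by (simp add: floyd_length_def)

lemma floyd_length_single: "floyd_length S f v [a] = 0"
  by (simp add: floyd_length_def)

lemma floyd_length_append:
  "floyd_length S f v (p @ a # q) = floyd_length S f v (p @ [a]) + floyd_length S f v (a # q)"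
proof (induction p)
  case Nil
  then show ?case by (simp add: floyd_length_single)
next
  case (Cons b p)
  then show ?case by (cases p) (simp_all add: floyd_length_Cons2 floyd_length_single)
qed

lemma floyd_length_rev: "floyd_length S f v (rev p) = floyd_length S f v p"
proof (induction p)
  case (Cons a p)
  show ?case
  proof (cases p)
    case (Cons b q)
    have "floyd_length S f v (rev (a # p)) =
        floyd_length S f v (rev p) + floyd_length S f v [b, a]"
      using floyd_length_append [of S f v "rev q" b "[a]"] by (simp add: Cons)
    then show ?thesis
      using Cons.IH by (simp add: Cons floyd_length_Cons2 floyd_length_single min.commute)
  qed simp
qed simp

lemma floyd_length_nonneg:
  assumes "floyd_function f"
  shows "0 \<le> floyd_length S f v p"
  using assms unfolding floyd_length_def floyd_function_def
  by (intro sum_list_nonneg) (auto intro: less_imp_le)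

lemma edge_path_exists:
  assumes "sym_gen_set S"
  shows "\<exists>p. edge_path S x y p"
proof -
  have *: "\<exists>p. edge_path S x (x + sum_list ws) p" if "set ws \<subseteq> S" for ws
    using that
  proof (induction ws arbitrary: x)
    case Nil
    have "edge_path S x x [x]" by (simp add: edge_path_def)
    then show ?case by auto
  next
    case (Cons w ws)
    then obtain p where p: "edge_path S (x + w) (x + w + sum_list ws) p" by fastforce
    then have "edge_path S x (x + w + sum_list ws) (x # p)"
      using Cons.prems by (cases p) (auto simp: edge_path_def)
    then show ?case by (auto simp: add.assoc)
  qed
  obtain ws where "set ws \<subseteq> S" "sum_list ws = - x + y"
    using assms unfolding sym_gen_set_def by blast
  with * [of ws] show ?thesis by (simp add: add.assoc [symmetric])
qed

lemma edge_path_rev: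
  assumes "sym_gen_set S" "edge_path S x y p"
  shows "edge_path S y x (rev p)"
proof -
  have "successively (\<lambda>a b. \<exists>s\<in>S. a = b + s) p"
  proof (rule successively_mono [where P = "\<lambda>a b. \<exists>s\<in>S. b = a + s"])
    show "successively (\<lambda>a b. \<exists>s\<in>S. b = a + s) p"
      using assms(2) by (simp add: edge_path_def)
    fix a b assume "\<exists>s\<in>S. b = a + s"
    then obtain s where "s \<in> S" "b = a + s" by blast
    then have "- s \<in> S" "a = b + - s"
      using assms(1) by (simp_all add: sym_gen_set_def add.assoc del: add_uminus_conv_diff)
    then show "\<exists>s\<in>S. a = b + s" by blast
  qed
  then show ?thesis
    using assms by (simp add: edge_path_def hd_rev last_rev)
qed

lemma edge_path_append:
  assumes "edge_path S x y p" "edge_path S y z q"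
  shows "\<exists>r. edge_path S x z r \<and>
    floyd_length S f v r = floyd_length S f v p + floyd_length S f v q"
proof -
  obtain p' where p: "p = p' @ [y]"
    using assms(1) by (metis append_butlast_last_id edge_path_def)
  obtain q' where q: "q = y # q'"
    using assms(2) by (metis edge_path_def list.collapse)
  have "edge_path S x z (p' @ y # q')"
    using assms by (auto simp: edge_path_def p q successively_append_iff hd_append split: if_splits)
  then show ?thesis
    using floyd_length_append [of S f v p' y q'] p q by blast
qed

lemma floyd_dist_le:
  assumes "floyd_function f" "edge_path S x y p"
  shows "floyd_dist S f v x y \<le> floyd_length S f v p"
  unfolding floyd_dist_def
  by (rule cInf_lower) (use assms floyd_length_nonneg in \<open>auto intro!: bdd_belowI [of _ 0]\<close>)

lemma floyd_dist_ge:
  assumes "sym_gen_set S" "\<And>p. edge_path S x y p \<Longrightarrow> r \<le> floyd_length S f v p"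
  shows "r \<le> floyd_dist S f v x y"
  unfolding floyd_dist_def
  by (rule cInf_greatest) (use assms edge_path_exists [of S x y] in auto)

lemma floyd_dist_nonneg:
  assumes "sym_gen_set S" "floyd_function f"
  shows "0 \<le> floyd_dist S f v x y"
  using assms by (intro floyd_dist_ge floyd_length_nonneg)

lemma floyd_dist_sym_le:
  assumes "sym_gen_set S" "floyd_function f"
  shows "floyd_dist S f v x y \<le> floyd_dist S f v y x"
proof (rule floyd_dist_ge [OF assms(1)])
  fix p assume "edge_path S y x p"
  then have "edge_path S x y (rev p)" by (rule edge_path_rev [OF assms(1)])
  from floyd_dist_le [OF assms(2) this] show "floyd_dist S f v x y \<le> floyd_length S f v p"
    by (simp add: floyd_length_rev)
qed

lemma floyd_dist_triangle:
  assumes "sym_gen_set S" "floyd_function f"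
  shows "floyd_dist S f v x z \<le> floyd_dist S f v x y + floyd_dist S f v y z"
proof -
  have "floyd_dist S f v x z - floyd_dist S f v y z \<le> floyd_dist S f v x y"
  proof (rule floyd_dist_ge [OF assms(1)])
    fix p assume p: "edge_path S x y p"
    have "floyd_dist S f v x z - floyd_length S f v p \<le> floyd_dist S f v y z"
    proof (rule floyd_dist_ge [OF assms(1)])
      fix q assume "edge_path S y z q"
      from edge_path_append [OF p this, of f v] floyd_dist_le [OF assms(2), of S x z _ v]
      show "floyd_dist S f v x z - floyd_length S f v p \<le> floyd_length S f v q" by force
    qed
    then show "floyd_dist S f v x z - floyd_dist S f v y z \<le> floyd_length S f v p" by simp
  qed
  then show ?thesis by simp
qed

lemma floyd_dist_pos:
  assumes "sym_gen_set S" "floyd_function f" "x \<noteq> y"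
  shows "0 < floyd_dist S f v x y"
proof -
  have "f (real (word_dist S v x)) \<le> floyd_dist S f v x y"
  proof (rule floyd_dist_ge [OF assms(1)])
    fix p assume p: "edge_path S x y p"
    then obtain b q where q: "p = x # b # q"
      using assms(3) unfolding edge_path_def by (cases p; cases "tl p") auto
    have "f (real (word_dist S v x)) \<le> f (real (min (word_dist S v x) (word_dist S v b)))"
      using assms(2) unfolding floyd_function_def by auto
    then show "f (real (word_dist S v x)) \<le> floyd_length S f v p"
      using floyd_length_nonneg [OF assms(2), of S v "b # q"] by (simp add: q floyd_length_Cons2)
  qed
  moreover have "0 < f (real (word_dist S v x))"
    using assms(2) by (simp add: floyd_function_def)
  ultimately show ?thesis by simp
qed

lemma Metric_space_floyd_dist:
  assumes "sym_gen_set S" "floyd_function f"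
  shows "Metric_space UNIV (floyd_dist S f v)"
proof
  fix x y z
  show "0 \<le> floyd_dist S f v x y" by (rule floyd_dist_nonneg [OF assms])
  show "floyd_dist S f v x y = floyd_dist S f v y x"
    by (intro antisym floyd_dist_sym_le assms)
  show "floyd_dist S f v x z \<le> floyd_dist S f v x y + floyd_dist S f v y z"
    by (rule floyd_dist_triangle [OF assms])
  have "edge_path S x x [x]" by (simp add: edge_path_def)
  from floyd_dist_le [OF assms(2) this, of v]
  have "floyd_dist S f v x x = 0"
    using floyd_dist_nonneg [OF assms, of v x x] by (simp add: floyd_length_single)
  then show "floyd_dist S f v x y = 0 \<longleftrightarrow> x = y"
    using floyd_dist_pos [OF assms, of x y v] by force
qed

lemma equiv_floyd_equiv:
  assumes "sym_gen_set S" "floyd_function f"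
  shows "equiv {s. Metric_space.MCauchy UNIV (floyd_dist S f v) s} (floyd_equiv S f v)"
proof -
  interpret M: Metric_space UNIV "floyd_dist S f v" by (rule Metric_space_floyd_dist [OF assms])
  show ?thesis
  proof (rule equivI)
    show "floyd_equiv S f v \<subseteq> {s. M.MCauchy s} \<times> {s. M.MCauchy s}"
      by (auto simp: floyd_equiv_def)
    show "refl_on {s. M.MCauchy s} (floyd_equiv S f v)"
      by (auto simp: refl_on_def floyd_equiv_def)
    show "sym (floyd_equiv S f v)"
      by (auto simp: sym_def floyd_equiv_def M.commute)
    show "trans (floyd_equiv S f v)"
    proof (rule transI)
      fix s t u assume st: "(s, t) \<in> floyd_equiv S f v" and tu: "(t, u) \<in> floyd_equiv S f v"
      have lim: "(\<lambda>n. floyd_dist S f v (s n) (t n) + floyd_dist S f v (t n) (u n)) \<longlonglongrightarrow> 0"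
        using st tu by (intro tendsto_add_zero) (auto simp: floyd_equiv_def)
      have "(\<lambda>n. floyd_dist S f v (s n) (u n)) \<longlonglongrightarrow> 0"
        by (rule tendsto_sandwich [OF _ _ tendsto_const lim]) (simp_all add: M.triangle)
      then show "(s, u) \<in> floyd_equiv S f v"
        using st tu by (auto simp: floyd_equiv_def)
    qed
  qed
qed

lemma floyd_act_class:
  assumes S: "sym_gen_set S" and f: "floyd_function f"
    and s: "Metric_space.MCauchy UNIV (floyd_dist S f v) s"
  shows "Metric_space.MCauchy UNIV (floyd_dist S f v) (\<lambda>n. g + s n)"
    and "floyd_act S f v g (floyd_equiv S f v `` {s}) = floyd_equiv S f v `` {\<lambda>n. g + s n}"
proof -
  interpret M: Metric_space UNIV "floyd_dist S f v" by (rule Metric_space_floyd_dist [OF S f])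
  obtain \<kappa> where \<kappa>: "1 \<le> \<kappa>" "\<And>n::nat. f (real n) / f (real (n + 1)) \<le> \<kappa>"
    using f unfolding floyd_function_def by blast
  have pos: "0 < f (real n)" for n using f by (simp add: floyd_function_def)
  have mono: "f (real n) \<le> f (real m)" if "m \<le> n" for m n :: nat
    using f that by (simp add: floyd_function_def)
  have step: "f (real n) \<le> \<kappa> ^ m * f (real (n + m))" for n m
  proof (induction m)
    case (Suc m)
    have "f (real (n + m)) \<le> \<kappa> * f (real (n + m + 1))"
      using \<kappa>(2) [of "n + m"] pos [of "n + m + 1"] by (simp add: divide_le_eq)
    then have "\<kappa> ^ m * f (real (n + m)) \<le> \<kappa> ^ m * (\<kappa> * f (real (n + m + 1)))"
      using \<kappa>(1) by (intro mult_left_mono) auto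
    with Suc show ?case by (simp add: mult_ac)
  qed simp
  define m where "m = word_dist S v (- g + v)"
  define K where "K = \<kappa> ^ m"
  have K: "1 \<le> K" using \<kappa>(1) by (simp add: K_def)
  have wd: "word_dist S v a \<le> word_dist S v (g + a) + m" for a
    using word_dist_triangle [OF S, of v a "- g + v"]
    by (simp add: m_def word_dist_def minus_add add.assoc)
  have len: "floyd_length S f v (map ((+) g) p) \<le> K * floyd_length S f v p" for p
  proof (induction p rule: induct_list012)
    case (3 a b p)
    let ?i = "min (word_dist S v (g + a)) (word_dist S v (g + b))"
    have "f (real ?i) \<le> K * f (real (?i + m))" unfolding K_def by (rule step)
    also have "\<dots> \<le> K * f (real (min (word_dist S v a) (word_dist S v b)))"
      using K wd [of a] wd [of b] by (intro mult_left_mono mono) (auto simp: min_def)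
    finally show ?case
      using 3 by (simp add: floyd_length_Cons2 distrib_left)
  qed (simp_all add: floyd_length_def)
  have lip: "floyd_dist S f v (g + x) (g + y) \<le> K * floyd_dist S f v x y" for x y
  proof -
    have "floyd_dist S f v (g + x) (g + y) / K \<le> floyd_dist S f v x y"
    proof (rule floyd_dist_ge [OF S])
      fix p assume "edge_path S x y p"
      then have "edge_path S (g + x) (g + y) (map ((+) g) p)"
        by (auto simp: edge_path_def successively_map hd_map last_map add.assoc)
      from floyd_dist_le [OF f this, of v] len [of p]
      show "floyd_dist S f v (g + x) (g + y) / K \<le> floyd_length S f v p"
        using K by (simp add: divide_le_eq mult.commute)
    qed
    then show ?thesis using K by (simp add: divide_le_eq mult.commute)
  qed
  have cauchy: "M.MCauchy (\<lambda>n. g + t n)" if tc: "M.MCauchy t" for t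
    unfolding M.MCauchy_def
  proof (intro conjI allI impI)
    fix \<epsilon> :: real assume "0 < \<epsilon>"
    then have "0 < \<epsilon> / K" using K by simp
    then obtain N where N: "\<And>n n'. N \<le> n \<Longrightarrow> N \<le> n' \<Longrightarrow> floyd_dist S f v (t n) (t n') < \<epsilon> / K"
      using tc unfolding M.MCauchy_def by meson
    show "\<exists>N. \<forall>n n'. N \<le> n \<longrightarrow> N \<le> n' \<longrightarrow> floyd_dist S f v (g + t n) (g + t n') < \<epsilon>"
    proof (intro exI [of _ N] allI impI)
      fix n n' assume "N \<le> n" "N \<le> n'"
      then have "K * floyd_dist S f v (t n) (t n') < \<epsilon>"
        using N [of n n'] K by (simp add: less_divide_eq mult.commute)
      then show "floyd_dist S f v (g + t n) (g + t n') < \<epsilon>"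
        using lip [of "t n" "t n'"] by linarith
    qed
  qed simp
  show "M.MCauchy (\<lambda>n. g + s n)" by (rule cauchy [OF s])
  note E = equiv_floyd_equiv [OF S f, of v]
  have img: "(\<lambda>n. g + s n, \<lambda>n. g + t n) \<in> floyd_equiv S f v" if "(s, t) \<in> floyd_equiv S f v" for t
  proof -
    have lim: "(\<lambda>n. K * floyd_dist S f v (s n) (t n)) \<longlonglongrightarrow> 0"
      using that by (intro tendsto_mult_right_zero) (auto simp: floyd_equiv_def)
    have "(\<lambda>n. floyd_dist S f v (g + s n) (g + t n)) \<longlonglongrightarrow> 0"
      by (rule tendsto_sandwich [OF _ _ tendsto_const lim]) (simp_all add: lip)
    then show ?thesis using that cauchy by (auto simp: floyd_equiv_def)
  qed
  have refl: "(s, s) \<in> floyd_equiv S f v"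
    using s by (simp add: floyd_equiv_def)
  show "floyd_act S f v g (floyd_equiv S f v `` {s}) = floyd_equiv S f v `` {\<lambda>n. g + s n}"
    (is "?L = ?R")
  proof
    show "?L \<subseteq> ?R"
      unfolding floyd_act_def using img E by (auto elim!: equivE dest: transD)
    show "?R \<subseteq> ?L"
      unfolding floyd_act_def using refl by auto
  qed
qed

lemma floyd_compactification_dist_class:
  assumes S: "sym_gen_set S" and f: "floyd_function f"
    and s: "Metric_space.MCauchy UNIV (floyd_dist S f v) s"
    and t: "Metric_space.MCauchy UNIV (floyd_dist S f v) t"
  shows "(\<lambda>n. floyd_dist S f v (s n) (t n)) \<longlonglongrightarrow>
    floyd_compactification_dist S f v (floyd_equiv S f v `` {s}) (floyd_equiv S f v `` {t})"
proof -
  interpret M: Metric_space UNIV "floyd_dist S f v" by (rule Metric_space_floyd_dist [OF S f])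
  let ?d = "floyd_dist S f v"
  have quad: "\<bar>?d a b - ?d a' b'\<bar> \<le> ?d a a' + ?d b b'" for a b a' b'
    using M.triangle [of a a' b] M.triangle [of a' b' b] M.triangle [of a' a b'] M.triangle [of a b b']
      M.commute [of a a'] M.commute [of b b'] by simp
  have "Cauchy (\<lambda>n. ?d (s n) (t n))"
    unfolding Cauchy_def dist_real_def
  proof (intro allI impI)
    fix e :: real assume "0 < e"
    then have "0 < e / 2" by simp
    then obtain N N' where
      N: "\<And>n n'. N \<le> n \<Longrightarrow> N \<le> n' \<Longrightarrow> ?d (s n) (s n') < e / 2" and
      N': "\<And>n n'. N' \<le> n \<Longrightarrow> N' \<le> n' \<Longrightarrow> ?d (t n) (t n') < e / 2"
      using s t unfolding M.MCauchy_def by meson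
    show "\<exists>M. \<forall>m\<ge>M. \<forall>n\<ge>M. \<bar>?d (s m) (t m) - ?d (s n) (t n)\<bar> < e"
    proof (intro exI [of _ "max N N'"] allI impI)
      fix m n assume "max N N' \<le> m" "max N N' \<le> n"
      then show "\<bar>?d (s m) (t m) - ?d (s n) (t n)\<bar> < e"
        using N [of m n] N' [of m n] quad [of "s m" "t m" "s n" "t n"] by simp
    qed
  qed
  then obtain r where r: "(\<lambda>n. ?d (s n) (t n)) \<longlonglongrightarrow> r"
    using real_Cauchy_convergent convergent_def by blast
  have uniq: "r' = r" if "(s, s') \<in> floyd_equiv S f v" "(t, t') \<in> floyd_equiv S f v"
    "(\<lambda>n. ?d (s' n) (t' n)) \<longlonglongrightarrow> r'" for r' s' t'
  proof -
    have lim: "(\<lambda>n. ?d (s n) (s' n) + ?d (t n) (t' n)) \<longlonglongrightarrow> 0"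
      using that by (intro tendsto_add_zero) (auto simp: floyd_equiv_def)
    have "(\<lambda>n. \<bar>?d (s n) (t n) - ?d (s' n) (t' n)\<bar>) \<longlonglongrightarrow> 0"
      by (rule tendsto_sandwich [OF _ _ tendsto_const lim]) (simp_all add: quad)
    then have "(\<lambda>n. ?d (s n) (t n) - ?d (s' n) (t' n)) \<longlonglongrightarrow> 0"
      by (simp add: tendsto_rabs_zero_iff)
    moreover have "(\<lambda>n. ?d (s n) (t n) - ?d (s' n) (t' n)) \<longlonglongrightarrow> r - r'"
      using r that(3) by (rule tendsto_diff)
    ultimately show ?thesis using LIMSEQ_unique by force
  qed
  have mem: "s \<in> floyd_equiv S f v `` {s}" "t \<in> floyd_equiv S f v `` {t}"
    using s t by (simp_all add: floyd_equiv_def)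
  have "floyd_equiv S f v `` {s} \<in> floyd_compactification S f v"
    "floyd_equiv S f v `` {t} \<in> floyd_compactification S f v"
    unfolding floyd_compactification_def by (rule quotientI; simp add: s t)+
  then have "floyd_compactification_dist S f v (floyd_equiv S f v `` {s}) (floyd_equiv S f v `` {t}) =
    (THE r. \<exists>s'\<in>floyd_equiv S f v `` {s}. \<exists>t'\<in>floyd_equiv S f v `` {t}. (\<lambda>n. ?d (s' n) (t' n)) \<longlonglongrightarrow> r)"
    by (simp only: floyd_compactification_dist_def simp_thms if_True)
  also have "\<dots> = r"
  proof (rule the_equality)
    show "\<exists>s'\<in>floyd_equiv S f v `` {s}. \<exists>t'\<in>floyd_equiv S f v `` {t}. (\<lambda>n. ?d (s' n) (t' n)) \<longlonglongrightarrow> r"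
      using mem r by (intro bexI)
    fix r' assume "\<exists>s'\<in>floyd_equiv S f v `` {s}. \<exists>t'\<in>floyd_equiv S f v `` {t}.
      (\<lambda>n. ?d (s' n) (t' n)) \<longlonglongrightarrow> r'"
    then show "r' = r" by (elim bexE) (erule uniq [rotated 2]; simp)
  qed
  finally have "floyd_compactification_dist S f v (floyd_equiv S f v `` {s}) (floyd_equiv S f v `` {t}) = r" .
  with r show ?thesis by simp
qed

lemma Metric_space_floyd_compactification:
  assumes S: "sym_gen_set S" and f: "floyd_function f"
  shows "Metric_space (floyd_compactification S f v) (floyd_compactification_dist S f v)"
proof -
  interpret M: Metric_space UNIV "floyd_dist S f v" by (rule Metric_space_floyd_dist [OF S f])
  let ?D = "floyd_compactification_dist S f v" and ?c = "\<lambda>s. floyd_equiv S f v `` {s}"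
  note lim = floyd_compactification_dist_class [OF S f, of v]
  note E = equiv_floyd_equiv [OF S f, of v]
  have rep: "\<exists>s. M.MCauchy s \<and> X = ?c s" if "X \<in> floyd_compactification S f v" for X
    using that unfolding floyd_compactification_def by (auto elim!: quotientE)
  have nonneg: "0 \<le> ?D (?c s) (?c t)" if "M.MCauchy s" "M.MCauchy t" for s t
    by (rule LIMSEQ_le_const [OF lim [OF that]]) auto
  have sym: "?D (?c s) (?c t) = ?D (?c t) (?c s)" if "M.MCauchy s" "M.MCauchy t" for s t
    using LIMSEQ_unique [OF lim [OF that]] lim [OF that(2,1)] by (simp add: M.commute)
  have zero: "?D (?c s) (?c t) = 0 \<longleftrightarrow> ?c s = ?c t" if "M.MCauchy s" "M.MCauchy t" for s t
  proof -
    have "?D (?c s) (?c t) = 0 \<longleftrightarrow> (s, t) \<in> floyd_equiv S f v"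
      using lim [OF that] that LIMSEQ_unique unfolding floyd_equiv_def by fastforce
    also have "\<dots> \<longleftrightarrow> ?c s = ?c t"
      using eq_equiv_class_iff [OF E] that by simp
    finally show ?thesis .
  qed
  have tri: "?D (?c s) (?c u) \<le> ?D (?c s) (?c t) + ?D (?c t) (?c u)"
    if "M.MCauchy s" "M.MCauchy t" "M.MCauchy u" for s t u
    by (rule LIMSEQ_le [OF lim [OF that(1,3)] tendsto_add [OF lim [OF that(1,2)] lim [OF that(2,3)]]])
      (auto intro: M.triangle)
  show ?thesis
  proof (unfold_locales)
    fix X Y
    have out: "?D X Y = 0 \<and> ?D Y X = 0"
      if "\<not> (X \<in> floyd_compactification S f v \<and> Y \<in> floyd_compactification S f v)"
      using that by (auto simp: floyd_compactification_dist_def)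
    show "0 \<le> ?D X Y"
      using out rep nonneg by (metis order_refl)
    show "?D X Y = ?D Y X"
      using out rep sym by metis
  next
    fix X Y assume "X \<in> floyd_compactification S f v" "Y \<in> floyd_compactification S f v"
    then show "?D X Y = 0 \<longleftrightarrow> X = Y" using rep zero by metis
  next
    fix X Y Z assume "X \<in> floyd_compactification S f v" "Y \<in> floyd_compactification S f v"
      "Z \<in> floyd_compactification S f v"
    then show "?D X Z \<le> ?D X Y + ?D Y Z" using rep tri by metis
  qed
qed


subsection \<open>Conical points\<close>

definition conical_point ::
    "'a::group_add set \<Rightarrow> (real \<Rightarrow> real) \<Rightarrow> 'a \<Rightarrow> (nat \<Rightarrow> 'a) set \<Rightarrow> bool" where
  "conical_point S f v \<zeta> \<longleftrightarrow> \<zeta> \<in> floyd_boundary S f v \<and>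
     (\<exists>g a b. a \<in> floyd_boundary S f v \<and> b \<in> floyd_boundary S f v \<and> a \<noteq> b \<and>
        limitin (floyd_topology S f v) (\<lambda>n. floyd_act S f v (g n) \<zeta>) a sequentially \<and>
        (\<forall>\<eta>\<in>floyd_compactification S f v - {\<zeta>}.
           limitin (floyd_topology S f v) (\<lambda>n. floyd_act S f v (g n) \<eta>) b sequentially))"

end

theory Submission
  imports Defs
begin

text \<open>
  The Floyd distance \<open>\<delta>\<^sub>v\<close> governs geodesics (two points that are \<open>\<delta>\<^sub>v\<close>-apart are only joined by
  geodesics passing near \<open>v\<close>), and the key is that it governs the Green function as well. If the
  Floyd boundary has two points, the return probabilities decay exponentially: with at least three
  points, translations with attracting and repelling regions form a paradoxical configuration, which
  contracts the quadratic norm; with exactly two points, counting the elements that a translation moves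
  from one end to the other yields a cocycle, whose drift is nonzero by transience. Exponential decay and the
  superexponential moment give the Ancona inequality \<open>G(x, z) \<le> A G(x, v) G(v, z)\<close> whenever
  \<open>\<delta>\<^sub>v(x, z) \<ge> \<epsilon>\<close>, by a maximum principle applied at doubling scales.

  If sequences with distinct Floyd limits had the same Martin kernel \<open>K\<close>, then \<open>K\<close> would be harmonic and,
  by Ancona, bounded by a multiple of \<open>G(\<cdot>, e)\<close>, hence zero. So Martin limits determine Floyd limits,
  and compactness does the rest. At a conical point, Ancona holds along a sequence of intermediate
  points, and any harmonic function \<open>u \<le> c K\<close> satisfies \<open>u \<ge> c' u(o) K'\<close> for the kernels
  \<open>K, K'\<close> over that point; applied to \<open>K - t K'\<close> with \<open>t\<close> maximal, this forces \<open>K = K'\<close>.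
\<close>

section \<open>Potential theory of convolution operators\<close>

text \<open>The walk may jump over any ball, so an estimate at one scale always leaks; two reserves
  pay for this. Exponential decay leaves room for a finite Green function \<open>H\<close> of a
  larger weight, inflated by a constant and by an exponential of the jump length, and the
  superexponential moment makes long jumps cheaper than any Harnack constant. A doubling scale of
  radius r then consumes a multiple of r f(r) of Floyd distance; by Cauchy condensation, summability
  of f keeps the total small. A step enlarges the ball for only one of the two points, so the walk
  and the reflected walk alternate. Exponential decay is claimed only when the boundary has two
  points, and it is invoked only there: two Martin sequences with different Floyd limits provide
  them, and so does the definition of a conical point. Two ends need a separate argument because
  such a group carries no paradoxical configuration; there the decay comes from the transience of
  the given walk. The potential theory lives in the extended nonnegative reals, so that convergence
  matters only where a Green function must be finite.\<close>

definition markov :: "('a::group_add \<Rightarrow> ennreal) \<Rightarrow> ('a \<Rightarrow> ennreal) \<Rightarrow> 'a \<Rightarrow> ennreal" where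
  "markov w u x = (\<integral>\<^sup>+ s. w s * u (x + s) \<partial>count_space UNIV)"

text \<open>One theory for several weights: besides the law of the walk, \<open>ancona_step\<close>
  uses its restriction to short jumps and an inflated weight of mass above one. Values are extended,
  so a potential exists before anything is known to converge.\<close>

definition potential :: "('a::group_add \<Rightarrow> ennreal) \<Rightarrow> ('a \<Rightarrow> ennreal) \<Rightarrow> 'a \<Rightarrow> ennreal" where
  "potential w u x = (\<Sum>n. (markov w ^^ n) u x)"

definition green_kernel :: "('a::group_add \<Rightarrow> ennreal) \<Rightarrow> 'a \<Rightarrow> 'a \<Rightarrow> ennreal" where
  "green_kernel w x z = potential w (indicator {z}) x"

lemma markov_mono:
  assumes "\<And>x. u x \<le> v x"
  shows "markov w u x \<le> markov w v x"
  unfolding markov_def by (intro nn_integral_mono mult_left_mono assms) auto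

lemma markov_mono_weight:
  assumes "\<And>s. w s \<le> w' s"
  shows "markov w u x \<le> markov w' u x"
  unfolding markov_def by (intro nn_integral_mono mult_right_mono assms) auto

lemma markov_add: "markov w (\<lambda>x. u x + v x) = (\<lambda>x. markov w u x + markov w v x)"
  unfolding markov_def by (auto simp: distrib_left nn_integral_add)

lemma markov_cmult: "markov w (\<lambda>x. c * u x) = (\<lambda>x. c * markov w u x)"
  unfolding markov_def by (auto simp: mult.left_commute [of _ c] nn_integral_cmult)

lemma markov_scale_weight: "markov (\<lambda>s. c * w s) u = (\<lambda>x. c * markov w u x)"
  unfolding markov_def by (auto simp: mult.assoc nn_integral_cmult)

lemma markov_suminf: "markov w (\<lambda>x. \<Sum>n. u n x) = (\<lambda>x. \<Sum>n. markov w (u n) x)"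
proof
  fix x
  have "markov w (\<lambda>x. \<Sum>n. u n x) x = (\<integral>\<^sup>+ s. (\<Sum>n. w s * u n (x + s)) \<partial>count_space UNIV)"
    unfolding markov_def by simp
  also have "\<dots> = (\<Sum>n. markov w (u n) x)"
    unfolding markov_def by (intro nn_integral_suminf) auto
  finally show "markov w (\<lambda>x. \<Sum>n. u n x) x = (\<Sum>n. markov w (u n) x)" .
qed

lemma markov_translate: "markov w (\<lambda>x. u (g + x)) x = markov w u (g + x)"
  by (simp add: markov_def add.assoc)

lemma markov_SUP:
  assumes "\<And>x. incseq (\<lambda>m. u m x)"
  shows "markov w (\<lambda>x. SUP m. u m x) x = (SUP m. markov w (u m) x)"
proof -
  have "markov w (\<lambda>x. SUP m. u m x) x = (\<integral>\<^sup>+ s. (SUP m. w s * u m (x + s)) \<partial>count_space UNIV)"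
    unfolding markov_def by (simp add: SUP_mult_left_ennreal)
  also have "\<dots> = (SUP m. markov w (u m) x)"
    unfolding markov_def
    by (rule nn_integral_monotone_convergence_SUP)
      (use assms in \<open>auto simp: incseq_def le_fun_def intro!: mult_left_mono\<close>)
  finally show ?thesis .
qed

lemma markov_ge: "w s * u (x + s) \<le> markov w u x"
proof -
  have "w s * u (x + s) = (\<integral>\<^sup>+ t. w t * u (x + t) * indicator {s} t \<partial>count_space UNIV)"
    by (simp add: nn_integral_count_space_indicator [symmetric] nn_integral_count_space_finite)
  also have "\<dots> \<le> markov w u x"
    unfolding markov_def by (intro nn_integral_mono) (auto simp: indicator_def)
  finally show ?thesis .
qed

lemma markov_pow_mono:
  assumes "\<And>x. u x \<le> v x"
  shows "(markov w ^^ n) u x \<le> (markov w ^^ n) v x"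
  using assms by (induction n arbitrary: x) (auto intro: markov_mono)

lemma markov_pow_mono_weight:
  assumes "\<And>s. w s \<le> w' s"
  shows "(markov w ^^ n) u x \<le> (markov w' ^^ n) u x"
proof (induction n arbitrary: x)
  case (Suc n)
  have "markov w ((markov w ^^ n) u) x \<le> markov w ((markov w' ^^ n) u) x"
    by (rule markov_mono) (rule Suc)
  also have "\<dots> \<le> markov w' ((markov w' ^^ n) u) x"
    by (rule markov_mono_weight) (rule assms)
  finally show ?case by simp
qed simp

lemma markov_pow_add:
  "(markov w ^^ n) (\<lambda>x. u x + v x) = (\<lambda>x. (markov w ^^ n) u x + (markov w ^^ n) v x)"
  by (induction n) (simp_all add: markov_add)

lemma markov_pow_cmult: "(markov w ^^ n) (\<lambda>x. c * u x) = (\<lambda>x. c * (markov w ^^ n) u x)"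
  by (induction n) (simp_all add: markov_cmult)

lemma markov_pow_suminf:
  "(markov w ^^ n) (\<lambda>x. \<Sum>k. u k x) = (\<lambda>x. \<Sum>k. (markov w ^^ n) (u k) x)"
  by (induction n) (simp_all add: markov_suminf)

lemma markov_pow_translate: "(markov w ^^ n) (\<lambda>x. u (g + x)) x = (markov w ^^ n) u (g + x)"
proof (induction n arbitrary: x)
  case (Suc n)
  have "(markov w ^^ n) (\<lambda>x. u (g + x)) = (\<lambda>x. (markov w ^^ n) u (g + x))"
    using Suc by auto
  then show ?case by (simp add: markov_translate)
qed simp

lemma markov_pow_scale_weight:
  "(markov (\<lambda>s. c * w s) ^^ n) u = (\<lambda>x. c ^ n * (markov w ^^ n) u x)"
  by (induction n) (simp_all add: markov_scale_weight markov_cmult mult.assoc)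

lemma markov_pow_superharmonic:
  assumes "\<And>x. markov w u x \<le> u x"
  shows "(markov w ^^ n) u x \<le> u x"
proof (induction n arbitrary: x)
  case (Suc n)
  have "markov w ((markov w ^^ n) u) x \<le> markov w u x"
    by (rule markov_mono) (rule Suc)
  also have "\<dots> \<le> u x" by (rule assms)
  finally show ?case by simp
qed simp

lemma markov_pow_subharmonic:
  assumes "\<And>x. u x \<le> markov w u x"
  shows "u x \<le> (markov w ^^ n) u x"
proof (induction n arbitrary: x)
  case (Suc n)
  have "u x \<le> markov w u x" by (rule assms)
  also have "\<dots> \<le> markov w ((markov w ^^ n) u) x"
    by (rule markov_mono) (rule Suc)
  finally show ?case by simp
qed simp

lemma potential_pow: "(markov w ^^ N) (potential w u) x = (\<Sum>n. (markov w ^^ (n + N)) u x)"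
proof -
  have "(markov w ^^ N) (\<lambda>x. \<Sum>n. (markov w ^^ n) u x) = (\<lambda>x. \<Sum>n. (markov w ^^ N) ((markov w ^^ n) u) x)"
    by (rule markov_pow_suminf)
  moreover have "(\<lambda>x. \<Sum>n. (markov w ^^ n) u x) = potential w u"
    by (simp add: potential_def fun_eq_iff)
  moreover have "(markov w ^^ N) ((markov w ^^ n) u) = (markov w ^^ (n + N)) u" for n
    by (simp add: funpow_add add.commute [of n N])
  ultimately show ?thesis by simp
qed

lemma potential_unfold: "potential w u x = u x + markov w (potential w u) x"
proof -
  have "potential w u x = (\<Sum>n. (markov w ^^ (n + 1)) u x) + (\<Sum>n<1. (markov w ^^ n) u x)"
    unfolding potential_def by (rule suminf_offset) simp
  then show ?thesis
    using potential_pow [of 1 w u x] by (simp add: add.commute)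
qed

lemma potential_superharmonic: "markov w (potential w u) x \<le> potential w u x"
  using potential_unfold [of w u x] by simp

text \<open>\<open>N\<close> applications of the operator turn the series for the potential into its
  tail from index \<open>N\<close> on, and the tails of a finite sum vanish.\<close>

lemma potential_tendsto_zero:
  assumes "potential w u x < \<infinity>"
  shows "(\<lambda>N. (markov w ^^ N) (potential w u) x) \<longlonglongrightarrow> 0"
proof -
  let ?a = "\<lambda>n. (markov w ^^ n) u x"
  have eq: "potential w u x = (markov w ^^ N) (potential w u) x + (\<Sum>n<N. ?a n)" for N
    unfolding potential_pow unfolding potential_def by (rule suminf_offset) simp
  have fin: "(\<Sum>n<N. ?a n) < \<infinity>" for N
    using eq [of N] assms by (auto simp: less_top [symmetric])
  have lim: "(\<lambda>N. \<Sum>n<N. ?a n) \<longlonglongrightarrow> potential w u x"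
    unfolding potential_def by (rule summable_LIMSEQ) simp
  have "(\<lambda>N. potential w u x - (\<Sum>n<N. ?a n)) \<longlonglongrightarrow> potential w u x - potential w u x"
    by (rule tendsto_diff_ennreal) (use lim assms in auto)
  moreover have "potential w u x - (\<Sum>n<N. ?a n) = (markov w ^^ N) (potential w u) x" for N
  proof -
    have "potential w u x - (\<Sum>n<N. ?a n) =
        ((markov w ^^ N) (potential w u) x + (\<Sum>n<N. ?a n)) - (\<Sum>n<N. ?a n)"
      by (rule arg_cong [OF eq])
    then show ?thesis using fin [of N] by (simp only: ennreal_add_diff_cancel_right less_top infinity_ennreal_def)
  qed
  ultimately show ?thesis using assms by simp
qed

lemma potential_mono_weight:
  assumes "\<And>s. w s \<le> w' s"
  shows "potential w u x \<le> potential w' u x"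
  unfolding potential_def by (intro suminf_le markov_pow_mono_weight assms) auto

lemma potential_add: "potential w (\<lambda>x. u x + v x) x = potential w u x + potential w v x"
  by (simp add: potential_def markov_pow_add suminf_add)

lemma markov_pow_integral:
  "(markov w ^^ n) u x = (\<integral>\<^sup>+ z. u z * (markov w ^^ n) (indicator {z}) x \<partial>count_space UNIV)"
proof (induction n arbitrary: x)
  case 0
  have "u x = (\<integral>\<^sup>+ z. u x * indicator {x} z \<partial>count_space UNIV)"
    by (simp add: nn_integral_cmult)
  also have "\<dots> = (\<integral>\<^sup>+ z. u z * indicator {z} x \<partial>count_space UNIV)"
    by (intro nn_integral_cong) (auto simp: indicator_def)
  finally show ?case by simp
next
  case (Suc n)
  let ?p = "\<lambda>z. (markov w ^^ n) (indicator {z})"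
  have "(markov w ^^ Suc n) u x =
      (\<integral>\<^sup>+ s. \<integral>\<^sup>+ z. w s * (u z * ?p z (x + s)) \<partial>count_space UNIV \<partial>count_space UNIV)"
    using Suc [abs_def] by (simp add: markov_def nn_integral_cmult)
  also have "\<dots> = (\<integral>\<^sup>+ z. \<integral>\<^sup>+ s. w s * (u z * ?p z (x + s)) \<partial>count_space UNIV \<partial>count_space UNIV)"
    using nn_integral_fst_count_space [of "\<lambda>(s, z). w s * (u z * ?p z (x + s))"]
      nn_integral_snd_count_space [of "\<lambda>(s, z). w s * (u z * ?p z (x + s))"] by simp
  also have "\<dots> = (\<integral>\<^sup>+ z. u z * (markov w ^^ Suc n) (indicator {z}) x \<partial>count_space UNIV)"
    by (simp add: markov_def mult.left_commute [of "w _" "u _"] nn_integral_cmult)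
  finally show ?case .
qed

lemma potential_integral:
  "potential w u x = (\<integral>\<^sup>+ z. u z * green_kernel w x z \<partial>count_space UNIV)"
proof -
  have "potential w u x = (\<Sum>n. \<integral>\<^sup>+ z. u z * (markov w ^^ n) (indicator {z}) x \<partial>count_space UNIV)"
    unfolding potential_def by (intro suminf_cong markov_pow_integral)
  also have "\<dots> = (\<integral>\<^sup>+ z. (\<Sum>n. u z * (markov w ^^ n) (indicator {z}) x) \<partial>count_space UNIV)"
    by (rule nn_integral_suminf [symmetric]) auto
  finally show ?thesis by (simp add: green_kernel_def potential_def)
qed

lemma green_kernel_translate: "green_kernel w (g + x) (g + z) = green_kernel w x z"
proof -
  have "(\<lambda>x. indicator {g + z} (g + x)) = (indicator {z} :: 'a \<Rightarrow> ennreal)"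
    by (auto simp: indicator_def)
  then have "(markov w ^^ n) (indicator {g + z}) (g + x) = (markov w ^^ n) (indicator {z}) x" for n
    using markov_pow_translate [of n w "indicator {g + z}" g x] by simp
  then show ?thesis by (simp add: green_kernel_def potential_def)
qed

lemma green_kernel_diag: "green_kernel w z z = green_kernel w 0 0"
  using green_kernel_translate [of w z 0 0] by simp

lemma green_kernel_unfold:
  "green_kernel w x z = indicator {z} x + markov w (\<lambda>x. green_kernel w x z) x"
  unfolding green_kernel_def by (rule potential_unfold)

lemma green_kernel_superharmonic: "markov w (\<lambda>x. green_kernel w x z) x \<le> green_kernel w x z"
  using green_kernel_unfold [of w x z] by simp

lemma green_kernel_diag_ge: "1 \<le> green_kernel w z z"
  using green_kernel_unfold [of w z z] by simp

lemma green_kernel_tendsto_zero: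
  assumes "green_kernel w x z < \<infinity>"
  shows "(\<lambda>N. (markov w ^^ N) (\<lambda>x. green_kernel w x z) x) \<longlonglongrightarrow> 0"
  using potential_tendsto_zero assms unfolding green_kernel_def .

text \<open>Iteration puts \<open>v\<close> below \<open>c\<close> times
  \<open>markov w ^^ N\<close> of a finite Green function, which tends to 0. This Liouville
  principle carries both the comparison principle and the contradiction in
  \<open>martin_limit_determines_floyd_limit\<close>.\<close>

lemma subharmonic_le_potential_zero:
  assumes sub: "\<And>x. v x \<le> markov w v x" and le: "\<And>x. v x \<le> c * green_kernel w x p"
    and c: "c < \<infinity>" and fin: "\<And>x. green_kernel w x p < \<infinity>"
  shows "v x = 0"
proof -
  have "v x \<le> c * (markov w ^^ N) (\<lambda>x. green_kernel w x p) x" for N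
    using markov_pow_subharmonic [of v w x N, OF sub] markov_pow_mono [of v _ N w x, OF le]
    by (simp add: markov_pow_cmult)
  moreover have "(\<lambda>N. c * (markov w ^^ N) (\<lambda>x. green_kernel w x p) x) \<longlonglongrightarrow> c * 0"
    using c by (intro ennreal_tendsto_cmult green_kernel_tendsto_zero fin) auto
  ultimately have "v x \<le> c * 0"
    by (intro LIMSEQ_le_const) auto
  then show ?thesis by simp
qed

text \<open>Extended subtraction truncates at 0, so the excess \<open>v - \<psi>\<close> vanishes
  off \<open>D\<close>; on \<open>D\<close> the sources \<open>b\<close> cancel and the excess is
  subharmonic for \<open>w\<close>. In \<open>ancona_step\<close> the smaller weight keeps the short
  jumps and \<open>b\<close> bounds what the long ones contribute.\<close>

lemma comparison_principle:
  assumes off: "\<And>x. x \<notin> D \<Longrightarrow> v x \<le> \<psi> x"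
    and on_v: "\<And>x. x \<in> D \<Longrightarrow> v x \<le> markov w' v x + b x"
    and on_psi: "\<And>x. x \<in> D \<Longrightarrow> markov w' \<psi> x + b x \<le> \<psi> x"
    and w: "\<And>s. w' s \<le> w s" and psi: "\<And>x. \<psi> x < \<infinity>"
    and le: "\<And>x. v x \<le> c * green_kernel w x p"
    and c: "c < \<infinity>" and fin: "\<And>x. green_kernel w x p < \<infinity>"
  shows "v x \<le> \<psi> x"
proof -
  let ?e = "\<lambda>x. v x - \<psi> x"
  have vfin: "v x < \<infinity>" for x
    using le [of x] c fin [of x] by (auto simp: ennreal_mult_less_top elim!: order.strict_trans1)
  have "?e x = 0"
  proof (rule subharmonic_le_potential_zero [OF _ _ c fin])
    fix x
    show "?e x \<le> c * green_kernel w x p"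
      using le [of x] diff_le_self_ennreal order_trans by blast
    show "?e x \<le> markov w ?e x"
    proof (cases "x \<in> D")
      case True
      have "v x \<le> markov w' (\<lambda>x. ?e x + \<psi> x) x + b x"
      proof (rule order_trans [OF on_v [OF True]])
        show "markov w' v x + b x \<le> markov w' (\<lambda>x. ?e x + \<psi> x) x + b x"
          by (intro add_right_mono markov_mono) (auto simp: diff_add_self_ennreal)
      qed
      also have "\<dots> = markov w' ?e x + (markov w' \<psi> x + b x)"
        by (simp add: markov_add add.assoc)
      also have "\<dots> \<le> markov w ?e x + \<psi> x"
        by (intro add_mono on_psi True markov_mono_weight w)
      finally have "?e x \<le> (markov w ?e x + \<psi> x) - \<psi> x"
        by (intro ennreal_minus_mono) auto
      then show ?thesis
        using psi [of x] by simp
    next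
      case False
      then have "?e x = 0" using off [OF False] vfin [of x] by (simp add: diff_eq_0_iff_ennreal)
      then show ?thesis by simp
    qed
  qed
  then show ?thesis by (simp add: diff_eq_0_iff_ennreal)
qed

text \<open>Both sides agree at \<open>p\<close>, and off \<open>p\<close> the Green function is
  harmonic while \<open>u\<close> is superharmonic. The diagonal value is multiplied out to avoid a
  division.\<close>

lemma superharmonic_ge_green:
  assumes sup: "\<And>x. markov w u x \<le> u x" and u: "\<And>x. u x < \<infinity>"
    and fin: "\<And>x. green_kernel w x p < \<infinity>"
  shows "u p * green_kernel w x p \<le> green_kernel w p p * u x"
proof (rule comparison_principle [where D = "- {p}" and w = w and w' = w and b = "\<lambda>x. 0"
      and c = "u p" and p = p])
  fix x assume "x \<in> - {p}"
  then show "u p * green_kernel w x p \<le> markov w (\<lambda>x. u p * green_kernel w x p) x + 0"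
    using green_kernel_unfold [of w x p] by (simp add: markov_cmult)
next
  fix x
  show "markov w (\<lambda>x. green_kernel w p p * u x) x + 0 \<le> green_kernel w p p * u x"
    using sup [of x] by (simp add: markov_cmult mult_left_mono)
qed (use u fin in \<open>auto simp: mult.commute ennreal_mult_less_top\<close>)

text \<open>Riesz decomposition with charge \<open>u - markov w u\<close>: the remainder
  \<open>(markov w ^^ N) u x\<close> is squeezed to 0 by the Green function that dominates
  \<open>u\<close>.\<close>

lemma superharmonic_eq_potential:
  assumes sup: "\<And>x. markov w u x \<le> u x"
    and le: "\<And>x. u x \<le> c * green_kernel w x p" and c: "c < \<infinity>"
    and fin: "\<And>x. green_kernel w x p < \<infinity>"
  shows "u x = potential w (\<lambda>x. u x - markov w u x) x"
proof -
  let ?n = "\<lambda>x. u x - markov w u x"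
  have ufin: "u x < \<infinity>" for x
    using le [of x] c fin [of x] by (auto simp: ennreal_mult_less_top elim!: order.strict_trans1)
  have un: "u = (\<lambda>x. ?n x + markov w u x)"
    using sup by (auto simp: diff_add_self_ennreal)
  have eq: "u x = (\<Sum>n<N. (markov w ^^ n) ?n x) + (markov w ^^ N) u x" for N
  proof (induction N)
    case (Suc N)
    have "(markov w ^^ N) u x = (markov w ^^ N) ?n x + (markov w ^^ N) (markov w u) x"
      by (subst un) (simp add: markov_pow_add)
    then show ?case using Suc by (simp add: add.assoc funpow_swap1)
  qed simp
  have z: "(\<lambda>N. (markov w ^^ N) u x) \<longlonglongrightarrow> 0"
  proof (rule tendsto_sandwich [OF _ _ tendsto_const])
    show "\<forall>\<^sub>F N in sequentially. (markov w ^^ N) u x \<le> c * (markov w ^^ N) (\<lambda>x. green_kernel w x p) x"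
      using markov_pow_mono [of u "\<lambda>x. c * green_kernel w x p" _ w x, OF le]
      by (simp add: markov_pow_cmult)
    have "(\<lambda>N. c * (markov w ^^ N) (\<lambda>x. green_kernel w x p) x) \<longlonglongrightarrow> c * 0"
      using c by (intro ennreal_tendsto_cmult green_kernel_tendsto_zero fin) auto
    then show "(\<lambda>N. c * (markov w ^^ N) (\<lambda>x. green_kernel w x p) x) \<longlonglongrightarrow> 0" by simp
  qed auto
  have "(\<lambda>N. (\<Sum>n<N. (markov w ^^ n) ?n x) + (markov w ^^ N) u x) \<longlonglongrightarrow> potential w ?n x + 0"
    unfolding potential_def by (intro tendsto_add z summable_LIMSEQ) auto
  then have "(\<lambda>N. u x) \<longlonglongrightarrow> potential w ?n x" using eq by simp
  then show ?thesis using LIMSEQ_unique tendsto_const by blast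
qed

lemma markov_min_superharmonic:
  assumes "\<And>x. markov w u x \<le> u x" "\<And>x. markov w v x \<le> v x"
  shows "markov w (\<lambda>x. min (u x) (v x)) x \<le> min (u x) (v x)"
proof (rule min.boundedI)
  show "markov w (\<lambda>x. min (u x) (v x)) x \<le> u x"
    by (rule order_trans [OF markov_mono assms(1)]) simp
  show "markov w (\<lambda>x. min (u x) (v x)) x \<le> v x"
    by (rule order_trans [OF markov_mono assms(2)]) simp
qed

section \<open>Random walks\<close>

text \<open>\<open>conv_power\<close> appends the last increment on the right, while
  \<open>markov\<close> iterated at a point consumes the first one; this reconciles them in
  \<open>markov_pow_pmf\<close>.\<close>

lemma conv_power_Suc_left:
  "conv_power \<mu> (Suc n) =
     bind_pmf \<mu> (\<lambda>y. bind_pmf (conv_power \<mu> n) (\<lambda>x. return_pmf (y + x)))"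
proof (induction n)
  case 0
  then show ?case by (simp add: bind_return_pmf)
next
  case (Suc n)
  have "conv_power \<mu> (Suc (Suc n)) =
      bind_pmf (conv_power \<mu> (Suc n)) (\<lambda>x. bind_pmf \<mu> (\<lambda>y. return_pmf (x + y)))"
    by simp
  also have "\<dots> = bind_pmf \<mu> (\<lambda>a. bind_pmf (conv_power \<mu> n) (\<lambda>b. bind_pmf \<mu> (\<lambda>y. return_pmf (a + (b + y)))))"
    unfolding Suc by (simp add: bind_assoc_pmf bind_return_pmf add.assoc)
  also have "\<dots> = bind_pmf \<mu> (\<lambda>a. bind_pmf (conv_power \<mu> (Suc n)) (\<lambda>x. return_pmf (a + x)))"
    by (simp add: bind_assoc_pmf bind_return_pmf)
  finally show ?case .
qed

lemma pmf_bind_translate: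
  "ennreal (pmf (bind_pmf p (\<lambda>x. return_pmf ((y::'a::group_add) + x))) g) = ennreal (pmf p (- y + g))"
proof -
  have "bind_pmf p (\<lambda>x. return_pmf (y + x)) = map_pmf ((+) y) p"
    by (simp add: map_pmf_def)
  moreover have "pmf (map_pmf ((+) y) p) (y + (- y + g)) = pmf p (- y + g)"
    by (rule pmf_map_inj') (simp add: inj_def)
  ultimately show ?thesis by (simp add: add.assoc [symmetric])
qed

lemma markov_pmf: "markov (\<lambda>s. ennreal (pmf \<mu> s)) u x = (\<integral>\<^sup>+ s. u (x + s) \<partial>measure_pmf \<mu>)"
  by (simp add: markov_def nn_integral_measure_pmf)

lemma markov_pmf_const [simp]: "markov (\<lambda>s. ennreal (pmf \<mu> s)) (\<lambda>x. c) x = c"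
  by (simp add: markov_pmf)

lemma markov_pow_pmf:
  "(markov (\<lambda>s. ennreal (pmf \<mu> s)) ^^ n) (indicator {z}) x = ennreal (pmf (conv_power \<mu> n) (- x + z))"
proof (induction n arbitrary: x)
  case 0
  have "z = x \<longleftrightarrow> - x + z = 0" by (metis add.left_inverse add_minus_cancel add.right_neutral)
  then show ?case by (auto simp: indicator_def)
next
  case (Suc n)
  have "(markov (\<lambda>s. ennreal (pmf \<mu> s)) ^^ Suc n) (indicator {z}) x =
      (\<integral>\<^sup>+ s. ennreal (pmf (conv_power \<mu> n) (- s + (- x + z))) \<partial>measure_pmf \<mu>)"
    by (simp add: Suc [abs_def] markov_pmf minus_add add.assoc del: add_uminus_conv_diff)
  also have "\<dots> = ennreal (pmf (conv_power \<mu> (Suc n)) (- x + z))"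
    unfolding conv_power_Suc_left by (subst ennreal_pmf_bind) (simp only: pmf_bind_translate)
  finally show ?case .
qed

lemma green_kernel_pmf:
  assumes "transient \<mu>"
  shows "green_kernel (\<lambda>s. ennreal (pmf \<mu> s)) x z = ennreal (green \<mu> x z)"
  using assms unfolding green_kernel_def potential_def green_def transient_def markov_pow_pmf
  by (intro suminf_ennreal2) auto

text \<open>Law of the inverse increments. Its Green function is the original one with exchanged
  arguments, which turns estimates in the first variable into estimates in the second.\<close>

definition reflected :: "'a::group_add pmf \<Rightarrow> 'a pmf" where
  "reflected \<mu> = map_pmf uminus \<mu>"

lemma pmf_reflected [simp]: "pmf (reflected \<mu>) g = pmf \<mu> (- g)"
  using pmf_map_inj' [of uminus \<mu> "- g"] by (simp add: reflected_def)

lemma conv_power_reflected: "conv_power (reflected \<mu>) n = reflected (conv_power \<mu> n)"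
proof (induction n)
  case (Suc n)
  have "conv_power (reflected \<mu>) (Suc n) =
      bind_pmf (conv_power \<mu> n) (\<lambda>x. bind_pmf \<mu> (\<lambda>y. return_pmf (- x + - y)))"
    unfolding conv_power.simps Suc by (simp add: reflected_def bind_map_pmf del: add_uminus_conv_diff)
  also have "\<dots> = bind_pmf \<mu> (\<lambda>y. bind_pmf (conv_power \<mu> n) (\<lambda>x. return_pmf (- (y + x))))"
    by (subst bind_commute_pmf) (simp add: minus_add del: add_uminus_conv_diff)
  also have "\<dots> = reflected (conv_power \<mu> (Suc n))"
    unfolding conv_power_Suc_left reflected_def by (simp add: map_bind_pmf)
  finally show ?case .
qed (simp add: reflected_def)

lemma green_kernel_reflected:
  "green_kernel (\<lambda>s. ennreal (pmf (reflected \<mu>) s)) x z = green_kernel (\<lambda>s. ennreal (pmf \<mu> s)) z x"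
  unfolding green_kernel_def potential_def markov_pow_pmf conv_power_reflected
  by (simp add: minus_add)

lemma word_norm_le:
  assumes "set ws \<subseteq> S"
  shows "word_norm S (sum_list ws) \<le> length ws"
  unfolding word_norm_def by (rule Least_le) (use assms in blast)

lemma word_norm_zero [simp]: "word_norm S 0 = 0"
  using word_norm_le [of "[]" S] by simp

lemma word_norm_uminus:
  assumes "sym_gen_set S"
  shows "word_norm S (- g) = word_norm S g"
proof -
  have le: "word_norm S (- g) \<le> word_norm S g" for g
  proof -
    obtain ws where ws: "length ws = word_norm S g" "set ws \<subseteq> S" "sum_list ws = g"
      by (rule word_norm_witness [OF assms])
    have "sum_list (rev (map uminus ws)) = - sum_list ws"
      by (induction ws) (simp_all add: minus_add)
    moreover have "set (rev (map uminus ws)) \<subseteq> S"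
      using ws assms by (auto simp: sym_gen_set_def)
    ultimately show ?thesis using word_norm_le ws by (metis length_map length_rev)
  qed
  show ?thesis using le [of g] le [of "- g"] by simp
qed

lemma word_dist_commute:
  assumes "sym_gen_set S"
  shows "word_dist S x y = word_dist S y x"
  using word_norm_uminus [OF assms, of "- x + y"] by (simp add: word_dist_def minus_add)

lemma word_dist_translate [simp]: "word_dist S (g + x) (g + y) = word_dist S x y"
  by (simp add: word_dist_def minus_add add.assoc del: add_uminus_conv_diff)

lemma word_dist_zero_left [simp]: "word_dist S 0 x = word_norm S x"
  by (simp add: word_dist_def)

lemma word_dist_self [simp]: "word_dist S x x = 0"
  by (simp add: word_dist_def)

lemma finite_word_ball:
  assumes "sym_gen_set S"
  shows "finite {g. word_norm S g \<le> n}"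
proof -
  have "{g. word_norm S g \<le> n} \<subseteq> sum_list ` {ws. set ws \<subseteq> S \<and> length ws \<le> n}"
  proof
    fix g assume "g \<in> {g. word_norm S g \<le> n}"
    then show "g \<in> sum_list ` {ws. set ws \<subseteq> S \<and> length ws \<le> n}"
      using word_norm_witness [OF assms, of g] by force
  qed
  moreover have "finite {ws. set ws \<subseteq> S \<and> length ws \<le> n}"
    using assms by (intro finite_lists_length_le) (simp add: sym_gen_set_def)
  ultimately show ?thesis by (rule finite_surj [rotated])
qed

lemma countable_sym_gen:
  assumes "sym_gen_set (S :: 'a::group_add set)"
  shows "countable (UNIV :: 'a set)"
proof -
  have "(UNIV :: 'a set) = (\<Union>n. {g. word_norm S g \<le> n})" by auto
  moreover have "countable (\<Union>n. {g. word_norm S g \<le> n})"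
    using finite_word_ball [OF assms] by (intro countable_UN) (auto intro: countable_finite)
  ultimately show ?thesis by simp
qed

text \<open>\<open>moment\<close> is the common consequence of the two alternatives on \<mu>. All
  bases are demanded because the one used in \<open>ancona_step\<close> depends on the Harnack
  constant.\<close>

locale superexp_walk =
  fixes S :: "'a::group_add set" and \<mu> :: "'a pmf"
  assumes sym_gen: "sym_gen_set S"
    and semigroup_gen: "semigroup_generates (set_pmf \<mu>)"
    and moment: "\<And>K::real. 1 \<le> K \<Longrightarrow> (\<integral>\<^sup>+ s. ennreal (K ^ word_norm S s) \<partial>measure_pmf \<mu>) < \<infinity>"
    and transient: "transient \<mu>"
begin

abbreviation w where "w \<equiv> \<lambda>s. ennreal (pmf \<mu> s)"
abbreviation P where "P \<equiv> markov w"
abbreviation G where "G \<equiv> green_kernel w"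

lemma green_finite [simp]: "G x z < \<top>" "G x z \<noteq> \<top>"
  using green_kernel_pmf [OF transient] by auto

lemma reflected_walk: "superexp_walk S (reflected \<mu>)"
proof
  show "semigroup_generates (set_pmf (reflected \<mu>))"
    unfolding semigroup_generates_def
  proof
    fix g
    obtain ws where ws: "ws \<noteq> []" "set ws \<subseteq> set_pmf \<mu>" "sum_list ws = - g"
      using semigroup_gen unfolding semigroup_generates_def by blast
    have "sum_list (rev (map uminus ws)) = - sum_list ws"
      by (induction ws) (simp_all add: minus_add)
    then show "\<exists>ws. ws \<noteq> [] \<and> set ws \<subseteq> set_pmf (reflected \<mu>) \<and> sum_list ws = g"
      using ws by (intro exI [of _ "rev (map uminus ws)"]) (auto simp: reflected_def)
  qed
  show "transient (reflected \<mu>)"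
    using transient unfolding transient_def conv_power_reflected
    by (auto simp: minus_add)
qed (use sym_gen moment in \<open>simp_all add: reflected_def word_norm_uminus\<close>)

text \<open>Spell \<open>g\<close> as a word in the support: along each letter \<open>s\<close>,
  superharmonicity loses no more than the factor \<open>pmf \<mu> s\<close>.\<close>

lemma superharmonic_step:
  "\<exists>C\<ge>1::real. \<forall>u. (\<forall>x. P u x \<le> u x) \<longrightarrow> (\<forall>x. u (x + g) \<le> ennreal C * u x)"
proof -
  have *: "\<exists>c>0. c \<le> 1 \<and> (\<forall>u. (\<forall>x. P u x \<le> u x) \<longrightarrow> (\<forall>x. ennreal c * u (x + sum_list ws) \<le> u x))"
    if "set ws \<subseteq> set_pmf \<mu>" for ws
    using that
  proof (induction ws)
    case Nil
    then show ?case by (intro exI [of _ 1]) auto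
  next
    case (Cons s ws)
    then obtain c where c: "c > 0" "c \<le> 1"
      "\<And>u x. (\<forall>x. P u x \<le> u x) \<Longrightarrow> ennreal c * u (x + sum_list ws) \<le> u x"
      by auto
    have s: "pmf \<mu> s > 0" using Cons.prems by (simp add: set_pmf_iff order_less_le)
    have "ennreal (pmf \<mu> s * c) * u (x + sum_list (s # ws)) \<le> u x" if "\<forall>x. P u x \<le> u x" for u x
    proof -
      have "ennreal (pmf \<mu> s * c) * u (x + sum_list (s # ws)) =
          w s * (ennreal c * u (x + s + sum_list ws))"
        using c s by (simp add: ennreal_mult' mult.assoc add.assoc)
      also have "\<dots> \<le> w s * u (x + s)"
        by (intro mult_left_mono c that) auto
      also have "\<dots> \<le> P u x" by (rule markov_ge)
      also have "\<dots> \<le> u x" using that by blast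
      finally show ?thesis .
    qed
    then show ?case using c s pmf_le_1 [of \<mu> s]
      by (intro exI [of _ "pmf \<mu> s * c"]) (auto simp: mult_le_one)
  qed
  obtain ws where ws: "set ws \<subseteq> set_pmf \<mu>" "sum_list ws = g"
    using semigroup_gen unfolding semigroup_generates_def by blast
  obtain c where c: "c > 0" "c \<le> 1"
      "\<And>u x. (\<forall>x. P u x \<le> u x) \<Longrightarrow> ennreal c * u (x + g) \<le> u x"
    using * [OF ws(1)] ws(2) by auto
  have "u (x + g) \<le> ennreal (1 / c) * u x" if "\<forall>x. P u x \<le> u x" for u x
  proof -
    have "u (x + g) = ennreal (1 / c) * (ennreal c * u (x + g))"
      using c by (simp add: mult.assoc [symmetric] ennreal_mult [symmetric])
    also have "\<dots> \<le> ennreal (1 / c) * u x"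
      by (intro mult_left_mono c that) auto
    finally show ?thesis .
  qed
  then show ?thesis using c by (intro exI [of _ "1 / c"]) auto
qed

text \<open>The constant is the worst one over the generators in \<open>S\<close>, iterated along a
  shortest word. As the word metric is symmetric, the values at \<open>x\<close> and
  \<open>y\<close> control each other.\<close>

lemma harnack:
  "\<exists>C\<ge>1::real. \<forall>u. (\<forall>x. P u x \<le> u x) \<longrightarrow> (\<forall>x y. u y \<le> ennreal (C ^ word_dist S x y) * u x)"
proof -
  obtain C where C: "\<And>g. C g \<ge> (1::real)"
    "\<And>g u x. (\<forall>x. P u x \<le> u x) \<Longrightarrow> u (x + g) \<le> ennreal (C g) * u x"
    using superharmonic_step by metis
  define K where "K = Max (insert 1 (C ` S))"
  have fin: "finite S" using sym_gen by (simp add: sym_gen_set_def)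
  have K: "K \<ge> 1" "\<And>s. s \<in> S \<Longrightarrow> C s \<le> K" using fin by (auto simp: K_def)
  have *: "u (x + sum_list ws) \<le> ennreal (K ^ length ws) * u x"
    if "set ws \<subseteq> S" "\<forall>x. P u x \<le> u x" for u x ws
    using that(1)
  proof (induction ws arbitrary: x)
    case (Cons s ws)
    have "u (x + sum_list (s # ws)) \<le> ennreal (K ^ length ws) * u (x + s)"
      using Cons.IH [of "x + s"] Cons.prems by (simp add: add.assoc)
    also have "\<dots> \<le> ennreal (K ^ length ws) * (ennreal K * u x)"
    proof (intro mult_left_mono)
      have "u (x + s) \<le> ennreal (C s) * u x" by (rule C(2) [OF that(2)])
      also have "\<dots> \<le> ennreal K * u x"
        using K Cons.prems by (intro mult_right_mono ennreal_leI) auto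
      finally show "u (x + s) \<le> ennreal K * u x" .
    qed auto
    also have "\<dots> = ennreal (K ^ length (s # ws)) * u x"
      using K by (simp add: mult.assoc [symmetric] ennreal_mult [symmetric] mult.commute)
    finally show ?case .
  qed simp
  have "u y \<le> ennreal (K ^ word_dist S x y) * u x" if "\<forall>x. P u x \<le> u x" for u x y
  proof -
    obtain ws where "length ws = word_norm S (- x + y)" "set ws \<subseteq> S" "sum_list ws = - x + y"
      by (rule word_norm_witness [OF sym_gen])
    then show ?thesis using * [of ws u x, OF _ that] by (simp add: word_dist_def add.assoc [symmetric])
  qed
  then show ?thesis using K by blast
qed

lemma green_le_diag: "G x z \<le> G 0 0"
  using superharmonic_ge_green [of w "\<lambda>x. 1" z x] by (simp add: green_kernel_diag [of w z])

lemma green_pos: "0 < G x z"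
proof -
  obtain C where C: "C \<ge> 1" "\<And>u x y. (\<forall>x. P u x \<le> u x) \<Longrightarrow> u y \<le> ennreal (C ^ word_dist S x y) * u x"
    using harnack by blast
  have "G z z \<le> ennreal (C ^ word_dist S x z) * G x z"
    by (rule C(2)) (use green_kernel_superharmonic in blast)
  then show ?thesis
    using green_kernel_diag_ge [of w z] by (metis mult_zero_right not_gr_zero not_one_le_zero order_trans)
qed

end

section \<open>Geometry of the Floyd metric\<close>

lemma sum_div_2: "(\<Sum>j<2 * n. g (j div 2)) = 2 * (\<Sum>i<n. g i :: real)" for n :: nat
  by (induction n) simp_all

definition geodesic :: "'a::group_add set \<Rightarrow> (nat \<Rightarrow> 'a) \<Rightarrow> nat \<Rightarrow> bool" where
  "geodesic S \<gamma> L \<longleftrightarrow> (\<forall>i j. i \<le> j \<longrightarrow> j \<le> L \<longrightarrow> word_dist S (\<gamma> i) (\<gamma> j) = j - i)"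

lemma geodesic_dist: "geodesic S \<gamma> L \<Longrightarrow> i \<le> j \<Longrightarrow> j \<le> L \<Longrightarrow> word_dist S (\<gamma> i) (\<gamma> j) = j - i"
  by (simp add: geodesic_def)

lemma geodesic_translate: "geodesic S \<gamma> L \<Longrightarrow> geodesic S (\<lambda>i. g + \<gamma> i) L"
  by (simp add: geodesic_def)

lemma geodesic_exists:
  assumes "sym_gen_set S"
  obtains \<gamma> where "geodesic S \<gamma> (word_dist S x y)" "\<gamma> 0 = x" "\<gamma> (word_dist S x y) = y"
proof -
  obtain ws where ws: "length ws = word_norm S (- x + y)" "set ws \<subseteq> S" "sum_list ws = - x + y"
    by (rule word_norm_witness [OF assms])
  define \<gamma> where "\<gamma> i = x + sum_list (take i ws)" for i
  let ?L = "word_dist S x y"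
  have L: "?L = length ws" using ws by (simp add: word_dist_def)
  have ends: "\<gamma> 0 = x" "\<gamma> ?L = y" using ws L by (simp_all add: \<gamma>_def add.assoc [symmetric])
  have le: "word_dist S (\<gamma> i) (\<gamma> j) \<le> j - i" if "i \<le> j" "j \<le> ?L" for i j
  proof -
    have "take j ws = take i ws @ take (j - i) (drop i ws)"
      using that by (metis le_add_diff_inverse take_add)
    then have "- \<gamma> i + \<gamma> j = sum_list (take (j - i) (drop i ws))"
      by (simp add: \<gamma>_def minus_add add.assoc del: add_uminus_conv_diff)
    moreover have "set (take (j - i) (drop i ws)) \<subseteq> S"
      using ws(2) by (meson set_drop_subset set_take_subset subset_trans)
    ultimately show ?thesis
      using word_norm_le [of "take (j - i) (drop i ws)" S] by (simp add: word_dist_def)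
  qed
  have "geodesic S \<gamma> ?L"
    unfolding geodesic_def
  proof (intro allI impI antisym le)
    fix i j assume ij: "i \<le> j" "j \<le> ?L"
    have "?L \<le> word_dist S (\<gamma> 0) (\<gamma> i) + (word_dist S (\<gamma> i) (\<gamma> j) + word_dist S (\<gamma> j) (\<gamma> ?L))"
      using word_dist_triangle [OF assms, of "\<gamma> 0" "\<gamma> ?L" "\<gamma> i"]
        word_dist_triangle [OF assms, of "\<gamma> i" "\<gamma> ?L" "\<gamma> j"] ends by simp
    then show "j - i \<le> word_dist S (\<gamma> i) (\<gamma> j)"
      using le [of 0 i] le [of j ?L] ij by simp
  qed
  with ends that show ?thesis by blast
qed

locale floyd =
  fixes S :: "'a::group_add set" and f :: "real \<Rightarrow> real"
  assumes gen: "sym_gen_set S" and ff: "floyd_function f"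
begin

abbreviation d where "d \<equiv> word_dist S"
abbreviation \<delta> where "\<delta> \<equiv> floyd_dist S f"

lemma f_pos: "0 < f (real n)"
  using ff by (simp add: floyd_function_def)

lemma f_mono: "m \<le> n \<Longrightarrow> f (real n) \<le> f (real m)"
  using ff by (simp add: floyd_function_def)

lemma f_summable: "summable (\<lambda>k. f (real (k + r)))"
  using ff summable_iff_shift [of "\<lambda>k. f (real k)" r] by (simp add: floyd_function_def)

definition tail :: "nat \<Rightarrow> real" where
  "tail r = (\<Sum>k. f (real (k + r)))"

lemma sum_le_tail: "(\<Sum>k<n. f (real (k + r))) \<le> tail r"
  unfolding tail_def by (rule sum_le_suminf [OF f_summable]) (use f_pos in \<open>auto intro: less_imp_le simp del: of_nat_add\<close>)

lemma tail_nonneg: "0 \<le> tail r"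
  using sum_le_tail [where n = 0 and r = r] by simp

lemma tail_antimono: "r \<le> r' \<Longrightarrow> tail r' \<le> tail r"
  unfolding tail_def by (intro suminf_le f_summable f_mono) simp

lemma tail_tendsto_zero: "tail \<longlonglongrightarrow> 0"
  unfolding tail_def [abs_def] using ff
  by (intro suminf_exist_split2) (simp add: floyd_function_def)

lemma tail_small:
  assumes "0 < \<epsilon>"
  obtains R where "\<And>r. R \<le> r \<Longrightarrow> tail r < \<epsilon>"
proof -
  have "\<forall>\<^sub>F r in sequentially. tail r < \<epsilon>"
    using tail_tendsto_zero assms by (rule order_tendstoD)
  then show ?thesis using that by (auto simp: eventually_sequentially)
qed

text \<open>At least half of the indices below \<open>r\<close> are no smaller than
  \<open>r div 2\<close>, and \<open>f\<close> at each of them is at least its value at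
  \<open>r\<close>.\<close>

lemma mult_f_le_tail: "real r * f (real r) \<le> 2 * tail (r div 2)"
proof -
  have "real r * f (real r) \<le> 2 * (\<Sum>k<r - r div 2. f (real r))"
    using f_pos [of r] by (simp add: mult_right_mono)
  also have "\<dots> \<le> 2 * (\<Sum>k<r - r div 2. f (real (k + r div 2)))"
    by (intro mult_left_mono sum_mono f_mono) auto
  also have "\<dots> \<le> 2 * tail (r div 2)"
    by (intro mult_left_mono sum_le_tail) auto
  finally show ?thesis .
qed

lemma d_triangle: "d x z \<le> d x y + d y z"
  by (rule word_dist_triangle [OF gen])

lemma d_commute: "d x y = d y x"
  by (rule word_dist_commute [OF gen])

lemma Metric_space_\<delta>: "Metric_space UNIV (\<delta> v)"
  by (rule Metric_space_floyd_dist [OF gen ff])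

lemma \<delta>_triangle: "\<delta> v x z \<le> \<delta> v x y + \<delta> v y z"
  by (rule floyd_dist_triangle [OF gen ff])

lemma \<delta>_commute: "\<delta> v x y = \<delta> v y x"
  using Metric_space.commute [OF Metric_space_\<delta>] .

lemma \<delta>_nonneg [simp]: "0 \<le> \<delta> v x y"
  by (rule floyd_dist_nonneg [OF gen ff])

lemma \<delta>_self [simp]: "\<delta> v x x = 0"
  using Metric_space.mdist_zero [OF Metric_space_\<delta>] by simp

lemma \<delta>_diff: "\<bar>\<delta> v x z - \<delta> v y z\<bar> \<le> \<delta> v x y"
  using \<delta>_triangle [of v x z y] \<delta>_triangle [of v y z x] \<delta>_commute [of v x y] by linarith

text \<open>The first edge of any path that leaves \<open>x\<close> already costs this much. So each
  group element is isolated, with an explicit radius.\<close>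

lemma \<delta>_ge_isolated:
  assumes "x \<noteq> y"
  shows "f (real (d v x)) \<le> \<delta> v x y"
proof (rule floyd_dist_ge [OF gen])
  fix p assume p: "edge_path S x y p"
  then obtain b q where q: "p = x # b # q"
    using assms unfolding edge_path_def by (cases p; cases "tl p") auto
  have "f (real (d v x)) \<le> f (real (min (d v x) (d v b)))"
    by (rule f_mono) simp
  then show "f (real (d v x)) \<le> floyd_length S f v p"
    using floyd_length_nonneg [OF ff, of S v "b # q"] by (simp add: q floyd_length_Cons2)
qed

lemma \<delta>_translate: "\<delta> (g + v) (g + x) (g + y) = \<delta> v x y"
proof -
  have le: "\<delta> (g + v) (g + x) (g + y) \<le> \<delta> v x y" for g v x y
  proof (rule floyd_dist_ge [OF gen])
    fix p assume p: "edge_path S x y p"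
    have len: "floyd_length S f (g + v) (map ((+) g) p) = floyd_length S f v p"
      by (induction p rule: induct_list012) (simp_all add: floyd_length_Cons2 floyd_length_def)
    from p have "edge_path S (g + x) (g + y) (map ((+) g) p)"
      by (auto simp: edge_path_def successively_map hd_map last_map add.assoc)
    from floyd_dist_le [OF ff this, of "g + v"] len
    show "\<delta> (g + v) (g + x) (g + y) \<le> floyd_length S f v p" by simp
  qed
  show ?thesis
    using le [of g v x y] le [of "- g" "g + v" "g + x" "g + y"] by simp
qed

lemma \<delta>_edge:
  assumes "d a b = 1"
  shows "\<delta> v a b \<le> f (real (min (d v a) (d v b)))"
proof -
  obtain ws where ws: "length ws = 1" "set ws \<subseteq> S" "sum_list ws = - a + b"
    using word_norm_witness [OF gen, of "- a + b"] assms by (auto simp: word_dist_def)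
  then obtain s where "s \<in> S" "s = - a + b"
    by (cases ws) auto
  then have "edge_path S a b [a, b]"
    by (auto simp: edge_path_def add.assoc [symmetric] intro!: bexI [of _ s])
  from floyd_dist_le [OF ff this, of v] show ?thesis
    by (simp add: floyd_length_Cons2 floyd_length_single)
qed

lemma \<delta>_geodesic:
  assumes "geodesic S \<gamma> L" "i + n \<le> L"
  shows "\<delta> v (\<gamma> i) (\<gamma> (i + n)) \<le> (\<Sum>k<n. f (real (min (d v (\<gamma> (i + k))) (d v (\<gamma> (i + k + 1))))))"
  using assms(2)
proof (induction n)
  case (Suc n)
  have "d (\<gamma> (i + n)) (\<gamma> (i + n + 1)) = 1"
    using geodesic_dist [OF assms(1), of "i + n" "i + n + 1"] Suc.prems by simp
  from \<delta>_edge [OF this, of v] \<delta>_triangle [of v "\<gamma> i" "\<gamma> (i + n + 1)" "\<gamma> (i + n)"] Suc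
  show ?case by simp
qed simp

text \<open>The hypothesis keeps a whole geodesic from \<open>a\<close> to \<open>b\<close> outside
  the open ball of radius \<open>r\<close> about \<open>v\<close>, so each of its edges costs at
  most \<open>f r\<close>.\<close>

lemma \<delta>_le_far:
  assumes "r + d a b \<le> d v a"
  shows "\<delta> v a b \<le> real (d a b) * f (real r)"
proof -
  obtain \<gamma> where \<gamma>: "geodesic S \<gamma> (d a b)" "\<gamma> 0 = a" "\<gamma> (d a b) = b"
    by (rule geodesic_exists [OF gen])
  have far: "r \<le> d v (\<gamma> k)" if "k \<le> d a b" for k
    using geodesic_dist [OF \<gamma>(1), of 0 k] that assms d_triangle [of v a "\<gamma> k"] d_commute [of a "\<gamma> k"]
    by (simp add: \<gamma>)
  have "\<delta> v a b \<le> (\<Sum>k<d a b. f (real (min (d v (\<gamma> k)) (d v (\<gamma> (k + 1))))))"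
    using \<delta>_geodesic [OF \<gamma>(1), of 0 "d a b" v] by (simp add: \<gamma>)
  also have "\<dots> \<le> (\<Sum>k<d a b. f (real r))"
    by (intro sum_mono f_mono) (use far in auto)
  finally show ?thesis by simp
qed

text \<open>The second hypothesis says that \<open>p\<close> lies on a geodesic from
  \<open>v\<close> to \<open>b\<close> up to a defect \<open>R\<close>. The \<open>k\<close>-th
  vertex of a geodesic from \<open>p\<close> to \<open>b\<close> is then at distance at least
  \<open>k + (d v p - R)\<close> from \<open>v\<close>.\<close>

lemma \<delta>_le_tail:
  assumes "R \<le> d v p" "d v p + d p b \<le> d v b + R"
  shows "\<delta> v p b \<le> tail (d v p - R)"
proof -
  obtain \<gamma> where \<gamma>: "geodesic S \<gamma> (d p b)" "\<gamma> 0 = p" "\<gamma> (d p b) = b"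
    by (rule geodesic_exists [OF gen])
  have far: "k + (d v p - R) \<le> d v (\<gamma> k)" if "k \<le> d p b" for k
    using geodesic_dist [OF \<gamma>(1), of k "d p b"] that assms d_triangle [of v b "\<gamma> k"]
    by (simp add: \<gamma>)
  have "\<delta> v p b \<le> (\<Sum>k<d p b. f (real (min (d v (\<gamma> k)) (d v (\<gamma> (k + 1))))))"
    using \<delta>_geodesic [OF \<gamma>(1), of 0 "d p b" v] by (simp add: \<gamma>)
  also have "\<dots> \<le> (\<Sum>k<d p b. f (real (k + (d v p - R))))"
  proof (intro sum_mono f_mono)
    fix k assume "k \<in> {..<d p b}"
    then show "k + (d v p - R) \<le> min (d v (\<gamma> k)) (d v (\<gamma> (k + 1)))"
      using far [of k] far [of "k + 1"] by simp
  qed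
  also have "\<dots> \<le> tail (d v p - R)" by (rule sum_le_tail)
  finally show ?thesis .
qed

text \<open>Karlsson's estimate. Cut at the vertex \<open>\<gamma> m\<close> nearest to
  \<open>v\<close>: a vertex \<open>j\<close> steps away from it is at distance at least
  \<open>max \<rho> (j div 2)\<close> from \<open>v\<close>, so each half costs at most
  \<open>2 * (\<rho> * f \<rho> + tail \<rho>)\<close>.\<close>

lemma \<delta>_geodesic_far:
  assumes \<gamma>: "geodesic S \<gamma> L" and far: "\<And>i. i \<le> L \<Longrightarrow> R \<le> d v (\<gamma> i)"
  shows "\<delta> v (\<gamma> 0) (\<gamma> L) \<le> 12 * tail (R div 2)"
proof -
  obtain m where m: "m \<le> L" "\<And>i. i \<le> L \<Longrightarrow> d v (\<gamma> m) \<le> d v (\<gamma> i)"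
    using ex_has_least_nat [of "\<lambda>i. i \<le> L" 0 "\<lambda>i. d v (\<gamma> i)"] by auto
  define \<rho> where "\<rho> = d v (\<gamma> m)"
  \<comment> \<open>The triangle inequality through \<open>v\<close> gives
    \<open>j \<le> \<rho> + d v (\<gamma> i) \<le> 2 * d v (\<gamma> i)\<close>. Truncated
    subtraction lets one statement serve both sides of \<open>m\<close>.\<close>
  have near: "max \<rho> (j div 2) \<le> d v (\<gamma> i)" if "i \<le> L" "j \<le> i - m \<or> j \<le> m - i" for i j
  proof -
    have "d (\<gamma> m) (\<gamma> i) = (if m \<le> i then i - m else m - i)"
      using geodesic_dist [OF \<gamma>, of m i] geodesic_dist [OF \<gamma>, of i m] m(1) that d_commute [of "\<gamma> m"]
      by auto
    moreover have "d (\<gamma> m) (\<gamma> i) \<le> \<rho> + d v (\<gamma> i)"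
      using d_triangle [of "\<gamma> m" "\<gamma> i" v] d_commute [of v "\<gamma> m"] by (simp add: \<rho>_def)
    moreover have "\<rho> \<le> d v (\<gamma> i)" using m that by (simp add: \<rho>_def)
    ultimately have "j \<le> 2 * d v (\<gamma> i)" using that by (auto split: if_splits)
    then show ?thesis using \<open>\<rho> \<le> d v (\<gamma> i)\<close> by simp
  qed
  have half: "(\<Sum>j<n. f (real (max \<rho> (j div 2)))) \<le> 6 * tail (R div 2)" for n
  proof -
    have "(\<Sum>j<n. f (real (max \<rho> (j div 2)))) \<le> (\<Sum>j<2 * (\<rho> + n). f (real (max \<rho> (j div 2))))"
      by (intro sum_mono2) (auto intro: less_imp_le f_pos)
    also have "\<dots> = 2 * (\<Sum>i<\<rho> + n. f (real (max \<rho> i)))" by (rule sum_div_2)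
    also have "(\<Sum>i<\<rho> + n. f (real (max \<rho> i))) = real \<rho> * f (real \<rho>) + (\<Sum>i<n. f (real (i + \<rho>)))"
    proof (induction n)
      case 0
      have "(\<Sum>i<\<rho>. f (real (max \<rho> i))) = (\<Sum>i<\<rho>. f (real \<rho>))"
        by (intro sum.cong) (auto simp: max_def)
      then show ?case by simp
    qed (simp add: add.commute)
    also have "\<dots> \<le> 2 * tail (\<rho> div 2) + tail \<rho>"
      by (intro add_mono mult_f_le_tail sum_le_tail)
    also have "\<dots> \<le> 3 * tail (R div 2)"
    proof -
      have "R div 2 \<le> \<rho> div 2" "R div 2 \<le> \<rho>"
        using far [OF m(1)] by (auto simp: \<rho>_def div_le_mono)
      then show ?thesis
        using tail_antimono [of "R div 2" "\<rho> div 2"] tail_antimono [of "R div 2" \<rho>] by simp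
    qed
    finally show ?thesis by simp
  qed
  have "\<delta> v (\<gamma> m) (\<gamma> (m + (L - m))) \<le> (\<Sum>k<L - m. f (real (min (d v (\<gamma> (m + k))) (d v (\<gamma> (m + k + 1))))))"
    by (rule \<delta>_geodesic [OF \<gamma>]) (use m in simp)
  also have "\<dots> \<le> (\<Sum>k<L - m. f (real (max \<rho> (k div 2))))"
    by (intro sum_mono f_mono min.boundedI near) auto
  finally have right: "\<delta> v (\<gamma> m) (\<gamma> L) \<le> 6 * tail (R div 2)"
    using half [of "L - m"] m(1) by simp
  have "\<delta> v (\<gamma> 0) (\<gamma> (0 + m)) \<le> (\<Sum>k<m. f (real (min (d v (\<gamma> (0 + k))) (d v (\<gamma> (0 + k + 1))))))"
    by (rule \<delta>_geodesic [OF \<gamma>]) (use m in simp)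
  \<comment> \<open>The left half is walked towards \<open>m\<close>: of the edge from
    \<open>k\<close> to \<open>k + 1\<close>, the endpoint nearer to \<open>\<gamma> m\<close> is
    \<open>m - Suc k\<close> steps away from it.\<close>
  also have "\<dots> \<le> (\<Sum>k<m. f (real (max \<rho> ((m - Suc k) div 2))))"
    by (intro sum_mono f_mono min.boundedI near) (use m(1) in auto)
  also have "\<dots> = (\<Sum>k<m. f (real (max \<rho> (k div 2))))"
    by (rule sum.nat_diff_reindex)
  finally have left: "\<delta> v (\<gamma> 0) (\<gamma> m) \<le> 6 * tail (R div 2)"
    using half [of m] by simp
  show ?thesis
    using left right \<delta>_triangle [of v "\<gamma> 0" "\<gamma> L" "\<gamma> m"] by simp
qed

lemma geodesic_meets_ball:
  assumes "0 < \<epsilon>"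
  obtains R where "\<And>v \<gamma> L. geodesic S \<gamma> L \<Longrightarrow> \<epsilon> \<le> \<delta> v (\<gamma> 0) (\<gamma> L) \<Longrightarrow> \<exists>i\<le>L. d v (\<gamma> i) \<le> R"
proof -
  obtain N where N: "\<And>r. N \<le> r \<Longrightarrow> tail r < \<epsilon> / 12"
    using tail_small [of "\<epsilon> / 12"] assms by auto
  show ?thesis
  proof (rule that [of "2 * N"])
    fix v \<gamma> L assume *: "geodesic S \<gamma> L" "\<epsilon> \<le> \<delta> v (\<gamma> 0) (\<gamma> L)"
    show "\<exists>i\<le>L. d v (\<gamma> i) \<le> 2 * N"
    proof (rule ccontr)
      assume "\<not> ?thesis"
      then have "\<delta> v (\<gamma> 0) (\<gamma> L) \<le> 12 * tail (2 * N div 2)"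
        by (intro \<delta>_geodesic_far *) (meson less_imp_le not_le)
      with N [of N] *(2) show False by simp
    qed
  qed
qed

text \<open>A geodesic from \<open>a\<close> to \<open>b\<close> passes near \<open>v\<close>, and
  going to \<open>v\<close> and back is the only detour.\<close>

lemma gromov_product_bounded:
  assumes "0 < \<epsilon>"
  obtains R where "\<And>v a b. \<epsilon> \<le> \<delta> v a b \<Longrightarrow> d a v + d v b \<le> d a b + R"
proof -
  obtain R where R: "\<And>v \<gamma> L. geodesic S \<gamma> L \<Longrightarrow> \<epsilon> \<le> \<delta> v (\<gamma> 0) (\<gamma> L) \<Longrightarrow> \<exists>i\<le>L. d v (\<gamma> i) \<le> R"
    by (rule geodesic_meets_ball [OF assms]) blast
  show ?thesis
  proof (rule that [of "2 * R"])
    fix v a b assume *: "\<epsilon> \<le> \<delta> v a b"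
    obtain \<gamma> where \<gamma>: "geodesic S \<gamma> (d a b)" "\<gamma> 0 = a" "\<gamma> (d a b) = b"
      by (rule geodesic_exists [OF gen])
    obtain i where i: "i \<le> d a b" "d v (\<gamma> i) \<le> R"
      using R [OF \<gamma>(1)] * \<gamma> by auto
    then have "d a (\<gamma> i) + d (\<gamma> i) b = d a b"
      using geodesic_dist [OF \<gamma>(1), of 0 i] geodesic_dist [OF \<gamma>(1), of i "d a b"] \<gamma> by simp
    then show "d a v + d v b \<le> d a b + 2 * R"
      using d_triangle [of a v "\<gamma> i"] d_triangle [of v b "\<gamma> i"] d_commute [of v "\<gamma> i"] i by simp
  qed
qed

text \<open>Convergence dynamics of a single element: a point \<open>x\<close> that is Floyd-far
  from \<open>- g + v\<close> has bounded Gromov product with it. Translated by \<open>g\<close>,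
  this says that \<open>g + v\<close> almost lies on a geodesic from \<open>v\<close> to
  \<open>g + x\<close>, and \<open>\<delta>_le_tail\<close> applies.\<close>

lemma attraction:
  assumes "0 < \<epsilon>" "0 < \<epsilon>'"
  obtains N where "\<And>v g x. N \<le> d v (g + v) \<Longrightarrow> \<epsilon> \<le> \<delta> v x (- g + v) \<Longrightarrow> \<delta> v (g + x) (g + v) \<le> \<epsilon>'"
proof -
  obtain R where R: "\<And>v a b. \<epsilon> \<le> \<delta> v a b \<Longrightarrow> d a v + d v b \<le> d a b + R"
    by (rule gromov_product_bounded [OF assms(1)]) blast
  obtain M where M: "\<And>r. M \<le> r \<Longrightarrow> tail r < \<epsilon>'"
    using tail_small [OF assms(2)] by blast
  show ?thesis
  proof (rule that [of "M + R"])
    fix v g x assume *: "M + R \<le> d v (g + v)" "\<epsilon> \<le> \<delta> v x (- g + v)"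
    have 1: "d (g + x) (g + v) = d x v" "d v (- g + v) = d (g + v) v" "d x (- g + v) = d (g + x) v"
      using word_dist_translate [of S g v "- g + v"] word_dist_translate [of S g x "- g + v"]
      by simp_all
    have "d v (g + v) + d (g + v) (g + x) \<le> d v (g + x) + R"
      using R [OF *(2)] 1 d_commute [of v "g + v"] d_commute [of v "g + x"]
        d_commute [of "g + v" "g + x"] by simp
    then have "\<delta> v (g + v) (g + x) \<le> tail (d v (g + v) - R)"
      using *(1) by (intro \<delta>_le_tail) auto
    moreover have "tail (d v (g + v) - R) < \<epsilon>'"
      using *(1) by (intro M) simp
    ultimately show "\<delta> v (g + x) (g + v) \<le> \<epsilon>'"
      using \<delta>_commute [of v "g + x"] by simp
  qed
qed

text \<open>Cauchy condensation: the block from \<open>2 ^ (k + m)\<close> to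
  \<open>2 ^ (k + m + 1)\<close> has \<open>2 ^ (k + m)\<close> members, so its sum is at least half
  of the \<open>k\<close>-th term.\<close>

lemma sum_dyadic_le_tail:
  "(\<Sum>k<n. 2 ^ (k + m + 1) * f (real (2 ^ (k + m + 1)))) \<le> 2 * tail (2 ^ m)"
proof -
  have "(\<Sum>k<n. 2 ^ (k + m + 1) * f (real (2 ^ (k + m + 1)))) \<le> 2 * (\<Sum>i\<in>{2 ^ m..<2 ^ (n + m)}. f (real i))"
  proof (induction n)
    case (Suc n)
    let ?a = "2 ^ (n + m) :: nat"
    have "2 ^ (n + m + 1) * f (real (2 ^ (n + m + 1))) = 2 * (\<Sum>i\<in>{?a..<2 * ?a}. f (real (2 * ?a)))"
      by simp
    also have "\<dots> \<le> 2 * (\<Sum>i\<in>{?a..<2 * ?a}. f (real i))"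
      by (intro mult_left_mono sum_mono f_mono) auto
    finally have "2 ^ (n + m + 1) * f (real (2 ^ (n + m + 1))) \<le> 2 * (\<Sum>i\<in>{?a..<2 * ?a}. f (real i))" .
    moreover have "(\<Sum>i\<in>{2 ^ m..<?a}. f (real i)) + (\<Sum>i\<in>{?a..<2 * ?a}. f (real i)) = (\<Sum>i\<in>{2 ^ m..<2 * ?a}. f (real i))"
      by (rule sum.atLeastLessThan_concat) auto
    ultimately show ?case using Suc by simp
  qed simp
  also have "(\<Sum>i\<in>{2 ^ m..<2 ^ (n + m)}. f (real i)) = (\<Sum>i<2 ^ (n + m) - 2 ^ m. f (real (i + 2 ^ m)))"
    using sum.atLeastLessThan_shift_0 [of "\<lambda>i. f (real i)" "2 ^ m" "2 ^ (n + m)"]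
    by (simp add: atLeast0LessThan add.commute)
  also have "2 * \<dots> \<le> 2 * tail (2 ^ m)"
    by (intro mult_left_mono sum_le_tail) simp
  finally show ?thesis by simp
qed

end

section \<open>Ancona inequality under a spectral gap\<close>

text \<open>The error is linear in \<open>t\<close> with an integrable coefficient, so the
  exponential moment of order \<open>t\<close> tends to 1 as \<open>t\<close> tends to 0.\<close>

lemma exp_mult_le:
  fixes t r :: real
  assumes "0 \<le> t" "t \<le> 1" "0 \<le> r"
  shows "exp (t * r) \<le> 1 + t * exp (2 * r)"
proof -
  have "1 - t * r \<le> exp (- (t * r))" using exp_ge_add_one_self [of "- (t * r)"] by simp
  then have "(1 - t * r) * exp (t * r) \<le> exp (- (t * r)) * exp (t * r)"
    by (intro mult_right_mono) auto
  then have "exp (t * r) \<le> 1 + t * r * exp (t * r)"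
    by (simp add: exp_minus algebra_simps)
  also have "t * r * exp (t * r) \<le> t * (exp r * exp r)"
  proof -
    have "r * exp (t * r) \<le> exp r * exp r"
    proof (intro mult_mono)
      show "r \<le> exp r" using exp_ge_add_one_self [of r] by linarith
      show "exp (t * r) \<le> exp r" using assms by (simp add: mult_left_le_one_le)
    qed (use assms in auto)
    then show ?thesis using assms(1) by (simp add: mult.assoc mult_left_mono)
  qed
  also have "exp r * exp r = exp (2 * r)" by (simp add: exp_add [symmetric])
  finally show ?thesis by simp
qed

text \<open>Equivalently, the spectral radius, i.e. the upper limit of the \<open>n\<close>-th roots
  of the return probabilities, is below one.\<close>

definition exp_decay :: "'a::group_add pmf \<Rightarrow> bool" where
  "exp_decay \<mu> \<longleftrightarrow> (\<exists>c>1. \<exists>K. \<forall>n. c ^ n * pmf (conv_power \<mu> n) 0 \<le> K)"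

lemma exp_decay_reflected: "exp_decay \<mu> \<Longrightarrow> exp_decay (reflected \<mu>)"
  by (simp add: exp_decay_def conv_power_reflected)

context superexp_walk
begin

lemma exp_moment:
  fixes t :: real
  assumes "0 \<le> t"
  shows "(\<integral>\<^sup>+ s. ennreal (exp (t * word_norm S s)) \<partial>measure_pmf \<mu>) < \<infinity>"
proof -
  have "exp (t * word_norm S s) = exp t ^ word_norm S s" for s
    by (simp add: exp_of_nat_mult [symmetric] mult.commute)
  then show ?thesis using moment [of "exp t"] assms by simp
qed

lemma exp_moment_near_one:
  assumes "1 < c"
  obtains t :: real where "0 < t" "(\<integral>\<^sup>+ s. ennreal (exp (t * word_norm S s)) \<partial>measure_pmf \<mu>) \<le> ennreal c"
proof -
  obtain M where M: "(\<integral>\<^sup>+ s. ennreal (exp (2 * word_norm S s)) \<partial>measure_pmf \<mu>) = ennreal M" "0 \<le> M"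
    using exp_moment [of 2] by (auto simp: less_top_ennreal)
  define t where "t = min 1 ((c - 1) / (M + 1))"
  have t: "0 < t" "t \<le> 1" "t \<le> (c - 1) / (M + 1)" using assms M by (auto simp: t_def)
  have "t * M \<le> t * (M + 1)" using t by (intro mult_left_mono) auto
  also have "\<dots> \<le> c - 1" using t M by (simp add: le_divide_eq)
  finally have tM: "1 + t * M \<le> c" by simp
  have "(\<integral>\<^sup>+ s. ennreal (exp (t * word_norm S s)) \<partial>measure_pmf \<mu>) \<le>
      (\<integral>\<^sup>+ s. ennreal 1 + ennreal t * ennreal (exp (2 * word_norm S s)) \<partial>measure_pmf \<mu>)"
    using t exp_mult_le [of t] by (intro nn_integral_mono) (simp add: ennreal_mult [symmetric] ennreal_plus [symmetric] del: ennreal_plus ennreal_1)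
  also have "\<dots> = ennreal (1 + t * M)"
    using t M by (simp add: nn_integral_add nn_integral_cmult ennreal_mult)
  also have "\<dots> \<le> ennreal c" using tM by (rule ennreal_leI)
  finally show ?thesis using that t by blast
qed

text \<open>The estimate is Cauchy--Schwarz, written as AM--GM with a free parameter so that it passes
  through the convolution.\<close>

lemma twisted_le:
  fixes t :: real
  assumes "0 < \<tau>"
  shows "2 * (markov (\<lambda>s. ennreal (exp (t * word_norm S s)) * w s) ^^ n) (indicator {z}) x \<le>
    ennreal \<tau> * (markov (\<lambda>s. ennreal (exp (2 * t * word_norm S s)) * w s) ^^ n) (indicator {z}) x +
    ennreal (1 / \<tau>) * (P ^^ n) (indicator {z}) x"
  using assms
proof (induction n arbitrary: \<tau> x)
  case 0
  have "2 * \<tau> \<le> \<tau> * \<tau> + 1"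
    using zero_le_power2 [of "\<tau> - 1"] by (simp add: power2_eq_square algebra_simps)
  then have "2 \<le> \<tau> + 1 / \<tau>" using 0 by (simp add: field_simps)
  then have "ennreal 2 \<le> ennreal \<tau> + ennreal (1 / \<tau>)"
    using 0 by (simp add: ennreal_plus [symmetric] del: ennreal_plus)
  then show ?case by (auto simp: indicator_def)
next
  case (Suc n)
  let ?e = "\<lambda>(t::real) s. ennreal (exp (t * word_norm S s))"
  let ?a = "(markov (\<lambda>s. ?e t s * w s) ^^ n) (indicator {z})"
  let ?b = "(markov (\<lambda>s. ?e (2 * t) s * w s) ^^ n) (indicator {z})"
  let ?p = "(P ^^ n) (indicator {z})"
  have "2 * (?e t s * w s * ?a (x + s)) \<le>
      ennreal \<tau> * (?e (2 * t) s * w s * ?b (x + s)) + ennreal (1 / \<tau>) * (w s * ?p (x + s))" for s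
  proof -
    let ?c = "exp (t * word_norm S s)"
    \<comment> \<open>The induction hypothesis is used with parameter \<open>\<tau> * ?c\<close>.
      After multiplication by \<open>?c\<close> the first term carries \<open>?c\<close> squared,
      the twist of order \<open>2 * t\<close>, and in the second term \<open>?c\<close>
      cancels.\<close>
    have "2 * ?a (x + s) \<le> ennreal (\<tau> * ?c) * ?b (x + s) + ennreal (1 / (\<tau> * ?c)) * ?p (x + s)"
      using Suc.prems by (intro Suc.IH) simp
    then have "?e t s * w s * (2 * ?a (x + s)) \<le>
        ?e t s * w s * (ennreal (\<tau> * ?c) * ?b (x + s) + ennreal (1 / (\<tau> * ?c)) * ?p (x + s))"
      by (intro mult_left_mono) auto
    also have "\<dots> = (ennreal ?c * ennreal (\<tau> * ?c)) * w s * ?b (x + s) +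
        (ennreal ?c * ennreal (1 / (\<tau> * ?c))) * w s * ?p (x + s)"
      by (simp only: distrib_left mult_ac)
    also have "ennreal ?c * ennreal (\<tau> * ?c) = ennreal \<tau> * ?e (2 * t) s"
      using Suc.prems by (simp add: ennreal_mult [symmetric] exp_add [symmetric] mult_ac)
    also have "ennreal ?c * ennreal (1 / (\<tau> * ?c)) = ennreal (1 / \<tau>)"
      using Suc.prems by (simp add: ennreal_mult [symmetric])
    finally show ?thesis by (simp only: mult_ac)
  qed
  then have "(\<integral>\<^sup>+ s. 2 * (?e t s * w s * ?a (x + s)) \<partial>count_space UNIV) \<le>
    (\<integral>\<^sup>+ s. ennreal \<tau> * (?e (2 * t) s * w s * ?b (x + s)) + ennreal (1 / \<tau>) * (w s * ?p (x + s)) \<partial>count_space UNIV)"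
    by (intro nn_integral_mono) auto
  then show ?case
    by (simp add: markov_def [of _ ?a] markov_def [of _ ?b] markov_def [of _ ?p]
        nn_integral_cmult nn_integral_add)
qed

text \<open>By \<open>twisted_le\<close> the twisted return weight is controlled by the geometric
  mean of the twisted total mass, at most \<open>m ^ n\<close>, and the return probability, at most
  \<open>K / c ^ n\<close>. With \<open>m < c\<close> this decays exponentially and leaves room for
  a factor \<open>q > 1\<close> per step.\<close>

lemma twisted_green_finite:
  assumes "exp_decay \<mu>"
  obtains t q :: real where "0 < t" "1 < q"
    "green_kernel (\<lambda>s. ennreal q * (ennreal (exp (t * word_norm S s)) * w s)) 0 0 < \<infinity>"
proof -
  obtain c K where c: "1 < c" and K: "\<And>n. c ^ n * pmf (conv_power \<mu> n) 0 \<le> K"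
    using assms unfolding exp_decay_def by blast
  have K0: "0 \<le> K" using K [of 0] by simp
  define m where "m = (1 + c) / 2"
  have m: "1 < m" "m < c" using c by (auto simp: m_def)
  obtain t :: real where t: "0 < t" "(\<integral>\<^sup>+ s. ennreal (exp (t * word_norm S s)) \<partial>measure_pmf \<mu>) \<le> ennreal m"
    by (rule exp_moment_near_one [OF m(1)])
  let ?a = "\<lambda>n. (markov (\<lambda>s. ennreal (exp (t / 2 * word_norm S s)) * w s) ^^ n) (indicator {0}) 0"
  let ?w2 = "\<lambda>s. ennreal (exp (2 * (t / 2) * word_norm S s)) * w s"
  have one: "markov ?w2 (\<lambda>x. 1) x \<le> ennreal m" for x :: 'a
    using t(2) by (simp add: markov_def nn_integral_measure_pmf mult.commute)
  have b: "(markov ?w2 ^^ n) (indicator {z}) x \<le> ennreal (m ^ n)" for n x z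
  proof (induction n arbitrary: x)
    case (Suc n)
    have "markov ?w2 ((markov ?w2 ^^ n) (indicator {z})) x \<le> markov ?w2 (\<lambda>x. ennreal (m ^ n) * 1) x"
      by (intro markov_mono) (use Suc in simp)
    also have "\<dots> \<le> ennreal (m ^ n) * ennreal m"
      unfolding markov_cmult by (intro mult_left_mono one) auto
    finally show ?case using m by (simp add: ennreal_mult [symmetric] mult.commute)
  qed (auto simp: indicator_def)
  define \<theta> where "\<theta> = sqrt (m / c)"
  have \<theta>: "0 < \<theta>" "\<theta> < 1" "\<theta> * \<theta> = m / c" using m c by (auto simp: \<theta>_def)
  have a: "?a n \<le> ennreal ((1 + K) * \<theta> ^ n)" for n
  proof -
    \<comment> \<open>This value balances the two terms:
      \<open>\<tau> * m ^ n = \<theta> ^ n\<close>, and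
      \<open>K / (\<tau> * c ^ n) = K * \<theta> ^ n\<close> because
      \<open>\<theta> * \<theta> = m / c\<close>.\<close>
    define \<tau> where "\<tau> = (\<theta> / m) ^ n"
    have \<tau>: "0 < \<tau>" using \<theta> m by (simp add: \<tau>_def)
    have "2 * ?a n \<le> ennreal \<tau> * (markov ?w2 ^^ n) (indicator {0}) 0 + ennreal (1 / \<tau>) * (P ^^ n) (indicator {0}) 0"
      by (rule twisted_le [OF \<tau>])
    also have "\<dots> \<le> ennreal \<tau> * ennreal (m ^ n) + ennreal (1 / \<tau>) * ennreal (K / c ^ n)"
      using K [of n] c unfolding markov_pow_pmf
      by (intro add_mono mult_left_mono b ennreal_leI) (simp_all add: field_simps)
    also have "\<dots> = ennreal (\<tau> * m ^ n + 1 / \<tau> * (K / c ^ n))"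
    proof -
      have "0 \<le> 1 / \<tau>" "0 \<le> K / c ^ n" "0 \<le> \<tau>" "0 \<le> m ^ n" using \<tau> m K0 c by auto
      then show ?thesis by (simp only: ennreal_mult ennreal_plus mult_nonneg_nonneg)
    qed
    also have "\<tau> * m ^ n = \<theta> ^ n"
      using m by (simp add: \<tau>_def power_mult_distrib [symmetric])
    also have "1 / \<tau> * (K / c ^ n) = K * (m / (\<theta> * c)) ^ n"
      using \<theta> m c by (simp add: \<tau>_def power_divide power_mult_distrib)
    also have "m / (\<theta> * c) = \<theta>" using \<theta> c by (simp add: field_simps)
    finally have "2 * ?a n \<le> ennreal ((1 + K) * \<theta> ^ n)" by (simp add: algebra_simps)
    moreover have "?a n \<le> 2 * ?a n" by (simp add: mult_2)
    ultimately show ?thesis by (rule order_trans [rotated])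
  qed
  \<comment> \<open>On the logarithmic scale half of the decay goes into \<open>q\<close>; what
    remains, \<open>q * \<theta> = sqrt \<theta>\<close>, is still summable.\<close>
  define q where "q = 1 / sqrt \<theta>"
  have q: "1 < q" "q * \<theta> = sqrt \<theta>" using \<theta> by (auto simp: q_def real_div_sqrt)
  have "green_kernel (\<lambda>s. ennreal q * (ennreal (exp (t / 2 * word_norm S s)) * w s)) 0 0 =
      (\<Sum>n. ennreal q ^ n * ?a n)"
    unfolding green_kernel_def potential_def markov_pow_scale_weight ..
  also have "\<dots> \<le> (\<Sum>n. ennreal ((1 + K) * sqrt \<theta> ^ n))"
  proof (intro suminf_le)
    fix n
    have "ennreal q ^ n * ?a n \<le> ennreal (q ^ n) * ennreal ((1 + K) * \<theta> ^ n)"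
      using q by (intro mult_mono a) (auto simp: ennreal_power)
    also have "\<dots> = ennreal ((1 + K) * (q * \<theta>) ^ n)"
    proof -
      have "(1 + K) * (q * \<theta>) ^ n = q ^ n * ((1 + K) * \<theta> ^ n)"
        by (simp only: power_mult_distrib mult_ac)
      moreover have "0 \<le> q ^ n" "0 \<le> (1 + K) * \<theta> ^ n" using q \<theta> K0 by auto
      ultimately show ?thesis by (simp only: ennreal_mult)
    qed
    finally show "ennreal q ^ n * ?a n \<le> ennreal ((1 + K) * sqrt \<theta> ^ n)"
      using q by simp
  qed auto
  also have "\<dots> < \<infinity>"
  proof -
    have "summable (\<lambda>n. (1 + K) * sqrt \<theta> ^ n)"
      using \<theta> by (intro summable_mult summable_geometric) simp
    then show ?thesis using K0 \<theta> by (subst suminf_ennreal2) auto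
  qed
  finally show ?thesis using t q by (intro that [of "t / 2" q]) auto
qed

end

locale floyd_walk = superexp_walk S \<mu> + floyd S f
  for S :: "'a::group_add set" and \<mu> :: "'a pmf" and f :: "real \<Rightarrow> real"
begin

lemma green_ge_dist:
  assumes C: "1 \<le> C" and har: "\<And>u x y. (\<forall>x. P u x \<le> u x) \<Longrightarrow> u y \<le> ennreal (C ^ d x y) * u x"
    and n: "d x z \<le> n"
  shows "1 \<le> ennreal (C ^ n) * G x z"
proof -
  have "1 \<le> G z z" by (rule green_kernel_diag_ge)
  also have "\<dots> \<le> ennreal (C ^ d x z) * G x z"
    by (rule har) (use green_kernel_superharmonic in blast)
  also have "\<dots> \<le> ennreal (C ^ n) * G x z"
    using C n by (intro mult_right_mono ennreal_leI power_increasing) auto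
  finally show ?thesis .
qed

text \<open>The second point \<open>z\<close> stays fixed while the ball for the first one doubles.
  The excess \<open>v\<close> over the old inequality is compared with \<psi>, the product of \<phi>
  and \<open>H\<close>: here \<open>H\<close> is the Green function of an inflated weight and \<phi>
  grows exponentially with the Floyd distance from \<open>x\<close>. Outside the ball of radius
  \<open>2 * r\<close> a short jump changes that distance by at most \<open>f r\<close> per unit of
  length, and the inflated weight absorbs the growth. At \<open>x\<close> itself \<phi> is so small
  that Harnack turns \<psi> into a small multiple of \<open>G x 0 * G 0 z\<close>.\<close>

lemma ancona_step:
  assumes "exp_decay \<mu>"
  obtains b\<^sub>0 Q where "0 \<le> Q" "\<And>b r A \<delta>\<^sub>0 x z.
    b\<^sub>0 \<le> b \<Longrightarrow> 1 \<le> r \<Longrightarrow> A < \<top> \<Longrightarrow> 0 \<le> \<delta>\<^sub>0 \<Longrightarrow>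
    word_norm S x \<le> 4 * r \<Longrightarrow> word_norm S z \<le> 4 * r \<Longrightarrow>
    \<delta>\<^sub>0 + b * (2 * real r) * f (real r) \<le> \<delta> 0 x z \<Longrightarrow>
    (\<And>u. word_norm S u \<le> 2 * r \<Longrightarrow> \<delta>\<^sub>0 \<le> \<delta> 0 u z \<Longrightarrow> G u z \<le> A * (G u 0 * G 0 z)) \<Longrightarrow>
    G x z \<le> (A + ennreal (Q * exp (- (2 * real r)))) * (G x 0 * G 0 z)"
proof -
  obtain C where C: "1 \<le> C" and har: "\<And>u x y. (\<forall>x. P u x \<le> u x) \<Longrightarrow> u y \<le> ennreal (C ^ d x y) * u x"
    using harnack by blast
  obtain t q :: real where t: "0 < t" and q: "1 < q"
    and Hfin: "green_kernel (\<lambda>s. ennreal q * (ennreal (exp (t * word_norm S s)) * w s)) 0 0 < \<infinity>"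
    by (rule twisted_green_finite [OF assms])
  define w' where "w' s = ennreal q * (ennreal (exp (t * word_norm S s)) * w s)" for s
  define H where "H z x = green_kernel w' x z" for z x
  obtain hh where hh: "0 \<le> hh" "H 0 0 = ennreal hh"
    using Hfin unfolding H_def w'_def [abs_def] by (auto simp: less_top_ennreal)
  have ww': "w s \<le> w' s" for s
  proof -
    have "1 * (1 * w s) \<le> w' s"
      unfolding w'_def using q t by (intro mult_mono) (auto simp: one_le_exp_iff simp flip: ennreal_1)
    then show ?thesis by simp
  qed
  have GH: "G x z \<le> H z x" for x z
    unfolding H_def green_kernel_def by (rule potential_mono_weight [OF ww'])
  have Hsup': "markov w' (H z) x \<le> H z x" for z x
    using green_kernel_superharmonic [of w' z x] unfolding H_def [abs_def] .
  have Hsup: "P (H z) x \<le> H z x" for z x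
    using markov_mono_weight [of w w', OF ww'] Hsup' order_trans by blast
  have Hle: "H z x \<le> ennreal (C ^ d z x * hh)" for z x
  proof -
    have "H z x \<le> ennreal (C ^ d z x) * H z z" by (rule har) (use Hsup in blast)
    also have "H z z = H 0 0" unfolding H_def by (rule green_kernel_diag)
    finally show ?thesis using hh C by (simp add: ennreal_mult)
  qed
  have Hfinite: "H z x < \<top>" for z x using Hle [of z x] ennreal_less_top le_less_trans by blast
  \<comment> \<open>At \<open>x\<close>, Harnack costs \<open>C ^ (8 * r)\<close> in
    \<open>H\<close> and again \<open>C ^ (8 * r)\<close> in \<open>G x 0 * G 0 z\<close>. With the
    desired \<open>exp (- (2 * real r))\<close> this asks for the factor
    \<open>1 / (exp 1 * C ^ 8) ^ (2 * r)\<close>, which is \<open>1 / K ^ r\<close>;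
    \<open>b\<^sub>0\<close> makes the exponential in \<phi> equally small at
    \<open>x\<close>.\<close>
  define K where "K = (exp 1 * C ^ 8) ^ 2"
  have eC: "1 \<le> exp 1 * C ^ 8"
    using C mult_mono [of 1 "exp 1" 1 "C ^ 8"] by (simp add: one_le_power)
  have K: "1 \<le> K" using eC by (simp add: K_def one_le_power)
  obtain M where M: "(\<integral>\<^sup>+ s. ennreal ((C * K) ^ word_norm S s) \<partial>measure_pmf \<mu>) = ennreal M" "0 \<le> M"
    using moment [of "C * K"] C K mult_mono [of 1 C 1 K] by (auto simp: less_top_ennreal)
  define Q where "Q = (1 + q / (q - 1) * M) * hh"
  define b\<^sub>0 where "b\<^sub>0 = ln (exp 1 * C ^ 8) / t"
  have Q: "0 \<le> Q" using q M hh by (auto simp: Q_def)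
  show ?thesis
  proof (rule that [of Q b\<^sub>0, OF Q])
    fix b :: real and r :: nat and A :: ennreal and \<delta>\<^sub>0 :: real and x z
    assume b: "b\<^sub>0 \<le> b" and r: "1 \<le> r" and A: "A < \<top>" and \<delta>\<^sub>0: "0 \<le> \<delta>\<^sub>0"
      and x: "word_norm S x \<le> 4 * r" and z: "word_norm S z \<le> 4 * r"
      and xz: "\<delta>\<^sub>0 + b * (2 * real r) * f (real r) \<le> \<delta> 0 x z"
      and IH: "\<And>u. word_norm S u \<le> 2 * r \<Longrightarrow> \<delta>\<^sub>0 \<le> \<delta> 0 u z \<Longrightarrow> G u z \<le> A * (G u 0 * G 0 z)"
    define fr where "fr = f (real r)"
    have fr: "0 < fr" by (simp add: fr_def f_pos)
    have b_nonneg: "0 \<le> b"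
    proof -
      have "0 \<le> b\<^sub>0" using t eC by (simp add: b\<^sub>0_def)
      with b show ?thesis by simp
    qed
    \<comment> \<open>Chebyshev for the jumps of length at least \<open>r\<close>: there
      \<open>C ^ word_norm S s\<close> is at most \<open>(C * K) ^ word_norm S s / K ^ r\<close>,
      whose mean is \<eta>.\<close>
    define \<eta> where "\<eta> = M / K ^ r"
    define \<eta>' where "\<eta>' = \<eta> * q / (q - 1)"
    have \<eta>: "0 \<le> \<eta>" "0 \<le> \<eta>'" using M K q by (auto simp: \<eta>_def \<eta>'_def)
    define F where "F u = A * (G u 0 * G 0 z)" for u
    define v where "v u = G u z - F u" for u
    define \<phi> where "\<phi> u = exp (t * (\<delta> 0 x u / fr - b * (2 * real r))) + \<eta>'" for u
    define \<psi> where "\<psi> u = ennreal (\<phi> u) * H z u" for u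
    define ws where "ws s = (if word_norm S s < r then w s else 0)" for s
    define wb where "wb s = (if word_norm S s < r then 0 else w s)" for s
    \<comment> \<open>Off \<open>D\<close> there are two cases: \<open>u\<close> lies in the old
      ball and is still Floyd-far from \<open>z\<close>, so the excess is 0, or the exponential in
      \<phi> is at least 1 and \<psi> dominates the full Green function.\<close>
    define D where "D = {u. \<delta> 0 x u < b * (2 * real r) * fr \<and> 2 * r < word_norm S u}"
    have \<phi>: "0 \<le> \<phi> u" for u using \<eta> by (simp add: \<phi>_def)
    have Ffin: "F u < \<top>" for u using A by (auto simp: F_def ennreal_mult_less_top)
    have Fsup: "P F u \<le> F u" for u
    proof -
      have "F = (\<lambda>u. (A * G 0 z) * G u 0)" by (simp add: F_def fun_eq_iff mult_ac)
      then show ?thesis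
        using mult_left_mono [OF green_kernel_superharmonic [of w 0 u], of "A * G 0 z"]
        by (simp add: markov_cmult)
    qed
    have split: "P u y = markov ws u y + markov wb u y" for u y
    proof -
      have "w s * u (y + s) = ws s * u (y + s) + wb s * u (y + s)" for s
        by (simp add: ws_def wb_def)
      then show ?thesis by (simp add: markov_def nn_integral_add)
    qed
    have big: "markov wb (\<lambda>u. G u z) u \<le> ennreal \<eta> * G u z" for u
    proof -
      have "wb s * G (u + s) z \<le> (ennreal (1 / K ^ r) * G u z) * (w s * ennreal ((C * K) ^ word_norm S s))" for s
      proof (cases "word_norm S s < r")
        case False
        have "G (u + s) z \<le> ennreal (C ^ word_norm S s) * G u z"
          using har [of "\<lambda>u. G u z" "u + s" u] green_kernel_superharmonic [of w z]
          by (simp add: word_dist_def add.assoc [symmetric])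
        also have "\<dots> \<le> ennreal (1 / K ^ r * (C * K) ^ word_norm S s) * G u z"
        proof (intro mult_right_mono ennreal_leI)
          have "C ^ word_norm S s * K ^ r \<le> C ^ word_norm S s * K ^ word_norm S s"
            using C K False by (intro mult_left_mono power_increasing) auto
          then show "C ^ word_norm S s \<le> 1 / K ^ r * (C * K) ^ word_norm S s"
            using K by (simp add: power_mult_distrib le_divide_eq)
        qed auto
        also have "\<dots> = ennreal (1 / K ^ r) * ennreal ((C * K) ^ word_norm S s) * G u z"
          using K C by (subst ennreal_mult) auto
        finally have "w s * G (u + s) z \<le> w s * (ennreal (1 / K ^ r) * ennreal ((C * K) ^ word_norm S s) * G u z)"
          by (intro mult_left_mono) auto
        then show ?thesis using False by (simp only: wb_def if_False mult_ac)
      qed (simp add: wb_def)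
      then have "markov wb (\<lambda>u. G u z) u \<le>
          (\<integral>\<^sup>+ s. (ennreal (1 / K ^ r) * G u z) * (w s * ennreal ((C * K) ^ word_norm S s)) \<partial>count_space UNIV)"
        unfolding markov_def by (intro nn_integral_mono)
      also have "\<dots> = (ennreal (1 / K ^ r) * G u z) * ennreal M"
        using M(1) by (simp add: nn_integral_cmult nn_integral_measure_pmf)
      also have "\<dots> = ennreal \<eta> * G u z"
        using M(2) K by (simp add: \<eta>_def ennreal_mult' [symmetric] mult_ac) (simp add: mult.assoc [symmetric] ennreal_mult' [symmetric] mult.commute)
      finally show ?thesis .
    qed
    have "v x \<le> \<psi> x"
    proof (rule comparison_principle [where D = D and w' = ws and w = w and b = "\<lambda>u. ennreal \<eta> * G u z"
          and p = z and c = 1])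
      fix u assume "u \<notin> D"
      show "v u \<le> \<psi> u"
      proof (cases "\<delta> 0 x u < b * (2 * real r) * fr")
        case True
        then have "word_norm S u \<le> 2 * r" using \<open>u \<notin> D\<close> by (simp add: D_def)
        moreover have "\<delta>\<^sub>0 \<le> \<delta> 0 u z"
          using True xz \<delta>_triangle [of 0 x z u] by (simp add: fr_def)
        ultimately have "G u z \<le> F u" unfolding F_def by (rule IH)
        then have "v u = 0" using Ffin by (simp add: v_def diff_eq_0_iff_ennreal)
        then show ?thesis by simp
      next
        case False
        then have "b * (2 * real r) \<le> \<delta> 0 x u / fr" using fr by (simp add: le_divide_eq)
        then have "1 \<le> exp (t * (\<delta> 0 x u / fr - b * (2 * real r)))" using t by simp
        then have "1 \<le> \<phi> u" using \<eta> unfolding \<phi>_def by linarith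
        then have "1 * H z u \<le> \<psi> u"
          unfolding \<psi>_def by (intro mult_right_mono) (auto simp flip: ennreal_1)
        moreover have "v u \<le> G u z" by (simp add: v_def)
        ultimately show ?thesis using GH [of u z] by simp
      qed
    next
      fix u assume u: "u \<in> D"
      \<comment> \<open>Needed so that \<open>G u z\<close> is harmonic at \<open>u\<close>: the
        point \<open>z\<close> is too far from \<open>x\<close> in the Floyd metric to belong to
        \<open>D\<close>.\<close>
      have "u \<noteq> z" using u xz \<delta>\<^sub>0 by (auto simp: D_def fr_def)
      then have "G u z = P (\<lambda>u. G u z) u"
        using green_kernel_unfold [of w u z] by simp
      also have "\<dots> = markov ws (\<lambda>u. G u z) u + markov wb (\<lambda>u. G u z) u" by (rule split)
      also have "\<dots> \<le> markov ws (\<lambda>u. v u + F u) u + ennreal \<eta> * G u z"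
        by (intro add_mono markov_mono big) (auto simp: v_def diff_add_self_ennreal)
      also have "\<dots> = markov ws v u + ennreal \<eta> * G u z + markov ws F u"
        by (simp add: markov_add add_ac)
      also have "\<dots> \<le> markov ws v u + ennreal \<eta> * G u z + F u"
      proof (intro add_left_mono)
        have "markov ws F u \<le> P F u" by (intro markov_mono_weight) (simp add: ws_def)
        then show "markov ws F u \<le> F u" using Fsup by (rule order_trans)
      qed
      finally have "v u \<le> (markov ws v u + ennreal \<eta> * G u z + F u) - F u"
        unfolding v_def by (intro ennreal_minus_mono) auto
      then show "v u \<le> markov ws v u + ennreal \<eta> * G u z"
        using Ffin [of u] by simp
      \<comment> \<open>A geodesic of length below \<open>r\<close> that starts outside the ball of
        radius \<open>2 * r\<close> stays at distance at least \<open>r\<close> from 0, where an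
        edge costs at most \<open>fr\<close>.\<close>
      have step: "\<phi> (u + s) \<le> \<phi> u * exp (t * word_norm S s)" if "word_norm S s < r" for s
      proof -
        have "\<delta> 0 u (u + s) \<le> real (d u (u + s)) * fr"
          unfolding fr_def by (rule \<delta>_le_far) (use u that in \<open>simp add: D_def word_dist_def add.assoc [symmetric]\<close>)
        then have "\<delta> 0 x (u + s) \<le> \<delta> 0 x u + real (word_norm S s) * fr"
          using \<delta>_triangle [of 0 x "u + s" u] by (simp add: word_dist_def add.assoc [symmetric])
        then have "\<delta> 0 x (u + s) / fr \<le> \<delta> 0 x u / fr + real (word_norm S s)"
          using fr by (simp add: field_simps)
        then have "t * (\<delta> 0 x (u + s) / fr) \<le> t * (\<delta> 0 x u / fr) + t * word_norm S s"
          using t mult_left_mono [of "\<delta> 0 x (u + s) / fr" "\<delta> 0 x u / fr + real (word_norm S s)" t]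
          by (simp add: distrib_left)
        then have "exp (t * (\<delta> 0 x (u + s) / fr - b * (2 * real r))) \<le>
            exp (t * (\<delta> 0 x u / fr - b * (2 * real r)) + t * word_norm S s)"
          by (simp add: right_diff_distrib)
        moreover have "\<eta>' * 1 \<le> \<eta>' * exp (t * word_norm S s)"
          using \<eta> t by (intro mult_left_mono) auto
        ultimately show ?thesis
          unfolding \<phi>_def distrib_right exp_add by linarith
      qed
      have "ws s * \<psi> (u + s) \<le> ennreal (\<phi> u / q) * (w' s * H z (u + s))" for s
      proof (cases "word_norm S s < r")
        case True
        have "ws s * \<psi> (u + s) = ennreal (\<phi> (u + s)) * (w s * H z (u + s))"
          using True by (simp add: ws_def \<psi>_def mult_ac)
        also have "\<dots> \<le> ennreal (\<phi> u * exp (t * word_norm S s)) * (w s * H z (u + s))"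
          by (intro mult_right_mono ennreal_leI step True) auto
        also have "\<phi> u * exp (t * word_norm S s) = \<phi> u / q * (q * exp (t * word_norm S s))"
          using q by simp
        also have "ennreal \<dots> * (w s * H z (u + s)) = ennreal (\<phi> u / q) * (w' s * H z (u + s))"
          using q \<phi> [of u] by (simp only: ennreal_mult' ennreal_mult w'_def mult_ac divide_nonneg_pos exp_ge_zero)
        finally show ?thesis .
      qed (simp add: ws_def)
      then have "markov ws \<psi> u \<le> ennreal (\<phi> u / q) * markov w' (H z) u"
        unfolding markov_def by (subst nn_integral_cmult [symmetric]) (auto intro: nn_integral_mono)
      also have "\<dots> \<le> ennreal (\<phi> u / q) * H z u"
        by (intro mult_left_mono Hsup') auto
      finally have "markov ws \<psi> u + ennreal \<eta> * G u z \<le> ennreal (\<phi> u / q) * H z u + ennreal \<eta> * H z u"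
        by (intro add_mono mult_left_mono GH) auto
      also have "\<dots> = ennreal (\<phi> u / q + \<eta>) * H z u"
        using \<phi> [of u] q \<eta> by (simp add: distrib_right)
      also have "\<dots> \<le> \<psi> u"
        unfolding \<psi>_def
      proof (intro mult_right_mono ennreal_leI)
        \<comment> \<open>The inflated weight spares the fraction \<open>(q - 1) / q\<close> of
          \<phi>; as \<phi> never drops below \<open>\<eta>'\<close>, that fraction pays for the
          long jumps.\<close>
        have "\<eta> = \<eta>' * ((q - 1) / q)" using q by (simp add: \<eta>'_def)
        also have "\<dots> \<le> \<phi> u * ((q - 1) / q)"
          using q by (intro mult_right_mono) (auto simp: \<phi>_def)
        finally show "\<phi> u / q + \<eta> \<le> \<phi> u" using q by (simp add: field_simps)
      qed auto
      finally show "markov ws \<psi> u + ennreal \<eta> * G u z \<le> \<psi> u" .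
    qed (auto simp: ws_def \<psi>_def v_def ennreal_mult_less_top Hfinite)
    then have "G x z \<le> \<psi> x + F x"
      unfolding v_def ennreal_minus_le_iff by (simp add: add.commute)
    also have "\<psi> x \<le> ennreal (Q * exp (- (2 * real r))) * (G x 0 * G 0 z)"
    proof -
      let ?e = "exp 1 * C ^ 8"
      have 1: "exp (t * (- (b * (2 * real r)))) \<le> 1 / ?e ^ (2 * r)"
      proof -
        have "ln ?e \<le> t * b" using b t by (simp add: b\<^sub>0_def divide_le_eq mult.commute)
        then have "t * (- (b * (2 * real r))) \<le> - (real (2 * r) * ln ?e)"
          using mult_left_mono [of "ln ?e" "t * b" "real (2 * r)"] by (simp add: mult_ac)
        then have "exp (t * (- (b * (2 * real r)))) \<le> exp (- (real (2 * r) * ln ?e))" by simp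
        also have "\<dots> = 1 / ?e ^ (2 * r)"
        proof -
          have "0 < ?e" using C by simp
          then have "exp (real (2 * r) * ln ?e) = ?e ^ (2 * r)"
            by (simp only: exp_of_nat_mult exp_ln)
          then show ?thesis by (simp only: exp_minus inverse_eq_divide)
        qed
        finally show ?thesis .
      qed
      have 2: "\<eta>' = q / (q - 1) * M * (1 / ?e ^ (2 * r))"
        by (simp add: \<eta>'_def \<eta>_def K_def power_mult [symmetric] mult.commute)
      have "\<phi> x \<le> (1 + q / (q - 1) * M) * (1 / ?e ^ (2 * r))"
        using 1 unfolding \<phi>_def distrib_right 2 [symmetric] by simp
      then have "\<psi> x \<le> ennreal ((1 + q / (q - 1) * M) * (1 / ?e ^ (2 * r))) * ennreal (C ^ (8 * r) * hh)"
      proof -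
        assume *: "\<phi> x \<le> (1 + q / (q - 1) * M) * (1 / ?e ^ (2 * r))"
        have "d z x \<le> 8 * r"
          using d_triangle [of z x 0] d_commute [of z 0] x z by simp
        then have "C ^ d z x * hh \<le> C ^ (8 * r) * hh"
          using C hh by (intro mult_right_mono power_increasing) auto
        then have "H z x \<le> ennreal (C ^ (8 * r) * hh)"
          using Hle [of z x] by (meson ennreal_leI order_trans)
        then show ?thesis unfolding \<psi>_def using * by (intro mult_mono ennreal_leI) auto
      qed
      also have "\<dots> = ennreal (Q * exp (- (2 * real r)) * (1 / C ^ (8 * r)))"
      proof -
        have "?e ^ (2 * r) = exp (2 * r) * C ^ (8 * r) * C ^ (8 * r)"
          using exp_of_nat_mult [of "2 * r" "1::real"]
          by (simp add: power_mult_distrib power_mult [symmetric] power_add [symmetric])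
        then have "(1 + q / (q - 1) * M) * (1 / ?e ^ (2 * r)) * (C ^ (8 * r) * hh) =
            Q * exp (- (2 * real r)) * (1 / C ^ (8 * r))"
          using C by (simp add: Q_def exp_minus field_simps)
        moreover have "0 \<le> (1 + q / (q - 1) * M) * (1 / ?e ^ (2 * r))"
          using q M C by (intro mult_nonneg_nonneg add_nonneg_nonneg) auto
        ultimately show ?thesis
          using C hh by (simp only: ennreal_mult' [symmetric])
      qed
      also have "\<dots> \<le> ennreal (Q * exp (- (2 * real r)) * (1 / C ^ (8 * r))) *
          ((ennreal (C ^ (4 * r)) * G x 0) * (ennreal (C ^ (4 * r)) * G 0 z))"
      proof -
        have "1 \<le> ennreal (C ^ (4 * r)) * G x 0" "1 \<le> ennreal (C ^ (4 * r)) * G 0 z"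
          using green_ge_dist [OF C har, of x 0 "4 * r"] green_ge_dist [OF C har, of 0 z "4 * r"]
            x z d_commute [of x 0] by simp_all
        then have "1 * 1 \<le> (ennreal (C ^ (4 * r)) * G x 0) * (ennreal (C ^ (4 * r)) * G 0 z)"
          by (intro mult_mono) auto
        then show ?thesis using mult_left_mono by fastforce
      qed
      also have "\<dots> = ennreal (Q * exp (- (2 * real r)) * (1 / C ^ (8 * r)) * (C ^ (4 * r) * C ^ (4 * r))) * (G x 0 * G 0 z)"
      proof -
        let ?a = "Q * exp (- (2 * real r)) * (1 / C ^ (8 * r))" and ?c = "C ^ (4 * r)"
        have "0 \<le> ?a" "0 \<le> ?c" using Q C by auto
        then have "ennreal (?a * (?c * ?c)) = ennreal ?a * (ennreal ?c * ennreal ?c)"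
          by (simp only: ennreal_mult' )
        then show ?thesis by (simp only: mult_ac)
      qed
      also have "Q * exp (- (2 * real r)) * (1 / C ^ (8 * r)) * (C ^ (4 * r) * C ^ (4 * r)) = Q * exp (- (2 * real r))"
        using C by (simp add: power_add [symmetric])
      finally show ?thesis .
    qed
    finally show "G x z \<le> (A + ennreal (Q * exp (- (2 * real r)))) * (G x 0 * G 0 z)"
      by (simp add: F_def distrib_right add.commute add_right_mono)
  qed
qed

text \<open>At the base scale Harnack suffices. Each scale then uses \<open>ancona_step\<close>
  twice, for the walk to move \<open>x\<close> out and for the reflected walk to move
  \<open>z\<close> out; hence the factors 2 in front of both losses. The Floyd losses
  \<open>e j\<close> are summed by condensation, the losses in the constant by a geometric
  series.\<close>

theorem ancona:
  assumes gap: "exp_decay \<mu>" and \<epsilon>: "0 < \<epsilon>"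
  obtains A :: real where "0 < A" "\<And>v x z. \<epsilon> \<le> \<delta> v x z \<Longrightarrow> G x z \<le> ennreal A * (G x v * G v z)"
proof -
  interpret R: floyd_walk S "reflected \<mu>" f
    by (intro floyd_walk.intro reflected_walk floyd_axioms)
  obtain b1 Q1 where Q1: "0 \<le> Q1" and s1: "\<And>b r A \<delta>\<^sub>0 x z.
    b1 \<le> b \<Longrightarrow> 1 \<le> r \<Longrightarrow> A < \<top> \<Longrightarrow> 0 \<le> \<delta>\<^sub>0 \<Longrightarrow>
    word_norm S x \<le> 4 * r \<Longrightarrow> word_norm S z \<le> 4 * r \<Longrightarrow>
    \<delta>\<^sub>0 + b * (2 * real r) * f (real r) \<le> \<delta> 0 x z \<Longrightarrow>
    (\<And>u. word_norm S u \<le> 2 * r \<Longrightarrow> \<delta>\<^sub>0 \<le> \<delta> 0 u z \<Longrightarrow> G u z \<le> A * (G u 0 * G 0 z)) \<Longrightarrow>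
    G x z \<le> (A + ennreal (Q1 * exp (- (2 * real r)))) * (G x 0 * G 0 z)"
    by (rule ancona_step [OF gap]) blast
  obtain b2 Q2 where Q2: "0 \<le> Q2" and s2: "\<And>b r A \<delta>\<^sub>0 x z.
    b2 \<le> b \<Longrightarrow> 1 \<le> r \<Longrightarrow> A < \<top> \<Longrightarrow> 0 \<le> \<delta>\<^sub>0 \<Longrightarrow>
    word_norm S x \<le> 4 * r \<Longrightarrow> word_norm S z \<le> 4 * r \<Longrightarrow>
    \<delta>\<^sub>0 + b * (2 * real r) * f (real r) \<le> \<delta> 0 x z \<Longrightarrow>
    (\<And>u. word_norm S u \<le> 2 * r \<Longrightarrow> \<delta>\<^sub>0 \<le> \<delta> 0 u z \<Longrightarrow> R.G u z \<le> A * (R.G u 0 * R.G 0 z)) \<Longrightarrow>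
    R.G x z \<le> (A + ennreal (Q2 * exp (- (2 * real r)))) * (R.G x 0 * R.G 0 z)"
    by (rule R.ancona_step [OF exp_decay_reflected [OF gap]]) blast
  define b where "b = max 0 (max b1 b2)"
  define Q where "Q = Q1 + Q2"
  have Q0: "0 \<le> Q" using Q1 Q2 by (simp add: Q_def)
  \<comment> \<open>Over all scales the Floyd loss is at most \<open>8 * b * tail (2 ^ m)\<close>.
    This choice of \<open>N\<close> makes it at most \<open>\<epsilon> / 2\<close>, so that the
    threshold, which starts at \<open>\<epsilon> / 2\<close>, never exceeds \<epsilon>.\<close>
  obtain N where N: "\<And>r. N \<le> r \<Longrightarrow> tail r < \<epsilon> / (16 * (b + 1))"
    using tail_small [of "\<epsilon> / (16 * (b + 1))"] \<epsilon> by (auto simp: b_def)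
  define m where "m = N"
  have "N \<le> 2 ^ m" unfolding m_def using less_exp [of N] by simp
  then have tm: "16 * (b * tail (2 ^ m)) \<le> \<epsilon>"
  proof -
    have "b * tail (2 ^ m) \<le> (b + 1) * tail (2 ^ m)"
      using tail_nonneg by (intro mult_right_mono) auto
    also have "\<dots> \<le> \<epsilon> / 16"
      using N [OF \<open>N \<le> 2 ^ m\<close>] \<epsilon> by (simp add: b_def field_simps)
    finally show ?thesis by simp
  qed
  define r where "r j = (2::nat) ^ (j + m + 1)" for j
  have le_r: "j \<le> 2 * r j" for j
  proof -
    have "j \<le> 2 ^ j * 1" using less_exp [of j] by simp
    also have "\<dots> \<le> 2 ^ j * (2 * 2 ^ (m + 1))" by (intro mult_left_mono) auto
    also have "\<dots> = 2 * r j" by (simp add: r_def power_add)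
    finally show ?thesis .
  qed
  define e where "e j = b * (2 * real (r j)) * f (real (r j))" for j
  have e_nonneg: "0 \<le> e j" for j
    using f_pos [of "r j"] by (simp add: e_def b_def)
  have esum: "2 * (\<Sum>i<j. e i) \<le> \<epsilon> / 2" for j
  proof -
    have "(\<Sum>i<j. e i) = 2 * b * (\<Sum>i<j. 2 ^ (i + m + 1) * f (real (2 ^ (i + m + 1))))"
      by (simp add: e_def r_def sum_distrib_left mult_ac)
    also have "\<dots> \<le> 2 * b * (2 * tail (2 ^ m))"
      by (intro mult_left_mono sum_dyadic_le_tail) (simp add: b_def)
    finally show ?thesis using tm by simp
  qed
  obtain C where C: "1 \<le> C" and har: "\<And>u x y. (\<forall>x. P u x \<le> u x) \<Longrightarrow> u y \<le> ennreal (C ^ d x y) * u x"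
    using harnack by blast
  \<comment> \<open>Base scale: the left side is at most \<open>G 0 0\<close>, and each factor on
    the right is at least \<open>1 / C ^ (2 * r 0)\<close>.\<close>
  define A0 where "A0 = enn2real (G 0 0) * (C ^ (2 * r 0) * C ^ (2 * r 0))"
  define A where "A j = A0 + (\<Sum>i<j. 2 * (Q * exp (- (2 * real (r i)))))" for j
  have A0: "0 \<le> A0" using C by (simp add: A0_def)
  have A_nonneg: "0 \<le> A j" for j
  proof -
    have "0 \<le> (\<Sum>i<j. 2 * (Q * exp (- (2 * real (r i)))))"
      by (rule sum_nonneg) (intro mult_nonneg_nonneg Q0 exp_ge_zero zero_le_numeral)
    then show ?thesis unfolding A_def by (rule add_nonneg_nonneg [OF A0])
  qed
  have main: "G x z \<le> ennreal (A j) * (G x 0 * G 0 z)"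
    if "word_norm S x \<le> 2 * r j" "word_norm S z \<le> 2 * r j" "\<epsilon> / 2 + 2 * (\<Sum>i<j. e i) \<le> \<delta> 0 x z" for j x z
    using that
  proof (induction j arbitrary: x z)
    case 0
    have "1 \<le> ennreal (C ^ (2 * r 0)) * G x 0" "1 \<le> ennreal (C ^ (2 * r 0)) * G 0 z"
      using green_ge_dist [OF C har, of x 0 "2 * r 0"] green_ge_dist [OF C har, of 0 z "2 * r 0"]
        0 d_commute [of x 0] by simp_all
    then have "1 * 1 \<le> (ennreal (C ^ (2 * r 0)) * G x 0) * (ennreal (C ^ (2 * r 0)) * G 0 z)"
      by (intro mult_mono) auto
    then have "G 0 0 * 1 \<le> G 0 0 * ((ennreal (C ^ (2 * r 0)) * G x 0) * (ennreal (C ^ (2 * r 0)) * G 0 z))"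
      by (intro mult_left_mono) auto
    also have "\<dots> = ennreal (A 0) * (G x 0 * G 0 z)"
    proof -
      have "ennreal (A 0) = G 0 0 * (ennreal (C ^ (2 * r 0)) * ennreal (C ^ (2 * r 0)))"
        using C by (simp add: A_def A0_def ennreal_mult)
      then show ?thesis by (simp only: mult_ac)
    qed
    finally show ?case using green_le_diag [of x z] by simp
  next
    case (Suc j)
    let ?s = "\<epsilon> / 2 + 2 * (\<Sum>i<j. e i)"
    have s: "0 \<le> ?s" using \<epsilon> e_nonneg by (intro add_nonneg_nonneg mult_nonneg_nonneg sum_nonneg) auto
    have r1: "1 \<le> r j" by (simp add: r_def)
    have rS: "2 * r (Suc j) = 4 * r j" by (simp add: r_def)
    have b: "b1 \<le> b" "b2 \<le> b" by (auto simp: b_def)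
    let ?E = "exp (- (2 * real (r j)))"
    have half: "G x u \<le> ennreal (A j + Q1 * ?E) * (G x 0 * G 0 u)"
      if "word_norm S x \<le> 4 * r j" "word_norm S u \<le> 2 * r j" "?s + e j \<le> \<delta> 0 x u" for x u
    proof -
      have "G x u \<le> (ennreal (A j) + ennreal (Q1 * ?E)) * (G x 0 * G 0 u)"
        using that Suc.IH by (intro s1 [OF b(1) r1 _ s]) (auto simp: e_def)
      then show ?thesis using A_nonneg Q1 by simp
    qed
    have "R.G z x \<le> (ennreal (A j + Q1 * ?E) + ennreal (Q2 * ?E)) * (R.G z 0 * R.G 0 x)"
    proof (rule s2 [where \<delta>\<^sub>0 = "?s + e j", OF b(2) r1])
      show "0 \<le> ?s + e j" using s e_nonneg by simp
      show "?s + e j + b * (2 * real (r j)) * f (real (r j)) \<le> \<delta> 0 z x"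
        using Suc.prems(3) \<delta>_commute [of 0 x z] by (simp add: e_def)
      show "R.G u x \<le> ennreal (A j + Q1 * ?E) * (R.G u 0 * R.G 0 x)"
        if "word_norm S u \<le> 2 * r j" "?s + e j \<le> \<delta> 0 u x" for u
        using half [of x u] that Suc.prems rS \<delta>_commute [of 0 u x]
        unfolding green_kernel_reflected by (simp add: mult.commute)
    qed (use Suc.prems rS in auto)
    also have "ennreal (A j + Q1 * ?E) + ennreal (Q2 * ?E) = ennreal (A j + Q1 * ?E + Q2 * ?E)"
      using A_nonneg [of j] Q1 Q2 by (intro ennreal_plus [symmetric]) auto
    also have "\<dots> * (R.G z 0 * R.G 0 x) \<le> ennreal (A (Suc j)) * (R.G z 0 * R.G 0 x)"
    proof (intro mult_right_mono ennreal_leI)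
      have "A (Suc j) = A j + 2 * ((Q1 + Q2) * ?E)" by (simp add: A_def Q_def)
      moreover have "0 \<le> (Q1 + Q2) * ?E" using Q1 Q2 by simp
      ultimately show "A j + Q1 * ?E + Q2 * ?E \<le> A (Suc j)"
        by (simp add: distrib_right)
    qed auto
    finally show ?case
      unfolding green_kernel_reflected by (simp add: mult_ac)
  qed
  define A' where "A' = A0 + 2 * Q * (\<Sum>i. exp (- 1) ^ i) + 1"
  have AA1: "A j + 1 \<le> A'" for j
  proof -
    have "(\<Sum>i<j. 2 * (Q * exp (- (2 * real (r i))))) \<le> (\<Sum>i<j. 2 * Q * exp (- 1) ^ i)"
    proof (intro sum_mono)
      fix i
      have "i \<le> 2 * r i" by (rule le_r)
      then have "exp (- (2 * real (r i))) \<le> exp (- real i)" by simp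
      also have "\<dots> = exp (- 1) ^ i" by (simp add: exp_of_nat_mult [symmetric])
      finally have "2 * Q * exp (- (2 * real (r i))) \<le> 2 * Q * exp (- 1) ^ i"
        using Q1 Q2 by (intro mult_left_mono) (auto simp: Q_def)
      then show "2 * (Q * exp (- (2 * real (r i)))) \<le> 2 * Q * exp (- 1) ^ i"
        by (simp only: mult.assoc)
    qed
    also have "\<dots> \<le> 2 * Q * (\<Sum>i. exp (- 1) ^ i)"
      unfolding sum_distrib_left [symmetric] using Q1 Q2
      by (intro mult_left_mono sum_le_suminf summable_geometric) (auto simp: Q_def)
    finally show ?thesis by (simp add: A_def A'_def)
  qed
  have AA: "A j \<le> A'" for j using AA1 [of j] by simp
  have A': "0 < A'" using AA1 [of 0] A_nonneg [of 0] by simp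
  show ?thesis
  proof (rule that [of A', OF A'])
    fix v x z assume *: "\<epsilon> \<le> \<delta> v x z"
    let ?x = "- v + x" and ?z = "- v + z"
    \<comment> \<open>The larger norm itself serves as the number of scales, since the radius
      \<open>2 * r j\<close> exceeds \<open>j\<close>.\<close>
    define j where "j = max (word_norm S ?x) (word_norm S ?z)"
    have j: "j \<le> 2 * r j" by (rule le_r)
    have "\<epsilon> \<le> \<delta> 0 ?x ?z" using * \<delta>_translate [of "- v" v x z] by simp
    then have "G ?x ?z \<le> ennreal (A j) * (G ?x 0 * G 0 ?z)"
      using esum [of j] j by (intro main) (auto simp: j_def)
    also have "\<dots> \<le> ennreal A' * (G ?x 0 * G 0 ?z)"
      by (intro mult_right_mono ennreal_leI AA) auto
    finally show "G x z \<le> ennreal A' * (G x v * G v z)"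
      using green_kernel_translate [of w "- v" x z] green_kernel_translate [of w "- v" x v]
        green_kernel_translate [of w "- v" v z] by simp
  qed
qed

end

section \<open>Spectral gap from a paradoxical configuration\<close>

lemma nn_integral_count_space_commute:
  "(\<integral>\<^sup>+ x. \<integral>\<^sup>+ y. h x y \<partial>count_space UNIV \<partial>count_space UNIV) =
   (\<integral>\<^sup>+ y. \<integral>\<^sup>+ x. h x y \<partial>count_space UNIV \<partial>count_space UNIV)"
  using nn_integral_fst_count_space [of "\<lambda>(x, y). h x y"]
    nn_integral_snd_count_space [of "\<lambda>(x, y). h x y"] by simp

lemma nn_integral_translate_right:
  "(\<integral>\<^sup>+ x. h (x + g) \<partial>count_space UNIV) = (\<integral>\<^sup>+ x. h (x :: 'a::group_add) \<partial>count_space UNIV)"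
  by (rule nn_integral_bij_count_space) (rule bij_betw_byWitness [where f' = "\<lambda>x. x - g"], auto)

lemma nn_integral_translate_left:
  "(\<integral>\<^sup>+ x. h (g + x) \<partial>count_space UNIV) = (\<integral>\<^sup>+ x. h (x :: 'a::group_add) \<partial>count_space UNIV)"
  by (rule nn_integral_bij_count_space)
    (rule bij_betw_byWitness [where f' = "\<lambda>x. - g + x"], auto simp: add.assoc [symmetric])

lemma ennreal_am_gm:
  fixes a b :: ennreal
  assumes "0 < t"
  shows "2 * (a * b) \<le> ennreal t * (a * a) + ennreal (1 / t) * (b * b)"
proof (cases a; cases b)
  fix x y :: real assume *: "a = ennreal x" "0 \<le> x" "b = ennreal y" "0 \<le> y"
  have "0 \<le> (t * x - y)\<^sup>2 / t" using assms by simp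
  then have "2 * (x * y) \<le> t * (x * x) + 1 / t * (y * y)"
    using assms by (simp add: field_simps power2_eq_square)
  then have "ennreal (2 * (x * y)) \<le> ennreal (t * (x * x) + 1 / t * (y * y))"
    by (rule ennreal_leI)
  also have "ennreal (2 * (x * y)) = 2 * (a * b)"
    using * by (simp add: ennreal_mult)
  also have "ennreal (t * (x * x) + 1 / t * (y * y)) = ennreal t * (a * a) + ennreal (1 / t) * (b * b)"
  proof -
    have "0 \<le> t" "0 \<le> 1 / t" "0 \<le> x * x" "0 \<le> y * y" using assms by auto
    then have "ennreal (t * (x * x) + 1 / t * (y * y)) =
        ennreal t * ennreal (x * x) + ennreal (1 / t) * ennreal (y * y)"
      by (simp only: ennreal_plus ennreal_mult mult_nonneg_nonneg)
    then show ?thesis using * by (simp only: ennreal_mult)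
  qed
  finally show ?thesis .
qed (use assms in \<open>auto simp: ennreal_mult_top ennreal_top_mult\<close>)

section \<open>Quadratic norm of a convolution\<close>

definition sq_norm :: "('a \<Rightarrow> ennreal) \<Rightarrow> ennreal" where
  "sq_norm u = (\<integral>\<^sup>+ x. u x * u x \<partial>count_space UNIV)"

text \<open>A matrix coefficient of the right regular representation. By
  \<open>sq_norm_markov\<close> the squared norm of a convolution is a weighted sum of
  these.\<close>

definition corr :: "('a::group_add \<Rightarrow> ennreal) \<Rightarrow> 'a \<Rightarrow> ennreal" where
  "corr u h = (\<integral>\<^sup>+ x. u x * u (x + h) \<partial>count_space UNIV)"

lemma sq_norm_mono: "(\<And>x. u x \<le> v x) \<Longrightarrow> sq_norm u \<le> sq_norm v"
  unfolding sq_norm_def by (intro nn_integral_mono mult_mono) auto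

lemma sq_norm_cmult: "sq_norm (\<lambda>x. c * u x) = c * c * sq_norm u"
  unfolding sq_norm_def by (simp add: nn_integral_cmult [symmetric] mult_ac)

lemma sq_norm_ge: "u x * u x \<le> sq_norm u"
proof -
  have "u x * u x = (\<integral>\<^sup>+ y. u y * u y * indicator {x} y \<partial>count_space UNIV)"
    by (simp add: nn_integral_count_space_indicator [symmetric] nn_integral_count_space_finite)
  also have "\<dots> \<le> sq_norm u"
    unfolding sq_norm_def by (intro nn_integral_mono) (auto simp: indicator_def)
  finally show ?thesis .
qed

lemma sq_norm_add:
  assumes "0 < t"
  shows "sq_norm (\<lambda>x. u x + v x) \<le> ennreal (1 + t) * sq_norm u + ennreal (1 + 1 / t) * sq_norm v"
proof -
  have "(u x + v x) * (u x + v x) \<le> ennreal (1 + t) * (u x * u x) + ennreal (1 + 1 / t) * (v x * v x)" for x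
  proof -
    have "(u x + v x) * (u x + v x) = u x * u x + v x * v x + 2 * (u x * v x)"
      by (simp add: distrib_left distrib_right mult_2 add_ac mult.commute)
    also have "\<dots> \<le> u x * u x + v x * v x + (ennreal t * (u x * u x) + ennreal (1 / t) * (v x * v x))"
      by (intro add_left_mono ennreal_am_gm assms)
    also have "\<dots> = ennreal (1 + t) * (u x * u x) + ennreal (1 + 1 / t) * (v x * v x)"
      using assms by (simp add: algebra_simps)
    finally show ?thesis .
  qed
  then show ?thesis
    unfolding sq_norm_def by (simp add: nn_integral_cmult [symmetric] nn_integral_add [symmetric] nn_integral_mono)
qed

lemma corr_le: "corr u h \<le> sq_norm u"
proof -
  have "2 * corr u h \<le> (\<integral>\<^sup>+ x. ennreal 1 * (u x * u x) + ennreal (1 / 1) * (u (x + h) * u (x + h)) \<partial>count_space UNIV)"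
    unfolding corr_def
    by (subst nn_integral_cmult [symmetric]) (simp, intro nn_integral_mono ennreal_am_gm zero_less_one)
  also have "\<dots> = 2 * sq_norm u"
    using nn_integral_translate_right [of "\<lambda>x. u x * u x" h]
    by (simp add: nn_integral_add sq_norm_def mult_2)
  finally show ?thesis by (subst (asm) ennreal_mult_le_mult_iff) auto
qed

lemma sq_norm_markov:
  "sq_norm (markov k u) =
    (\<integral>\<^sup>+ s. \<integral>\<^sup>+ t. k s * k t * corr u (- s + t) \<partial>count_space UNIV \<partial>count_space UNIV)"
proof -
  have "sq_norm (markov k u) = (\<integral>\<^sup>+ x. \<integral>\<^sup>+ s. \<integral>\<^sup>+ t. (k s * u (x + s)) * (k t * u (x + t))
      \<partial>count_space UNIV \<partial>count_space UNIV \<partial>count_space UNIV)"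
    unfolding sq_norm_def markov_def by (simp add: nn_integral_cmult nn_integral_multc)
  also have "\<dots> = (\<integral>\<^sup>+ s. \<integral>\<^sup>+ x. \<integral>\<^sup>+ t. (k s * u (x + s)) * (k t * u (x + t))
      \<partial>count_space UNIV \<partial>count_space UNIV \<partial>count_space UNIV)"
    by (rule nn_integral_count_space_commute)
  also have "\<dots> = (\<integral>\<^sup>+ s. \<integral>\<^sup>+ t. \<integral>\<^sup>+ x. (k s * u (x + s)) * (k t * u (x + t))
      \<partial>count_space UNIV \<partial>count_space UNIV \<partial>count_space UNIV)"
    by (intro nn_integral_cong nn_integral_count_space_commute)
  also have "\<dots> = (\<integral>\<^sup>+ s. \<integral>\<^sup>+ t. k s * k t * corr u (- s + t) \<partial>count_space UNIV \<partial>count_space UNIV)"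
  proof (intro nn_integral_cong)
    fix s t
    have "(\<integral>\<^sup>+ x. (k s * u (x + s)) * (k t * u (x + t)) \<partial>count_space UNIV) =
        k s * k t * (\<integral>\<^sup>+ x. u (x + s) * u ((x + s) + (- s + t)) \<partial>count_space UNIV)"
      by (subst nn_integral_cmult [symmetric]) (auto simp: mult_ac add.assoc)
    also have "(\<integral>\<^sup>+ x. u (x + s) * u ((x + s) + (- s + t)) \<partial>count_space UNIV) = corr u (- s + t)"
      unfolding corr_def by (rule nn_integral_translate_right)
    finally show "(\<integral>\<^sup>+ x. (k s * u (x + s)) * (k t * u (x + t)) \<partial>count_space UNIV) =
        k s * k t * corr u (- s + t)" .
  qed
  finally show ?thesis .
qed

lemma nn_integral_prod_le_one:
  assumes "(\<integral>\<^sup>+ s. k s \<partial>count_space UNIV) \<le> 1"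
  shows "(\<integral>\<^sup>+ s. \<integral>\<^sup>+ t. k s * k t * c \<partial>count_space UNIV \<partial>count_space UNIV) \<le> (c :: ennreal)"
proof -
  have "(\<integral>\<^sup>+ s. \<integral>\<^sup>+ t. k s * k t * c \<partial>count_space UNIV \<partial>count_space UNIV) =
      (\<integral>\<^sup>+ s. k s \<partial>count_space UNIV) * ((\<integral>\<^sup>+ s. k s \<partial>count_space UNIV) * c)"
    by (simp add: nn_integral_multc nn_integral_cmult mult.assoc)
  also have "\<dots> \<le> 1 * (1 * c)" by (intro mult_mono assms) auto
  finally show ?thesis by simp
qed

lemma sq_norm_markov_le:
  assumes "(\<integral>\<^sup>+ s. k s \<partial>count_space UNIV) \<le> 1"
  shows "sq_norm (markov k u) \<le> sq_norm u"
proof -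
  have "sq_norm (markov k u) \<le> (\<integral>\<^sup>+ s. \<integral>\<^sup>+ t. k s * k t * sq_norm u \<partial>count_space UNIV \<partial>count_space UNIV)"
    unfolding sq_norm_markov by (intro nn_integral_mono mult_left_mono corr_le) auto
  also have "\<dots> \<le> sq_norm u" by (rule nn_integral_prod_le_one [OF assms])
  finally show ?thesis .
qed

text \<open>All pairs of increments obey \<open>corr_le\<close>; the pair (0, \<open>h\<close>) does
  better by \<open>t * sq_norm u\<close> and has weight at least \<open>c * c\<close>. This is why
  the kernel has to charge 0 as well as \<open>h\<close>.\<close>

lemma sq_norm_markov_contraction:
  assumes k: "(\<integral>\<^sup>+ s. k s \<partial>count_space UNIV) \<le> 1"
    and c: "ennreal c \<le> k h" "ennreal c \<le> k 0" "0 \<le> c"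
    and h: "corr u h + ennreal t * sq_norm u \<le> sq_norm u" and t: "0 \<le> t"
  shows "sq_norm (markov k u) + ennreal (c * c * t) * sq_norm u \<le> sq_norm u"
proof -
  let ?i = "\<lambda>s r. indicator {0} s * indicator {h} r :: ennreal"
  have "corr u (- s + r) + ennreal t * sq_norm u * ?i s r \<le> sq_norm u" for s r
    using corr_le [of u "- s + r"] h by (auto simp: indicator_def)
  then have "(\<integral>\<^sup>+ s. \<integral>\<^sup>+ r. k s * k r * (corr u (- s + r) + ennreal t * sq_norm u * ?i s r) \<partial>count_space UNIV \<partial>count_space UNIV)
    \<le> (\<integral>\<^sup>+ s. \<integral>\<^sup>+ r. k s * k r * sq_norm u \<partial>count_space UNIV \<partial>count_space UNIV)"
    by (intro nn_integral_mono mult_left_mono) auto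
  also have "\<dots> \<le> sq_norm u" by (rule nn_integral_prod_le_one [OF k])
  also have "(\<integral>\<^sup>+ s. \<integral>\<^sup>+ r. k s * k r * (corr u (- s + r) + ennreal t * sq_norm u * ?i s r) \<partial>count_space UNIV \<partial>count_space UNIV) =
    sq_norm (markov k u) + (\<integral>\<^sup>+ s. \<integral>\<^sup>+ r. (k s * k r * (ennreal t * sq_norm u)) * (indicator {0} s * indicator {h} r) \<partial>count_space UNIV \<partial>count_space UNIV)"
    unfolding sq_norm_markov by (simp add: distrib_left nn_integral_add mult.assoc)
  also have "(\<integral>\<^sup>+ s. \<integral>\<^sup>+ r. (k s * k r * (ennreal t * sq_norm u)) * (indicator {0} s * indicator {h} r) \<partial>count_space UNIV \<partial>count_space UNIV) =
      (\<integral>\<^sup>+ s. (k s * k h * (ennreal t * sq_norm u)) * indicator {0} s \<partial>count_space UNIV)"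
    by (simp add: mult.assoc [symmetric] nn_integral_count_space_indicator [symmetric] nn_integral_count_space_finite)
  also have "\<dots> = k 0 * k h * (ennreal t * sq_norm u)"
    by (simp add: nn_integral_count_space_indicator [symmetric] nn_integral_count_space_finite)
  finally have *: "sq_norm (markov k u) + k 0 * k h * (ennreal t * sq_norm u) \<le> sq_norm u" .
  have "ennreal (c * c * t) * sq_norm u = ennreal c * ennreal c * (ennreal t * sq_norm u)"
    using c t by (simp add: ennreal_mult mult.assoc)
  also have "\<dots> \<le> k 0 * k h * (ennreal t * sq_norm u)"
    using c by (intro mult_mono) auto
  finally show ?thesis using * by (meson add_left_mono order_trans)
qed

text \<open>The weights \<open>1 + e (v - 1 / 2)\<close> and \<open>1 + e (u - 1 / 2) + e\<^sup>2 / 2\<close>, where \<open>v\<close> and \<open>u\<close>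
  indicate membership of \<open>x\<close> in \<open>V i\<close> and of \<open>x + h i\<close> in \<open>U i\<close>, dominate a pair of mutually
  inverse numbers as soon as \<open>v + u \<ge> 1\<close>; summing over \<open>i\<close>, the covering bound makes the term
  linear in \<open>e\<close> negative.\<close>

lemma corr_paradoxical:
  fixes h :: "'i \<Rightarrow> 'a::group_add"
  assumes I: "finite I" and UV: "\<And>i x. i \<in> I \<Longrightarrow> x \<in> V i \<or> x + h i \<in> U i"
    and cover: "\<And>x. card {i \<in> I. x \<in> U i} + card {i \<in> I. x \<in> V i} < card I"
  shows "\<exists>i\<in>I. corr u (h i) + ennreal (1 / (4 * card I * card I)) * sq_norm u \<le> sq_norm u"
proof -
  define m where "m = real (card I)"
  have m: "1 \<le> m" using cover [of 0] by (simp add: m_def)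
  \<comment> \<open>The weights sum to at most \<open>2 * m - e + m * (e * e / 2)\<close>. This is
    smallest at \<open>e = 1 / m\<close>, where the saving is \<open>1 / (2 * m)\<close>.\<close>
  define e where "e = 1 / m"
  have e: "0 < e" "e \<le> 1" using m by (auto simp: e_def)
  define \<alpha> where "\<alpha> i x = 1 + e * (of_bool (x \<in> V i) - 1 / 2)" for i x
  \<comment> \<open>The extra \<open>e * e / 2\<close> makes up for the second-order deficit of the
    product of \<open>1 - e / 2\<close> and \<open>1 + e / 2\<close>.\<close>
  define \<beta> where "\<beta> i x = 1 + e * (of_bool (x \<in> U i) - 1 / 2) + e * e / 2" for i x
  have \<alpha>\<beta>: "0 \<le> \<alpha> i x" "0 \<le> \<beta> i x" for i x
  proof -
    have "0 \<le> e * e" using e by simp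
    then show "0 \<le> \<alpha> i x" "0 \<le> \<beta> i x"
      using e by (auto simp: \<alpha>_def \<beta>_def of_bool_def)
  qed
  have key: "2 * (u x * u (x + h i)) \<le> ennreal (\<alpha> i x) * (u x * u x) + ennreal (\<beta> i (x + h i)) * (u (x + h i) * u (x + h i))"
    if i: "i \<in> I" for i x
  proof -
    have "\<exists>t>0. t \<le> \<alpha> i x \<and> 1 / t \<le> \<beta> i (x + h i)"
    proof (cases "x \<in> V i"; cases "x + h i \<in> U i")
      assume "x \<in> V i" "x + h i \<in> U i"
      then show ?thesis using e by (intro exI [of _ 1]) (auto simp: \<alpha>_def \<beta>_def)
    next
      assume *: "x \<in> V i" "x + h i \<notin> U i"
      have "1 \<le> (1 - e / 2 + e * e / 2) * (1 + e / 2)"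
      proof -
        have "(1 - e / 2 + e * e / 2) * (1 + e / 2) = 1 + e * e / 4 + e * e * e / 4"
          by (simp add: field_simps)
        then show ?thesis using e by simp
      qed
      then show ?thesis using e *
        by (intro exI [of _ "1 + e / 2"]) (auto simp: \<alpha>_def \<beta>_def divide_le_eq)
    next
      assume *: "x \<notin> V i" "x + h i \<in> U i"
      have "1 \<le> (1 + e / 2 + e * e / 2) * (1 - e / 2)"
      proof -
        have "(1 + e / 2 + e * e / 2) * (1 - e / 2) = 1 + e * e / 4 * (1 - e)"
          by (simp add: field_simps)
        then show ?thesis using e by simp
      qed
      then show ?thesis using e *
        by (intro exI [of _ "1 - e / 2"]) (auto simp: \<alpha>_def \<beta>_def divide_le_eq)
    qed (use UV [OF i] in auto)
    then obtain t where t: "0 < t" "t \<le> \<alpha> i x" "1 / t \<le> \<beta> i (x + h i)" by blast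
    have "2 * (u x * u (x + h i)) \<le> ennreal t * (u x * u x) + ennreal (1 / t) * (u (x + h i) * u (x + h i))"
      by (rule ennreal_am_gm [OF t(1)])
    also have "\<dots> \<le> ennreal (\<alpha> i x) * (u x * u x) + ennreal (\<beta> i (x + h i)) * (u (x + h i) * u (x + h i))"
      using t by (intro add_mono mult_right_mono ennreal_leI) auto
    finally show ?thesis .
  qed
  have each: "2 * corr u (h i) \<le> (\<integral>\<^sup>+ x. ennreal (\<alpha> i x + \<beta> i x) * (u x * u x) \<partial>count_space UNIV)"
    if i: "i \<in> I" for i
  proof -
    have "2 * corr u (h i) \<le> (\<integral>\<^sup>+ x. ennreal (\<alpha> i x) * (u x * u x) + ennreal (\<beta> i (x + h i)) * (u (x + h i) * u (x + h i)) \<partial>count_space UNIV)"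
      unfolding corr_def by (subst nn_integral_cmult [symmetric]) (auto intro!: nn_integral_mono key i)
    also have "\<dots> = (\<integral>\<^sup>+ x. ennreal (\<alpha> i x) * (u x * u x) \<partial>count_space UNIV) +
        (\<integral>\<^sup>+ x. ennreal (\<beta> i x) * (u x * u x) \<partial>count_space UNIV)"
      using nn_integral_translate_right [of "\<lambda>x. ennreal (\<beta> i x) * (u x * u x)" "h i"]
      by (simp add: nn_integral_add)
    also have "\<dots> = (\<integral>\<^sup>+ x. ennreal (\<alpha> i x + \<beta> i x) * (u x * u x) \<partial>count_space UNIV)"
      using \<alpha>\<beta> by (simp add: nn_integral_add [symmetric] distrib_right)
    finally show ?thesis .
  qed
  have total: "(\<Sum>i\<in>I. \<alpha> i x + \<beta> i x) \<le> 2 * m - 1 / (2 * m)" for x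
  proof -
    have "(\<Sum>i\<in>I. of_bool (x \<in> V i)) = real (card {i \<in> I. x \<in> V i})"
      "(\<Sum>i\<in>I. of_bool (x \<in> U i)) = real (card {i \<in> I. x \<in> U i})"
      using I by (simp_all add: sum.If_cases of_bool_def Int_def)
    then have "(\<Sum>i\<in>I. \<alpha> i x + \<beta> i x) =
        2 * m + e * (real (card {i \<in> I. x \<in> U i} + card {i \<in> I. x \<in> V i}) - m) + m * (e * e / 2)"
      by (simp add: \<alpha>_def \<beta>_def sum.distrib sum_distrib_left [symmetric] sum_subtractf m_def algebra_simps)
    also have "\<dots> \<le> 2 * m + e * (- 1) + m * (e * e / 2)"
    proof -
      have "real (card {i \<in> I. x \<in> U i} + card {i \<in> I. x \<in> V i}) - m \<le> - 1"
        using cover [of x] unfolding m_def by linarith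
      then show ?thesis using e by (intro add_mono mult_left_mono) auto
    qed
    also have "\<dots> = 2 * m - 1 / (2 * m)" using m by (simp add: e_def field_simps)
    finally show ?thesis .
  qed
  obtain i where i: "i \<in> I" "\<And>j. j \<in> I \<Longrightarrow> corr u (h i) \<le> corr u (h j)"
  proof -
    have "I \<noteq> {}" using m by (auto simp: m_def)
    then have "Min ((\<lambda>i. corr u (h i)) ` I) \<in> (\<lambda>i. corr u (h i)) ` I" using I by (intro Min_in) auto
    then obtain i where "i \<in> I" "corr u (h i) = Min ((\<lambda>i. corr u (h i)) ` I)" by auto
    then show ?thesis using that [of i] I by simp
  qed
  have "ennreal (2 * m) * corr u (h i) = (\<Sum>j\<in>I. 2 * corr u (h i))"
    by (simp add: m_def ennreal_mult ennreal_of_nat_eq_real_of_nat mult_ac)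
  also have "\<dots> \<le> (\<Sum>j\<in>I. 2 * corr u (h j))"
    by (intro sum_mono mult_left_mono i) auto
  also have "\<dots> \<le> (\<Sum>j\<in>I. \<integral>\<^sup>+ x. ennreal (\<alpha> j x + \<beta> j x) * (u x * u x) \<partial>count_space UNIV)"
    by (intro sum_mono each)
  also have "\<dots> = (\<integral>\<^sup>+ x. (\<Sum>j\<in>I. ennreal (\<alpha> j x + \<beta> j x) * (u x * u x)) \<partial>count_space UNIV)"
    by (rule nn_integral_sum [symmetric]) auto
  also have "\<dots> = (\<integral>\<^sup>+ x. ennreal (\<Sum>j\<in>I. \<alpha> j x + \<beta> j x) * (u x * u x) \<partial>count_space UNIV)"
    using \<alpha>\<beta> by (intro nn_integral_cong)
      (simp only: sum_distrib_right [symmetric] sum_ennreal add_nonneg_nonneg)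
  also have "\<dots> \<le> (\<integral>\<^sup>+ x. ennreal (2 * m - 1 / (2 * m)) * (u x * u x) \<partial>count_space UNIV)"
    by (intro nn_integral_mono mult_right_mono ennreal_leI total) auto
  also have "\<dots> = ennreal (2 * m - 1 / (2 * m)) * sq_norm u"
    by (simp add: nn_integral_cmult sq_norm_def)
  finally have "ennreal (2 * m) * corr u (h i) + ennreal (1 / (2 * m)) * sq_norm u \<le>
      ennreal (2 * m - 1 / (2 * m)) * sq_norm u + ennreal (1 / (2 * m)) * sq_norm u"
    by (rule add_right_mono)
  also have "\<dots> = ennreal (2 * m) * sq_norm u"
  proof -
    have "1 / (2 * m) \<le> 1 / 1" using m by (intro divide_left_mono) auto
    then have "1 / (2 * m) \<le> 2 * m" using m by linarith
    then show ?thesis using m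
      by (simp add: distrib_right [symmetric] ennreal_plus [symmetric] del: ennreal_plus)
  qed
  also have "ennreal (1 / (2 * m)) = ennreal (2 * m) * ennreal (1 / (4 * m * m))"
    using m by (simp add: ennreal_mult [symmetric])
  finally have "ennreal (2 * m) * (corr u (h i) + ennreal (1 / (4 * m * m)) * sq_norm u) \<le> ennreal (2 * m) * sq_norm u"
    by (simp add: distrib_left mult.assoc)
  then have "corr u (h i) + ennreal (1 / (4 * m * m)) * sq_norm u \<le> sq_norm u"
    using m by (subst (asm) ennreal_mult_le_mult_iff) auto
  then show ?thesis using i(1) by (auto simp: m_def)
qed

lemma sum_list_in_conv_power:
  "set ws \<subseteq> set_pmf \<mu> \<Longrightarrow> sum_list ws \<in> set_pmf (conv_power \<mu> (length ws))"
proof (induction ws)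
  case (Cons s ws)
  then show ?case unfolding length_Cons conv_power_Suc_left by (fastforce simp: set_bind_pmf)
qed simp

lemma nn_integral_pmf_count_space: "(\<integral>\<^sup>+ s. ennreal (pmf p s) \<partial>count_space UNIV) = 1"
  using nn_integral_measure_pmf [of p "\<lambda>s. 1"] by simp

lemma markov_conv_power:
  "markov (\<lambda>s. ennreal (pmf (conv_power \<mu> n) s)) u x = (markov (\<lambda>s. ennreal (pmf \<mu> s)) ^^ n) u x"
proof -
  have "(markov (\<lambda>s. ennreal (pmf \<mu> s)) ^^ n) u x =
      (\<integral>\<^sup>+ z. u z * ennreal (pmf (conv_power \<mu> n) (- x + z)) \<partial>count_space UNIV)"
    by (subst markov_pow_integral) (simp only: markov_pow_pmf)
  also have "\<dots> = (\<integral>\<^sup>+ s. u (x + s) * ennreal (pmf (conv_power \<mu> n) (- x + (x + s))) \<partial>count_space UNIV)"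
    by (rule nn_integral_translate_left [symmetric])
  finally show ?thesis by (simp add: markov_def mult.commute add.assoc [symmetric])
qed

text \<open>Powers of the operator are only known to be nonexpanding. The average \<open>k\<close>
  of the first \<open>J\<close> powers charges 0 and every \<open>h i\<close>, hence contracts,
  although the index \<open>i\<close> responsible depends on the function. To return to single
  powers, take the truncated generating function \<Phi> at a radius \<open>c\<close> above 1: up to
  a fixed function it is at most \<open>c ^ J\<close> times its own \<open>k\<close>-average, and
  the contraction bounds its norm independently of the truncation.\<close>

theorem exp_decay_paradoxical:
  fixes h :: "'i \<Rightarrow> 'a::group_add" and \<mu> :: "'a pmf"
  assumes gen: "semigroup_generates (set_pmf \<mu>)"
    and I: "finite I" and UV: "\<And>i x. i \<in> I \<Longrightarrow> x \<in> V i \<or> x + h i \<in> U i"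
    and cover: "\<And>x. card {i \<in> I. x \<in> U i} + card {i \<in> I. x \<in> V i} < card I"
  shows "exp_decay \<mu>"
proof -
  let ?P = "markov (\<lambda>s. ennreal (pmf \<mu> s))"
  have "\<exists>j. 0 < pmf (conv_power \<mu> j) g" for g
  proof -
    obtain ws where "set ws \<subseteq> set_pmf \<mu>" "sum_list ws = g"
      using gen unfolding semigroup_generates_def by blast
    then show ?thesis using sum_list_in_conv_power [of ws \<mu>] by (auto simp: set_pmf_iff order_less_le)
  qed
  then obtain j where j: "\<And>g. 0 < pmf (conv_power \<mu> (j g)) g" by metis
  have cI: "0 < card I" using cover [of 0] by simp
  define J where "J = Suc (Max (j ` h ` I))"
  have jJ: "j (h i) < J" if "i \<in> I" for i
    using that I by (simp add: J_def less_Suc_eq_le)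
  have J: "0 < J" by (simp add: J_def)
  define k where "k s = (\<Sum>j<J. ennreal (1 / J) * ennreal (pmf (conv_power \<mu> j) s))" for s
  have k1: "(\<integral>\<^sup>+ s. k s \<partial>count_space UNIV) \<le> 1"
  proof -
    have "(\<integral>\<^sup>+ s. k s \<partial>count_space UNIV) = (\<Sum>j<J. ennreal (1 / J))"
      unfolding k_def by (subst nn_integral_sum) (auto simp: nn_integral_cmult nn_integral_pmf_count_space)
    also have "\<dots> = ennreal 1" using J by (subst sum_ennreal) auto
    finally show ?thesis by simp
  qed
  have kge: "ennreal (1 / J * pmf (conv_power \<mu> j) s) \<le> k s" if "j < J" for j s
  proof -
    have "ennreal (1 / J * pmf (conv_power \<mu> j) s) = ennreal (1 / J) * ennreal (pmf (conv_power \<mu> j) s)"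
      by (rule ennreal_mult) auto
    also have "\<dots> \<le> k s" unfolding k_def by (rule member_le_sum) (use that in auto)
    finally show ?thesis .
  qed
  \<comment> \<open>The entry \<open>1 / J\<close> comes from the zeroth power, a unit mass at 0,
    which gives \<open>k\<close> its charge at 0.\<close>
  define a where "a = Min (insert (1 / J) ((\<lambda>i. 1 / J * pmf (conv_power \<mu> (j (h i))) (h i)) ` I))"
  have a: "0 < a" "a \<le> 1 / J" "\<And>i. i \<in> I \<Longrightarrow> a \<le> 1 / J * pmf (conv_power \<mu> (j (h i))) (h i)"
    using I J j by (auto simp: a_def)
  have "1 / real J \<le> 1" using J by simp
  then have a1: "a \<le> 1" using a(2) by linarith
  define \<tau> where "\<tau> = a * a * (1 / (4 * card I * card I))"
  have \<tau>: "0 < \<tau>" "\<tau> \<le> 1/4"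
  proof -
    show "0 < \<tau>" using a cI by (simp add: \<tau>_def)
    have "1 \<le> real (card I) * real (card I)"
      using cI mult_mono [of 1 "real (card I)" 1 "real (card I)"] by simp
    then have "1 / (4 * real (card I) * real (card I)) \<le> 1 / 4" by (simp add: divide_le_eq)
    moreover have "a * a \<le> 1 * 1" using a a1 by (intro mult_mono) auto
    ultimately have "\<tau> \<le> (1 * 1) * (1 / 4)"
      unfolding \<tau>_def by (intro mult_mono [of "a * a" "1 * 1"]) auto
    then show "\<tau> \<le> 1/4" by simp
  qed
  have contr: "sq_norm (markov k u) \<le> ennreal (1 - \<tau>) * sq_norm u" if fin: "sq_norm u < \<top>" for u
  proof -
    obtain i where i: "i \<in> I" "corr u (h i) + ennreal (1 / (4 * card I * card I)) * sq_norm u \<le> sq_norm u"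
      using corr_paradoxical [OF I UV cover] by blast
    have "sq_norm (markov k u) + ennreal \<tau> * sq_norm u \<le> sq_norm u"
      unfolding \<tau>_def
    proof (rule sq_norm_markov_contraction [OF k1 _ _ _ i(2)])
      show "ennreal a \<le> k (h i)"
        using kge [OF jJ [OF i(1)], of "h i"] a(3) [OF i(1)] by (meson ennreal_leI order_trans)
      have "ennreal a \<le> ennreal (1 / J * pmf (conv_power \<mu> 0) 0)"
        using a(2) by (intro ennreal_leI) simp
      also have "\<dots> \<le> k 0" by (rule kge [OF J])
      finally show "ennreal a \<le> k 0" .
    qed (use a in auto)
    moreover obtain B where B: "sq_norm u = ennreal B" "0 \<le> B" using fin by (auto simp: less_top_ennreal)
    ultimately have le: "sq_norm (markov k u) + ennreal (\<tau> * B) \<le> ennreal B"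
      using \<tau> by (simp add: ennreal_mult)
    have "sq_norm (markov k u) < \<top>"
      by (rule le_less_trans [OF sq_norm_markov_le [OF k1] fin])
    then obtain D where D: "sq_norm (markov k u) = ennreal D" "0 \<le> D" by (auto simp: less_top_ennreal)
    with le B \<tau> have "D + \<tau> * B \<le> B" by (simp add: ennreal_plus [symmetric] del: ennreal_plus)
    then show ?thesis using B D \<tau> by (simp add: ennreal_mult [symmetric] algebra_simps)
  qed
  \<comment> \<open>Two factors \<open>1 + \<tau> / 4\<close>, one from \<open>c ^ (2 * J)\<close>
    and one from the parameter \<open>t\<close> in \<open>sq_norm_add\<close>, still leave at most
    \<open>1 - \<tau> / 4\<close> after multiplication by \<open>1 - \<tau>\<close>.\<close>
  define c where "c = root (2 * J) (1 + \<tau> / 4)"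
  have c: "1 < c" "c ^ (2 * J) = 1 + \<tau> / 4" using \<tau> J by (auto simp: c_def)
  have cJ: "c ^ J * c ^ J = 1 + \<tau> / 4" using c(2) by (simp add: power_add [symmetric] mult_2)
  define \<Phi> where "\<Phi> N x = (\<Sum>n<N. ennreal (c ^ n) * (?P ^^ n) (indicator {0}) x)" for N x
  have P1: "sq_norm ((?P ^^ n) (indicator {0})) \<le> 1" for n
  proof (induction n)
    case 0
    have "sq_norm (indicator {0 :: 'a}) = (\<integral>\<^sup>+ x. indicator {0 :: 'a} x \<partial>count_space UNIV)"
      unfolding sq_norm_def by (intro nn_integral_cong) (auto simp: indicator_def)
    then show ?case by simp
  next
    case (Suc n)
    then show ?case
      using sq_norm_markov_le [of "\<lambda>s. ennreal (pmf \<mu> s)" "(?P ^^ n) (indicator {0})"]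
      by (simp add: nn_integral_pmf_count_space)
  qed
  have fin: "sq_norm (\<Phi> N) < \<top>" for N
  proof (induction N)
    case 0
    then show ?case by (simp add: \<Phi>_def sq_norm_def)
  next
    case (Suc N)
    have "\<Phi> (Suc N) = (\<lambda>x. \<Phi> N x + ennreal (c ^ N) * (?P ^^ N) (indicator {0}) x)"
      by (simp add: \<Phi>_def fun_eq_iff)
    then have "sq_norm (\<Phi> (Suc N)) \<le> ennreal (1 + 1) * sq_norm (\<Phi> N) +
        ennreal (1 + 1 / 1) * sq_norm (\<lambda>x. ennreal (c ^ N) * (?P ^^ N) (indicator {0}) x)"
      using sq_norm_add [of 1 "\<Phi> N"] by simp
    also have "\<dots> < \<top>"
      using Suc P1 [of N] by (auto simp: sq_norm_cmult ennreal_mult_less_top intro: le_less_trans)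
    finally show ?case .
  qed
  have split: "\<Phi> N x \<le> \<Phi> i x + ennreal (c ^ i) * (?P ^^ i) (\<Phi> N) x" for N i x
  proof -
    have "\<Phi> N x \<le> (\<Sum>n<i + N. ennreal (c ^ n) * (?P ^^ n) (indicator {0}) x)"
      unfolding \<Phi>_def by (intro sum_mono2) auto
    also have "\<dots> = \<Phi> i x + (\<Sum>n<N. ennreal (c ^ (i + n)) * (?P ^^ (i + n)) (indicator {0}) x)"
      unfolding \<Phi>_def by (induction N) (simp_all add: add.assoc)
    also have "(\<Sum>n<N. ennreal (c ^ (i + n)) * (?P ^^ (i + n)) (indicator {0}) x) =
        ennreal (c ^ i) * (?P ^^ i) (\<Phi> N) x"
    proof (induction N)
      case 0
      have "(?P ^^ i) (\<lambda>x. 0) x = 0"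
        using markov_pow_cmult [of i "\<lambda>s. ennreal (pmf \<mu> s)" 0 "\<lambda>x. 0"] by simp
      then show ?case by (simp add: \<Phi>_def [abs_def])
    next
      case (Suc N)
      have "\<Phi> (Suc N) = (\<lambda>x. \<Phi> N x + ennreal (c ^ N) * (?P ^^ N) (indicator {0}) x)"
        by (simp add: \<Phi>_def fun_eq_iff)
      then show ?case using Suc c(1)
        by (simp add: markov_pow_add markov_pow_cmult distrib_left power_add ennreal_mult funpow_add mult.assoc)
    qed
    finally show ?thesis .
  qed
  \<comment> \<open>Split the series after \<open>i\<close> terms for every \<open>i < J\<close> and
    average over \<open>i\<close>; the initial pieces are all at most
    \<open>\<Phi> J x\<close>.\<close>
  have avg: "\<Phi> N x \<le> \<Phi> J x + ennreal (c ^ J) * markov k (\<Phi> N) x" for N x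
  proof -
    have "\<Phi> N x = (\<Sum>i<J. ennreal (1 / J)) * \<Phi> N x" using J by (subst sum_ennreal) auto
    also have "\<dots> \<le> (\<Sum>i<J. ennreal (1 / J) * (\<Phi> J x + ennreal (c ^ J) * (?P ^^ i) (\<Phi> N) x))"
      unfolding sum_distrib_right
    proof (intro sum_mono mult_left_mono)
      fix i assume "i \<in> {..<J}"
      then show "\<Phi> N x \<le> \<Phi> J x + ennreal (c ^ J) * (?P ^^ i) (\<Phi> N) x"
        using c(1) by (intro order_trans [OF split [of N x i]] add_mono mult_right_mono ennreal_leI)
          (auto simp: \<Phi>_def intro!: sum_mono2 power_increasing)
    qed auto
    also have "\<dots> = (\<Sum>i<J. ennreal (1 / J)) * \<Phi> J x + ennreal (c ^ J) * (\<Sum>i<J. ennreal (1 / J) * (?P ^^ i) (\<Phi> N) x)"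
      by (simp add: distrib_left sum.distrib sum_distrib_right sum_distrib_left mult_ac)
    also have "(\<Sum>i<J. ennreal (1 / J)) = 1" using J by (subst sum_ennreal) auto
    also have "(\<Sum>i<J. ennreal (1 / J) * (?P ^^ i) (\<Phi> N) x) = markov k (\<Phi> N) x"
      unfolding markov_conv_power [symmetric] markov_def k_def
      by (simp add: sum_distrib_right nn_integral_sum mult.assoc nn_integral_cmult)
    finally show ?thesis by simp
  qed
  define t where "t = 4 / \<tau>"
  have t: "0 < t" "1 + 1 / t = 1 + \<tau> / 4" using \<tau> by (auto simp: t_def)
  obtain B where B: "sq_norm (\<Phi> J) = ennreal B" "0 \<le> B" using fin [of J] by (auto simp: less_top_ennreal)
  have bound: "sq_norm (\<Phi> N) \<le> ennreal ((1 + t) * B / (\<tau> / 4))" for N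
  proof -
    obtain D where D: "sq_norm (\<Phi> N) = ennreal D" "0 \<le> D" using fin [of N] by (auto simp: less_top_ennreal)
    have "sq_norm (\<Phi> N) \<le> sq_norm (\<lambda>x. \<Phi> J x + ennreal (c ^ J) * markov k (\<Phi> N) x)"
      by (rule sq_norm_mono) (rule avg)
    also have "\<dots> \<le> ennreal (1 + t) * sq_norm (\<Phi> J) + ennreal (1 + 1 / t) * sq_norm (\<lambda>x. ennreal (c ^ J) * markov k (\<Phi> N) x)"
      by (rule sq_norm_add [OF t(1)])
    also have "\<dots> \<le> ennreal (1 + t) * sq_norm (\<Phi> J) + ennreal (1 + 1 / t) * (ennreal (c ^ J) * ennreal (c ^ J) * (ennreal (1 - \<tau>) * sq_norm (\<Phi> N)))"
      unfolding sq_norm_cmult by (intro add_left_mono mult_left_mono contr fin) auto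
    also have "\<dots> = ennreal ((1 + t) * B + (1 + 1 / t) * (c ^ J * c ^ J * ((1 - \<tau>) * D)))"
    proof -
      have "0 \<le> 1 + t" "0 \<le> 1 + 1 / t" "0 \<le> c ^ J" "0 \<le> 1 - \<tau>" using t(1) \<tau> c(1) by auto
      then show ?thesis
        using B D by (simp only: ennreal_plus ennreal_mult mult_nonneg_nonneg)
    qed
    finally have le: "ennreal D \<le> ennreal ((1 + t) * B + (1 + 1 / t) * (c ^ J * c ^ J * ((1 - \<tau>) * D)))"
      unfolding D(1) .
    have "0 \<le> (1 + t) * B + (1 + 1 / t) * (c ^ J * c ^ J * ((1 - \<tau>) * D))"
      using t(1) \<tau> c(1) B(2) D(2) by (intro add_nonneg_nonneg mult_nonneg_nonneg) auto
    with le have "D \<le> (1 + t) * B + (1 + \<tau> / 4) * ((1 + \<tau> / 4) * ((1 - \<tau>) * D))"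
      unfolding t(2) cJ by (simp only: ennreal_le_iff)
    moreover have "(1 + \<tau> / 4) * ((1 + \<tau> / 4) * ((1 - \<tau>) * D)) \<le> (1 - \<tau> / 4) * D"
    proof -
      define x where "x = \<tau> / 4"
      have x: "0 \<le> x" "\<tau> = 4 * x" using \<tau> by (simp_all add: x_def)
      have "(1 + x) * (1 + x) * (1 - 4 * x) = 1 - 2 * x - 7 * (x * x) - 4 * (x * x * x)"
        by (simp add: algebra_simps)
      moreover have "0 \<le> x * x" "0 \<le> x * x * x" using x by auto
      ultimately have "(1 + x) * (1 + x) * (1 - 4 * x) \<le> 1 - x" using x(1) by linarith
      then have "(1 + \<tau> / 4) * (1 + \<tau> / 4) * (1 - \<tau>) * D \<le> (1 - \<tau> / 4) * D"
        unfolding x_def [symmetric] x(2) [symmetric] using D(2) by (rule mult_right_mono)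
      then show ?thesis by (simp only: mult.assoc)
    qed
    ultimately have "D \<le> (1 + t) * B + (1 - \<tau> / 4) * D" by linarith
    moreover have "(1 - \<tau> / 4) * D = D - D * (\<tau> / 4)" by (simp add: left_diff_distrib)
    ultimately have "D * (\<tau> / 4) \<le> (1 + t) * B" by linarith
    then have "D \<le> (1 + t) * B / (\<tau> / 4)" using \<tau> by (simp add: le_divide_eq)
    then show ?thesis unfolding D(1) by (rule ennreal_leI)
  qed
  define Q where "Q = (1 + t) * B / (\<tau> / 4)"
  have "c ^ n * pmf (conv_power \<mu> n) 0 \<le> 1 + Q" for n
  proof -
    let ?y = "c ^ n * pmf (conv_power \<mu> n) 0"
    have y: "0 \<le> ?y" using c(1) by simp
    have "ennreal ?y = ennreal (c ^ n) * (?P ^^ n) (indicator {0}) 0"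
      unfolding markov_pow_pmf using c(1) by (simp add: ennreal_mult)
    also have "\<dots> \<le> \<Phi> (Suc n) 0" unfolding \<Phi>_def by (rule member_le_sum) auto
    finally have "ennreal ?y * ennreal ?y \<le> \<Phi> (Suc n) 0 * \<Phi> (Suc n) 0" by (intro mult_mono) auto
    also have "\<dots> \<le> sq_norm (\<Phi> (Suc n))" by (rule sq_norm_ge)
    also have "\<dots> \<le> ennreal Q" unfolding Q_def by (rule bound)
    finally have "ennreal (?y * ?y) \<le> ennreal Q" using y by (simp add: ennreal_mult)
    moreover have "0 \<le> Q" using t(1) B(2) \<tau> by (simp add: Q_def)
    ultimately have "?y * ?y \<le> Q" by simp
    moreover have "2 * ?y \<le> ?y * ?y + 1"
      using zero_le_power2 [of "?y - 1"] by (simp add: power2_eq_square algebra_simps)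
    ultimately show ?thesis using y by linarith
  qed
  then show ?thesis unfolding exp_decay_def using c(1) by blast
qed

section \<open>Boundary sequences\<close>

context floyd
begin

text \<open>Distances to \<open>v\<close> and \<open>v'\<close> differ by at most
  \<open>d v' v\<close>, and \<open>f\<close> drops by at most a factor \<kappa> per unit step, so
  each edge weight changes by at most the factor \<open>\<kappa> ^ d v' v\<close>.\<close>

lemma base_change:
  obtains K where "1 \<le> K" "\<And>x y. \<delta> v x y \<le> K * \<delta> v' x y"
proof -
  obtain \<kappa> where \<kappa>: "1 \<le> \<kappa>" "\<And>n::nat. f (real n) / f (real (n + 1)) \<le> \<kappa>"
    using ff unfolding floyd_function_def by blast
  have step: "f (real n) \<le> \<kappa> ^ m * f (real (n + m))" for n m
  proof (induction m)
    case (Suc m)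
    have "f (real (n + m)) \<le> \<kappa> * f (real (n + m + 1))"
      using \<kappa>(2) [of "n + m"] f_pos [of "n + m + 1"] by (simp add: divide_le_eq)
    then have "\<kappa> ^ m * f (real (n + m)) \<le> \<kappa> ^ m * (\<kappa> * f (real (n + m + 1)))"
      using \<kappa>(1) by (intro mult_left_mono) auto
    with Suc show ?case by (simp add: mult_ac)
  qed simp
  define K where "K = \<kappa> ^ d v' v"
  have K: "1 \<le> K" using \<kappa>(1) by (simp add: K_def)
  have len: "floyd_length S f v p \<le> K * floyd_length S f v' p" for p
  proof (induction p rule: induct_list012)
    case (3 a b p)
    let ?i = "min (d v a) (d v b)"
    have "f (real ?i) \<le> K * f (real (?i + d v' v))" unfolding K_def by (rule step)
    also have "\<dots> \<le> K * f (real (min (d v' a) (d v' b)))"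
      using K d_triangle [of v' a v] d_triangle [of v' b v]
      by (intro mult_left_mono f_mono) (auto simp: min_def)
    finally show ?case
      using 3 by (simp add: floyd_length_Cons2 distrib_left)
  qed (simp_all add: floyd_length_def)
  have "\<delta> v x y / K \<le> \<delta> v' x y" for x y
  proof (rule floyd_dist_ge [OF gen])
    fix p assume "edge_path S x y p"
    from floyd_dist_le [OF ff this, of v] len [of p] show "\<delta> v x y / K \<le> floyd_length S f v' p"
      using K by (simp add: divide_le_eq mult.commute)
  qed
  then show ?thesis using K that [of K] by (simp add: divide_le_eq mult.commute)
qed

lemma left_lipschitz:
  obtains K where "1 \<le> K" "\<And>x y. \<delta> v (g + x) (g + y) \<le> K * \<delta> v x y"
proof -
  obtain K where K: "1 \<le> K" "\<And>x y. \<delta> (- g + v) x y \<le> K * \<delta> v x y"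
    by (rule base_change [of "- g + v" v]) blast
  have "\<delta> v (g + x) (g + y) = \<delta> (- g + v) x y" for x y
    using \<delta>_translate [of g "- g + v" x y] by simp
  with K that show ?thesis by simp
qed

text \<open>Points of the Floyd compactification are handled through the Cauchy sequences representing
  them; \<open>gap s t\<close> is the distance between the points represented by \<open>s\<close> and \<open>t\<close>.\<close>

definition cau :: "(nat \<Rightarrow> 'a) \<Rightarrow> bool" where
  "cau s \<longleftrightarrow> (\<forall>e>0. \<exists>N. \<forall>m\<ge>N. \<forall>n\<ge>N. \<delta> 0 (s m) (s n) < e)"

definition gap :: "(nat \<Rightarrow> 'a) \<Rightarrow> (nat \<Rightarrow> 'a) \<Rightarrow> real" where
  "gap s t = lim (\<lambda>n. \<delta> 0 (s n) (t n))"

abbreviation point :: "'a \<Rightarrow> nat \<Rightarrow> 'a" where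
  "point x \<equiv> \<lambda>_. x"

lemma cau_point [simp]: "cau (point x)"
  by (auto simp: cau_def)

lemma cau_limit:
  assumes "cau s" "cau t"
  shows "(\<lambda>n. \<delta> 0 (s n) (t n)) \<longlonglongrightarrow> gap s t"
proof -
  have "Cauchy (\<lambda>n. \<delta> 0 (s n) (t n))"
    unfolding Cauchy_def dist_real_def
  proof (intro allI impI)
    fix e :: real assume "0 < e"
    then have "0 < e / 2" by simp
    then obtain N N' where N: "\<And>m n. N \<le> m \<Longrightarrow> N \<le> n \<Longrightarrow> \<delta> 0 (s m) (s n) < e / 2"
      and N': "\<And>m n. N' \<le> m \<Longrightarrow> N' \<le> n \<Longrightarrow> \<delta> 0 (t m) (t n) < e / 2"
      using assms unfolding cau_def by meson
    show "\<exists>M. \<forall>m\<ge>M. \<forall>n\<ge>M. \<bar>\<delta> 0 (s m) (t m) - \<delta> 0 (s n) (t n)\<bar> < e"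
    proof (intro exI [of _ "max N N'"] allI impI)
      fix m n assume "max N N' \<le> m" "max N N' \<le> n"
      then have "\<delta> 0 (s m) (s n) < e / 2" "\<delta> 0 (t m) (t n) < e / 2"
        using N [of m n] N' [of m n] by auto
      then show "\<bar>\<delta> 0 (s m) (t m) - \<delta> 0 (s n) (t n)\<bar> < e"
        using \<delta>_diff [of 0 "s m" "t m" "s n"] \<delta>_diff [of 0 "t m" "s n" "t n"]
          \<delta>_commute [of 0 "s n"] by (smt (verit) field_sum_of_halves)
    qed
  qed
  then show ?thesis
    unfolding gap_def using real_Cauchy_convergent convergent_LIMSEQ_iff by blast
qed

lemma gap_unique: "cau s \<Longrightarrow> cau t \<Longrightarrow> (\<lambda>n. \<delta> 0 (s n) (t n)) \<longlonglongrightarrow> l \<Longrightarrow> gap s t = l"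
  using cau_limit LIMSEQ_unique by blast

lemma gap_nonneg: "cau s \<Longrightarrow> cau t \<Longrightarrow> 0 \<le> gap s t"
  by (rule LIMSEQ_le_const [OF cau_limit]) auto

lemma gap_commute: "gap s t = gap t s"
  unfolding gap_def by (simp add: \<delta>_commute [of 0 "s _"])

lemma gap_triangle: "cau s \<Longrightarrow> cau t \<Longrightarrow> cau u \<Longrightarrow> gap s u \<le> gap s t + gap t u"
  by (rule LIMSEQ_le [OF cau_limit tendsto_add [OF cau_limit cau_limit]]) (auto intro: \<delta>_triangle)

lemma gap_self [simp]: "gap s s = 0"
  by (simp add: gap_def)

lemma gap_points [simp]: "gap (point x) (point y) = \<delta> 0 x y"
  by (simp add: gap_def)

lemma gap_point_self_tendsto:
  assumes "cau s"
  shows "(\<lambda>m. gap (point (s m)) s) \<longlonglongrightarrow> 0"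
proof (rule LIMSEQ_I)
  fix e :: real assume "0 < e"
  then have "0 < e / 2" by simp
  then obtain N where N: "\<And>m n. N \<le> m \<Longrightarrow> N \<le> n \<Longrightarrow> \<delta> 0 (s m) (s n) < e / 2"
    using assms unfolding cau_def by meson
  show "\<exists>N. \<forall>n\<ge>N. norm (gap (point (s n)) s - 0) < e"
  proof (intro exI [of _ N] allI impI)
    fix m assume "N \<le> m"
    have "\<forall>n\<ge>N. \<delta> 0 (s m) (s n) \<le> e / 2"
      using N [OF \<open>N \<le> m\<close>] less_imp_le by blast
    then have "gap (point (s m)) s \<le> e / 2"
      by (intro LIMSEQ_le_const2 [OF cau_limit [OF cau_point assms]]) blast
    then show "norm (gap (point (s m)) s - 0) < e"
      using \<open>0 < e\<close> gap_nonneg [OF cau_point assms, of "s m"] by simp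
  qed
qed

lemma cau_subseq:
  assumes "cau s" "strict_mono r"
  shows "cau (s \<circ> r)" "gap (s \<circ> r) s = 0"
proof -
  have le: "n \<le> r n" for n using assms(2) by (rule seq_suble)
  show c: "cau (s \<circ> r)"
    using assms(1) le unfolding cau_def comp_def by (meson order_trans)
  have "(\<lambda>n. gap (point ((s \<circ> r) n)) s) \<longlonglongrightarrow> 0"
    using LIMSEQ_subseq_LIMSEQ [OF gap_point_self_tendsto [OF assms(1)] assms(2)] by (simp add: comp_def)
  then have "(\<lambda>n. gap (point ((s \<circ> r) n)) s + gap (point (s n)) s) \<longlonglongrightarrow> 0 + 0"
    by (rule tendsto_add [OF _ gap_point_self_tendsto [OF assms(1)]])
  then have lim: "(\<lambda>n. gap (point (s (r n))) s + gap (point (s n)) s) \<longlonglongrightarrow> 0" by (simp add: comp_def)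
  have le: "\<delta> 0 (s (r n)) (s n) \<le> gap (point (s (r n))) s + gap (point (s n)) s" for n
    using gap_triangle [OF cau_point assms(1) cau_point, of "s (r n)" "s n"]
    by (simp add: gap_commute [of s])
  have "(\<lambda>n. \<delta> 0 ((s \<circ> r) n) (s n)) \<longlonglongrightarrow> 0"
    unfolding comp_def
    by (rule tendsto_sandwich [OF _ _ tendsto_const lim]) (simp_all add: le)
  then show "gap (s \<circ> r) s = 0" by (rule gap_unique [OF c assms(1)])
qed

lemma gap_zero_eq:
  assumes "cau s" "cau t" "cau u" "gap s t = 0"
  shows "gap s u = gap t u"
  using gap_triangle [of s t u] gap_triangle [of t s u] assms gap_commute [of s t] by simp

lemma gap_point_tendsto:
  assumes "cau s" "cau t"
  shows "(\<lambda>m. gap (point (s m)) t) \<longlonglongrightarrow> gap s t"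
proof -
  have "(\<lambda>m. gap (point (s m)) t - gap s t) \<longlonglongrightarrow> 0"
  proof (rule Lim_null_comparison [OF _ gap_point_self_tendsto [OF assms(1)]])
    show "\<forall>\<^sub>F m in sequentially. norm (gap (point (s m)) t - gap s t) \<le> gap (point (s m)) s"
    proof (rule always_eventually, rule allI)
      fix m
      show "norm (gap (point (s m)) t - gap s t) \<le> gap (point (s m)) s"
        using gap_triangle [OF cau_point assms(1,2), of "s m"] gap_triangle [OF assms(1) cau_point assms(2), of "s m"]
          gap_commute [of s "point (s m)"] by simp
    qed
  qed
  then show ?thesis by (simp add: LIM_zero_iff)
qed

lemma cau_equivalent:
  assumes "cau s" "(\<lambda>n. \<delta> 0 (s n) (t n)) \<longlonglongrightarrow> 0"
  shows "cau t" "gap s t = 0"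
proof -
  show "cau t"
    unfolding cau_def
  proof (intro allI impI)
    fix e :: real assume "0 < e"
    then have e: "0 < e / 3" by simp
    obtain N where N: "\<And>m n. N \<le> m \<Longrightarrow> N \<le> n \<Longrightarrow> \<delta> 0 (s m) (s n) < e / 3"
      using assms(1) e unfolding cau_def by meson
    obtain M where M: "\<And>n. M \<le> n \<Longrightarrow> \<delta> 0 (s n) (t n) < e / 3"
      using order_tendstoD(2) [OF assms(2) e] by (auto simp: eventually_sequentially)
    show "\<exists>N. \<forall>m\<ge>N. \<forall>n\<ge>N. \<delta> 0 (t m) (t n) < e"
    proof (intro exI [of _ "max N M"] allI impI)
      fix m n assume "max N M \<le> m" "max N M \<le> n"
      then have "\<delta> 0 (s m) (s n) < e / 3" "\<delta> 0 (s m) (t m) < e / 3" "\<delta> 0 (s n) (t n) < e / 3"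
        using N M by auto
      then show "\<delta> 0 (t m) (t n) < e"
        using \<delta>_triangle [of 0 "t m" "t n" "s m"] \<delta>_triangle [of 0 "s m" "t n" "s n"] \<delta>_commute [of 0 "t m" "s m"]
        by linarith
    qed
  qed
  then show "gap s t = 0" using gap_unique assms by blast
qed

lemma cau_translate:
  assumes "cau s"
  shows "cau (\<lambda>n. g + s n)"
  unfolding cau_def
proof (intro allI impI)
  fix e :: real assume "0 < e"
  obtain K where K: "1 \<le> K" "\<And>x y. \<delta> 0 (g + x) (g + y) \<le> K * \<delta> 0 x y"
    by (rule left_lipschitz [where g = g and v = 0]) blast
  have "0 < e / K" using K \<open>0 < e\<close> by simp
  then obtain N where N: "\<And>m n. N \<le> m \<Longrightarrow> N \<le> n \<Longrightarrow> \<delta> 0 (s m) (s n) < e / K"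
    using assms unfolding cau_def by meson
  show "\<exists>N. \<forall>m\<ge>N. \<forall>n\<ge>N. \<delta> 0 (g + s m) (g + s n) < e"
  proof (intro exI [of _ N] allI impI)
    fix m n assume "N \<le> m" "N \<le> n"
    then have "K * \<delta> 0 (s m) (s n) < e" using N [of m n] K by (simp add: less_divide_eq mult.commute)
    then show "\<delta> 0 (g + s m) (g + s n) < e" using K(2) [of "s m" "s n"] by linarith
  qed
qed

lemma gap_translate_zero:
  assumes "cau s" "cau t"
  shows "gap (\<lambda>n. g + s n) (\<lambda>n. g + t n) = 0 \<longleftrightarrow> gap s t = 0"
proof -
  have imp: "gap (\<lambda>n. g + s n) (\<lambda>n. g + t n) = 0" if st: "cau s" "cau t" "gap s t = 0" for g s t
  proof -
    obtain K where K: "1 \<le> K" "\<And>x y. \<delta> 0 (g + x) (g + y) \<le> K * \<delta> 0 x y"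
      by (rule left_lipschitz [where g = g and v = 0]) blast
    have lim: "(\<lambda>n. K * \<delta> 0 (s n) (t n)) \<longlonglongrightarrow> 0"
      using tendsto_mult_left [OF cau_limit [OF st(1,2)], of K] st(3) by simp
    have "(\<lambda>n. \<delta> 0 (g + s n) (g + t n)) \<longlonglongrightarrow> 0"
      by (rule tendsto_sandwich [OF _ _ tendsto_const lim]) (simp_all add: K(2))
    then show ?thesis by (intro gap_unique cau_translate st)
  qed
  from imp [OF assms, of g] imp [OF cau_translate [OF assms(1), of g] cau_translate [OF assms(2), of g], of "- g"]
  show ?thesis by (auto simp: add.assoc [symmetric])
qed

section \<open>Sequences leaving every finite set, and compactness\<close>

definition escaping :: "(nat \<Rightarrow> 'a) \<Rightarrow> bool" where
  "escaping s \<longleftrightarrow> filterlim (\<lambda>n. word_norm S (s n)) at_top sequentially"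

text \<open>By \<open>boundary_iff\<close> these sequences represent exactly the points of the Floyd
  boundary; without escape a Cauchy sequence may settle at a group element.\<close>

definition bseq :: "(nat \<Rightarrow> 'a) \<Rightarrow> bool" where
  "bseq s \<longleftrightarrow> cau s \<and> escaping s"

lemma escapingD: "escaping s \<Longrightarrow> \<forall>\<^sub>F n in sequentially. R \<le> word_norm S (s n)"
  by (simp add: escaping_def filterlim_at_top)

lemma escaping_iff: "escaping s \<longleftrightarrow> filterlim s cofinite sequentially"
proof
  assume s: "escaping s"
  show "filterlim s cofinite sequentially"
    unfolding filterlim_iff eventually_cofinite
  proof (intro allI impI)
    fix P :: "'a \<Rightarrow> bool" assume fin: "finite {x. \<not> P x}"
    define R where "R = Max (insert 0 (word_norm S ` {x. \<not> P x}))"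
    have "P x" if "Suc R \<le> word_norm S x" for x
    proof (rule ccontr)
      assume "\<not> P x"
      then have "word_norm S x \<le> R" unfolding R_def using fin by (intro Max_ge) auto
      with that show False by simp
    qed
    then show "\<forall>\<^sub>F n in sequentially. P (s n)"
      using escapingD [OF s, of "Suc R"] by (auto elim: eventually_mono)
  qed
next
  assume s: "filterlim s cofinite sequentially"
  show "escaping s"
    unfolding escaping_def filterlim_at_top
  proof
    fix R
    have "{x. \<not> R \<le> word_norm S x} \<subseteq> {x. word_norm S x \<le> R}" by auto
    then have "finite {x. \<not> R \<le> word_norm S x}"
      using finite_word_ball [OF gen] finite_subset by blast
    then have "eventually (\<lambda>x. R \<le> word_norm S x) cofinite" by (simp add: eventually_cofinite)
    then show "\<forall>\<^sub>F n in sequentially. R \<le> word_norm S (s n)"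
      using s unfolding filterlim_iff by blast
  qed
qed

lemma escaping_subseq: "escaping s \<Longrightarrow> strict_mono r \<Longrightarrow> escaping (s \<circ> r)"
  unfolding escaping_def comp_def by (rule filterlim_compose [OF _ filterlim_subseq])

lemma escaping_uminus: "escaping s \<Longrightarrow> escaping (\<lambda>n. - s n)"
  by (simp add: escaping_def word_norm_uminus [OF gen])

lemma word_norm_le_add: "word_norm S x \<le> word_norm S (x + b) + word_norm S b"
  "word_norm S x \<le> word_norm S (b + x) + word_norm S b"
  using word_norm_add [OF gen, of "x + b" "- b"] word_norm_add [OF gen, of "- b" "b + x"]
  by (simp_all add: word_norm_uminus [OF gen] add.assoc [symmetric])

lemma escaping_mono:
  assumes "escaping s" "\<And>n. word_norm S (s n) \<le> word_norm S (t n) + c"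
  shows "escaping t"
  unfolding escaping_def filterlim_at_top
proof
  fix R
  show "\<forall>\<^sub>F n in sequentially. R \<le> word_norm S (t n)"
    using escapingD [OF assms(1), of "R + c"]
  proof (rule eventually_mono)
    fix n assume "R + c \<le> word_norm S (s n)"
    with assms(2) [of n] show "R \<le> word_norm S (t n)" by simp
  qed
qed

lemma escaping_translate: "escaping s \<Longrightarrow> escaping (\<lambda>n. g + s n)"
  by (erule escaping_mono) (rule word_norm_le_add)

lemma bseq_translate: "bseq s \<Longrightarrow> bseq (\<lambda>n. g + s n)"
  by (simp add: bseq_def cau_translate escaping_translate)

lemma bseq_subseq: "bseq s \<Longrightarrow> strict_mono r \<Longrightarrow> bseq (s \<circ> r)"
  by (simp add: bseq_def cau_subseq escaping_subseq)

text \<open>Cut a geodesic from 0 to \<open>g\<close> at radius \<open>R\<close>: what lies beyond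
  has Floyd length at most \<open>tail R\<close>, so the finite ball of radius \<open>R\<close> is a
  net.\<close>

lemma totally_bounded: "Metric_space.mtotally_bounded UNIV (\<delta> 0) UNIV"
proof -
  interpret M: Metric_space UNIV "\<delta> 0" by (rule Metric_space_\<delta>)
  show ?thesis
    unfolding M.mtotally_bounded_def
  proof (intro allI impI)
    fix e :: real assume "0 < e"
    then obtain R where R: "\<And>r. R \<le> r \<Longrightarrow> tail r < e" using tail_small by blast
    let ?K = "{g. word_norm S g \<le> R}"
    have "\<exists>p\<in>?K. \<delta> 0 p g < e" for g
    proof (cases "word_norm S g \<le> R")
      case True
      then show ?thesis using \<open>0 < e\<close> by (intro bexI [of _ g]) auto
    next
      case False
      obtain \<gamma> where \<gamma>: "geodesic S \<gamma> (d 0 g)" "\<gamma> 0 = 0" "\<gamma> (d 0 g) = g"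
        by (rule geodesic_exists [OF gen])
      have 1: "d 0 (\<gamma> R) = R" "d (\<gamma> R) g = d 0 g - R"
        using geodesic_dist [OF \<gamma>(1), of 0 R] geodesic_dist [OF \<gamma>(1), of R "d 0 g"] False \<gamma> by auto
      have "\<delta> 0 (\<gamma> R) g \<le> tail (d 0 (\<gamma> R) - 0)"
        by (rule \<delta>_le_tail) (use 1 False in auto)
      then show ?thesis using R [of R] 1 by (intro bexI [of _ "\<gamma> R"]) auto
    qed
    then show "\<exists>K. finite K \<and> K \<subseteq> UNIV \<and> UNIV \<subseteq> (\<Union>x\<in>K. M.mball x e)"
      using finite_word_ball [OF gen] by (intro exI [of _ ?K]) (auto simp: M.in_mball)
  qed
qed

lemma cau_iff_MCauchy: "cau s \<longleftrightarrow> Metric_space.MCauchy UNIV (\<delta> 0) s"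
proof -
  interpret M: Metric_space UNIV "\<delta> 0" by (rule Metric_space_\<delta>)
  have "(\<forall>m\<ge>N. \<forall>n\<ge>N. \<delta> 0 (s m) (s n) < e) \<longleftrightarrow> (\<forall>m n. N \<le> m \<longrightarrow> N \<le> n \<longrightarrow> \<delta> 0 (s m) (s n) < e)" for N e
    by blast
  then show ?thesis by (simp only: cau_def M.MCauchy_def subset_UNIV simp_thms)
qed

lemma cau_subseq_exists: "\<exists>r. strict_mono r \<and> cau (s \<circ> r)" for s :: "nat \<Rightarrow> 'a"
proof -
  interpret M: Metric_space UNIV "\<delta> 0" by (rule Metric_space_\<delta>)
  have "\<forall>\<sigma>::nat \<Rightarrow> 'a. range \<sigma> \<subseteq> UNIV \<longrightarrow> (\<exists>r. strict_mono r \<and> M.MCauchy (\<sigma> \<circ> r))"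
    using totally_bounded unfolding M.mtotally_bounded_sequentially by (rule conjunct2)
  then show ?thesis unfolding cau_iff_MCauchy by blast
qed

lemma bseq_subseq_exists:
  assumes "escaping s"
  obtains r where "strict_mono r" "bseq (s \<circ> r)"
proof -
  obtain r where "strict_mono r" "cau (s \<circ> r)" using cau_subseq_exists [of s] by blast
  with escaping_subseq [OF assms] that show ?thesis by (simp add: bseq_def)
qed

lemma infinite_bseq_exists:
  assumes "infinite X"
  obtains s where "bseq s" "\<And>n. s n \<in> X"
proof -
  obtain t :: "nat \<Rightarrow> 'a" where t: "inj t" "range t \<subseteq> X"
    using infinite_countable_subset [OF assms] by blast
  have "filterlim t cofinite sequentially"
    unfolding filterlim_iff
  proof (intro allI impI)
    fix P :: "'a \<Rightarrow> bool" assume "eventually P cofinite"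
    then have "finite {x. \<not> P x}" by (simp only: eventually_cofinite)
    then have "finite (t -` {x. \<not> P x})" by (rule finite_vimageI [OF _ t(1)])
    then have "eventually (\<lambda>n. P (t n)) cofinite"
      by (simp only: eventually_cofinite vimage_def mem_Collect_eq)
    then show "\<forall>\<^sub>F n in sequentially. P (t n)"
      by (simp only: cofinite_eq_sequentially)
  qed
  then have "escaping t" by (simp add: escaping_iff)
  then obtain r where r: "strict_mono r" "bseq (t \<circ> r)" by (rule bseq_subseq_exists)
  show ?thesis
    by (rule that [of "t \<circ> r"]) (use r t in auto)
qed

text \<open>Right multiplication by bounded elements moves a point a bounded word distance, and far
  out a path of bounded length costs almost nothing. So it fixes boundary points, whereas left
  multiplication may move them.\<close>

lemma right_bounded_small:
  assumes "escaping s" "\<And>n. word_norm S (b n) \<le> R"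
  shows "(\<lambda>n. \<delta> 0 (s n) (s n + b n)) \<longlonglongrightarrow> 0"
proof (rule LIMSEQ_I)
  fix e :: real assume "0 < e"
  have "(\<lambda>k. real R * f (real k)) \<longlonglongrightarrow> real R * 0"
    using f_summable [of 0] by (intro tendsto_mult_left summable_LIMSEQ_zero) simp
  then have "\<forall>\<^sub>F k in sequentially. real R * f (real k) < e"
    using \<open>0 < e\<close> by (intro order_tendstoD) auto
  then obtain k where k: "real R * f (real k) < e" by (auto simp: eventually_sequentially)
  obtain N where N: "\<And>n. N \<le> n \<Longrightarrow> k + R \<le> word_norm S (s n)"
    using escapingD [OF assms(1)] by (auto simp: eventually_sequentially)
  show "\<exists>N. \<forall>n\<ge>N. norm (\<delta> 0 (s n) (s n + b n) - 0) < e"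
  proof (intro exI [of _ N] allI impI)
    fix n assume "N \<le> n"
    have db: "d (s n) (s n + b n) = word_norm S (b n)" by (simp add: word_dist_def add.assoc [symmetric])
    have "\<delta> 0 (s n) (s n + b n) \<le> real (d (s n) (s n + b n)) * f (real k)"
      by (rule \<delta>_le_far) (use N [OF \<open>N \<le> n\<close>] assms(2) [of n] db in simp)
    also have "\<dots> \<le> real R * f (real k)"
      using assms(2) [of n] db f_pos [of k] by (intro mult_right_mono) auto
    finally show "norm (\<delta> 0 (s n) (s n + b n) - 0) < e" using k by simp
  qed
qed

lemma bseq_right:
  assumes "bseq s" "\<And>n. word_norm S (b n) \<le> R"
  shows "bseq (\<lambda>n. s n + b n)" "gap s (\<lambda>n. s n + b n) = 0"
proof -
  have "(\<lambda>n. \<delta> 0 (s n) (s n + b n)) \<longlonglongrightarrow> 0"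
    using assms by (intro right_bounded_small) (auto simp: bseq_def)
  from cau_equivalent [OF _ this] assms(1)
  have c: "cau (\<lambda>n. s n + b n)" "gap s (\<lambda>n. s n + b n) = 0" by (auto simp: bseq_def)
  have "escaping (\<lambda>n. s n + b n)"
  proof (rule escaping_mono)
    show "escaping s" using assms(1) by (simp add: bseq_def)
    show "word_norm S (s n) \<le> word_norm S (s n + b n) + R" for n
      using word_norm_le_add(1) [of "s n" "b n"] assms(2) [of n] by simp
  qed
  with c show "bseq (\<lambda>n. s n + b n)" "gap s (\<lambda>n. s n + b n) = 0" by (auto simp: bseq_def)
qed

lemma attraction_seq:
  assumes "escaping s" "0 < \<epsilon>" "0 < \<epsilon>'"
  shows "\<forall>\<^sub>F n in sequentially. \<forall>x. \<epsilon> \<le> \<delta> 0 x (- s n) \<longrightarrow> \<delta> 0 (s n + x) (s n) \<le> \<epsilon>'"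
proof -
  obtain N where N: "\<And>v g x. N \<le> d v (g + v) \<Longrightarrow> \<epsilon> \<le> \<delta> v x (- g + v) \<Longrightarrow> \<delta> v (g + x) (g + v) \<le> \<epsilon>'"
    by (rule attraction [OF assms(2,3)]) blast
  show ?thesis
    using escapingD [OF assms(1), of N] by (rule eventually_mono) (use N [where v = 0] in auto)
qed

lemma gap_nonzero_pos: "cau s \<Longrightarrow> cau t \<Longrightarrow> gap s t \<noteq> 0 \<Longrightarrow> 0 < gap s t"
  using gap_nonneg [of s t] by linarith

text \<open>If the inverses stayed away from \<eta>, \<open>attraction_seq\<close> would carry
  \<eta> close to \<open>\<xi> n\<close>; but \<eta> is fixed and \<open>\<xi> n\<close> stays away
  from it.\<close>

lemma uminus_converges_fixed:
  assumes \<xi>: "bseq \<xi>" "bseq (\<lambda>n. - \<xi> n)" and \<eta>: "bseq \<eta>"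
    and fixed: "\<And>n. gap (\<lambda>k. \<xi> n + \<eta> k) \<eta> = 0" and ne: "gap \<xi> \<eta> \<noteq> 0"
  shows "gap (\<lambda>n. - \<xi> n) \<eta> = 0"
proof (rule ccontr)
  assume ne': "gap (\<lambda>n. - \<xi> n) \<eta> \<noteq> 0"
  have c: "cau \<xi>" "cau (\<lambda>n. - \<xi> n)" "cau \<eta>" using \<xi> \<eta> by (auto simp: bseq_def)
  define \<epsilon> where "\<epsilon> = gap \<xi> \<eta> / 2"
  define \<epsilon>1 where "\<epsilon>1 = gap (\<lambda>n. - \<xi> n) \<eta> / 2"
  have pos: "0 < \<epsilon>" "0 < \<epsilon>1"
    using gap_nonzero_pos [OF c(1,3) ne] gap_nonzero_pos [OF c(2,3) ne'] by (auto simp: \<epsilon>_def \<epsilon>1_def)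
  have ev1: "\<forall>\<^sub>F n in sequentially. \<epsilon>1 < gap (point (- \<xi> n)) \<eta>"
    using order_tendstoD(1) [OF gap_point_tendsto [OF c(2,3)], of \<epsilon>1] pos by (simp add: \<epsilon>1_def)
  have ev2: "\<forall>\<^sub>F n in sequentially. \<epsilon> < gap (point (\<xi> n)) \<eta>"
    using order_tendstoD(1) [OF gap_point_tendsto [OF c(1,3)], of \<epsilon>] pos by (simp add: \<epsilon>_def)
  have ev3: "\<forall>\<^sub>F n in sequentially. \<forall>x. \<epsilon>1 \<le> \<delta> 0 x (- \<xi> n) \<longrightarrow> \<delta> 0 (\<xi> n + x) (\<xi> n) \<le> \<epsilon>"
    using \<xi>(1) pos by (intro attraction_seq) (auto simp: bseq_def)
  obtain n where n: "\<epsilon>1 < gap (point (- \<xi> n)) \<eta>" "\<epsilon> < gap (point (\<xi> n)) \<eta>"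
    "\<And>x. \<epsilon>1 \<le> \<delta> 0 x (- \<xi> n) \<Longrightarrow> \<delta> 0 (\<xi> n + x) (\<xi> n) \<le> \<epsilon>"
    using eventually_happens' [OF _ eventually_conj [OF ev1 eventually_conj [OF ev2 ev3]]] by auto
  have "\<forall>\<^sub>F k in sequentially. \<epsilon>1 < \<delta> 0 (- \<xi> n) (\<eta> k)"
    using cau_limit [OF cau_point c(3)] n(1) by (rule order_tendstoD)
  then have ev: "\<forall>\<^sub>F k in sequentially. \<delta> 0 (\<xi> n) (\<xi> n + \<eta> k) \<le> \<epsilon>"
  proof (rule eventually_mono)
    fix k assume "\<epsilon>1 < \<delta> 0 (- \<xi> n) (\<eta> k)"
    then show "\<delta> 0 (\<xi> n) (\<xi> n + \<eta> k) \<le> \<epsilon>"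
      using n(3) [of "\<eta> k"] \<delta>_commute [of 0 "\<eta> k"] \<delta>_commute [of 0 "\<xi> n"] by simp
  qed
  have "gap (point (\<xi> n)) (\<lambda>k. \<xi> n + \<eta> k) \<le> \<epsilon>"
    by (rule tendsto_upperbound [OF cau_limit [OF cau_point cau_translate [OF c(3)]] ev]) simp
  then have "gap (point (\<xi> n)) \<eta> \<le> \<epsilon>"
    using gap_triangle [OF cau_point cau_translate [OF c(3)] c(3), of "\<xi> n" "\<xi> n"] fixed [of n] by simp
  with n(2) show False by simp
qed

end

section \<open>At least three boundary points\<close>

lemma finite_pos_lower_bound:
  assumes "finite A" "\<And>x. x \<in> A \<Longrightarrow> 0 < g x"
  obtains e :: real where "0 < e" "\<And>x. x \<in> A \<Longrightarrow> e < g x"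
proof -
  define e where "e = Min (insert 1 (g ` A)) / 2"
  have pos: "0 < Min (insert 1 (g ` A))" using assms by simp
  have "e < g x" if "x \<in> A" for x
  proof -
    have "Min (insert 1 (g ` A)) \<le> g x" using assms(1) that by (intro Min_le) auto
    with pos show ?thesis by (simp add: e_def)
  qed
  then show ?thesis using that [of e] pos by (simp add: e_def)
qed

context floyd
begin

definition fixed_point :: "(nat \<Rightarrow> 'a) \<Rightarrow> bool" where
  "fixed_point \<eta> \<longleftrightarrow> (\<forall>g. gap (\<lambda>k. g + \<eta> k) \<eta> = 0)"

lemma bseqD: "bseq s \<Longrightarrow> cau s" "bseq s \<Longrightarrow> escaping s"
  by (simp_all add: bseq_def)

text \<open>The points at norm \<open>m\<close> on geodesics from 0 to far members of the sequence.
  With norms exactly \<open>m\<close>, two such sequences can be compared index by index through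
  \<open>equal_length_close\<close>.\<close>

lemma radial:
  assumes "bseq \<xi>"
  obtains p where "bseq p" "gap \<xi> p = 0" "\<And>m. word_norm S (p m) = m"
proof -
  have "\<exists>q. \<delta> 0 q (\<xi> n) \<le> tail m \<and> word_norm S q = m" if "m \<le> word_norm S (\<xi> n)" for m n
  proof -
    obtain \<gamma> where \<gamma>: "geodesic S \<gamma> (d 0 (\<xi> n))" "\<gamma> 0 = 0" "\<gamma> (d 0 (\<xi> n)) = \<xi> n"
      by (rule geodesic_exists [OF gen])
    have 1: "d 0 (\<gamma> m) = m" "d (\<gamma> m) (\<xi> n) = d 0 (\<xi> n) - m"
      using geodesic_dist [OF \<gamma>(1), of 0 m] geodesic_dist [OF \<gamma>(1), of m "d 0 (\<xi> n)"] that \<gamma> by auto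
    have "\<delta> 0 (\<gamma> m) (\<xi> n) \<le> tail (d 0 (\<gamma> m) - 0)"
      by (rule \<delta>_le_tail) (use 1 that in auto)
    then show ?thesis using 1 by (intro exI [of _ "\<gamma> m"]) simp
  qed
  moreover have "\<exists>n\<ge>m. m \<le> word_norm S (\<xi> n)" for m
    using escapingD [OF bseqD(2) [OF assms], of m] unfolding eventually_sequentially by (meson linear)
  ultimately have "\<forall>m. \<exists>n q. m \<le> n \<and> \<delta> 0 q (\<xi> n) \<le> tail m \<and> word_norm S q = m" by meson
  then obtain n p where np: "\<And>m. m \<le> n m" "\<And>m. \<delta> 0 (p m) (\<xi> (n m)) \<le> tail m" "\<And>m. word_norm S (p m) = m"
    by metis
  have "(\<lambda>m. \<delta> 0 (\<xi> m) (p m)) \<longlonglongrightarrow> 0"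
  proof (rule LIMSEQ_I)
    fix e :: real assume "0 < e"
    then have e: "0 < e / 2" by simp
    obtain N where N: "\<And>m n. N \<le> m \<Longrightarrow> N \<le> n \<Longrightarrow> \<delta> 0 (\<xi> m) (\<xi> n) < e / 2"
      using bseqD(1) [OF assms] e unfolding cau_def by meson
    obtain M where M: "\<And>r. M \<le> r \<Longrightarrow> tail r < e / 2" using tail_small [OF e] by blast
    show "\<exists>N. \<forall>m\<ge>N. norm (\<delta> 0 (\<xi> m) (p m) - 0) < e"
    proof (intro exI [of _ "max N M"] allI impI)
      fix m assume m: "max N M \<le> m"
      then have "\<delta> 0 (\<xi> m) (\<xi> (n m)) < e / 2" using np(1) [of m] by (intro N) auto
      moreover have "tail m < e / 2" using m by (intro M) simp
      ultimately show "norm (\<delta> 0 (\<xi> m) (p m) - 0) < e"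
        using \<delta>_triangle [of 0 "\<xi> m" "p m" "\<xi> (n m)"] np(2) [of m] \<delta>_commute [of 0 "p m" "\<xi> (n m)"]
        by simp
    qed
  qed
  from cau_equivalent [OF bseqD(1) [OF assms] this]
  have "cau p" "gap \<xi> p = 0" .
  moreover have "escaping p"
    unfolding escaping_def np(3) by (rule filterlim_ident)
  ultimately show ?thesis using that np(3) by (simp add: bseq_def)
qed

text \<open>A geodesic from \<open>a\<close> to the fixed point passes near the base point; translating by
  \<open>- a\<close>, the inverses of all such \<open>a\<close> lie near a single geodesic ray towards the fixed point.\<close>

lemma equal_length_close:
  assumes \<eta>: "bseq \<eta>" and fixed: "\<And>g. gap (\<lambda>k. g + \<eta> k) \<eta> = 0" and \<epsilon>: "0 < \<epsilon>"
  obtains R where "\<And>a b. word_norm S a = word_norm S b \<Longrightarrow> \<epsilon> \<le> gap (point a) \<eta> \<Longrightarrow>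
    \<epsilon> \<le> gap (point b) \<eta> \<Longrightarrow> word_norm S (b + - a) \<le> R"
proof -
  have e2: "0 < \<epsilon> / 2" using \<epsilon> by simp
  obtain R where R: "\<And>v \<gamma> L. geodesic S \<gamma> L \<Longrightarrow> \<epsilon> / 2 \<le> \<delta> v (\<gamma> 0) (\<gamma> L) \<Longrightarrow> \<exists>i\<le>L. d v (\<gamma> i) \<le> R"
    by (rule geodesic_meets_ball [OF e2]) blast
  have c\<eta>: "cau \<eta>" using \<eta> by (rule bseqD)
  have far: "\<forall>\<^sub>F j in sequentially. \<epsilon> / 2 < \<delta> 0 a (a + \<eta> j)" if "\<epsilon> \<le> gap (point a) \<eta>" for a
  proof -
    have "gap (\<lambda>k. a + \<eta> k) (point a) = gap \<eta> (point a)"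
      by (rule gap_zero_eq [OF cau_translate [OF c\<eta>] c\<eta> cau_point fixed])
    then have "\<epsilon> / 2 < gap (point a) (\<lambda>k. a + \<eta> k)"
      using that \<epsilon> by (simp add: gap_commute [of "point a"])
    with cau_limit [OF cau_point cau_translate [OF c\<eta>]] show ?thesis by (rule order_tendstoD)
  qed
  show ?thesis
  proof (rule that [of "4 * R"])
    fix a b assume ab: "word_norm S a = word_norm S b" "\<epsilon> \<le> gap (point a) \<eta>" "\<epsilon> \<le> gap (point b) \<eta>"
    obtain j where j: "\<epsilon> / 2 < \<delta> 0 a (a + \<eta> j)" "\<epsilon> / 2 < \<delta> 0 b (b + \<eta> j)"
      using eventually_happens' [OF _ eventually_conj [OF far [OF ab(2)] far [OF ab(3)]]] by auto
    obtain \<gamma> where \<gamma>: "geodesic S \<gamma> (d 0 (\<eta> j))" "\<gamma> 0 = 0" "\<gamma> (d 0 (\<eta> j)) = \<eta> j"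
      by (rule geodesic_exists [OF gen])
    have near: "\<exists>i\<le>d 0 (\<eta> j). d (- c) (\<gamma> i) \<le> R" if "\<epsilon> / 2 < \<delta> 0 c (c + \<eta> j)" for c
    proof -
      have "\<exists>i\<le>d 0 (\<eta> j). d 0 (c + \<gamma> i) \<le> R"
        using R [OF geodesic_translate [OF \<gamma>(1), of c], of 0] that \<gamma>(2,3) by simp
      moreover have "d 0 (c + \<gamma> i) = d (- c) (\<gamma> i)" for i
        using word_dist_translate [of S c "- c" "\<gamma> i"] by simp
      ultimately show ?thesis by simp
    qed
    obtain i where i: "i \<le> d 0 (\<eta> j)" "d (- a) (\<gamma> i) \<le> R" using near [OF j(1)] by blast
    obtain k where k: "k \<le> d 0 (\<eta> j)" "d (- b) (\<gamma> k) \<le> R" using near [OF j(2)] by blast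
    have norms: "d 0 (\<gamma> i) = i" "d 0 (\<gamma> k) = k"
      using geodesic_dist [OF \<gamma>(1), of 0 i] geodesic_dist [OF \<gamma>(1), of 0 k] \<gamma>(2) i k by auto
    have "d 0 (- a) = d 0 (- b)" using ab(1) by (simp add: word_norm_uminus [OF gen])
    \<comment> \<open>The inverses of \<open>a\<close> and \<open>b\<close> have equal norm and lie
      within \<open>R\<close> of the same geodesic, so their positions along it differ by at most
      \<open>2 * R\<close>.\<close>
    then have "i \<le> k + 2 * R" "k \<le> i + 2 * R"
      using d_triangle [of 0 "\<gamma> i" "- a"] d_triangle [of 0 "- a" "\<gamma> i"] d_triangle [of 0 "\<gamma> k" "- b"]
        d_triangle [of 0 "- b" "\<gamma> k"] norms i k d_commute [of "\<gamma> i"] d_commute [of "\<gamma> k"] by auto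
    then have "d (\<gamma> i) (\<gamma> k) \<le> 2 * R"
      using geodesic_dist [OF \<gamma>(1), of i k] geodesic_dist [OF \<gamma>(1), of k i] i k d_commute [of "\<gamma> i" "\<gamma> k"]
      by (cases "i \<le> k") auto
    then have "d (- b) (- a) \<le> 4 * R"
      using d_triangle [of "- b" "- a" "\<gamma> k"] d_triangle [of "\<gamma> k" "- a" "\<gamma> i"] i k
        d_commute [of "\<gamma> i" "\<gamma> k"] d_commute [of "- a" "\<gamma> i"] by simp
    then show "word_norm S (b + - a) \<le> 4 * R" by (simp add: word_dist_def)
  qed
qed

text \<open>The differences \<open>q' m + - p m\<close> eventually stay in a finite ball, so one of
  them recurs for infinitely many \<open>m\<close>. Thus the boundary points more than \<epsilon>
  away from the fixed point are finitely many, all of them translates of one.\<close>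

lemma orbit_covers:
  assumes \<eta>: "bseq \<eta>" and fixed: "\<And>g. gap (\<lambda>k. g + \<eta> k) \<eta> = 0" and \<epsilon>: "0 < \<epsilon>"
    and p: "bseq p" "\<And>m. word_norm S (p m) = m" "\<epsilon> < gap p \<eta>"
  obtains R where "\<And>q. bseq q \<Longrightarrow> \<epsilon> < gap q \<eta> \<Longrightarrow> \<exists>t. word_norm S t \<le> R \<and> gap (\<lambda>n. t + p n) q = 0"
proof -
  obtain R where R: "\<And>a b. word_norm S a = word_norm S b \<Longrightarrow> \<epsilon> \<le> gap (point a) \<eta> \<Longrightarrow>
    \<epsilon> \<le> gap (point b) \<eta> \<Longrightarrow> word_norm S (b + - a) \<le> R"
    by (rule equal_length_close [OF \<eta> fixed \<epsilon>]) blast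
  show ?thesis
  proof (rule that [of R])
    fix q assume q: "bseq q" "\<epsilon> < gap q \<eta>"
    obtain q' where q': "bseq q'" "gap q q' = 0" "\<And>m. word_norm S (q' m) = m"
      by (rule radial [OF q(1)]) blast
    have c: "cau q" "cau q'" "cau p" "cau \<eta>" using q q' p \<eta> bseqD by auto
    have "\<epsilon> < gap q' \<eta>" using gap_zero_eq [OF c(1,2,4) q'(2)] q(2) by simp
    then have "\<forall>\<^sub>F m in sequentially. \<epsilon> < gap (point (q' m)) \<eta>"
      by (rule order_tendstoD(1) [OF gap_point_tendsto [OF c(2,4)]])
    moreover have "\<forall>\<^sub>F m in sequentially. \<epsilon> < gap (point (p m)) \<eta>"
      by (rule order_tendstoD(1) [OF gap_point_tendsto [OF c(3,4)] p(3)])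
    ultimately have "\<forall>\<^sub>F m in sequentially. word_norm S (q' m + - p m) \<le> R"
    proof eventually_elim
      case (elim m)
      show ?case by (rule R) (use elim p(2) q'(3) in auto)
    qed
    then obtain M where M: "\<And>m. M \<le> m \<Longrightarrow> word_norm S (q' m + - p m) \<le> R"
      unfolding eventually_sequentially by blast
    let ?f = "\<lambda>m. q' m + - p m"
    have "?f ` {M..} \<subseteq> {t. word_norm S t \<le> R}" using M by blast
    then have "finite (?f ` {M..})" using finite_word_ball [OF gen] finite_subset by blast
    then obtain m0 where m0: "m0 \<in> {M..}" "infinite {m \<in> {M..}. ?f m = ?f m0}"
      using pigeonhole_infinite [OF infinite_Ici, of ?f M] by blast
    obtain r :: "nat \<Rightarrow> nat" where r: "strict_mono r" "\<And>n. r n \<in> {m \<in> {M..}. ?f m = ?f m0}"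
      using infinite_enumerate [OF m0(2)] by blast
    have eq: "?f m0 + p (r n) = q' (r n)" for n
    proof -
      have "?f (r n) = ?f m0" using r(2) [of n] by simp
      then show ?thesis by (metis diff_add_cancel diff_conv_add_uminus)
    qed
    have "((\<lambda>n. \<delta> 0 (?f m0 + p n) (q' n)) \<circ> r) \<longlonglongrightarrow> gap (\<lambda>n. ?f m0 + p n) q'"
      by (rule LIMSEQ_subseq_LIMSEQ [OF cau_limit [OF cau_translate [OF c(3)] c(2)] r(1)])
    moreover have "((\<lambda>n. \<delta> 0 (?f m0 + p n) (q' n)) \<circ> r) = (\<lambda>n. 0)"
      using eq by (simp add: fun_eq_iff)
    ultimately have "gap (\<lambda>n. ?f m0 + p n) q' = 0" using LIMSEQ_unique tendsto_const by metis
    then have "gap (\<lambda>n. ?f m0 + p n) q = 0"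
      using gap_zero_eq [OF c(1,2) cau_translate [OF c(3)] q'(2), of "?f m0"] gap_commute by metis
    then show "\<exists>t. word_norm S t \<le> R \<and> gap (\<lambda>n. t + p n) q = 0"
      using M m0(1) by (intro exI [of _ "?f m0"]) auto
  qed
qed

text \<open>Away from \<eta> the boundary is locally finite by \<open>orbit_covers\<close>, so the
  point of \<open>p\<close> is isolated in it. The translations by \<open>a m\<close> contract
  \<xi>1 and \<xi>2 towards this point, hence eventually onto it, but a translation cannot identify
  two points.\<close>

lemma no_fixed_point:
  assumes \<eta>: "bseq \<eta>" and fixed: "\<And>g. gap (\<lambda>k. g + \<eta> k) \<eta> = 0"
    and \<xi>: "bseq \<xi>1" "bseq \<xi>2" and ne: "gap \<xi>1 \<eta> \<noteq> 0" "gap \<xi>2 \<eta> \<noteq> 0" "gap \<xi>1 \<xi>2 \<noteq> 0"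
  shows False
proof -
  obtain p where p: "bseq p" "gap \<xi>1 p = 0" "\<And>m. word_norm S (p m) = m"
    by (rule radial [OF \<xi>(1)]) blast
  have "escaping (\<lambda>n. - p n)" using bseqD(2) [OF p(1)] by (rule escaping_uminus)
  then obtain r where r: "strict_mono r" "bseq ((\<lambda>n. - p n) \<circ> r)" by (rule bseq_subseq_exists)
  define a where "a = p \<circ> r"
  have a: "bseq a" "bseq (\<lambda>n. - a n)"
    using bseq_subseq [OF p(1) r(1)] r(2) by (simp_all add: a_def comp_def)
  have c: "cau \<xi>1" "cau \<xi>2" "cau \<eta>" "cau p" "cau a" "cau (\<lambda>n. - a n)"
    using \<xi> \<eta> p a bseqD by auto
  have ap: "gap a p = 0" unfolding a_def by (rule cau_subseq [OF c(4) r(1)])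
  have p\<eta>: "gap p \<eta> = gap \<xi>1 \<eta>" using gap_zero_eq [OF c(1,4,3) p(2)] by simp
  have "gap a \<eta> \<noteq> 0" using gap_zero_eq [OF c(5,4,3) ap] p\<eta> ne(1) by simp
  then have a\<eta>: "gap (\<lambda>n. - a n) \<eta> = 0"
    by (intro uminus_converges_fixed a \<eta> fixed)
  define \<epsilon> where "\<epsilon> = gap p \<eta> / 2"
  have \<epsilon>: "0 < \<epsilon>" "gap p \<eta> = 2 * \<epsilon>"
    using gap_nonzero_pos [OF c(1,3) ne(1)] p\<eta> by (auto simp: \<epsilon>_def)
  have "\<epsilon> < gap p \<eta>" using \<epsilon> by simp
  then obtain R where R: "\<And>q. bseq q \<Longrightarrow> \<epsilon> < gap q \<eta> \<Longrightarrow> \<exists>t. word_norm S t \<le> R \<and> gap (\<lambda>n. t + p n) q = 0"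
    using orbit_covers [OF \<eta> fixed \<epsilon>(1) p(1,3)] by blast
  define T where "T = {t. word_norm S t \<le> R \<and> gap (\<lambda>n. t + p n) p \<noteq> 0}"
  have "finite T"
    by (rule finite_subset [OF _ finite_word_ball [OF gen, of R]]) (auto simp: T_def)
  moreover have "0 < gap (\<lambda>n. t + p n) p" if "t \<in> T" for t
    using gap_nonzero_pos [OF cau_translate [OF c(4)] c(4)] that by (simp add: T_def)
  ultimately obtain e where e: "0 < e" "\<And>t. t \<in> T \<Longrightarrow> e < gap (\<lambda>n. t + p n) p"
    using finite_pos_lower_bound [of T "\<lambda>t. gap (\<lambda>n. t + p n) p"] by blast
  \<comment> \<open>An image point within \<open>2 * e'\<close> of \<open>p\<close> is
    \<epsilon>-far from \<eta>, hence a translate of \<open>p\<close> by an element of norm at most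
    \<open>R\<close>; being also within \<open>e\<close> of \<open>p\<close>, it must equal
    \<open>p\<close>.\<close>
  define e' where "e' = min e \<epsilon> / 3"
  have e': "0 < e'" "2 * e' < e" "2 * e' < \<epsilon>" using e(1) \<epsilon> by (auto simp: e'_def)
  have near: "\<forall>\<^sub>F m in sequentially. gap (\<lambda>n. a m + \<xi> n) p = 0" if \<xi>: "bseq \<xi>" "gap \<xi> \<eta> \<noteq> 0" for \<xi>
  proof -
    have c\<xi>: "cau \<xi>" using \<xi>(1) by (rule bseqD)
    define g where "g = gap \<xi> \<eta> / 2"
    have g: "0 < g" using gap_nonzero_pos [OF c\<xi> c(3) \<xi>(2)] by (simp add: g_def)
    have "g < gap (\<lambda>n. - a n) \<xi>"
      using gap_zero_eq [OF c(6,3) c\<xi> a\<eta>] g gap_commute [of \<eta> \<xi>] by (simp add: g_def)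
    then have "\<forall>\<^sub>F m in sequentially. g < gap (point (- a m)) \<xi>"
      by (rule order_tendstoD(1) [OF gap_point_tendsto [OF c(6) c\<xi>]])
    moreover have "\<forall>\<^sub>F m in sequentially. \<forall>x. g \<le> \<delta> 0 x (- a m) \<longrightarrow> \<delta> 0 (a m + x) (a m) \<le> e'"
      by (rule attraction_seq [OF bseqD(2) [OF a(1)] g e'(1)])
    moreover have "\<forall>\<^sub>F m in sequentially. gap (point (a m)) p < e'"
      using e'(1) ap by (intro order_tendstoD(2) [OF gap_point_tendsto [OF c(5,4)]]) simp
    ultimately show ?thesis
    proof eventually_elim
      case (elim m)
      let ?q = "\<lambda>n. a m + \<xi> n"
      have cq: "cau ?q" by (rule cau_translate [OF c\<xi>])
      have "\<forall>\<^sub>F n in sequentially. g < \<delta> 0 (- a m) (\<xi> n)"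
        using cau_limit [OF cau_point c\<xi>] elim(1) by (rule order_tendstoD)
      then have "\<forall>\<^sub>F n in sequentially. \<delta> 0 (a m + \<xi> n) (a m) \<le> e'"
      proof (rule eventually_mono)
        fix n assume "g < \<delta> 0 (- a m) (\<xi> n)"
        then show "\<delta> 0 (a m + \<xi> n) (a m) \<le> e'" using elim(2) \<delta>_commute [of 0 "- a m" "\<xi> n"] by simp
      qed
      then have "gap ?q (point (a m)) \<le> e'"
        by (rule tendsto_upperbound [OF cau_limit [OF cq cau_point]]) simp
      then have qp: "gap ?q p < 2 * e'"
        using gap_triangle [OF cq cau_point c(4), of "a m"] elim(3) by simp
      have "gap p \<eta> \<le> gap ?q p + gap ?q \<eta>"
        using gap_triangle [OF c(4) cq c(3)] gap_commute [of p ?q] by simp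
      then have "\<epsilon> < gap ?q \<eta>" using qp e' \<epsilon> by simp
      then obtain t where t: "word_norm S t \<le> R" "gap (\<lambda>n. t + p n) ?q = 0"
        using R [OF bseq_translate [OF \<xi>(1)]] by blast
      have eq: "gap (\<lambda>n. t + p n) p = gap ?q p"
        by (rule gap_zero_eq [OF cau_translate [OF c(4)] cq c(4) t(2)])
      have "t \<notin> T" using e(2) [of t] eq qp e'(2) by auto
      then show "gap ?q p = 0" using t(1) eq by (simp add: T_def)
    qed
  qed
  obtain m where m: "gap (\<lambda>n. a m + \<xi>1 n) p = 0" "gap (\<lambda>n. a m + \<xi>2 n) p = 0"
    using eventually_happens' [OF _ eventually_conj [OF near [OF \<xi>(1) ne(1)] near [OF \<xi>(2) ne(2)]]] by auto
  have "gap (\<lambda>n. a m + \<xi>1 n) (\<lambda>n. a m + \<xi>2 n) = gap p (\<lambda>n. a m + \<xi>2 n)"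
    by (rule gap_zero_eq [OF cau_translate [OF c(1)] c(4) cau_translate [OF c(2)] m(1)])
  also have "\<dots> = 0" using m(2) gap_commute [of p] by simp
  finally have "gap \<xi>1 \<xi>2 = 0" using gap_translate_zero [OF c(1,2)] by simp
  with ne(3) show False by simp
qed

end

context floyd_walk
begin

text \<open>Two translations per boundary point: \<open>a i n\<close> and
  \<open>a i n + - u i\<close> share the attracting point, but their repelling points differ because
  \<open>u i\<close> moves the first of them. For different \<open>i\<close> the repelling points
  may coincide. So among the six indices an element lies in at most 2 attracting and at most 3
  repelling regions, and 2 + 3 < 6.\<close>

lemma exp_decay_no_fixed_point:
  fixes \<xi> :: "nat \<Rightarrow> nat \<Rightarrow> 'a"
  assumes \<xi>: "\<And>i. i < 3 \<Longrightarrow> bseq (\<xi> i)"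
    and ne: "\<And>i j. i < 3 \<Longrightarrow> j < 3 \<Longrightarrow> i \<noteq> j \<Longrightarrow> gap (\<xi> i) (\<xi> j) \<noteq> 0"
    and nofix: "\<And>\<eta>. bseq \<eta> \<Longrightarrow> \<not> fixed_point \<eta>"
  shows "exp_decay \<mu>"
proof -
  have "\<exists>r. strict_mono r \<and> bseq ((\<lambda>n. - \<xi> i n) \<circ> r)" if "i < 3" for i
    using bseq_subseq_exists [OF escaping_uminus [OF bseqD(2) [OF \<xi> [OF that]]]] by blast
  then obtain r where r: "\<And>i. i < 3 \<Longrightarrow> strict_mono (r i)" "\<And>i. i < 3 \<Longrightarrow> bseq ((\<lambda>n. - \<xi> i n) \<circ> r i)"
    by metis
  define a where "a i n = \<xi> i (r i n)" for i n
  have a: "bseq (a i)" "bseq (\<lambda>n. - a i n)" if "i < 3" for i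
    using bseq_subseq [OF \<xi> [OF that] r(1) [OF that]] r(2) [OF that] by (simp_all add: a_def [abs_def] comp_def)
  have a\<xi>: "gap (a i) (\<xi> i) = 0" if "i < 3" for i
    using cau_subseq(2) [OF bseqD(1) [OF \<xi> [OF that]] r(1) [OF that]] by (simp add: a_def [abs_def] comp_def)
  have ane: "gap (a i) (a j) \<noteq> 0" if "i < 3" "j < 3" "i \<noteq> j" for i j
  proof -
    have c: "cau (a i)" "cau (a j)" "cau (\<xi> i)" "cau (\<xi> j)" using a \<xi> that bseqD by auto
    have "gap (a i) (a j) = gap (\<xi> i) (a j)" by (rule gap_zero_eq [OF c(1,3,2) a\<xi> [OF that(1)]])
    also have "\<dots> = gap (\<xi> i) (\<xi> j)"
      using gap_zero_eq [OF c(2,4,3) a\<xi> [OF that(2)]] gap_commute by metis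
    finally show ?thesis using ne that by simp
  qed
  define moves where "moves i v \<longleftrightarrow> gap (\<lambda>k. v + - a i k) (\<lambda>k. - a i k) \<noteq> 0" for i v
  have "\<exists>v. moves i v" if "i < 3" for i
    using nofix [OF a(2) [OF that]] by (simp add: fixed_point_def moves_def)
  then obtain u where "\<And>i. i < 3 \<Longrightarrow> moves i (u i)" by metis
  then have u: "\<And>i. i < 3 \<Longrightarrow> gap (\<lambda>k. u i + - a i k) (\<lambda>k. - a i k) \<noteq> 0"
    unfolding moves_def .
  \<comment> \<open>A factor \<open>- u\<close> on the right leaves the limit unchanged
    (\<open>bseq_right\<close>) but multiplies the inverse by \<open>u\<close> on the left.\<close>
  define s where "s k n = (if snd k then a (fst k) n + - u (fst k) else a (fst k) n)" for k n
  have s: "bseq (s k)" "gap (a (fst k)) (s k) = 0" if k: "fst k < 3" for k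
  proof -
    have eq: "s k = (if snd k then (\<lambda>n. a (fst k) n + - u (fst k)) else a (fst k))"
      by (simp add: s_def fun_eq_iff)
    have right: "bseq (\<lambda>n. a (fst k) n + - u (fst k))" "gap (a (fst k)) (\<lambda>n. a (fst k) n + - u (fst k)) = 0"
      by (rule bseq_right [OF a(1) [OF k] order_refl])+
    show "bseq (s k)" unfolding eq using a(1) [OF k] right(1) by (cases "snd k") (simp_all only: if_True if_False)
    show "gap (a (fst k)) (s k) = 0" unfolding eq using right(2) by (cases "snd k") (simp_all only: if_True if_False gap_self)
  qed
  have cu: "cau (\<lambda>n. - s k n)" if "fst k < 3" for k
  proof -
    have "(\<lambda>n. - s k n) = (if snd k then (\<lambda>n. u (fst k) + - a (fst k) n) else (\<lambda>n. - a (fst k) n))"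
      by (simp add: s_def fun_eq_iff minus_add)
    moreover have "cau (\<lambda>n. - a (fst k) n)" by (rule bseqD(1) [OF a(2) [OF that]])
    moreover from this have "cau (\<lambda>n. u (fst k) + - a (fst k) n)" by (rule cau_translate)
    ultimately show ?thesis by (cases "snd k") (simp_all only: if_True if_False)
  qed
  have sne: "gap (s k) (s l) \<noteq> 0" if "fst k < 3" "fst l < 3" "fst k \<noteq> fst l" for k l
  proof -
    have c: "cau (a (fst k))" "cau (a (fst l))" "cau (s k)" "cau (s l)" using a s that bseqD by auto
    have "gap (a (fst k)) (a (fst l)) = gap (s k) (a (fst l))"
      by (rule gap_zero_eq [OF c(1,3,2) s(2) [OF that(1)]])
    also have "\<dots> = gap (s k) (s l)"
      using gap_zero_eq [OF c(2,4,3) s(2) [OF that(2)]] gap_commute by metis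
    finally show ?thesis using ane [OF that] by simp
  qed
  have une: "gap (\<lambda>n. - s (i, True) n) (\<lambda>n. - s (i, False) n) \<noteq> 0" if "i < 3" for i
    using u [OF that] by (simp add: s_def minus_add)
  define A where "A = {0..<3::nat} \<times> (UNIV :: bool set)"
  have fA: "finite A" "card A = 6" by (simp_all add: A_def card_cartesian_product)
  obtain e1 where e1: "0 < e1" "\<And>x. x \<in> {(k, l). k \<in> A \<and> l \<in> A \<and> fst k \<noteq> fst l} \<Longrightarrow> e1 < gap (s (fst x)) (s (snd x))"
  proof (rule finite_pos_lower_bound)
    show "finite {(k, l). k \<in> A \<and> l \<in> A \<and> fst k \<noteq> fst l}"
      by (rule finite_subset [of _ "A \<times> A"]) (use fA in auto)
    fix x assume "x \<in> {(k, l). k \<in> A \<and> l \<in> A \<and> fst k \<noteq> fst l}"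
    then have k: "fst (fst x) < 3" "fst (snd x) < 3" "fst (fst x) \<noteq> fst (snd x)" by (auto simp: A_def)
    then show "0 < gap (s (fst x)) (s (snd x))"
      using gap_nonzero_pos [OF bseqD(1) [OF s(1) [OF k(1)]] bseqD(1) [OF s(1) [OF k(2)]] sne [OF k]] by simp
  qed blast
  obtain e2 where e2: "0 < e2" "\<And>i. i \<in> {0..<3} \<Longrightarrow> e2 < gap (\<lambda>n. - s (i, True) n) (\<lambda>n. - s (i, False) n)"
  proof (rule finite_pos_lower_bound)
    show "finite {0..<3::nat}" by simp
    fix i :: nat assume "i \<in> {0..<3}"
    then show "0 < gap (\<lambda>n. - s (i, True) n) (\<lambda>n. - s (i, False) n)"
      using gap_nonzero_pos [OF cu [of "(i, True)"] cu [of "(i, False)"] une [of i]] by simp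
  qed blast
  define e where "e = min e1 e2 / 3"
  have e: "0 < e" "2 * e < e1" "2 * e < e2" using e1(1) e2(1) by (auto simp: e_def)
  have ev1: "\<forall>\<^sub>F n in sequentially. \<forall>k\<in>A. \<forall>l\<in>A. fst k \<noteq> fst l \<longrightarrow> 2 * e < \<delta> 0 (s k n) (s l n)"
  proof (intro eventually_ball_finite fA ballI)
    fix k l assume kl: "k \<in> A" "l \<in> A"
    show "\<forall>\<^sub>F n in sequentially. fst k \<noteq> fst l \<longrightarrow> 2 * e < \<delta> 0 (s k n) (s l n)"
    proof (cases "fst k = fst l")
      case False
      have "2 * e < gap (s k) (s l)" using e1(2) [of "(k, l)"] kl False e by simp
      moreover have "cau (s k)" "cau (s l)" using s kl bseqD by (auto simp: A_def)
      ultimately have "\<forall>\<^sub>F n in sequentially. 2 * e < \<delta> 0 (s k n) (s l n)"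
        using order_tendstoD(1) [OF cau_limit] by blast
      then show ?thesis by (rule eventually_mono) simp
    qed simp
  qed
  have ev2: "\<forall>\<^sub>F n in sequentially. \<forall>i\<in>{0..<3}. 2 * e < \<delta> 0 (- s (i, True) n) (- s (i, False) n)"
  proof (intro eventually_ball_finite ballI)
    fix i :: nat assume i: "i \<in> {0..<3}"
    have "2 * e < gap (\<lambda>n. - s (i, True) n) (\<lambda>n. - s (i, False) n)" using e2(2) [OF i] e by simp
    moreover have "cau (\<lambda>n. - s (i, True) n)" "cau (\<lambda>n. - s (i, False) n)" using cu i by auto
    ultimately show "\<forall>\<^sub>F n in sequentially. 2 * e < \<delta> 0 (- s (i, True) n) (- s (i, False) n)"
      using order_tendstoD(1) [OF cau_limit] by blast
  qed simp
  have ev3: "\<forall>\<^sub>F n in sequentially. \<forall>k\<in>A. \<forall>x. e \<le> \<delta> 0 x (- s k n) \<longrightarrow> \<delta> 0 (s k n + x) (s k n) \<le> e"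
  proof (intro eventually_ball_finite fA ballI)
    fix k assume "k \<in> A"
    then have "escaping (s k)" using s bseqD by (auto simp: A_def)
    then show "\<forall>\<^sub>F n in sequentially. \<forall>x. e \<le> \<delta> 0 x (- s k n) \<longrightarrow> \<delta> 0 (s k n + x) (s k n) \<le> e"
      using e(1) by (intro attraction_seq) auto
  qed
  obtain n where n: "\<forall>k\<in>A. \<forall>l\<in>A. fst k \<noteq> fst l \<longrightarrow> 2 * e < \<delta> 0 (s k n) (s l n)"
    "\<forall>i\<in>{0..<3}. 2 * e < \<delta> 0 (- s (i, True) n) (- s (i, False) n)"
    "\<forall>k\<in>A. \<forall>x. e \<le> \<delta> 0 x (- s k n) \<longrightarrow> \<delta> 0 (s k n + x) (s k n) \<le> e"
    using eventually_happens' [OF sequentially_bot eventually_conj [OF ev1 eventually_conj [OF ev2 ev3]]]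
    by blast
  have n1: "2 * e < \<delta> 0 (s k n) (s l n)" if "k \<in> A" "l \<in> A" "fst k \<noteq> fst l" for k l
    using n(1) that by blast
  have n2: "2 * e < \<delta> 0 (- s (i, True) n) (- s (i, False) n)" if "i < 3" for i
    using n(2) that by simp
  have n3: "\<delta> 0 (s k n + x) (s k n) \<le> e" if "k \<in> A" "e \<le> \<delta> 0 x (- s k n)" for k x
    using n(3) that by blast
  \<comment> \<open>The regions are read off from \<open>- x\<close>: \<open>corr\<close> translates
    on the right, and \<open>- (x + - s k n) = s k n + - x\<close> is a left translation, to which
    \<open>attraction_seq\<close> applies.\<close>
  define U where "U k = {x. \<delta> 0 (- x) (s k n) \<le> e}" for k
  define V where "V k = {x. \<delta> 0 (- x) (- s k n) < e}" for k
  show ?thesis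
  proof (rule exp_decay_paradoxical [OF semigroup_gen fA(1), where h = "\<lambda>k. - s k n" and U = U and V = V])
    fix k x assume k: "k \<in> A"
    show "x \<in> V k \<or> x + - s k n \<in> U k"
    proof (cases "x \<in> V k")
      case False
      then have "\<delta> 0 (s k n + - x) (s k n) \<le> e" by (intro n3 [OF k]) (simp add: V_def)
      then show ?thesis by (simp add: U_def)
    qed simp
  next
    fix x
    have "card {k \<in> A. x \<in> U k} \<le> 2"
    proof (cases "{k \<in> A. x \<in> U k} = {}")
      case False
      then obtain k where k: "k \<in> A" "x \<in> U k" by blast
      have "{k \<in> A. x \<in> U k} \<subseteq> {fst k} \<times> UNIV"
      proof
        fix l assume "l \<in> {k \<in> A. x \<in> U k}"
        then have l: "l \<in> A" "x \<in> U l" by auto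
        have "\<delta> 0 (s k n) (s l n) \<le> 2 * e"
          using k(2) l(2) \<delta>_triangle [of 0 "s k n" "s l n" "- x"] \<delta>_commute [of 0 "s k n" "- x"]
          by (simp add: U_def)
        then have "fst k = fst l" using n1 [OF k(1) l(1)] by force
        then show "l \<in> {fst k} \<times> UNIV" by (simp add: mem_Times_iff)
      qed
      then have "card {k \<in> A. x \<in> U k} \<le> card ({fst k} \<times> (UNIV :: bool set))" by (intro card_mono) auto
      then show ?thesis by (simp add: card_cartesian_product)
    next
      case True
      show ?thesis unfolding True by simp
    qed
    moreover have "card {k \<in> A. x \<in> V k} \<le> card {0..<3::nat}"
    proof (rule card_inj_on_le)
      show "fst ` {k \<in> A. x \<in> V k} \<subseteq> {0..<3}" by (auto simp: A_def)
      show "inj_on fst {k \<in> A. x \<in> V k}"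
      proof (rule inj_onI)
        fix k l assume kl: "k \<in> {k \<in> A. x \<in> V k}" "l \<in> {k \<in> A. x \<in> V k}" "fst k = fst l"
        have close: "\<delta> 0 (- s k n) (- s l n) < 2 * e" if "x \<in> V k" "x \<in> V l" for k l
          using that \<delta>_triangle [of 0 "- s k n" "- s l n" "- x"] \<delta>_commute [of 0 "- s k n" "- x"]
          by (simp add: V_def)
        show "k = l"
        proof (rule ccontr)
          assume "k \<noteq> l"
          then have "(k = (fst k, True) \<and> l = (fst k, False)) \<or> (k = (fst k, False) \<and> l = (fst k, True))"
            using kl(3) by (cases k; cases l) auto
          moreover have "x \<in> V k" "x \<in> V l" "fst k < 3" using kl by (auto simp: A_def)
          ultimately show False
            using close [of "(fst k, True)" "(fst k, False)"] n2 [of "fst k"] by auto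
        qed
      qed
    qed simp
    ultimately show "card {k \<in> A. x \<in> U k} + card {k \<in> A. x \<in> V k} < card A"
      using fA by simp
  qed
qed

text \<open>A global fixed point coincides with at most one of the three points, and the other two
  then contradict \<open>no_fixed_point\<close>.\<close>

theorem exp_decay_three_points:
  assumes \<xi>: "bseq \<xi>1" "bseq \<xi>2" "bseq \<xi>3"
    and ne: "gap \<xi>1 \<xi>2 \<noteq> 0" "gap \<xi>1 \<xi>3 \<noteq> 0" "gap \<xi>2 \<xi>3 \<noteq> 0"
  shows "exp_decay \<mu>"
proof (cases "\<exists>\<eta>. bseq \<eta> \<and> fixed_point \<eta>")
  case True
  then obtain \<eta> where \<eta>: "bseq \<eta>" "fixed_point \<eta>" by blast
  have fixed: "gap (\<lambda>k. u + \<eta> k) \<eta> = 0" for u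
    using \<eta>(2) by (simp add: fixed_point_def)
  have c: "cau \<xi>1" "cau \<xi>2" "cau \<xi>3" "cau \<eta>" using \<xi> \<eta> bseqD by auto
  have one: "gap s t = 0" if "cau s" "cau t" "gap s \<eta> = 0" "gap t \<eta> = 0" for s t
    using gap_zero_eq [OF that(1) c(4) that(2,3)] that(4) gap_commute [of \<eta> t] by simp
  have "(gap \<xi>1 \<eta> \<noteq> 0 \<and> gap \<xi>2 \<eta> \<noteq> 0) \<or> (gap \<xi>1 \<eta> \<noteq> 0 \<and> gap \<xi>3 \<eta> \<noteq> 0) \<or> (gap \<xi>2 \<eta> \<noteq> 0 \<and> gap \<xi>3 \<eta> \<noteq> 0)"
    using one [OF c(1,2)] one [OF c(1,3)] one [OF c(2,3)] ne by blast
  moreover note no_fixed_point [OF \<eta>(1) fixed \<xi>(1,2) _ _ ne(1)]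
    no_fixed_point [OF \<eta>(1) fixed \<xi>(1,3) _ _ ne(2)] no_fixed_point [OF \<eta>(1) fixed \<xi>(2,3) _ _ ne(3)]
  ultimately show ?thesis by blast
next
  case False
  define \<xi> where "\<xi> = (\<lambda>i::nat. if i = 0 then \<xi>1 else if i = 1 then \<xi>2 else \<xi>3)"
  show ?thesis
  proof (rule exp_decay_no_fixed_point [of \<xi>])
    show "bseq (\<xi> i)" for i using assms(1-3) by (simp add: \<xi>_def)
    show "gap (\<xi> i) (\<xi> j) \<noteq> 0" if "i < 3" "j < 3" "i \<noteq> j" for i j
    proof -
      have "i = 0 \<or> i = 1 \<or> i = 2" "j = 0 \<or> j = 1 \<or> j = 2" using that by auto
      then show ?thesis
        using ne that(3) gap_commute [of \<xi>2 \<xi>1] gap_commute [of \<xi>3 \<xi>1] gap_commute [of \<xi>3 \<xi>2]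
        by (elim disjE) (auto simp: \<xi>_def)
    qed
    show "\<not> fixed_point \<eta>" if "bseq \<eta>" for \<eta> using False that by blast
  qed
qed

end

section \<open>Exactly two boundary points\<close>

lemma exp_le_quadratic: "exp y \<le> 1 + y + y\<^sup>2 * exp \<bar>y\<bar>" for y :: real
proof -
  obtain t where t: "\<bar>t\<bar> \<le> \<bar>y\<bar>" "exp y = (\<Sum>m<2. y ^ m / fact m) + exp t / fact 2 * y ^ 2"
    using Maclaurin_exp_le [of y 2] by blast
  have "exp t / 2 \<le> exp \<bar>y\<bar>"
  proof -
    have "exp t \<le> exp \<bar>y\<bar>" using t(1) by simp
    moreover have "0 < exp t" by simp
    ultimately show ?thesis by linarith
  qed
  then have "exp t / 2 * y\<^sup>2 \<le> exp \<bar>y\<bar> * y\<^sup>2" by (rule mult_right_mono) simp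
  then show ?thesis using t(2) by (simp add: numeral_2_eq_2 mult.commute)
qed

locale two_points = floyd_walk S \<mu> f
  for S :: "'a::group_add set" and \<mu> :: "'a pmf" and f :: "real \<Rightarrow> real" +
  fixes \<xi> \<eta> :: "nat \<Rightarrow> 'a"
  assumes \<xi>: "bseq \<xi>" and \<eta>: "bseq \<eta>" and ne: "gap \<xi> \<eta> \<noteq> 0"
    and only: "\<And>s. bseq s \<Longrightarrow> gap s \<xi> = 0 \<or> gap s \<eta> = 0"
begin

lemma cau_ends: "cau \<xi>" "cau \<eta>"
  using \<xi> \<eta> bseqD by auto

definition \<theta> where "\<theta> = gap \<xi> \<eta>"

lemma \<theta>_pos: "0 < \<theta>"
  unfolding \<theta>_def by (rule gap_nonzero_pos [OF cau_ends ne])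

definition side :: "(nat \<Rightarrow> 'a) \<Rightarrow> bool" where
  "side s \<longleftrightarrow> gap s \<xi> = 0"

lemma not_side: "bseq s \<Longrightarrow> \<not> side s \<longleftrightarrow> gap s \<eta> = 0"
proof -
  assume s: "bseq s"
  have "\<not> (gap s \<xi> = 0 \<and> gap s \<eta> = 0)"
    using gap_zero_eq [OF bseqD(1) [OF s] cau_ends] ne by auto
  then show ?thesis using only [OF s] by (auto simp: side_def)
qed

lemma side_same:
  assumes "bseq s" "bseq t"
  shows "side s = side t \<longleftrightarrow> gap s t = 0"
proof -
  have c: "cau s" "cau t" using assms bseqD by auto
  have 1: "gap s t = 0" if "gap s u = 0" "gap t u = 0" "cau u" for u
    using gap_zero_eq [OF c(1) that(3) c(2) that(1)] that(2) gap_commute [of u t] by simp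
  show ?thesis
  proof
    assume "side s = side t"
    then show "gap s t = 0"
      using 1 [of \<xi>] 1 [of \<eta>] cau_ends not_side assms by (cases "side s") (auto simp: side_def)
  next
    assume "gap s t = 0"
    then have "gap s \<xi> = gap t \<xi>" by (rule gap_zero_eq [OF c cau_ends(1)])
    then show "side s = side t" by (simp add: side_def)
  qed
qed

text \<open>Membership in the subgroup, of index at most two, that fixes both ends; it fails for the
  elements that exchange them.\<close>

definition \<sigma> :: "'a \<Rightarrow> bool" where
  "\<sigma> g \<longleftrightarrow> side (\<lambda>n. g + \<xi> n)"

lemma side_\<xi>: "side \<xi>" and side_\<eta>: "\<not> side \<eta>"
  using not_side [OF \<eta>] by (auto simp: side_def)

lemma side_translate:
  assumes "bseq s"
  shows "side (\<lambda>n. g + s n) \<longleftrightarrow> (\<sigma> g \<longleftrightarrow> side s)"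
proof -
  have "side (\<lambda>n. g + s n) = side (\<lambda>n. g + \<xi> n) \<longleftrightarrow> side s = side \<xi>"
    unfolding side_same [OF bseq_translate [OF assms] bseq_translate [OF \<xi>]] side_same [OF assms \<xi>]
    by (rule gap_translate_zero [OF bseqD(1) [OF assms] cau_ends(1)])
  then show ?thesis using side_\<xi> by (auto simp: \<sigma>_def)
qed

lemma \<sigma>_add: "\<sigma> (g + h) \<longleftrightarrow> (\<sigma> g \<longleftrightarrow> \<sigma> h)"
  using side_translate [OF bseq_translate [OF \<xi>, of h], of g] by (simp add: \<sigma>_def add.assoc)

lemma \<sigma>_zero [simp]: "\<sigma> 0"
  using side_\<xi> by (simp add: \<sigma>_def)

lemma \<sigma>_uminus [simp]: "\<sigma> (- g) = \<sigma> g"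
  using \<sigma>_add [of g "- g"] by simp

lemma \<sigma>_fixes:
  assumes "\<sigma> g" "bseq s"
  shows "gap (\<lambda>k. g + s k) s = 0"
  using side_same [OF bseq_translate [OF assms(2), of g] assms(2)] side_translate [OF assms(2), of g] assms(1) by simp

text \<open>A half-space for the end \<xi>: every boundary sequence is eventually inside or
  eventually outside, according to its end.\<close>

definition A :: "'a set" where
  "A = {x. gap (point x) \<xi> < \<theta> / 2}"

lemma eventually_A:
  assumes "bseq s"
  shows "\<forall>\<^sub>F n in sequentially. s n \<in> A \<longleftrightarrow> side s"
proof (cases "side s")
  case True
  have "\<forall>\<^sub>F n in sequentially. gap (point (s n)) \<xi> < \<theta> / 2"
    using True \<theta>_pos by (intro order_tendstoD(2) [OF gap_point_tendsto [OF bseqD(1) [OF assms] cau_ends(1)]])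
      (simp add: side_def)
  then show ?thesis by (rule eventually_mono) (simp add: A_def True)
next
  case False
  have "gap s \<xi> = gap \<eta> \<xi>"
    using False not_side [OF assms] by (intro gap_zero_eq [OF bseqD(1) [OF assms] cau_ends(2,1)]) simp
  then have "\<theta> / 2 < gap s \<xi>" using \<theta>_pos by (simp add: \<theta>_def gap_commute [of \<eta>])
  then have "\<forall>\<^sub>F n in sequentially. \<theta> / 2 < gap (point (s n)) \<xi>"
    by (rule order_tendstoD(1) [OF gap_point_tendsto [OF bseqD(1) [OF assms] cau_ends(1)]])
  then show ?thesis by (rule eventually_mono) (simp add: A_def False)
qed

definition B :: "'a \<Rightarrow> 'a set" where
  "B g = {x. - g + x \<in> A \<longleftrightarrow> \<sigma> g}"

definition D :: "'a \<Rightarrow> 'a set" where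
  "D g = {x. x \<in> A \<longleftrightarrow> x \<notin> B g}"

text \<open>An infinite set contains a boundary sequence, and along it membership in
  \<open>A\<close> and in \<open>B g\<close> are eventually decided by the same end.\<close>

lemma finite_D: "finite (D g)"
proof (rule ccontr)
  assume "infinite (D g)"
  then obtain s where s: "bseq s" "\<And>n. s n \<in> D g" by (rule infinite_bseq_exists) blast
  have "\<forall>\<^sub>F n in sequentially. (s n \<in> A \<longleftrightarrow> side s) \<and> (- g + s n \<in> A \<longleftrightarrow> side (\<lambda>n. - g + s n))"
    by (rule eventually_conj [OF eventually_A [OF s(1)] eventually_A [OF bseq_translate [OF s(1)]]])
  then obtain n where n: "s n \<in> A \<longleftrightarrow> side s" "- g + s n \<in> A \<longleftrightarrow> side (\<lambda>n. - g + s n)"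
    using eventually_happens' [OF sequentially_bot] by blast
  have "side (\<lambda>n. - g + s n) \<longleftrightarrow> (\<sigma> g \<longleftrightarrow> side s)" using side_translate [OF s(1), of "- g"] by simp
  then show False using n s(2) [of n] by (auto simp: D_def B_def)
qed

text \<open>\<open>T g\<close> is the regularised difference of the cardinalities of \<open>A\<close> and of its translate
  \<open>B g\<close> (complemented when \<open>g\<close> exchanges the two ends).\<close>

definition T :: "'a \<Rightarrow> int" where
  "T g = (\<Sum>x\<in>D g. of_bool (x \<in> A) - of_bool (x \<in> B g))"

definition sg :: "'a \<Rightarrow> int" where
  "sg g = (if \<sigma> g then 1 else - 1)"

lemma T_sum:
  assumes "finite F" "D g \<subseteq> F"
  shows "T g = (\<Sum>x\<in>F. of_bool (x \<in> A) - of_bool (x \<in> B g))"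
  unfolding T_def using assms by (intro sum.mono_neutral_left) (auto simp: D_def)

text \<open>Compare \<open>A\<close> with its translate by \<open>g\<close>, and that with the
  translate by \<open>g + h\<close>. The second comparison is the \<open>g\<close>-translate of the
  one for \<open>h\<close>; complementation when \<open>g\<close> exchanges the ends produces the
  sign. All sums are extended to one finite set \<open>F\<close>.\<close>

lemma T_add: "T (g + h) = T g + sg g * T h"
proof -
  define F where "F = D g \<union> (+) g ` D h \<union> D (g + h)"
  have F: "finite F" "D g \<subseteq> F" "(+) g ` D h \<subseteq> F" "D (g + h) \<subseteq> F"
    using finite_D by (auto simp: F_def)
  have B: "x \<in> B (g + h) \<longleftrightarrow> (- g + x \<in> B h \<longleftrightarrow> \<sigma> g)" for x
    by (auto simp: B_def \<sigma>_add minus_add add.assoc simp del: add_uminus_conv_diff)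
  have "T (g + h) = (\<Sum>x\<in>F. of_bool (x \<in> A) - of_bool (x \<in> B (g + h)))"
    by (rule T_sum [OF F(1,4)])
  also have "\<dots> = (\<Sum>x\<in>F. (of_bool (x \<in> A) - of_bool (x \<in> B g)) +
      sg g * (of_bool (- g + x \<in> A) - of_bool (- g + x \<in> B h)))"
    by (intro sum.cong) (auto simp: B sg_def B_def [of g])
  also have "\<dots> = T g + sg g * (\<Sum>x\<in>F. of_bool (- g + x \<in> A) - of_bool (- g + x \<in> B h))"
    by (simp add: sum.distrib sum_distrib_left T_sum [OF F(1,2)])
  also have "(\<Sum>x\<in>F. of_bool (- g + x \<in> A) - of_bool (- g + x \<in> B h)) =
      (\<Sum>x\<in>(+) g ` D h. of_bool (- g + x \<in> A) - of_bool (- g + x \<in> B h) :: int)"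
  proof (rule sum.mono_neutral_right [OF F(1,3)], rule ballI)
    fix x assume x: "x \<in> F - (+) g ` D h"
    have "- g + x \<notin> D h"
    proof
      assume "- g + x \<in> D h"
      then have "g + (- g + x) \<in> (+) g ` D h" by (rule imageI)
      with x show False by (simp add: add.assoc [symmetric])
    qed
    then show "of_bool (- g + x \<in> A) - of_bool (- g + x \<in> B h) = (0 :: int)" by (simp add: D_def)
  qed
  also have "\<dots> = T h"
    unfolding T_def by (subst sum.reindex) (auto simp: add.assoc [symmetric])
  finally show ?thesis .
qed

lemma T_zero [simp]: "T 0 = 0"
  using T_add [of 0 0] by (simp add: sg_def)

lemma sg_add: "sg (g + h) = sg g * sg h"
  by (simp add: sg_def \<sigma>_add)

lemma T_lipschitz:
  obtains C :: nat where "\<And>g. \<bar>T g\<bar> \<le> int (C * word_norm S g)"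
proof -
  have fin: "finite S" using gen by (simp add: sym_gen_set_def)
  define C where "C = Max (insert 0 ((\<lambda>s. nat \<bar>T s\<bar>) ` S))"
  have C: "\<bar>T s\<bar> \<le> int C" if "s \<in> S" for s
  proof -
    have "nat \<bar>T s\<bar> \<le> C" unfolding C_def using fin that by (intro Max_ge) auto
    then show ?thesis by simp
  qed
  have *: "\<bar>T (sum_list ws)\<bar> \<le> int (C * length ws)" if "set ws \<subseteq> S" for ws
    using that
  proof (induction ws)
    case (Cons s ws)
    have "\<bar>T (s + sum_list ws)\<bar> \<le> \<bar>T s\<bar> + \<bar>T (sum_list ws)\<bar>"
      unfolding T_add by (auto simp: sg_def)
    also have "\<dots> \<le> int C + int (C * length ws)"
      using Cons C [of s] by (intro add_mono) auto
    finally show ?case by (simp add: algebra_simps)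
  qed simp
  show ?thesis
  proof (rule that [of C])
    fix g
    obtain ws where "length ws = word_norm S g" "set ws \<subseteq> S" "sum_list ws = g"
      by (rule word_norm_witness [OF gen])
    then show "\<bar>T g\<bar> \<le> int (C * word_norm S g)" using * [of ws] by simp
  qed
qed

text \<open>If \<open>s n\<close> tends to one end and its inverse to the other, then \<open>s n\<close> maps \<open>A\<close> strictly into
  itself.\<close>

lemma T_pos_attracting:
  assumes s: "bseq s" "bseq (\<lambda>n. - s n)" and \<sigma>: "\<And>n. \<sigma> (s n)" and side: "side s"
  shows "\<exists>n. T (s n) \<noteq> 0"
proof -
  have c: "cau s" "cau (\<lambda>n. - s n)" using s bseqD by auto
  have "gap s \<eta> \<noteq> 0" using side not_side [OF s(1)] by simp
  then have inv: "gap (\<lambda>n. - s n) \<eta> = 0"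
    by (intro uminus_converges_fixed s \<eta> \<sigma>_fixes \<sigma>)
  obtain a where a: "a \<in> A"
    using eventually_happens' [OF sequentially_bot eventually_A [OF \<xi>]] side_\<xi> by blast
  have a_pos: "0 < gap (point a) \<xi>"
  proof -
    have "\<forall>\<^sub>F n in sequentially. word_norm S a + 1 \<le> word_norm S (\<xi> n)"
      by (rule escapingD [OF bseqD(2) [OF \<xi>]])
    then have "\<forall>\<^sub>F n in sequentially. f (real (d 0 a)) \<le> \<delta> 0 a (\<xi> n)"
    proof (rule eventually_mono)
      fix n assume "word_norm S a + 1 \<le> word_norm S (\<xi> n)"
      then show "f (real (d 0 a)) \<le> \<delta> 0 a (\<xi> n)" by (intro \<delta>_ge_isolated) auto
    qed
    then have "f (real (d 0 a)) \<le> gap (point a) \<xi>"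
      by (rule tendsto_lowerbound [OF cau_limit [OF cau_point cau_ends(1)]]) simp
    then show ?thesis using f_pos [of "d 0 a"] by linarith
  qed
  \<comment> \<open>Smaller than the distance of the chosen \<open>a\<close> from \<xi>, so that the
    image of \<open>A\<close> misses \<open>a\<close> and the inclusion is strict.\<close>
  define e where "e = min (\<theta> / 2) (gap (point a) \<xi>) / 3"
  have e: "0 < e" "2 * e < \<theta> / 2" "2 * e < gap (point a) \<xi>" using a_pos \<theta>_pos by (auto simp: e_def)
  have \<theta>4: "0 < \<theta> / 4" using \<theta>_pos by simp
  have ev1: "\<forall>\<^sub>F n in sequentially. gap (point (- s n)) \<eta> < \<theta> / 4"
    using inv \<theta>4 by (intro order_tendstoD(2) [OF gap_point_tendsto [OF c(2) cau_ends(2)]]) simp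
  have ev2: "\<forall>\<^sub>F n in sequentially. gap (point (s n)) \<xi> < e"
    using side e(1) by (intro order_tendstoD(2) [OF gap_point_tendsto [OF c(1) cau_ends(1)]]) (simp add: side_def)
  have ev3: "\<forall>\<^sub>F n in sequentially. \<forall>x. \<theta> / 4 \<le> \<delta> 0 x (- s n) \<longrightarrow> \<delta> 0 (s n + x) (s n) \<le> e"
    by (rule attraction_seq [OF bseqD(2) [OF s(1)] \<theta>4 e(1)])
  obtain n where n: "gap (point (- s n)) \<eta> < \<theta> / 4" "gap (point (s n)) \<xi> < e"
    "\<forall>x. \<theta> / 4 \<le> \<delta> 0 x (- s n) \<longrightarrow> \<delta> 0 (s n + x) (s n) \<le> e"
    using eventually_happens' [OF sequentially_bot eventually_conj [OF ev1 eventually_conj [OF ev2 ev3]]] by blast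
  have close: "gap (point (s n + x)) \<xi> < 2 * e" if "x \<in> A" for x
  proof -
    have "\<theta> \<le> gap (point x) \<xi> + gap (point x) \<eta>"
      using gap_triangle [OF cau_ends(1) cau_point cau_ends(2), of x] gap_commute [of \<xi> "point x"] by (simp add: \<theta>_def)
    moreover have "gap (point x) \<eta> \<le> \<delta> 0 x (- s n) + gap (point (- s n)) \<eta>"
      using gap_triangle [OF cau_point cau_point cau_ends(2), of x "- s n"] by simp
    ultimately have "\<theta> / 4 \<le> \<delta> 0 x (- s n)" using that n(1) by (simp add: A_def)
    then have "\<delta> 0 (s n + x) (s n) \<le> e" using n(3) by blast
    then show ?thesis
      using gap_triangle [OF cau_point cau_point cau_ends(1), of "s n + x" "s n"] n(2) by simp
  qed
  have sub: "x \<in> A \<and> x \<noteq> a" if "x \<in> B (s n)" for x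
  proof -
    have "- s n + x \<in> A" using that \<sigma> by (simp add: B_def)
    from close [OF this] have "gap (point x) \<xi> < 2 * e" by (simp add: add.assoc [symmetric])
    then show ?thesis using e by (auto simp: A_def)
  qed
  have "T (s n) = (\<Sum>x\<in>D (s n). 1)"
    unfolding T_def by (rule sum.cong) (use sub in \<open>auto simp: D_def\<close>)
  also have "\<dots> = int (card (D (s n)))" by simp
  finally have "T (s n) = int (card (D (s n)))" .
  moreover have "a \<in> D (s n)" using a sub by (auto simp: D_def)
  ultimately have "T (s n) \<noteq> 0" using finite_D [of "s n"] by auto
  then show ?thesis by blast
qed

text \<open>An infinite kernel contains a boundary sequence whose inverses converge too. Either it
  or, by \<open>uminus_converges_fixed\<close>, its inverse tends to \<xi>, and there
  \<open>T_pos_attracting\<close> gives a nonzero value.\<close>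

lemma finite_kernel: "finite {g. \<sigma> g \<and> T g = 0}"
proof (rule ccontr)
  assume "infinite {g. \<sigma> g \<and> T g = 0}"
  then obtain s0 where s0: "bseq s0" "\<And>n. s0 n \<in> {g. \<sigma> g \<and> T g = 0}" by (rule infinite_bseq_exists) blast
  obtain r where r: "strict_mono r" "bseq ((\<lambda>n. - s0 n) \<circ> r)"
    by (rule bseq_subseq_exists [OF escaping_uminus [OF bseqD(2) [OF s0(1)]]])
  define s where "s = s0 \<circ> r"
  have s: "bseq s" "bseq (\<lambda>n. - s n)"
    using bseq_subseq [OF s0(1) r(1)] r(2) by (simp_all add: s_def comp_def)
  have s\<sigma>: "\<sigma> (s n)" "T (s n) = 0" for n using s0(2) [of "r n"] by (simp_all add: s_def)
  have inv: "\<sigma> (- s n)" "T (- s n) = 0" for n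
    using s\<sigma> [of n] T_add [of "s n" "- s n"] by (simp_all add: sg_def)
  show False
  proof (cases "side s")
    case True
    then show False using T_pos_attracting [OF s s\<sigma>(1)] s\<sigma>(2) by simp
  next
    case False
    then have "gap s \<xi> \<noteq> 0" by (simp add: side_def)
    then have "gap (\<lambda>n. - s n) \<xi> = 0"
      by (intro uminus_converges_fixed s \<xi> \<sigma>_fixes s\<sigma>)
    then have "side (\<lambda>n. - s n)" by (simp add: side_def)
    moreover have "bseq (\<lambda>n. - (- s n))" using s(1) by simp
    ultimately show False using T_pos_attracting [OF s(2) _ inv(1)] inv(2) by simp
  qed
qed

text \<open>Each nonempty fibre of (\<open>\<sigma>\<close>, \<open>T\<close>) lies in a coset of
  the finite kernel; there are two signs and \<open>2 * r + 1\<close> values. The linear growth in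
  \<open>r\<close> is what makes a centred walk recurrent.\<close>

lemma card_T_le:
  obtains K :: nat where "\<And>r. finite {g. \<bar>T g\<bar> \<le> int r}" "\<And>r. card {g. \<bar>T g\<bar> \<le> int r} \<le> K * (2 * r + 1)"
proof -
  define Z where "Z = {g. \<sigma> g \<and> T g = 0}"
  have fZ: "finite Z" unfolding Z_def by (rule finite_kernel)
  define fib where "fib p = {g. \<sigma> g = fst p \<and> T g = snd p}" for p :: "bool \<times> int"
  have fib: "finite (fib p) \<and> card (fib p) \<le> card Z" for p
  proof (cases "fib p = {}")
    case False
    then obtain g0 where g0: "g0 \<in> fib p" by blast
    have "fib p \<subseteq> (+) g0 ` Z"
    proof
      fix g assume g: "g \<in> fib p"
      have "g0 + (- g0 + g) = g" by (simp add: add.assoc [symmetric])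
      then have "\<sigma> g0 = \<sigma> g \<longrightarrow> \<sigma> (- g0 + g)" "T g = T g0 + sg g0 * T (- g0 + g)"
        using T_add [of g0 "- g0 + g"] by (simp_all add: \<sigma>_add)
      then have "- g0 + g \<in> Z" using g g0 by (auto simp: Z_def fib_def sg_def split: if_splits)
      then have "g0 + (- g0 + g) \<in> (+) g0 ` Z" by (rule imageI)
      then show "g \<in> (+) g0 ` Z" by (simp add: add.assoc [symmetric])
    qed
    then show ?thesis
      using fZ by (meson card_image_le card_mono finite_imageI finite_subset le_trans)
  qed simp
  have eq: "{g. \<bar>T g\<bar> \<le> int r} = (\<Union>p\<in>UNIV \<times> {- int r..int r}. fib p)" for r
    by (auto simp: fib_def)
  have fin: "finite ((UNIV :: bool set) \<times> {- int r..int r})" for r by simp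
  show ?thesis
  proof (rule that [of "2 * card Z"])
    fix r
    show "finite {g. \<bar>T g\<bar> \<le> int r}" unfolding eq using fin fib by blast
    have "card {g. \<bar>T g\<bar> \<le> int r} \<le> (\<Sum>p\<in>UNIV \<times> {- int r..int r}. card (fib p))"
      unfolding eq by (rule card_UN_le [OF fin])
    also have "\<dots> \<le> (\<Sum>p\<in>(UNIV :: bool set) \<times> {- int r..int r}. card Z)"
      by (rule sum_mono) (use fib in blast)
    also have "\<dots> = 2 * card Z * (2 * r + 1)"
    proof -
      have "card {- int r..int r} = 2 * r + 1"
        by (subst card_atLeastAtMost_int) (simp add: nat_eq_iff)
      then show ?thesis by (simp add: card_cartesian_product)
    qed
    finally show "card {g. \<bar>T g\<bar> \<le> int r} \<le> 2 * card Z * (2 * r + 1)" .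
  qed
qed

section \<open>Transience forces a drift of the cocycle\<close>

lemma integrable_exp_bound:
  fixes F :: "'a \<Rightarrow> real" and t K :: real
  assumes "0 \<le> t" "\<And>g. \<bar>F g\<bar> \<le> K * exp (t * word_norm S g)"
  shows "integrable (measure_pmf \<mu>) F"
proof (rule integrableI_bounded)
  have K: "0 \<le> K" using assms(2) [of 0] by simp
  have "(\<integral>\<^sup>+ g. ennreal (norm (F g)) \<partial>measure_pmf \<mu>) \<le>
      (\<integral>\<^sup>+ g. ennreal K * ennreal (exp (t * word_norm S g)) \<partial>measure_pmf \<mu>)"
    using assms(2) K by (intro nn_integral_mono) (simp add: ennreal_mult [symmetric])
  also have "\<dots> = ennreal K * (\<integral>\<^sup>+ g. ennreal (exp (t * word_norm S g)) \<partial>measure_pmf \<mu>)"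
    by (rule nn_integral_cmult) simp
  also have "\<dots> < \<infinity>"
    using exp_moment [OF assms(1)] by (simp add: ennreal_mult_less_top)
  finally show "(\<integral>\<^sup>+ g. ennreal (norm (F g)) \<partial>measure_pmf \<mu>) < \<infinity>" .
qed simp

text \<open>A centred affine cocycle has \<open>E (F (S\<^sub>n)\<^sup>2) = n v\<close>, so by Chebyshev the walk spends about
  \<open>n\<close> steps of time in \<open>{|F| \<le> r}\<close> with \<open>r\<close> of order \<open>sqrt n\<close>, a set with \<open>O(r)\<close> elements.\<close>

lemma centred_cocycle_recurrent:
  fixes F :: "'a \<Rightarrow> real"
  assumes F: "\<And>x s. F (x + s) = F x + of_int (sg x) * F s" and close: "\<And>x. \<bar>F x - of_int (T x)\<bar> \<le> c"
    and centred: "(\<integral>s. F s \<partial>measure_pmf \<mu>) = 0"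
  shows False
proof -
  obtain C :: nat where C: "\<And>g. \<bar>T g\<bar> \<le> int (C * word_norm S g)" by (rule T_lipschitz) blast
  obtain K :: nat where K: "\<And>r. finite {g. \<bar>T g\<bar> \<le> int r}" "\<And>r. card {g. \<bar>T g\<bar> \<le> int r} \<le> K * (2 * r + 1)"
    by (rule card_T_le) blast
  have c: "0 \<le> c" using close [of 0] by linarith
  have FC: "\<bar>F g\<bar> \<le> (real C + c) * exp (1 * real (word_norm S g))" for g
  proof -
    have "\<bar>of_int (T g) :: real\<bar> \<le> real (C * word_norm S g)"
      using C [of g] by (metis of_int_abs of_int_le_iff of_int_of_nat_eq)
    then have "\<bar>F g\<bar> \<le> real C * word_norm S g + c" using close [of g] by simp
    also have "\<dots> \<le> real C * exp (word_norm S g) + c * exp (word_norm S g)"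
    proof (intro add_mono)
      show "real C * word_norm S g \<le> real C * exp (word_norm S g)"
        using exp_ge_add_one_self [of "word_norm S g"] by (intro mult_left_mono) linarith+
      show "c \<le> c * exp (word_norm S g)"
        using c mult_left_mono [of 1 "exp (word_norm S g)" c] by simp
    qed
    finally show ?thesis by (simp add: distrib_right)
  qed
  have int1: "integrable (measure_pmf \<mu>) F"
    by (rule integrable_exp_bound [OF _ FC]) simp
  have int2: "integrable (measure_pmf \<mu>) (\<lambda>s. (F s)\<^sup>2)"
  proof (rule integrable_exp_bound)
    fix g
    have "(F g)\<^sup>2 = \<bar>F g\<bar> * \<bar>F g\<bar>" by (simp add: power2_eq_square)
    also have "\<dots> \<le> ((real C + c) * exp (1 * real (word_norm S g))) * ((real C + c) * exp (1 * real (word_norm S g)))"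
      by (intro mult_mono FC) (use c in auto)
    also have "\<dots> = (real C + c)\<^sup>2 * exp (2 * real (word_norm S g))"
      by (simp only: power2_eq_square mult_2 exp_add mult_1 mult_ac)
    finally show "\<bar>(F g)\<^sup>2\<bar> \<le> (real C + c)\<^sup>2 * exp (2 * real (word_norm S g))" by simp
  qed simp
  define v where "v = (\<integral>s. (F s)\<^sup>2 \<partial>measure_pmf \<mu>)"
  have v: "0 \<le> v" unfolding v_def by (rule integral_nonneg_AE) simp
  let ?V = "\<lambda>x. ennreal ((F x)\<^sup>2)"
  have PV: "P ?V x = ?V x + ennreal v" for x
  proof -
    \<comment> \<open>The sign squares to 1, and the cross term has mean 0, so the second moment
      grows by exactly \<open>v\<close> per step.\<close>
    have sq: "(F (x + s))\<^sup>2 = (F x)\<^sup>2 + 2 * F x * of_int (sg x) * F s + (F s)\<^sup>2" for s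
      by (simp add: F power2_eq_square algebra_simps) (simp add: sg_def)
    have int: "integrable (measure_pmf \<mu>) (\<lambda>s. (F (x + s))\<^sup>2)"
      unfolding sq using int1 int2 by simp
    have "P ?V x = ennreal (\<integral>s. (F (x + s))\<^sup>2 \<partial>measure_pmf \<mu>)"
      unfolding markov_pmf by (rule nn_integral_eq_integral [OF int]) simp
    also have "(\<integral>s. (F (x + s))\<^sup>2 \<partial>measure_pmf \<mu>) = (F x)\<^sup>2 + v"
      unfolding sq using int1 int2 centred by (simp add: v_def)
    finally show ?thesis using v by simp
  qed
  have PnV: "(P ^^ n) ?V x = ?V x + ennreal (real n * v)" for n x
  proof (induction n arbitrary: x)
    case (Suc n)
    have "(P ^^ Suc n) ?V x = P (\<lambda>x. ?V x + ennreal (real n * v)) x"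
      unfolding funpow.simps comp_apply by (rule arg_cong2 [of _ _ x x P]) (auto simp: Suc)
    also have "\<dots> = ?V x + (ennreal v + ennreal (real n * v))"
      by (simp add: markov_add PV add.assoc)
    also have "ennreal v + ennreal (real n * v) = ennreal (real (Suc n) * v)"
      using v by (simp add: ennreal_plus [symmetric] algebra_simps del: ennreal_plus)
    finally show ?case .
  qed simp
  have F0: "F 0 = 0" using F [of 0 0] by (simp add: sg_def)
  obtain g0 where g0: "0 \<le> g0" "G 0 0 = ennreal g0" by (metis green_finite(2) ennreal_cases)
  have bound: "real N / 2 \<le> real K * (2 * (sqrt (2 * real N * (v + 1)) + c + 1) + 1) * g0" if N: "0 < N" for N :: nat
  proof -
    \<comment> \<open>With this radius Chebyshev leaves mass at least 1/2 in \<open>E\<close> at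
      every time before \<open>N\<close>; \<open>v + 1\<close> keeps \<rho> positive.\<close>
    define \<rho> where "\<rho> = sqrt (2 * real N * (v + 1))"
    have \<rho>: "0 < \<rho>" "\<rho>\<^sup>2 = 2 * real N * (v + 1)" using N v by (auto simp: \<rho>_def)
    define E where "E = {x. \<bar>F x\<bar> \<le> \<rho>}"
    define r where "r = nat \<lceil>\<rho> + c\<rceil>"
    have r: "\<rho> + c \<le> r" "r \<le> \<rho> + c + 1" using \<rho>(1) c by (auto simp: r_def)
    have sub: "E \<subseteq> {g. \<bar>T g\<bar> \<le> int r}"
    proof
      fix g assume "g \<in> E"
      then have "\<bar>of_int (T g) :: real\<bar> \<le> of_int (int r)" using close [of g] r(1) by (simp add: E_def)
      then show "g \<in> {g. \<bar>T g\<bar> \<le> int r}" by (metis mem_Collect_eq of_int_abs of_int_le_iff)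
    qed
    have fE: "finite E" using sub K(1) finite_subset by blast
    have cE: "real (card E) \<le> real K * (2 * (\<rho> + c + 1) + 1)"
    proof -
      have "card E \<le> K * (2 * r + 1)" using card_mono [OF K(1) sub] K(2) [of r] by simp
      then have "real (card E) \<le> real (K * (2 * r + 1))" by (simp only: of_nat_le_iff)
      also have "\<dots> = real K * (2 * real r + 1)"
        by (simp only: of_nat_mult of_nat_add of_nat_numeral of_nat_1)
      also have "\<dots> \<le> real K * (2 * (\<rho> + c + 1) + 1)" using r(2) by (intro mult_left_mono) auto
      finally show ?thesis .
    qed
    have half: "ennreal (1 / 2) \<le> (P ^^ n) (indicator E) 0" if "n < N" for n
    proof -
      have "1 \<le> indicator E x + ennreal (1 / \<rho>\<^sup>2) * ?V x" for x
      proof (cases "x \<in> E")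
        case False
        then have "\<rho>\<^sup>2 \<le> (F x)\<^sup>2" using \<rho>(1) by (simp add: E_def abs_le_square_iff [symmetric])
        then have "1 \<le> 1 / \<rho>\<^sup>2 * (F x)\<^sup>2" using \<rho>(1) by (simp add: le_divide_eq)
        then have "ennreal 1 \<le> ennreal (1 / \<rho>\<^sup>2 * (F x)\<^sup>2)" by (rule ennreal_leI)
        also have "\<dots> = ennreal (1 / \<rho>\<^sup>2) * ?V x" by (rule ennreal_mult) auto
        finally show ?thesis using False by simp
      qed simp
      then have "(P ^^ n) (\<lambda>x. 1) 0 \<le> (P ^^ n) (\<lambda>x. indicator E x + ennreal (1 / \<rho>\<^sup>2) * ?V x) 0"
        by (rule markov_pow_mono)
      also have "\<dots> = (P ^^ n) (indicator E) 0 + ennreal (1 / \<rho>\<^sup>2) * ennreal (real n * v)"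
        by (simp add: markov_pow_add markov_pow_cmult PnV F0)
      also have "ennreal (1 / \<rho>\<^sup>2) * ennreal (real n * v) \<le> ennreal (1 / 2)"
      proof -
        have "2 * (real n * v) \<le> \<rho>\<^sup>2"
          unfolding \<rho>(2) using \<open>n < N\<close> v mult_mono [of "real n" "real N" v "v + 1"] by simp
        then have "1 / \<rho>\<^sup>2 * (real n * v) \<le> 1 / 2" using \<rho>(1) by (simp add: divide_le_eq)
        then have "ennreal (1 / \<rho>\<^sup>2 * (real n * v)) \<le> ennreal (1 / 2)" by (rule ennreal_leI)
        then show ?thesis using v by (subst ennreal_mult [symmetric]) auto
      qed
      finally have le: "(P ^^ n) (\<lambda>x. 1) 0 \<le> (P ^^ n) (indicator E) 0 + ennreal (1 / 2)"
        by (simp add: add_left_mono)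
      have one: "(P ^^ n) (\<lambda>x. 1) = (\<lambda>x. 1)"
      proof (induction n)
        case (Suc n)
        show ?case unfolding funpow.simps comp_apply Suc by (rule ext) simp
      qed simp
      have "ennreal (1 / 2 + 1 / 2) = ennreal (1 / 2) + ennreal (1 / 2)" by (rule ennreal_plus) auto
      then have two: "ennreal (1 / 2) + ennreal (1 / 2) = 1" by simp
      have "ennreal (1 / 2) + ennreal (1 / 2) \<le> (P ^^ n) (indicator E) 0 + ennreal (1 / 2)"
        unfolding two using le unfolding one .
      then show ?thesis by (simp add: ennreal_add_left_cancel_le add.commute)
    qed
    have "ennreal (real N / 2) = (\<Sum>n<N. ennreal (1 / 2))" by (subst sum_ennreal) auto
    also have "\<dots> \<le> (\<Sum>n<N. (P ^^ n) (indicator E) 0)" by (rule sum_mono) (use half in simp)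
    also have "\<dots> \<le> potential w (indicator E) 0"
      unfolding potential_def by (rule sum_le_suminf) auto
    also have "\<dots> \<le> (\<integral>\<^sup>+ z. indicator E z * G 0 0 \<partial>count_space UNIV)"
      unfolding potential_integral by (intro nn_integral_mono mult_left_mono green_le_diag) auto
    also have "\<dots> = ennreal (real (card E)) * ennreal g0"
      using fE by (simp add: nn_integral_multc g0(2) ennreal_of_nat_eq_real_of_nat)
    also have "\<dots> = ennreal (real (card E) * g0)" using g0(1) by (simp add: ennreal_mult)
    finally have "real N / 2 \<le> real (card E) * g0" using g0(1) by simp
    also have "\<dots> \<le> real K * (2 * (\<rho> + c + 1) + 1) * g0" using g0(1) by (intro mult_right_mono cE)
    finally show ?thesis by (simp add: \<rho>_def)
  qed
  define p where "p = 4 * (real K * g0 * sqrt (2 * (v + 1)))"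
  define q where "q = 2 * (real K * (2 * (c + 1) + 1) * g0)"
  have b2: "real N \<le> p * sqrt N + q" if "0 < N" for N :: nat
  proof -
    have eq: "sqrt (2 * real N * (v + 1)) = sqrt (2 * (v + 1)) * sqrt (real N)"
      by (simp only: real_sqrt_mult mult_ac)
    show ?thesis using bound [OF that] unfolding eq by (simp add: p_def q_def algebra_simps)
  qed
  have pq: "0 \<le> p" "0 \<le> q" using g0 v c by (auto simp: p_def q_def)
  \<comment> \<open>The left side of \<open>b2\<close> grows like \<open>N\<close>, the right side
    only like its square root; \<open>N = m * m\<close> makes the contradiction explicit.\<close>
  obtain m :: nat where m: "p + q + 1 < real m" using reals_Archimedean2 by blast
  have m0: "0 < m" using m pq by (cases m) auto
  have "real (m * m) \<le> p * sqrt (m * m) + q" by (rule b2) (use m0 in simp)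
  then have le: "real m * real m \<le> p * real m + q" by (simp add: real_sqrt_mult_self)
  have "p * real m + q < real m * real m"
  proof -
    have "q \<le> q * real m" using m0 pq by (simp add: mult_le_cancel_left1)
    then have "p * real m + q \<le> (p + q) * real m" by (simp add: distrib_right)
    also have "\<dots> < real m * real m" using m m0 by (intro mult_strict_right_mono) auto
    finally show ?thesis .
  qed
  with le show False by simp
qed

text \<open>No increment exchanges the ends, so \<open>T\<close> is a homomorphism. An exponential
  of \<open>T\<close> whose rate has the sign opposite to the drift shrinks by a factor at most
  \<open>M < 1\<close> in each step, and it dominates the indicator of 0.\<close>

lemma exp_decay_drift:
  assumes \<sigma>1: "\<And>s. s \<in> set_pmf \<mu> \<Longrightarrow> \<sigma> s" and drift: "(\<integral>s. of_int (T s) \<partial>measure_pmf \<mu>) \<noteq> (0 :: real)"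
  shows "exp_decay \<mu>"
proof -
  obtain C :: nat where C: "\<And>g. \<bar>T g\<bar> \<le> int (C * word_norm S g)" by (rule T_lipschitz) blast
  have TC: "\<bar>of_int (T g) :: real\<bar> \<le> real C * word_norm S g" for g
    using C [of g] by (metis of_int_abs of_int_le_iff of_int_of_nat_eq of_nat_mult)
  have sg1: "sg g = 1" for g
  proof -
    obtain ws where ws: "set ws \<subseteq> set_pmf \<mu>" "sum_list ws = g"
      using semigroup_gen unfolding semigroup_generates_def by blast
    have "\<sigma> (sum_list ws)" using ws(1) by (induction ws) (auto simp: \<sigma>_add \<sigma>1)
    then show ?thesis using ws(2) by (simp add: sg_def)
  qed
  define m where "m = (\<integral>s. of_int (T s) \<partial>measure_pmf \<mu> :: real)"
  define Z where "Z g = (of_int (T g))\<^sup>2 * exp \<bar>of_int (T g) :: real\<bar>" for g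
  have Zb: "\<bar>Z g\<bar> \<le> 1 * exp ((3 * real C) * word_norm S g)" for g
  proof -
    let ?y = "\<bar>of_int (T g) :: real\<bar>"
    have "?y \<le> exp ?y" using exp_ge_add_one_self [of ?y] by linarith
    then have "?y * ?y * exp ?y \<le> exp ?y * exp ?y * exp ?y" by (intro mult_mono) auto
    also have "\<dots> = exp (3 * ?y)" by (simp add: exp_add [symmetric])
    also have "\<dots> \<le> exp ((3 * real C) * word_norm S g)" using TC [of g] by simp
    finally show ?thesis by (simp add: Z_def power2_eq_square)
  qed
  have intZ: "integrable (measure_pmf \<mu>) Z" by (rule integrable_exp_bound [OF _ Zb]) simp
  have intT: "integrable (measure_pmf \<mu>) (\<lambda>g. of_int (T g) :: real)"
  proof (rule integrable_exp_bound)
    fix g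
    have "\<bar>of_int (T g) :: real\<bar> \<le> exp (real C * word_norm S g)"
      using TC [of g] exp_ge_add_one_self [of "real C * word_norm S g"] by linarith
    then show "\<bar>of_int (T g) :: real\<bar> \<le> 1 * exp (real C * word_norm S g)" by simp
  qed simp
  define z where "z = (\<integral>s. Z s \<partial>measure_pmf \<mu>)"
  have z: "0 \<le> z" unfolding z_def by (rule integral_nonneg_AE) (simp add: Z_def)
  have m: "m \<noteq> 0" using drift by (simp add: m_def)
  \<comment> \<open>Small enough for the quadratic error to eat at most half of the linear gain:
    \<open>h * z \<le> \<bar>m\<bar> / 2\<close>.\<close>
  define h where "h = min 1 (\<bar>m\<bar> / (2 * (z + 1)))"
  have h: "0 < h" "h \<le> 1" "h * (z + 1) \<le> \<bar>m\<bar> / 2"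
  proof -
    show "0 < h" "h \<le> 1" using m z by (auto simp: h_def)
    have "h \<le> \<bar>m\<bar> / (2 * (z + 1))" by (simp add: h_def)
    then show "h * (z + 1) \<le> \<bar>m\<bar> / 2" using z by (simp add: field_simps)
  qed
  define l where "l = - sgn m * h"
  have l: "\<bar>l\<bar> = h" "l * m = - h * \<bar>m\<bar>" using m h by (auto simp: l_def abs_mult sgn_mult abs_sgn sgn_if)
  let ?\<Lambda> = "\<lambda>x. exp (l * of_int (T x)) :: real"
  have le: "?\<Lambda> s \<le> 1 + l * of_int (T s) + h\<^sup>2 * Z s" for s
  proof -
    let ?t = "of_int (T s) :: real"
    have "\<bar>l * ?t\<bar> \<le> \<bar>?t\<bar>" using l(1) h by (simp add: abs_mult mult_left_le_one_le)
    then have "(l * ?t)\<^sup>2 * exp \<bar>l * ?t\<bar> \<le> (l * ?t)\<^sup>2 * exp \<bar>?t\<bar>" by (intro mult_left_mono) auto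
    moreover have "(l * ?t)\<^sup>2 = h\<^sup>2 * ?t\<^sup>2" using l(1) by (metis power2_abs power_mult_distrib)
    ultimately have "(l * ?t)\<^sup>2 * exp \<bar>l * ?t\<bar> \<le> h\<^sup>2 * Z s" by (simp only: Z_def mult.assoc)
    then show ?thesis using exp_le_quadratic [of "l * ?t"] by linarith
  qed
  define M where "M = 1 - h * \<bar>m\<bar> / 2"
  have intU: "integrable (measure_pmf \<mu>) (\<lambda>s. 1 + l * of_int (T s) + h\<^sup>2 * Z s)" using intZ intT by simp
  have int\<Lambda>: "integrable (measure_pmf \<mu>) ?\<Lambda>"
    by (rule Bochner_Integration.integrable_bound [OF intU]) (use le in \<open>auto intro: order_trans [OF _ abs_ge_self]\<close>)
  have E\<Lambda>: "(\<integral>s. ?\<Lambda> s \<partial>measure_pmf \<mu>) \<le> M"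
  proof -
    have "(\<integral>s. ?\<Lambda> s \<partial>measure_pmf \<mu>) \<le> (\<integral>s. 1 + l * of_int (T s) + h\<^sup>2 * Z s \<partial>measure_pmf \<mu>)"
      by (rule integral_mono [OF int\<Lambda> intU le])
    also have "\<dots> = 1 + l * m + h\<^sup>2 * z" using intZ intT by (simp add: m_def z_def)
    also have "\<dots> \<le> M"
    proof -
      have "h * z \<le> h * (z + 1)" using h by simp
      then have "h * z \<le> \<bar>m\<bar> / 2" using h(3) by linarith
      then have "h * (h * z) \<le> h * (\<bar>m\<bar> / 2)" using h(1) by (intro mult_left_mono) auto
      then show ?thesis by (simp add: M_def l(2) power2_eq_square mult.assoc)
    qed
    finally show ?thesis .
  qed
  have "0 < (\<integral>s. ?\<Lambda> s \<partial>measure_pmf \<mu>)"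
  proof -
    have "0 \<le> (\<integral>s. ?\<Lambda> s \<partial>measure_pmf \<mu>)" by (rule integral_nonneg_AE) simp
    moreover have "(\<integral>s. ?\<Lambda> s \<partial>measure_pmf \<mu>) \<noteq> 0"
    proof
      assume "(\<integral>s. ?\<Lambda> s \<partial>measure_pmf \<mu>) = 0"
      then have "AE s in measure_pmf \<mu>. ?\<Lambda> s = 0"
        using integral_nonneg_eq_0_iff_AE [OF int\<Lambda>] by simp
      then show False by (simp add: AE_measure_pmf_iff set_pmf_not_empty)
    qed
    ultimately show ?thesis by linarith
  qed
  then have M: "0 < M" "M < 1" using E\<Lambda> h m by (auto simp: M_def)
  have P\<Lambda>: "P (\<lambda>x. ennreal (?\<Lambda> x)) x \<le> ennreal M * ennreal (?\<Lambda> x)" for x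
  proof -
    have "P (\<lambda>x. ennreal (?\<Lambda> x)) x = (\<integral>\<^sup>+ s. ennreal (?\<Lambda> x) * ennreal (?\<Lambda> s) \<partial>measure_pmf \<mu>)"
      unfolding markov_pmf by (intro nn_integral_cong) (simp add: T_add sg1 distrib_left exp_add ennreal_mult)
    also have "\<dots> = ennreal (?\<Lambda> x) * ennreal (\<integral>s. ?\<Lambda> s \<partial>measure_pmf \<mu>)"
      using nn_integral_eq_integral [OF int\<Lambda>] by (simp add: nn_integral_cmult)
    also have "\<dots> \<le> ennreal (?\<Lambda> x) * ennreal M" by (intro mult_left_mono ennreal_leI E\<Lambda>) simp
    finally show ?thesis by (simp add: mult.commute)
  qed
  have Pn\<Lambda>: "(P ^^ n) (\<lambda>x. ennreal (?\<Lambda> x)) x \<le> ennreal (M ^ n) * ennreal (?\<Lambda> x)" for n x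
  proof (induction n arbitrary: x)
    case (Suc n)
    have "(P ^^ Suc n) (\<lambda>x. ennreal (?\<Lambda> x)) x \<le> P (\<lambda>x. ennreal (M ^ n) * ennreal (?\<Lambda> x)) x"
      unfolding funpow.simps comp_apply by (rule markov_mono) (rule Suc)
    also have "\<dots> \<le> ennreal (M ^ n) * (ennreal M * ennreal (?\<Lambda> x))"
      unfolding markov_cmult by (intro mult_left_mono P\<Lambda>) simp
    also have "\<dots> = ennreal (M ^ Suc n) * ennreal (?\<Lambda> x)"
      using M by (simp add: ennreal_mult mult_ac)
    finally show ?case .
  qed simp
  have "pmf (conv_power \<mu> n) 0 \<le> M ^ n" for n
  proof -
    have "ennreal (pmf (conv_power \<mu> n) 0) = (P ^^ n) (indicator {0}) 0" by (simp add: markov_pow_pmf)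
    also have "\<dots> \<le> (P ^^ n) (\<lambda>x. ennreal (?\<Lambda> x)) 0" by (rule markov_pow_mono) (auto simp: indicator_def)
    also have "\<dots> \<le> ennreal (M ^ n)" using Pn\<Lambda> [of n 0] by simp
    finally show ?thesis using M by simp
  qed
  then have "(1 / M) ^ n * pmf (conv_power \<mu> n) 0 \<le> 1" for n
    using M by (simp add: power_divide divide_le_eq)
  then show ?thesis unfolding exp_decay_def using M by (intro exI [of _ "1 / M"]) auto
qed

text \<open>Adding the coboundary \<open>(1 - sg x) * c\<close> keeps the cocycle identity and
  shifts the mean by \<open>(1 - q) * c\<close>. If some increment exchanged the ends, then
  \<open>q < 1\<close> and a suitable \<open>c\<close> would centre the cocycle, which is
  impossible. So none does, and \<open>c = 0\<close> shows that the drift is nonzero.\<close>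

theorem exp_decay_two_points: "exp_decay \<mu>"
proof -
  obtain C :: nat where C: "\<And>g. \<bar>T g\<bar> \<le> int (C * word_norm S g)" by (rule T_lipschitz) blast
  have TC: "\<bar>of_int (T g) :: real\<bar> \<le> real C * word_norm S g" for g
    using C [of g] by (metis of_int_abs of_int_le_iff of_int_of_nat_eq of_nat_mult)
  have intT: "integrable (measure_pmf \<mu>) (\<lambda>g. of_int (T g) :: real)"
  proof (rule integrable_exp_bound)
    fix g
    have "\<bar>of_int (T g) :: real\<bar> \<le> exp (real C * word_norm S g)"
      using TC [of g] exp_ge_add_one_self [of "real C * word_norm S g"] by linarith
    then show "\<bar>of_int (T g) :: real\<bar> \<le> 1 * exp (real C * word_norm S g)" by simp
  qed simp
  have int\<sigma>: "integrable (measure_pmf \<mu>) (\<lambda>g. of_int (sg g) :: real)"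
    by (rule integrable_exp_bound [of 0 _ 1]) (auto simp: sg_def)
  define m where "m = (\<integral>s. of_int (T s) \<partial>measure_pmf \<mu> :: real)"
  define q where "q = (\<integral>s. of_int (sg s) \<partial>measure_pmf \<mu> :: real)"
  have rec: False if "m + (1 - q) * c = 0" for c
  proof -
    define F where "F x = of_int (T x) + (1 - of_int (sg x)) * c" for x
    show False
    proof (rule centred_cocycle_recurrent [of F "2 * \<bar>c\<bar>"])
      show "F (x + s) = F x + of_int (sg x) * F s" for x s
        by (simp add: F_def T_add sg_add algebra_simps)
      show "\<bar>F x - of_int (T x)\<bar> \<le> 2 * \<bar>c\<bar>" for x
        by (simp add: F_def sg_def abs_mult)
      show "(\<integral>s. F s \<partial>measure_pmf \<mu>) = 0"
        using that intT int\<sigma> by (simp add: F_def m_def q_def)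
    qed
  qed
  have q: "q = 1" using rec [of "- m / (1 - q)"] by (cases "q = 1") auto
  have "m \<noteq> 0" using rec [of 0] by auto
  moreover have "\<sigma> s" if "s \<in> set_pmf \<mu>" for s
  proof -
    have "(\<integral>s. 1 - of_int (sg s) \<partial>measure_pmf \<mu>) = (0 :: real)" using int\<sigma> q by (simp add: q_def)
    moreover have "integrable (measure_pmf \<mu>) (\<lambda>s. 1 - of_int (sg s) :: real)" using int\<sigma> by simp
    moreover have "0 \<le> (1 - of_int (sg s) :: real)" for s by (simp add: sg_def)
    ultimately have "AE s in measure_pmf \<mu>. 1 - of_int (sg s) = (0 :: real)"
      using integral_nonneg_eq_0_iff_AE [of "measure_pmf \<mu>" "\<lambda>s. 1 - of_int (sg s) :: real"] by simp
    then show ?thesis using that by (auto simp: AE_measure_pmf_iff sg_def split: if_splits)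
  qed
  ultimately show ?thesis by (intro exp_decay_drift) (simp_all add: m_def)
qed

end

theorem (in floyd_walk) exp_decay_of_boundary:
  assumes "bseq \<xi>" "bseq \<eta>" "gap \<xi> \<eta> \<noteq> 0"
  shows "exp_decay \<mu>"
proof (cases "\<exists>s. bseq s \<and> gap s \<xi> \<noteq> 0 \<and> gap s \<eta> \<noteq> 0")
  case True
  then obtain s where "bseq s" "gap s \<xi> \<noteq> 0" "gap s \<eta> \<noteq> 0" by blast
  then show ?thesis using exp_decay_three_points [of s \<xi> \<eta>] assms by blast
next
  case False
  then interpret two_points S \<mu> f \<xi> \<eta>
    using assms by unfold_locales auto
  show ?thesis by (rule exp_decay_two_points)
qed

section \<open>Martin kernels\<close>

lemma markov_pow_SUP:
  assumes "\<And>x. incseq (\<lambda>m. u m x)"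
  shows "(markov w ^^ n) (\<lambda>x. SUP m. u m x) x = (SUP m. (markov w ^^ n) (u m) x)"
proof (induction n arbitrary: x)
  case (Suc n)
  have inc: "incseq (\<lambda>m. (markov w ^^ n) (u m) x)" for x
    unfolding incseq_def by (intro allI impI markov_pow_mono) (use assms in \<open>auto simp: incseq_def\<close>)
  have "(markov w ^^ Suc n) (\<lambda>x. SUP m. u m x) x = markov w (\<lambda>x. SUP m. (markov w ^^ n) (u m) x) x"
    unfolding funpow.simps comp_apply by (rule arg_cong2 [of _ _ x x "markov w"]) (auto simp: Suc)
  also have "\<dots> = (SUP m. markov w ((markov w ^^ n) (u m)) x)"
    by (rule markov_SUP [OF inc])
  finally show ?case by simp
qed simp

context superexp_walk
begin

lemma green_eq: "G x z = ennreal (green \<mu> x z)"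
  by (rule green_kernel_pmf [OF transient])

lemma green_real_pos: "0 < green \<mu> x z"
  using green_pos [of x z] unfolding green_eq by simp

text \<open>The Martin kernel before the limit. Minus its logarithm is the difference of Green
  distances, so a horofunction \<open>h\<close> corresponds to the positive function
  \<open>exp (- h)\<close>, with which the proof works.\<close>

definition ratio :: "'a \<Rightarrow> 'a \<Rightarrow> 'a \<Rightarrow> real" where
  "ratio bp z x = green \<mu> z x / green \<mu> bp x"

lemma ratio_pos: "0 < ratio bp z x"
  using green_real_pos by (simp add: ratio_def)

lemma ratio_eq_exp: "ratio bp z x = exp (- (green_dist \<mu> z x - green_dist \<mu> bp x))"
proof -
  have pos: "0 < green \<mu> z x / green \<mu> 0 0" "0 < green \<mu> bp x / green \<mu> 0 0"
    using green_real_pos by simp_all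
  have "exp (- (green_dist \<mu> z x - green_dist \<mu> bp x)) =
      exp (ln (green \<mu> z x / green \<mu> 0 0)) / exp (ln (green \<mu> bp x / green \<mu> 0 0))"
    by (simp only: green_dist_def exp_diff [symmetric]) simp
  also have "\<dots> = ratio bp z x"
    using pos green_real_pos [of 0 0] by (simp only: exp_ln ratio_def) simp
  finally show ?thesis by simp
qed

lemma martin_limit_ratio:
  assumes "martin_limit \<mu> bp x h"
  shows "(\<lambda>n. ratio bp z (x n)) \<longlonglongrightarrow> exp (- h z)"
  unfolding ratio_eq_exp using assms unfolding martin_limit_def by (intro tendsto_exp tendsto_minus) blast

lemma martin_limit_base:
  assumes "martin_limit \<mu> bp x h"
  shows "h bp = 0"
proof -
  have "(\<lambda>n. green_dist \<mu> bp (x n) - green_dist \<mu> bp (x n)) \<longlonglongrightarrow> h bp"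
    using assms unfolding martin_limit_def by blast
  then have "(\<lambda>n::nat. 0) \<longlonglongrightarrow> h bp" by simp
  from LIMSEQ_unique [OF this tendsto_const] show ?thesis .
qed

lemma martin_limit_subseq:
  assumes "martin_limit \<mu> bp x h" "strict_mono r"
  shows "martin_limit \<mu> bp (x \<circ> r) h"
  unfolding martin_limit_def
proof
  fix z
  have "(\<lambda>n. green_dist \<mu> z (x n) - green_dist \<mu> bp (x n)) \<longlonglongrightarrow> h z"
    using assms(1) unfolding martin_limit_def by blast
  from LIMSEQ_subseq_LIMSEQ [OF this assms(2)]
  show "(\<lambda>n. green_dist \<mu> z ((x \<circ> r) n) - green_dist \<mu> bp ((x \<circ> r) n)) \<longlonglongrightarrow> h z"
    by (simp add: comp_def)
qed

text \<open>The quotient is harmonic at \<open>z\<close> as soon as \<open>x n \<noteq> z\<close>.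
  Jumps may be unbounded, so the limit under the sum uses the Harnack majorant
  \<open>C ^ word_norm S s\<close>, integrable by \<open>moment\<close>.\<close>

lemma kernel_harmonic:
  assumes esc: "filterlim x cofinite sequentially" and lim: "martin_limit \<mu> bp x h"
  shows "P (\<lambda>z. ennreal (exp (- h z))) z = ennreal (exp (- h z))"
proof -
  obtain C where C: "1 \<le> C" and har: "\<And>u x y. (\<forall>x. P u x \<le> u x) \<Longrightarrow> u y \<le> ennreal (C ^ word_dist S x y) * u x"
    using harnack by blast
  define K where "K n z = ennreal (ratio bp z (x n))" for n z
  have K: "K n z = ennreal (1 / green \<mu> bp (x n)) * G z (x n)" for n z
    using green_real_pos by (simp add: K_def ratio_def green_eq ennreal_mult [symmetric] less_imp_le)
  have Kfun: "K n = (\<lambda>z. ennreal (1 / green \<mu> bp (x n)) * G z (x n))" for n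
    by (simp add: K fun_eq_iff)
  have lim': "(\<lambda>n. K n z) \<longlonglongrightarrow> ennreal (exp (- h z))" for z
    unfolding K_def by (intro tendsto_ennrealI martin_limit_ratio lim)
  have "Bseq (\<lambda>n. ratio bp z (x n))"
    using martin_limit_ratio [OF lim] convergent_imp_Bseq convergentI by blast
  then obtain M where M: "0 < M" "\<And>n. norm (ratio bp z (x n)) \<le> M" by (rule BseqE) blast
  have bound: "K n (z + s) \<le> ennreal M * ennreal (C ^ word_norm S s)" for n s
  proof -
    have "K n (z + s) \<le> ennreal (C ^ word_dist S z (z + s)) * K n z"
    proof (rule har, rule allI)
      fix y
      show "P (K n) y \<le> K n y"
        unfolding Kfun markov_cmult by (intro mult_left_mono green_kernel_superharmonic) simp
    qed
    also have "\<dots> \<le> ennreal (C ^ word_norm S s) * ennreal M"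
      using M(2) [of n] by (intro mult_mono) (auto simp: K_def word_dist_def add.assoc [symmetric] intro!: ennreal_leI)
    finally show ?thesis by (simp add: mult.commute)
  qed
  have "(\<lambda>n. \<integral>\<^sup>+ s. K n (z + s) \<partial>measure_pmf \<mu>) \<longlonglongrightarrow> (\<integral>\<^sup>+ s. ennreal (exp (- h (z + s))) \<partial>measure_pmf \<mu>)"
  proof (rule nn_integral_dominated_convergence [where w = "\<lambda>s. ennreal M * ennreal (C ^ word_norm S s)"])
    show "(\<integral>\<^sup>+ s. ennreal M * ennreal (C ^ word_norm S s) \<partial>measure_pmf \<mu>) < \<infinity>"
      using moment [OF C] by (simp add: nn_integral_cmult ennreal_mult_less_top)
  qed (use bound lim' in auto)
  then have 1: "(\<lambda>n. P (K n) z) \<longlonglongrightarrow> P (\<lambda>z. ennreal (exp (- h z))) z"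
    by (simp only: markov_pmf)
  have "\<forall>\<^sub>F n in sequentially. x n \<noteq> z"
  proof -
    have "eventually (\<lambda>y. y \<noteq> z) cofinite" by (simp add: eventually_cofinite)
    then show ?thesis using esc unfolding filterlim_iff by blast
  qed
  then have "\<forall>\<^sub>F n in sequentially. P (K n) z = K n z"
  proof (rule eventually_mono)
    fix n assume "x n \<noteq> z"
    then have "G z (x n) = P (\<lambda>z. G z (x n)) z"
      using green_kernel_unfold [of w z "x n"] by simp
    then show "P (K n) z = K n z" unfolding Kfun markov_cmult by simp
  qed
  with 1 have "(\<lambda>n. K n z) \<longlonglongrightarrow> P (\<lambda>z. ennreal (exp (- h z))) z"
    by (rule Lim_transform_eventually)
  then show ?thesis using lim' LIMSEQ_unique by blast
qed

end

context floyd_walk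
begin

text \<open>The Ancona inequality divided by \<open>green \<mu> bp (x n)\<close>. Infinitely many
  good \<open>n\<close> suffice because the quotients converge anyway.\<close>

lemma kernel_le_green:
  assumes A: "\<And>v x z. \<epsilon> \<le> \<delta> v x z \<Longrightarrow> G x z \<le> ennreal A * (G x v * G v z)" and A0: "0 < A"
    and lim: "martin_limit \<mu> bp x h" and freq: "\<exists>\<^sub>F n in sequentially. \<epsilon> \<le> \<delta> p z (x n)"
  shows "ennreal (exp (- h z)) \<le> ennreal A * G z p * ennreal (exp (- h p))"
proof -
  have step: "ratio bp z (x n) \<le> A * green \<mu> z p * ratio bp p (x n)" if "\<epsilon> \<le> \<delta> p z (x n)" for n
  proof -
    have "ennreal (green \<mu> z (x n)) \<le> ennreal (A * (green \<mu> z p * green \<mu> p (x n)))"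
      using A [OF that] A0 green_real_pos by (simp add: green_eq ennreal_mult less_imp_le)
    then have "green \<mu> z (x n) \<le> A * (green \<mu> z p * green \<mu> p (x n))"
      using A0 green_real_pos [of z p] green_real_pos [of p "x n"] by (subst (asm) ennreal_le_iff) auto
    then show ?thesis
      using green_real_pos [of bp "x n"] by (simp add: ratio_def divide_right_mono mult.assoc)
  qed
  have "exp (- h z) \<le> A * green \<mu> z p * exp (- h p)"
  proof (rule ccontr)
    assume "\<not> ?thesis"
    then have neg: "A * green \<mu> z p * exp (- h p) - exp (- h z) < 0" by simp
    have "(\<lambda>n. A * green \<mu> z p * ratio bp p (x n) - ratio bp z (x n)) \<longlonglongrightarrow> A * green \<mu> z p * exp (- h p) - exp (- h z)"
      by (intro tendsto_intros martin_limit_ratio lim)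
    then have "\<forall>\<^sub>F n in sequentially. A * green \<mu> z p * ratio bp p (x n) - ratio bp z (x n) < 0"
      using neg by (rule order_tendstoD)
    then have "\<forall>\<^sub>F n in sequentially. \<not> \<epsilon> \<le> \<delta> p z (x n)"
      by (rule eventually_mono) (use step in force)
    then show False using freq by (simp add: frequently_def)
  qed
  then have "ennreal (exp (- h z)) \<le> ennreal (A * green \<mu> z p * exp (- h p))" by (rule ennreal_leI)
  also have "\<dots> = ennreal A * G z p * ennreal (exp (- h p))"
    using A0 green_real_pos [of z p] by (simp add: green_eq ennreal_mult less_imp_le)
  finally show ?thesis .
qed

text \<open>No \<open>z\<close> can stay \<epsilon>-close to both sequences, whose terms are
  eventually more than \<open>2 * \<epsilon>\<close> apart. One of the two therefore bounds the
  common kernel at \<open>z\<close> by a fixed multiple of the Green function at 0.\<close>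

theorem martin_limit_determines_floyd_limit:
  assumes x: "bseq x" "martin_limit \<mu> bp x h" and y: "bseq y" "martin_limit \<mu> bp y h"
  shows "gap x y = 0"
proof (rule ccontr)
  assume ne: "gap x y \<noteq> 0"
  have c: "cau x" "cau y" using x y bseqD by auto
  define \<epsilon> where "\<epsilon> = gap x y / 3"
  have \<epsilon>: "0 < \<epsilon>" "2 * \<epsilon> < gap x y" using gap_nonzero_pos [OF c ne] by (auto simp: \<epsilon>_def)
  obtain A where A0: "0 < A" and A: "\<And>v x z. \<epsilon> \<le> \<delta> v x z \<Longrightarrow> G x z \<le> ennreal A * (G x v * G v z)"
    by (rule ancona [OF exp_decay_of_boundary [OF x(1) y(1) ne] \<epsilon>(1)]) blast
  have ev: "\<forall>\<^sub>F n in sequentially. 2 * \<epsilon> < \<delta> 0 (x n) (y n)"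
    by (rule order_tendstoD(1) [OF cau_limit [OF c] \<epsilon>(2)])
  let ?k = "\<lambda>z. ennreal (exp (- h z))"
  have "?k 0 = 0"
  proof (rule subharmonic_le_potential_zero [where w = w and p = 0 and c = "ennreal A * ?k 0"])
    fix z
    show "?k z \<le> P ?k z"
      using kernel_harmonic [OF _ x(2)] bseqD(2) [OF x(1)] by (simp add: escaping_iff)
    have "(\<exists>\<^sub>F n in sequentially. \<epsilon> \<le> \<delta> 0 z (x n)) \<or> (\<exists>\<^sub>F n in sequentially. \<epsilon> \<le> \<delta> 0 z (y n))"
    proof (rule ccontr)
      assume "\<not> ?thesis"
      then have "\<forall>\<^sub>F n in sequentially. \<delta> 0 z (x n) < \<epsilon>" "\<forall>\<^sub>F n in sequentially. \<delta> 0 z (y n) < \<epsilon>"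
        by (simp_all add: not_frequently not_le)
      with ev have "\<forall>\<^sub>F n in sequentially. False"
      proof eventually_elim
        case (elim n)
        then show False using \<delta>_triangle [of 0 "x n" "y n" z] \<delta>_commute [of 0 "x n" z] by simp
      qed
      then show False by simp
    qed
    then show "?k z \<le> ennreal A * ?k 0 * G z 0"
      using kernel_le_green [OF A A0 x(2)] kernel_le_green [OF A A0 y(2)] by (auto simp: mult_ac)
  qed (auto simp: ennreal_mult_less_top)
  then show False by simp
qed

text \<open>The harmonic function \<open>u\<close> is approximated by the potentials \<open>min u (m G(\<cdot>, o))\<close>. Charges
  beyond \<open>p\<close> contribute at most \<open>A G(o, p) u(p)\<close> by Ancona; the potentials of the remaining
  charges are bounded by a multiple of \<open>G(\<cdot>, p)\<close>, uniformly in \<open>m\<close>, hence are negligible.\<close>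

lemma harmonic_le_through:
  assumes \<epsilon>: "0 < \<epsilon>" and A0: "0 < A"
    and A: "\<And>v x z. \<epsilon> \<le> \<delta> v x z \<Longrightarrow> G x z \<le> ennreal A * (G x v * G v z)"
    and lim: "martin_limit \<mu> bp x h"
    and u: "\<And>z. P u z = u z" "\<And>z. u z < \<top>" "\<And>z. u z \<le> ennreal c * ennreal (exp (- h z))"
    and p: "\<forall>\<^sub>F k in sequentially. 4 * \<epsilon> \<le> \<delta> p bp (x k)"
  shows "u bp \<le> ennreal A * G bp p * u p"
proof -
  let ?k = "\<lambda>z. ennreal (exp (- h z))"
  define U where "U m z = min (u z) (of_nat m * G z bp)" for m z
  \<comment> \<open>The charges that Ancona handles from \<open>bp\<close> through \<open>p\<close>.
    The threshold lies between \<epsilon> and the \<open>4 * \<epsilon>\<close> of the boundary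
    point, leaving room for the triangle inequalities in \<open>second\<close>.\<close>
  define E where "E = {y. 2 * \<epsilon> \<le> \<delta> p bp y}"
  define \<nu> where "\<nu> m z = U m z - P (U m) z" for m z
  define \<nu>1 where "\<nu>1 m z = \<nu> m z * indicator E z" for m z
  define \<nu>2 where "\<nu>2 m z = \<nu> m z * indicator (- E) z" for m z
  define c' where "c' = ennreal A * u p + ennreal c * (ennreal A * ?k p)"
  have c': "c' < \<top>" using u(2) by (auto simp: c'_def ennreal_mult_less_top)
  have Usup: "P (U m) z \<le> U m z" for m z
    unfolding U_def [abs_def]
  proof (rule markov_min_superharmonic)
    show "P u x \<le> u x" for x using u(1) by simp
    show "P (\<lambda>z. of_nat m * G z bp) x \<le> of_nat m * G x bp" for x
      unfolding markov_cmult by (intro mult_left_mono green_kernel_superharmonic) simp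
  qed
  have Upot: "U m z = potential w (\<nu> m) z" for m z
    unfolding \<nu>_def
  proof (rule superharmonic_eq_potential [OF Usup, where c = "of_nat m" and p = bp])
    show "U m x \<le> of_nat m * G x bp" for x by (simp add: U_def)
  qed (auto simp: of_nat_less_top)
  have \<nu>_split: "\<nu> m = (\<lambda>z. \<nu>1 m z + \<nu>2 m z)" for m
    by (auto simp: \<nu>1_def \<nu>2_def fun_eq_iff indicator_def)
  have Usplit: "U m z = potential w (\<nu>1 m) z + potential w (\<nu>2 m) z" for m z
    unfolding Upot \<nu>_split [of m] by (rule potential_add)
  have through: "potential w (\<lambda>y. \<nu> m y * indicator F y) z \<le> ennreal A * G z p * U m p"
    if F: "\<And>y. y \<in> F \<Longrightarrow> \<epsilon> \<le> \<delta> p z y" for F m z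
  proof -
    have "potential w (\<lambda>y. \<nu> m y * indicator F y) z =
        (\<integral>\<^sup>+ y. \<nu> m y * indicator F y * G z y \<partial>count_space UNIV)"
      by (rule potential_integral)
    also have "\<dots> \<le> (\<integral>\<^sup>+ y. (ennreal A * G z p) * (\<nu> m y * G p y) \<partial>count_space UNIV)"
    proof (rule nn_integral_mono)
      fix y
      show "\<nu> m y * indicator F y * G z y \<le> (ennreal A * G z p) * (\<nu> m y * G p y)"
      proof (cases "y \<in> F")
        case True
        have "\<nu> m y * G z y \<le> \<nu> m y * (ennreal A * (G z p * G p y))"
          by (intro mult_left_mono A F True) simp
        then show ?thesis using True by (simp add: mult_ac)
      qed simp
    qed
    also have "\<dots> = ennreal A * G z p * potential w (\<nu> m) p"
      unfolding potential_integral by (rule nn_integral_cmult) simp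
    finally show ?thesis by (simp only: Upot)
  qed
  have first: "potential w (\<nu>1 m) bp \<le> ennreal A * G bp p * u p" for m
  proof -
    have "potential w (\<nu>1 m) bp \<le> ennreal A * G bp p * U m p"
      unfolding \<nu>1_def by (rule through) (use \<epsilon> in \<open>simp add: E_def\<close>)
    also have "\<dots> \<le> ennreal A * G bp p * u p" by (intro mult_left_mono) (auto simp: U_def)
    finally show ?thesis .
  qed
  \<comment> \<open>A point \<open>z\<close> at least \<open>3 * \<epsilon>\<close> away from
    \<open>bp\<close> is \<epsilon>-far from every charge outside \<open>E\<close>. A closer one is
    \<epsilon>-far from the tail of \<open>x\<close>, and there the kernel bound on \<open>u\<close>
    takes over.\<close>
  have second: "potential w (\<nu>2 m) z \<le> c' * G z p" for m z
  proof (cases "3 * \<epsilon> \<le> \<delta> p bp z")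
    case True
    have "potential w (\<nu>2 m) z \<le> ennreal A * G z p * U m p"
      unfolding \<nu>2_def
    proof (rule through)
      fix y assume "y \<in> - E"
      then show "\<epsilon> \<le> \<delta> p z y"
        using True \<delta>_triangle [of p bp z y] \<delta>_commute [of p y z] by (simp add: E_def)
    qed
    also have "\<dots> \<le> ennreal A * G z p * u p" by (intro mult_left_mono) (auto simp: U_def)
    also have "\<dots> \<le> c' * G z p"
      unfolding c'_def distrib_right by (simp add: mult_ac)
    finally show ?thesis .
  next
    case False
    have "\<forall>\<^sub>F k in sequentially. \<epsilon> \<le> \<delta> p z (x k)"
      using p
    proof (rule eventually_mono)
      fix k assume "4 * \<epsilon> \<le> \<delta> p bp (x k)"
      then show "\<epsilon> \<le> \<delta> p z (x k)" using False \<delta>_triangle [of p bp "x k" z] by simp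
    qed
    then have k: "?k z \<le> ennreal A * G z p * ?k p"
      by (intro kernel_le_green [OF A A0 lim] eventually_frequently) auto
    have "potential w (\<nu>2 m) z \<le> U m z" unfolding Usplit by simp
    also have "\<dots> \<le> u z" by (simp add: U_def)
    also have "\<dots> \<le> ennreal c * ?k z" by (rule u(3))
    also have "\<dots> \<le> ennreal c * (ennreal A * G z p * ?k p)" by (intro mult_left_mono k) simp
    also have "\<dots> \<le> c' * G z p" unfolding c'_def distrib_right by (simp add: mult_ac)
    finally show ?thesis .
  qed
  \<comment> \<open>The first potential can only decrease under \<open>P\<close>; the second lies
    below a multiple of the Green function at \<open>p\<close> that does not depend on
    \<open>m\<close>. So \<open>m\<close> can go to infinity first and \<open>N\<close>
    afterwards.\<close>
  have PU: "(P ^^ N) (U m) bp \<le> ennreal A * G bp p * u p + c' * (P ^^ N) (\<lambda>z. G z p) bp" for N m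
  proof -
    have "U m = (\<lambda>z. potential w (\<nu>1 m) z + potential w (\<nu>2 m) z)" by (simp add: Usplit fun_eq_iff)
    then have "(P ^^ N) (U m) bp = (P ^^ N) (potential w (\<nu>1 m)) bp + (P ^^ N) (potential w (\<nu>2 m)) bp"
      by (simp only: markov_pow_add)
    also have "\<dots> \<le> potential w (\<nu>1 m) bp + (P ^^ N) (\<lambda>z. c' * G z p) bp"
      by (intro add_mono markov_pow_superharmonic potential_superharmonic markov_pow_mono second)
    also have "\<dots> \<le> ennreal A * G bp p * u p + c' * (P ^^ N) (\<lambda>z. G z p) bp"
      unfolding markov_pow_cmult by (intro add_right_mono first)
    finally show ?thesis .
  qed
  have SUP: "(SUP m. U m z) = u z" for z
  proof (rule antisym)
    show "(SUP m. U m z) \<le> u z" by (rule SUP_least) (simp add: U_def)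
    obtain a where a: "u z = ennreal a" "0 \<le> a" using u(2) [of z] by (auto simp: less_top_ennreal)
    obtain m :: nat where m: "a / green \<mu> z bp < real m" using reals_Archimedean2 by blast
    have "ennreal a \<le> ennreal (real m * green \<mu> z bp)"
      using m green_real_pos [of z bp] by (intro ennreal_leI) (simp add: divide_less_eq)
    also have "\<dots> = of_nat m * G z bp"
      using green_real_pos [of z bp] by (simp add: green_eq ennreal_mult less_imp_le ennreal_of_nat_eq_real_of_nat)
    finally have "u z \<le> U m z" using a by (simp add: U_def)
    also have "\<dots> \<le> (SUP m. U m z)" by (rule SUP_upper) simp
    finally show "u z \<le> (SUP m. U m z)" .
  qed
  have inc: "incseq (\<lambda>m. U m z)" for z
    unfolding U_def incseq_def by (intro allI impI min.mono mult_right_mono) auto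
  have Pu: "(P ^^ N) u z = u z" for N z
  proof (induction N arbitrary: z)
    case (Suc N)
    have "(P ^^ N) u = u" using Suc by (rule ext)
    then show ?case using u(1) by simp
  qed simp
  have "u = (\<lambda>z. SUP m. U m z)" by (simp add: SUP)
  then have eq: "u bp = (SUP m. (P ^^ N) (U m) bp)" for N
    using markov_pow_SUP [of U N w bp, OF inc] Pu [of N bp] by simp
  have le: "u bp \<le> ennreal A * G bp p * u p + c' * (P ^^ N) (\<lambda>z. G z p) bp" for N
    by (subst eq [of N]) (rule SUP_least, rule PU)
  have "(\<lambda>N. ennreal A * G bp p * u p + c' * (P ^^ N) (\<lambda>z. G z p) bp) \<longlonglongrightarrow> ennreal A * G bp p * u p + c' * 0"
    using c' by (intro tendsto_add tendsto_const ennreal_tendsto_cmult green_kernel_tendsto_zero) auto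
  then show ?thesis
    using le by (intro LIMSEQ_le_const [of _ "ennreal A * G bp p * u p"]) auto
qed

text \<open>For a conical point \<open>p n\<close> will be \<open>- g n\<close>: seen from there,
  \<open>z\<close> is separated from the tails of both sequences. How large \<open>n\<close> must be
  may depend on \<open>z\<close>, but \<epsilon> may not.\<close>

definition conical_pair :: "(nat \<Rightarrow> 'a) \<Rightarrow> (nat \<Rightarrow> 'a) \<Rightarrow> bool" where
  "conical_pair x y \<longleftrightarrow> (\<exists>\<epsilon>>0. \<exists>p :: nat \<Rightarrow> 'a. \<forall>z. \<forall>\<^sub>F n in sequentially.
     \<forall>\<^sub>F k in sequentially. \<epsilon> \<le> \<delta> (p n) z (x k) \<and> \<epsilon> \<le> \<delta> (p n) z (y k))"

lemma conical_pair_sym: "conical_pair x y \<Longrightarrow> conical_pair y x"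
  unfolding conical_pair_def by (simp add: conj_commute)

text \<open>For one \<open>n\<close> that serves both \<open>bp\<close> and \<open>z\<close>, Ancona
  bounds \<open>exp (- h' z)\<close> and \<open>u bp\<close> from above through \<open>p n\<close>,
  and superharmonicity bounds \<open>exp (- h' bp)\<close> and \<open>u z\<close> from below through
  the same point. The factors at \<open>p n\<close> cancel, so \<open>L\<close> does not depend on
  \<open>n\<close>, \<open>u\<close> or \<open>z\<close>.\<close>

lemma boundary_harnack:
  assumes gap: "exp_decay \<mu>" and con: "conical_pair x y"
    and x: "martin_limit \<mu> bp x h" and y: "martin_limit \<mu> bp y h'" "filterlim y cofinite sequentially"
  obtains L :: real where "0 < L"
    "\<And>u c z. (\<And>z. P u z = u z) \<Longrightarrow> (\<And>z. u z < \<top>) \<Longrightarrow> (\<And>z. u z \<le> ennreal c * ennreal (exp (- h z))) \<Longrightarrow>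
      ennreal (exp (- h' z)) * u bp \<le> ennreal L * u z"
proof -
  obtain \<epsilon>4 and p :: "nat \<Rightarrow> 'a" where \<epsilon>4: "0 < \<epsilon>4" and p: "\<And>z. \<forall>\<^sub>F n in sequentially.
     \<forall>\<^sub>F k in sequentially. \<epsilon>4 \<le> \<delta> (p n) z (x k) \<and> \<epsilon>4 \<le> \<delta> (p n) z (y k)"
    using con unfolding conical_pair_def by blast
  define \<epsilon> where "\<epsilon> = \<epsilon>4 / 4"
  have \<epsilon>: "0 < \<epsilon>" "4 * \<epsilon> = \<epsilon>4" using \<epsilon>4 by (auto simp: \<epsilon>_def)
  obtain A where A0: "0 < A" and A: "\<And>v x z. \<epsilon> \<le> \<delta> v x z \<Longrightarrow> G x z \<le> ennreal A * (G x v * G v z)"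
    by (rule ancona [OF gap \<epsilon>(1)]) blast
  define g where "g = green \<mu> 0 0"
  have g: "0 < g" by (simp add: g_def green_real_pos)
  have gG: "G q q = ennreal g" for q using green_kernel_diag [of w q] by (simp add: g_def green_eq)
  show ?thesis
  proof (rule that [of "A * A * g * g"])
    show "0 < A * A * g * g" using A0 g by simp
    fix u c z
    assume u: "\<And>z. P u z = u z" "\<And>z. u z < \<top>" "\<And>z. u z \<le> ennreal c * ennreal (exp (- h z))"
    let ?k = "\<lambda>z. ennreal (exp (- h' z))"
    obtain n where n: "\<forall>\<^sub>F k in sequentially. \<epsilon>4 \<le> \<delta> (p n) bp (x k) \<and> \<epsilon>4 \<le> \<delta> (p n) bp (y k)"
      "\<forall>\<^sub>F k in sequentially. \<epsilon>4 \<le> \<delta> (p n) z (x k) \<and> \<epsilon>4 \<le> \<delta> (p n) z (y k)"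
      using eventually_happens' [OF sequentially_bot eventually_conj [OF p [of bp] p [of z]]] by blast
    let ?p = "p n"
    have uo: "u bp \<le> ennreal A * G bp ?p * u ?p"
      by (rule harmonic_le_through [OF \<epsilon>(1) A0 A x u]) (use n(1) \<epsilon>(2) in \<open>auto elim: eventually_mono\<close>)
    have "\<forall>\<^sub>F k in sequentially. \<epsilon> \<le> \<delta> ?p z (y k)"
      using n(2) by (rule eventually_mono) (use \<epsilon> in auto)
    then have kz: "?k z \<le> ennreal A * G z ?p * ?k ?p"
      by (intro kernel_le_green [OF A A0 y(1)] eventually_frequently) auto
    have ko: "?k ?p * G bp ?p \<le> ennreal g * ?k bp"
      using superharmonic_ge_green [of w ?k ?p bp] kernel_harmonic [OF y(2,1)] by (simp add: gG)
    have uz: "u ?p * G z ?p \<le> ennreal g * u z"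
      using superharmonic_ge_green [of w u ?p z] u by (simp add: gG)
    have "?k z * u bp \<le> (ennreal A * G z ?p * ?k ?p) * (ennreal A * G bp ?p * u ?p)"
      by (intro mult_mono kz uo) auto
    also have "\<dots> = ennreal A * ennreal A * ((?k ?p * G bp ?p) * (u ?p * G z ?p))" by (simp only: mult_ac)
    also have "\<dots> \<le> ennreal A * ennreal A * ((ennreal g * ?k bp) * (ennreal g * u z))"
      by (intro mult_left_mono mult_mono ko uz) auto
    also have "\<dots> = ennreal (A * A * g * g) * u z"
      using A0 g martin_limit_base [OF y(1)] by (simp add: ennreal_mult mult_ac)
    finally show "?k z * u bp \<le> ennreal (A * A * g * g) * u z" .
  qed
qed

lemma conical_kernel_le:
  assumes gap: "exp_decay \<mu>" and con: "conical_pair x y"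
    and x: "martin_limit \<mu> bp x h" "filterlim x cofinite sequentially"
    and y: "martin_limit \<mu> bp y h'" "filterlim y cofinite sequentially"
  shows "exp (- h' z) \<le> exp (- h z)"
proof -
  obtain L :: real where L: "0 < L" and bh: "\<And>u c z. (\<And>z. P u z = u z) \<Longrightarrow> (\<And>z. u z < \<top>) \<Longrightarrow>
      (\<And>z. u z \<le> ennreal c * ennreal (exp (- h z))) \<Longrightarrow> ennreal (exp (- h' z)) * u bp \<le> ennreal L * u z"
    by (rule boundary_harnack [OF gap con x(1) y]) blast
  let ?k = "\<lambda>z. exp (- h z)" and ?k' = "\<lambda>z. exp (- h' z)"
  have base: "?k bp = 1" "?k' bp = 1" using martin_limit_base x(1) y(1) by simp_all
  define T where "T = {t. 0 \<le> t \<and> (\<forall>z. t * ?k' z \<le> ?k z)}"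
  have T0: "0 \<in> T" by (simp add: T_def)
  have T1: "t \<le> 1" if "t \<in> T" for t
  proof -
    have "t * ?k' bp \<le> ?k bp" using that unfolding T_def by blast
    then show ?thesis unfolding base by simp
  qed
  have bdd: "bdd_above T" using T1 by (intro bdd_aboveI) blast
  define t where "t = Sup T"
  have t: "0 \<le> t" "t \<le> 1"
    unfolding t_def using T0 T1 bdd cSup_upper [OF T0 bdd] cSup_least [of T 1] by auto
  have tk: "t * ?k' z \<le> ?k z" for z
  proof -
    have "t \<le> ?k z / ?k' z"
      unfolding t_def using T0 by (intro cSup_least) (auto simp: T_def le_divide_eq)
    then show ?thesis by (simp add: le_divide_eq)
  qed
  define u where "u z = ennreal (?k z - t * ?k' z)" for z
  have sum: "ennreal (?k z) = u z + ennreal t * ennreal (?k' z)" for z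
    using tk [of z] t by (simp add: u_def ennreal_mult [symmetric] ennreal_plus [symmetric] del: ennreal_plus)
  have "P u z = u z" for z
  proof -
    have "ennreal (?k z) = P (\<lambda>z. ennreal (?k z)) z" by (rule kernel_harmonic [OF x(2,1), symmetric])
    also have "\<dots> = P u z + ennreal t * P (\<lambda>z. ennreal (?k' z)) z"
      unfolding sum markov_add markov_cmult ..
    also have "\<dots> = P u z + ennreal t * ennreal (?k' z)"
      by (simp only: kernel_harmonic [OF y(2,1)])
    finally have "u z + ennreal t * ennreal (?k' z) = P u z + ennreal t * ennreal (?k' z)"
      by (simp only: sum)
    moreover have "ennreal t * ennreal (?k' z) \<noteq> \<top>" by (simp add: ennreal_mult_eq_top_iff)
    ultimately show ?thesis
      using ennreal_add_diff_cancel_right [of "ennreal t * ennreal (?k' z)"] by metis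
  qed
  moreover have "u z < \<top>" for z by (simp add: u_def)
  moreover have "u z \<le> ennreal 1 * ennreal (?k z)" for z
    using t by (auto simp: u_def intro!: ennreal_leI)
  ultimately have bhu: "ennreal (?k' z) * u bp \<le> ennreal L * u z" for z by (rule bh)
  \<comment> \<open>Both kernels are 1 at \<open>bp\<close>, so \<open>u bp = 1 - t\<close>; for
    \<open>t < 1\<close> the lower bound on \<open>u\<close> would allow a larger multiple of
    \<open>exp (- h')\<close>, against maximality.\<close>
  have "t + (1 - t) / L \<in> T"
  proof -
    have "(t + (1 - t) / L) * ?k' z \<le> ?k z" for z
    proof -
      have "ennreal (?k' z * (1 - t)) \<le> ennreal (L * (?k z - t * ?k' z))"
        using bhu [of z] L t tk [of z] unfolding u_def base by (simp add: ennreal_mult)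
      then have "?k' z * (1 - t) \<le> L * (?k z - t * ?k' z)"
        using L tk [of z] by (subst (asm) ennreal_le_iff) auto
      then show ?thesis using L by (simp add: field_simps)
    qed
    then show ?thesis using t L by (simp add: T_def)
  qed
  then have "t + (1 - t) / L \<le> t" unfolding t_def by (rule cSup_upper [OF _ bdd])
  then have "(1 - t) / L \<le> 0" by simp
  then have "1 \<le> t" using L by (simp add: divide_le_0_iff)
  then have "1 * ?k' z \<le> t * ?k' z" by (intro mult_right_mono) auto
  from order_trans [OF this tk] show ?thesis by (simp only: mult_1)
qed

theorem conical_martin_limit_unique:
  assumes "exp_decay \<mu>" "conical_pair x y"
    and "martin_limit \<mu> bp x h" "filterlim x cofinite sequentially"
    and "martin_limit \<mu> bp y h'" "filterlim y cofinite sequentially"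
  shows "h = h'"
proof
  fix z
  show "h z = h' z"
    using conical_kernel_le [OF assms, of z]
      conical_kernel_le [OF assms(1) conical_pair_sym [OF assms(2)] assms(5,6,3,4), of z] by simp
qed

end

section \<open>The boundary map\<close>

context floyd
begin

text \<open>By \<open>base_change\<close> in both directions the base points \<open>v\<close> and 0
  give equivalent metrics, with the same Cauchy sequences and the same pairs at distance 0.\<close>

lemma floyd_equiv_iff:
  fixes s t :: "nat \<Rightarrow> 'a"
  shows "(s, t) \<in> floyd_equiv S f v \<longleftrightarrow> cau s \<and> cau t \<and> gap s t = 0"
proof -
  obtain K where K: "1 \<le> K" "\<And>x y. \<delta> v x y \<le> K * \<delta> 0 x y" by (rule base_change) blast
  obtain K' where K': "1 \<le> K'" "\<And>x y. \<delta> 0 x y \<le> K' * \<delta> v x y" by (rule base_change) blast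
  have Cauchy: "Metric_space.MCauchy UNIV (\<delta> a) s" if sC: "Metric_space.MCauchy UNIV (\<delta> b) s"
    and "1 \<le> K" and "\<And>x y. \<delta> a x y \<le> K * \<delta> b x y" for a b K s
  proof -
    interpret A: Metric_space UNIV "\<delta> a" by (rule Metric_space_\<delta>)
    interpret B: Metric_space UNIV "\<delta> b" by (rule Metric_space_\<delta>)
    show ?thesis
      unfolding A.MCauchy_def
    proof (intro conjI allI impI)
      fix e :: real assume "0 < e"
      then have "0 < e / K" using that by simp
      then obtain N where N: "\<And>m n. N \<le> m \<Longrightarrow> N \<le> n \<Longrightarrow> \<delta> b (s m) (s n) < e / K"
        using sC unfolding B.MCauchy_def by meson
      show "\<exists>N. \<forall>n n'. N \<le> n \<longrightarrow> N \<le> n' \<longrightarrow> \<delta> a (s n) (s n') < e"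
      proof (intro exI [of _ N] allI impI)
        fix m n assume "N \<le> m" "N \<le> n"
        then have "K * \<delta> b (s m) (s n) < e"
          using N [of m n] that(2) by (simp add: less_divide_eq mult.commute)
        then show "\<delta> a (s m) (s n) < e" using that(3) [of "s m" "s n"] by linarith
      qed
    qed simp
  qed
  have null: "(\<lambda>n. \<delta> a (s n) (t n)) \<longlonglongrightarrow> 0" if lim: "(\<lambda>n. \<delta> b (s n) (t n)) \<longlonglongrightarrow> 0"
    and "\<And>x y. \<delta> a x y \<le> K * \<delta> b x y" for a b K and s t :: "nat \<Rightarrow> 'a"
  proof -
    have lim': "(\<lambda>n. K * \<delta> b (s n) (t n)) \<longlonglongrightarrow> 0"
      using tendsto_mult_left [OF lim, of K] by simp
    show ?thesis by (rule tendsto_sandwich [OF _ _ tendsto_const lim']) (simp_all add: that(2))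
  qed
  have cau: "Metric_space.MCauchy UNIV (\<delta> v) s \<longleftrightarrow> cau s" for s
    unfolding cau_iff_MCauchy using Cauchy [OF _ K] Cauchy [OF _ K'] by blast
  have "(\<lambda>n. \<delta> v (s n) (t n)) \<longlonglongrightarrow> 0 \<longleftrightarrow> gap s t = 0" if c: "cau s" "cau t" for s t
  proof
    assume "(\<lambda>n. \<delta> v (s n) (t n)) \<longlonglongrightarrow> 0"
    then show "gap s t = 0" by (intro gap_unique c null [OF _ K'(2)])
  next
    assume "gap s t = 0"
    then show "(\<lambda>n. \<delta> v (s n) (t n)) \<longlonglongrightarrow> 0"
      using null [OF _ K(2)] cau_limit [OF c] by simp
  qed
  then show ?thesis by (auto simp: floyd_equiv_def cau)
qed

lemma MCauchy_iff_cau: "Metric_space.MCauchy UNIV (\<delta> v) s \<longleftrightarrow> cau s"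
proof -
  interpret Metric_space UNIV "\<delta> v" by (rule Metric_space_\<delta>)
  have "MCauchy s \<longleftrightarrow> (s, s) \<in> floyd_equiv S f v" by (simp add: floyd_equiv_def)
  then show ?thesis by (simp add: floyd_equiv_iff)
qed

text \<open>Free of a base point: by \<open>floyd_class\<close> every \<open>v\<close> yields the
  same class as a set.\<close>

definition cl :: "(nat \<Rightarrow> 'a) \<Rightarrow> (nat \<Rightarrow> 'a) set" where
  "cl s = {t. cau s \<and> cau t \<and> gap s t = 0}"

lemma floyd_class: "floyd_equiv S f v `` {s} = cl s"
  by (auto simp: cl_def floyd_equiv_iff)

lemma cl_eq_iff: "cau s \<Longrightarrow> cau t \<Longrightarrow> cl s = cl t \<longleftrightarrow> gap s t = 0"
  using eq_equiv_class_iff [OF equiv_floyd_equiv [OF gen ff, of 0], of s t]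
  by (simp add: floyd_class floyd_equiv_iff MCauchy_iff_cau)

lemma compactification_iff: "X \<in> floyd_compactification S f v \<longleftrightarrow> (\<exists>s. cau s \<and> X = cl s)"
  by (auto simp: floyd_compactification_def quotient_def floyd_class MCauchy_iff_cau)

lemma floyd_embed_eq: "floyd_embed S f v g = cl (point g)"
  by (simp add: floyd_embed_def floyd_class)

lemma floyd_act_cl: "cau s \<Longrightarrow> floyd_act S f v g (cl s) = cl (\<lambda>n. g + s n)"
  using floyd_act_class(2) [OF gen ff, of v s g] by (simp add: floyd_class MCauchy_iff_cau)

lemma bseq_gap_point: "bseq s \<Longrightarrow> gap s (point g) \<noteq> 0"
proof
  assume s: "bseq s" and zero: "gap s (point g) = 0"
  then have "filterlim s cofinite sequentially" by (simp add: bseq_def escaping_iff)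
  moreover have "eventually (\<lambda>y. y \<noteq> g) cofinite" by (simp add: eventually_cofinite)
  ultimately have "\<forall>\<^sub>F n in sequentially. s n \<noteq> g" unfolding filterlim_iff by blast
  then have "\<forall>\<^sub>F n in sequentially. f (real (d 0 g)) \<le> \<delta> 0 (s n) (point g n)"
    by (rule eventually_mono) (use \<delta>_ge_isolated [of g "s _" 0] \<delta>_commute in metis)
  then have "f (real (d 0 g)) \<le> gap s (point g)"
    using s by (intro tendsto_lowerbound [OF cau_limit]) (auto simp: bseq_def)
  then show False using zero f_pos [of "d 0 g"] by simp
qed

text \<open>A Cauchy sequence that does not escape visits a finite ball infinitely often, hence some
  element of it, and converges to that element.\<close>

lemma cau_cases:
  assumes "cau s"
  obtains "bseq s" | g where "gap s (point g) = 0"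
proof (cases "escaping s")
  case True
  with assms that show ?thesis by (simp add: bseq_def)
next
  case False
  then obtain R where R: "\<not> (\<forall>\<^sub>F n in sequentially. R \<le> word_norm S (s n))"
    by (auto simp: escaping_def filterlim_at_top)
  obtain r :: "nat \<Rightarrow> nat" where r: "strict_mono r" "\<And>n. \<not> R \<le> word_norm S (s (r n))"
    using not_eventually_sequentiallyD [OF R] by blast
  have "range (s \<circ> r) \<subseteq> {g. word_norm S g \<le> R}" using r(2) by (auto simp: not_le less_imp_le)
  then have fin: "finite (range (s \<circ> r))" using finite_word_ball [OF gen] finite_subset by blast
  obtain n where n: "infinite {m. (s \<circ> r) m = (s \<circ> r) n}"
    using pigeonhole_infinite [OF infinite_UNIV_nat fin] by auto
  obtain q :: "nat \<Rightarrow> nat" where q: "strict_mono q" "\<And>m. (s \<circ> r) (q m) = (s \<circ> r) n"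
    using infinite_enumerate [OF n] by auto
  have "(s \<circ> (r \<circ> q)) = point ((s \<circ> r) n)" using q(2) by (auto simp: fun_eq_iff)
  moreover have "gap (s \<circ> (r \<circ> q)) s = 0" using cau_subseq(2) [OF assms] r(1) q(1) strict_mono_o by blast
  ultimately have "gap s (point ((s \<circ> r) n)) = 0" by (simp add: gap_commute)
  then show ?thesis by (rule that(2))
qed

lemma boundary_iff: "X \<in> floyd_boundary S f v \<longleftrightarrow> (\<exists>s. bseq s \<and> X = cl s)"
proof
  assume "X \<in> floyd_boundary S f v"
  then obtain s where s: "cau s" "X = cl s" and ne: "\<And>g. X \<noteq> cl (point g)"
    unfolding floyd_boundary_def by (auto simp: compactification_iff floyd_embed_eq)
  from s(1) show "\<exists>s. bseq s \<and> X = cl s"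
  proof (cases rule: cau_cases)
    case 1
    then show ?thesis using s by blast
  next
    case (2 g)
    then show ?thesis using ne [of g] s cl_eq_iff [OF s(1) cau_point] by simp
  qed
next
  assume "\<exists>s. bseq s \<and> X = cl s"
  then obtain s where s: "bseq s" "X = cl s" by blast
  have "X \<noteq> cl (point g)" for g
    using bseq_gap_point [OF s(1), of g] cl_eq_iff [of s "point g"] s by (simp add: bseq_def)
  then show "X \<in> floyd_boundary S f v"
    using s by (auto simp: floyd_boundary_def compactification_iff floyd_embed_eq bseq_def)
qed

lemma compactification_dist_gap:
  obtains K where "1 \<le> K"
    "\<And>s t. cau s \<Longrightarrow> cau t \<Longrightarrow> floyd_compactification_dist S f v (cl s) (cl t) \<le> K * gap s t"
    "\<And>s t. cau s \<Longrightarrow> cau t \<Longrightarrow> gap s t \<le> K * floyd_compactification_dist S f v (cl s) (cl t)"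
proof -
  obtain K where K: "1 \<le> K" "\<And>x y. \<delta> v x y \<le> K * \<delta> 0 x y" by (rule base_change) blast
  obtain K' where K': "1 \<le> K'" "\<And>x y. \<delta> 0 x y \<le> K' * \<delta> v x y" by (rule base_change) blast
  let ?D = "floyd_compactification_dist S f v"
  have lim: "(\<lambda>n. \<delta> v (s n) (t n)) \<longlonglongrightarrow> ?D (cl s) (cl t)" if "cau s" "cau t" for s t
    using floyd_compactification_dist_class [OF gen ff, of v s t] that by (simp add: MCauchy_iff_cau floyd_class)
  have 1: "?D (cl s) (cl t) \<le> max K K' * gap s t" if c: "cau s" "cau t" for s t
  proof (rule LIMSEQ_le [OF lim [OF c] tendsto_mult_left [OF cau_limit [OF c]]], intro exI allI impI)
    fix n
    show "\<delta> v (s n) (t n) \<le> max K K' * \<delta> 0 (s n) (t n)"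
      by (rule order_trans [OF K(2)]) (intro mult_right_mono, auto)
  qed
  have 2: "gap s t \<le> max K K' * ?D (cl s) (cl t)" if c: "cau s" "cau t" for s t
  proof (rule LIMSEQ_le [OF cau_limit [OF c] tendsto_mult_left [OF lim [OF c]]], intro exI allI impI)
    fix n
    show "\<delta> 0 (s n) (t n) \<le> max K K' * \<delta> v (s n) (t n)"
      by (rule order_trans [OF K'(2)]) (intro mult_right_mono, auto)
  qed
  show ?thesis by (rule that [of "max K K'"]) (use K(1) 1 2 in auto)
qed

lemma limitin_floyd_iff:
  assumes s: "cau s" and t: "\<And>n. cau (t n)"
  shows "limitin (floyd_topology S f v) (\<lambda>n. cl (t n)) (cl s) sequentially \<longleftrightarrow> (\<lambda>n. gap (t n) s) \<longlonglongrightarrow> 0"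
proof -
  let ?D = "floyd_compactification_dist S f v"
  interpret M: Metric_space "floyd_compactification S f v" ?D
    by (rule Metric_space_floyd_compactification [OF gen ff])
  obtain K where K: "1 \<le> K" "\<And>s t. cau s \<Longrightarrow> cau t \<Longrightarrow> ?D (cl s) (cl t) \<le> K * gap s t"
    "\<And>s t. cau s \<Longrightarrow> cau t \<Longrightarrow> gap s t \<le> K * ?D (cl s) (cl t)"
    by (rule compactification_dist_gap [of v]) blast
  have mem: "cl s \<in> floyd_compactification S f v" "cl (t n) \<in> floyd_compactification S f v" for n
    using s t by (auto simp: compactification_iff)
  have "limitin (floyd_topology S f v) (\<lambda>n. cl (t n)) (cl s) sequentially \<longleftrightarrow> (\<lambda>n. ?D (cl (t n)) (cl s)) \<longlonglongrightarrow> 0"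
    by (simp add: floyd_topology_def M.limitin_metric_dist_null mem)
  also have "\<dots> \<longleftrightarrow> (\<lambda>n. gap (t n) s) \<longlonglongrightarrow> 0"
  proof
    assume "(\<lambda>n. ?D (cl (t n)) (cl s)) \<longlonglongrightarrow> 0"
    from tendsto_mult_left [OF this, of K] have lim: "(\<lambda>n. K * ?D (cl (t n)) (cl s)) \<longlonglongrightarrow> 0" by simp
    show "(\<lambda>n. gap (t n) s) \<longlonglongrightarrow> 0"
      by (rule tendsto_sandwich [OF _ _ tendsto_const lim]) (simp_all add: K(3) s t gap_nonneg)
  next
    assume "(\<lambda>n. gap (t n) s) \<longlonglongrightarrow> 0"
    from tendsto_mult_left [OF this, of K] have lim: "(\<lambda>n. K * gap (t n) s) \<longlonglongrightarrow> 0" by simp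
    show "(\<lambda>n. ?D (cl (t n)) (cl s)) \<longlonglongrightarrow> 0"
      by (rule tendsto_sandwich [OF _ _ tendsto_const lim]) (simp_all add: K(2) s t)
  qed
  finally show ?thesis .
qed

end

section \<open>Compactness for Martin limits\<close>

context superexp_walk
begin

lemma green_dist_diff_bounded:
  obtains B where "\<And>x. \<bar>green_dist \<mu> z x - green_dist \<mu> bp x\<bar> \<le> B"
proof -
  obtain C where C: "1 \<le> C" and har: "\<And>u x y. (\<forall>x. P u x \<le> u x) \<Longrightarrow> u y \<le> ennreal (C ^ word_dist S x y) * u x"
    using harnack by blast
  have le: "ln (ratio a b x) \<le> real (word_dist S a b) * ln C" for a b x
  proof -
    have "G b x \<le> ennreal (C ^ word_dist S a b) * G a x"
      by (rule har [of "\<lambda>z. G z x"]) (simp add: green_kernel_superharmonic)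
    then have "ennreal (green \<mu> b x) \<le> ennreal (C ^ word_dist S a b * green \<mu> a x)"
      using C by (simp add: green_eq ennreal_mult' )
    then have "green \<mu> b x \<le> C ^ word_dist S a b * green \<mu> a x"
      using C green_real_pos [of a x] by (subst (asm) ennreal_le_iff) auto
    then have "ratio a b x \<le> C ^ word_dist S a b"
      using green_real_pos [of a x] by (simp add: ratio_def divide_le_eq)
    then have "ln (ratio a b x) \<le> ln (C ^ word_dist S a b)"
      using ratio_pos [of a b x] C by (subst ln_le_cancel_iff) auto
    then show ?thesis using C by (simp add: ln_realpow)
  qed
  have eq: "green_dist \<mu> b x - green_dist \<mu> a x = - ln (ratio a b x)" for a b x
    by (simp add: ratio_eq_exp)
  have "\<bar>green_dist \<mu> z x - green_dist \<mu> bp x\<bar> \<le> real (word_dist S bp z + word_dist S z bp) * ln C" for x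
  proof -
    have 0: "0 \<le> real (word_dist S bp z) * ln C" "0 \<le> real (word_dist S z bp) * ln C" using C by auto
    show ?thesis
      using eq [of z x bp] eq [of bp x z] le [of bp z x] le [of z bp x] 0
      unfolding of_nat_add distrib_right by linarith
  qed
  then show ?thesis by (rule that)
qed

text \<open>Harnack bounds each difference of Green distances, and a diagonal sequence over the
  countable group makes all of them converge.\<close>

lemma martin_limit_subseq_exists:
  obtains r :: "nat \<Rightarrow> nat" and h where "strict_mono r" "martin_limit \<mu> bp (s \<circ> r) h"
proof -
  define D where "D z x = green_dist \<mu> z x - green_dist \<mu> bp x" for z x
  have "countable (UNIV :: 'a set)" by (rule countable_sym_gen [OF sym_gen])
  define e :: "nat \<Rightarrow> 'a" where "e = from_nat_into UNIV"
  have e: "range e = UNIV"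
    unfolding e_def using \<open>countable (UNIV :: 'a set)\<close> by (intro range_from_nat_into) auto
  interpret subseqs "\<lambda>k (r :: nat \<Rightarrow> nat). convergent (\<lambda>n. D (e k) (s (r n)))"
  proof
    fix k and q :: "nat \<Rightarrow> nat"
    obtain B where B: "\<And>x. \<bar>D (e k) x\<bar> \<le> B"
      unfolding D_def by (rule green_dist_diff_bounded [of "e k" bp]) blast
    have "bounded (range (\<lambda>n. D (e k) (s (q n))))"
      unfolding bounded_iff using B by auto
    then obtain l r where "strict_mono r" "((\<lambda>n. D (e k) (s (q n))) \<circ> r) \<longlonglongrightarrow> l"
      using bounded_imp_convergent_subsequence by blast
    then show "\<exists>r. strict_mono r \<and> convergent (\<lambda>n. D (e k) (s ((q \<circ> r) n)))"
      by (auto simp: comp_def convergent_def)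
  qed
  have conv: "convergent (\<lambda>n. D z (s (diagseq n)))" for z
  proof -
    obtain k where k: "z = e k" using e by blast
    have "convergent (\<lambda>n. D (e k) (s ((diagseq \<circ> (+) (Suc k)) n)))"
    proof (rule diagseq_holds)
      fix r q :: "nat \<Rightarrow> nat" and n
      assume "strict_mono r" "convergent (\<lambda>m. D (e n) (s (q m)))"
      then show "convergent (\<lambda>m. D (e n) (s ((q \<circ> r) m)))"
        using convergent_subseq_convergent [of "\<lambda>m. D (e n) (s (q m))" r] by (simp add: comp_def)
    qed
    then have "convergent (\<lambda>n. D (e k) (s (diagseq (n + Suc k))))" by (simp add: comp_def add.commute)
    then show ?thesis
      unfolding k using convergent_ignore_initial_segment [of "\<lambda>n. D (e k) (s (diagseq n))" "Suc k"] by simp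
  qed
  have "martin_limit \<mu> bp (s \<circ> diagseq) (\<lambda>z. lim (\<lambda>n. D z (s (diagseq n))))"
    using conv unfolding martin_limit_def convergent_LIMSEQ_iff D_def comp_def by blast
  with subseq_diagseq that show ?thesis by blast
qed

lemma martin_limit_filterlim:
  assumes "martin_limit \<mu> bp x h" "filterlim m sequentially sequentially"
  shows "martin_limit \<mu> bp (\<lambda>n. x (m n)) h"
  unfolding martin_limit_def
proof
  fix z
  have "(\<lambda>n. green_dist \<mu> z (x n) - green_dist \<mu> bp (x n)) \<longlonglongrightarrow> h z"
    using assms(1) unfolding martin_limit_def by blast
  from filterlim_compose [OF this assms(2)]
  show "(\<lambda>n. green_dist \<mu> z (x (m n)) - green_dist \<mu> bp (x (m n))) \<longlonglongrightarrow> h z" .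
qed

end

section \<open>Comparison of Martin and Floyd limits\<close>

context floyd_walk
begin

definition witness :: "'a \<Rightarrow> ('a \<Rightarrow> real) \<Rightarrow> (nat \<Rightarrow> 'a) \<Rightarrow> bool" where
  "witness bp h s \<longleftrightarrow> bseq s \<and> martin_limit \<mu> bp s h"

text \<open>An unbounded sequence need not escape, but its range is infinite and so contains a
  boundary sequence. The indices of the latter tend to infinity because it leaves the finite set of
  the first \<open>j\<close> terms, for every \<open>j\<close>.\<close>

lemma martin_boundary_iff: "h \<in> martin_boundary S \<mu> bp \<longleftrightarrow> (\<exists>s. witness bp h s)"
proof
  assume "h \<in> martin_boundary S \<mu> bp"
  then obtain x where x: "\<And>r. \<exists>n. r < word_dist S bp (x n)" and lim: "martin_limit \<mu> bp x h"
    unfolding martin_boundary_def by blast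
  have "infinite (range x)"
  proof
    assume "finite (range x)"
    then have fin: "finite (word_dist S bp ` range x)" by (rule finite_imageI)
    obtain n where "Max (word_dist S bp ` range x) < word_dist S bp (x n)" using x by blast
    moreover have "word_dist S bp (x n) \<le> Max (word_dist S bp ` range x)" by (rule Max_ge [OF fin]) simp
    ultimately show False by simp
  qed
  then obtain s where s: "bseq s" "\<And>n. s n \<in> range x" by (rule infinite_bseq_exists) blast
  then have "\<forall>n. \<exists>m. s n = x m" by blast
  then obtain m where m: "\<And>n. s n = x (m n)" by metis
  have sx: "s = (\<lambda>n. x (m n))" using m by (rule ext)
  have "filterlim m sequentially sequentially"
    unfolding filterlim_at_top
  proof
    fix j
    have "eventually (\<lambda>y. y \<notin> x ` {..<j}) cofinite" by (simp add: eventually_cofinite)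
    then have "\<forall>\<^sub>F n in sequentially. s n \<notin> x ` {..<j}"
      using s(1) unfolding bseq_def escaping_iff filterlim_iff by blast
    then show "\<forall>\<^sub>F n in sequentially. j \<le> m n"
      by (rule eventually_mono) (metis m image_eqI lessThan_iff not_le)
  qed
  then have "martin_limit \<mu> bp s h" unfolding sx by (rule martin_limit_filterlim [OF lim])
  then show "\<exists>s. witness bp h s" using s(1) unfolding witness_def by blast
next
  assume "\<exists>s. witness bp h s"
  then obtain s where s: "bseq s" "martin_limit \<mu> bp s h" unfolding witness_def by blast
  have "\<exists>n. r < word_dist S bp (s n)" for r
  proof -
    have "\<forall>\<^sub>F n in sequentially. r + word_norm S bp + 1 \<le> word_norm S (s n)"
      using s(1) escapingD by (simp add: bseq_def)
    then obtain n where "r + word_norm S bp + 1 \<le> word_norm S (s n)"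
      by (auto simp: eventually_sequentially)
    moreover have "word_norm S (s n) \<le> word_norm S bp + word_dist S bp (s n)"
      using word_norm_add [OF gen, of bp "- bp + s n"] by (simp add: word_dist_def add.assoc [symmetric])
    ultimately show ?thesis by (intro exI [of _ n]) simp
  qed
  then show "h \<in> martin_boundary S \<mu> bp" unfolding martin_boundary_def using s(2) by blast
qed

lemma witness_gap: "witness bp h s \<Longrightarrow> witness bp h t \<Longrightarrow> gap s t = 0"
  unfolding witness_def using martin_limit_determines_floyd_limit by blast

lemma witness_bseq: "witness bp h s \<Longrightarrow> bseq s"
  by (simp add: witness_def)

lemma witness_cau: "witness bp h s \<Longrightarrow> cau s"
  by (simp add: witness_def bseq_def)

text \<open>Otherwise a subsequence stays away from \<open>s\<close>. By compactness part of it is a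
  boundary sequence with the same Martin limit, and \<open>witness_gap\<close> puts it at distance 0
  from \<open>s\<close>.\<close>

lemma martin_limit_gap_tendsto:
  assumes x: "escaping x" "martin_limit \<mu> bp x h" and s: "witness bp h s"
  shows "(\<lambda>n. gap (point (x n)) s) \<longlonglongrightarrow> 0"
proof (rule ccontr)
  assume "\<not> ?thesis"
  then obtain e where e: "0 < e" "\<not> (\<forall>\<^sub>F n in sequentially. dist (gap (point (x n)) s) 0 < e)"
    unfolding tendsto_iff by blast
  obtain r :: "nat \<Rightarrow> nat" where r: "strict_mono r" "\<And>n. \<not> dist (gap (point (x (r n))) s) 0 < e"
    using not_eventually_sequentiallyD [OF e(2)] by blast
  obtain q where q: "strict_mono q" "bseq (x \<circ> r \<circ> q)"
    by (rule bseq_subseq_exists [OF escaping_subseq [OF x(1) r(1)]]) blast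
  have rq: "strict_mono (r \<circ> q)" using r(1) q(1) by (rule strict_mono_o)
  have "witness bp h (x \<circ> (r \<circ> q))"
    unfolding witness_def using q(2) martin_limit_subseq [OF x(2) rq] by (simp add: comp_assoc)
  from witness_gap [OF this s] have "(\<lambda>n. gap (point ((x \<circ> (r \<circ> q)) n)) s) \<longlonglongrightarrow> 0"
    using gap_point_tendsto [of "x \<circ> (r \<circ> q)" s] q(2) witness_cau [OF s] by (simp add: bseq_def comp_assoc)
  then have "\<forall>\<^sub>F n in sequentially. dist (gap (point ((x \<circ> (r \<circ> q)) n)) s) 0 < e"
    using e(1) unfolding tendsto_iff by blast
  then show False using r(2) by (auto simp: eventually_sequentially)
qed

text \<open>If it failed, for each \<open>k\<close> some group element of norm at least
  \<open>k\<close> would approximate \<open>h0\<close> on the ball of radius \<open>k\<close> up to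
  order \<open>1 / k\<close>, yet stay \<open>e / 2\<close> away from \<open>s0\<close>. These
  elements form a single sequence with Martin limit \<open>h0\<close>, against
  \<open>martin_limit_gap_tendsto\<close>.\<close>

lemma witness_continuous:
  assumes h0: "witness bp h0 s0" and e: "0 < e"
  shows "\<exists>F \<eta>. finite F \<and> 0 < \<eta> \<and>
    (\<forall>h s. witness bp h s \<longrightarrow> (\<forall>z\<in>F. \<bar>h z - h0 z\<bar> < \<eta>) \<longrightarrow> gap s s0 < e)"
proof (rule ccontr)
  define good where "good F \<eta> \<longleftrightarrow>
    (\<forall>h s. witness bp h s \<longrightarrow> (\<forall>z\<in>F. \<bar>h z - h0 z\<bar> < \<eta>) \<longrightarrow> gap s s0 < e)" for F \<eta>
  assume "\<not> ?thesis"
  then have neg: "\<not> good F \<eta>" if "finite F" "0 < \<eta>" for F \<eta>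
    using that unfolding good_def [symmetric] by blast
  let ?D = "\<lambda>z x. green_dist \<mu> z x - green_dist \<mu> bp x"
  define Q where "Q k x \<longleftrightarrow> (\<forall>z\<in>{z. word_norm S z \<le> k}. \<bar>?D z x - h0 z\<bar> < 2 / real (Suc k)) \<and>
    k \<le> word_norm S x \<and> e / 2 \<le> gap (point x) s0" for k x
  have "\<exists>x. Q k x" for k
  proof -
    let ?F = "{z. word_norm S z \<le> k}" and ?\<eta> = "1 / real (Suc k)"
    have F: "finite ?F" "0 < ?\<eta>" using finite_word_ball [OF gen] by auto
    then have "\<not> good ?F ?\<eta>" by (rule neg)
    then obtain h s where s: "witness bp h s" "\<And>z. z \<in> ?F \<Longrightarrow> \<bar>h z - h0 z\<bar> < ?\<eta>" "e \<le> gap s s0"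
      unfolding good_def not_all not_imp not_less by blast
    have "\<forall>\<^sub>F n in sequentially. \<bar>?D z (s n) - h z\<bar> < ?\<eta>" for z
    proof -
      have "(\<lambda>n. ?D z (s n)) \<longlonglongrightarrow> h z" using s(1) unfolding witness_def martin_limit_def by blast
      then show ?thesis using F(2) unfolding tendsto_iff dist_real_def by blast
    qed
    then have ev1: "\<forall>\<^sub>F n in sequentially. \<forall>z\<in>?F. \<bar>?D z (s n) - h z\<bar> < ?\<eta>"
      by (intro eventually_ball_finite [OF F(1)] ballI)
    have ev2: "\<forall>\<^sub>F n in sequentially. k \<le> word_norm S (s n)"
      using witness_bseq [OF s(1)] escapingD by (simp add: bseq_def)
    have "e / 2 < gap s s0" using s(3) e by simp
    with gap_point_tendsto [OF witness_cau [OF s(1)] witness_cau [OF h0]]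
    have ev3: "\<forall>\<^sub>F n in sequentially. e / 2 < gap (point (s n)) s0" by (rule order_tendstoD)
    obtain n where n: "\<forall>z\<in>?F. \<bar>?D z (s n) - h z\<bar> < ?\<eta>" "k \<le> word_norm S (s n)" "e / 2 < gap (point (s n)) s0"
      using eventually_happens' [OF sequentially_bot eventually_conj [OF ev1 eventually_conj [OF ev2 ev3]]] by blast
    have "\<bar>?D z (s n) - h0 z\<bar> < 2 / real (Suc k)" if "z \<in> ?F" for z
    proof -
      have "\<bar>?D z (s n) - h z\<bar> < ?\<eta>" "\<bar>h z - h0 z\<bar> < ?\<eta>" using n(1) s(2) that by blast+
      moreover have "2 / real (Suc k) = ?\<eta> + ?\<eta>" by simp
      ultimately show ?thesis by linarith
    qed
    then have "Q k (s n)" unfolding Q_def using n(2,3) by (intro conjI ballI) simp_all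
    then show ?thesis by blast
  qed
  then obtain x where x: "\<And>k. Q k (x k)" by metis
  have "escaping x"
    unfolding escaping_def filterlim_at_top
  proof
    fix R
    show "\<forall>\<^sub>F n in sequentially. R \<le> word_norm S (x n)"
      using eventually_ge_at_top [of R]
    proof (rule eventually_mono)
      fix n assume "R \<le> n"
      moreover have "n \<le> word_norm S (x n)" using x [of n] by (simp add: Q_def)
      ultimately show "R \<le> word_norm S (x n)" by simp
    qed
  qed
  moreover have "martin_limit \<mu> bp x h0"
    unfolding martin_limit_def
  proof
    fix z
    have "(\<lambda>k. ?D z (x k) - h0 z) \<longlonglongrightarrow> 0"
    proof (rule Lim_null_comparison)
      show "\<forall>\<^sub>F k in sequentially. norm (?D z (x k) - h0 z) \<le> 2 / real (Suc k)"
        using eventually_ge_at_top [of "word_norm S z"]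
      proof (rule eventually_mono)
        fix k assume "word_norm S z \<le> k"
        then have "\<bar>?D z (x k) - h0 z\<bar> < 2 / real (Suc k)"
          using x [of k] unfolding Q_def by blast
        then show "norm (?D z (x k) - h0 z) \<le> 2 / real (Suc k)" by simp
      qed
      show "(\<lambda>k. 2 / real (Suc k)) \<longlonglongrightarrow> 0"
        using tendsto_mult_left [OF LIMSEQ_inverse_real_of_nat, of 2] by (simp add: divide_inverse)
    qed
    then show "(\<lambda>k. ?D z (x k)) \<longlonglongrightarrow> h0 z" by (rule LIM_zero_cancel)
  qed
  ultimately have "(\<lambda>n. gap (point (x n)) s0) \<longlonglongrightarrow> 0" using h0 by (rule martin_limit_gap_tendsto)
  then have "\<forall>\<^sub>F n in sequentially. gap (point (x n)) s0 < e / 2" using e by (intro order_tendstoD) auto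
  then obtain n where "gap (point (x n)) s0 < e / 2" by (auto simp: eventually_sequentially)
  then show False using x [of n] by (simp add: Q_def)
qed

lemma witness_exists:
  assumes "bseq s"
  obtains h and r :: "nat \<Rightarrow> nat" where "strict_mono r" "witness bp h (s \<circ> r)"
proof -
  obtain r h where "strict_mono r" "martin_limit \<mu> bp (s \<circ> r) h" by (rule martin_limit_subseq_exists) blast
  with bseq_subseq [OF assms] that show ?thesis by (simp add: witness_def)
qed

lemma witness_act:
  assumes "witness bp h s"
  shows "witness bp (martin_act bp g h) (\<lambda>n. g + s n)"
proof -
  have "martin_converges \<mu> bp s h"
    using assms by (simp add: witness_def martin_converges_def bseq_def escaping_iff)
  from martin_converges_act [OF this, of g] show ?thesis
    using assms by (simp add: witness_def martin_converges_def bseq_translate)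
qed

text \<open>The metric \<delta> based at \<open>- g n\<close> is \<delta> based at 0 after
  translation by \<open>g n\<close>. There \<open>z\<close> approaches \<open>b\<close> while both
  sequences approach \<open>a\<close>, so a quarter of the distance from \<open>a\<close> to
  \<open>b\<close> separates them. The points \<open>a\<close> and \<open>b\<close> also supply the
  exponential decay.\<close>

lemma conical_point_unique:
  assumes con: "conical_point S f v \<zeta>" and x: "witness bp h x" "\<zeta> = cl x" and y: "witness bp h' y" "\<zeta> = cl y"
  shows "h = h'"
proof -
  obtain g a b where a: "a \<in> floyd_boundary S f v" and b: "b \<in> floyd_boundary S f v" and ab: "a \<noteq> b"
    and lima: "limitin (floyd_topology S f v) (\<lambda>n. floyd_act S f v (g n) \<zeta>) a sequentially"
    and limb: "\<And>\<eta>. \<eta> \<in> floyd_compactification S f v - {\<zeta>} \<Longrightarrow>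
      limitin (floyd_topology S f v) (\<lambda>n. floyd_act S f v (g n) \<eta>) b sequentially"
    using con unfolding conical_point_def by blast
  obtain \<alpha> where \<alpha>: "bseq \<alpha>" "a = cl \<alpha>" using a unfolding boundary_iff by blast
  obtain \<beta> where \<beta>: "bseq \<beta>" "b = cl \<beta>" using b unfolding boundary_iff by blast
  have c: "cau \<alpha>" "cau \<beta>" using \<alpha> \<beta> by (auto simp: bseq_def)
  have ne: "gap \<alpha> \<beta> \<noteq> 0" using ab cl_eq_iff [OF c] \<alpha> \<beta> by blast
  define \<epsilon> where "\<epsilon> = gap \<alpha> \<beta> / 4"
  have \<epsilon>: "0 < \<epsilon>" "gap \<alpha> \<beta> = 4 * \<epsilon>" using gap_nonzero_pos [OF c ne] by (auto simp: \<epsilon>_def)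
  have toa: "\<forall>\<^sub>F n in sequentially. gap (\<lambda>k. g n + t k) \<alpha> < \<epsilon>" if t: "witness bp k t" "\<zeta> = cl t" for k t
  proof -
    have "(\<lambda>n. floyd_act S f v (g n) \<zeta>) = (\<lambda>n. cl (\<lambda>k. g n + t k))"
      unfolding t(2) using floyd_act_cl [OF witness_cau [OF t(1)]] by (rule ext)
    with lima have "limitin (floyd_topology S f v) (\<lambda>n. cl (\<lambda>k. g n + t k)) (cl \<alpha>) sequentially"
      by (simp only: \<alpha>(2))
    then have "(\<lambda>n. gap (\<lambda>k. g n + t k) \<alpha>) \<longlonglongrightarrow> 0"
      using limitin_floyd_iff [OF c(1), of "\<lambda>n k. g n + t k"] cau_translate [OF witness_cau [OF t(1)]] by blast
    then show ?thesis using \<epsilon>(1) by (rule order_tendstoD)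
  qed
  have tob: "\<forall>\<^sub>F n in sequentially. gap (point (g n + z)) \<beta> < \<epsilon>" for z
  proof -
    have "gap x (point z) \<noteq> 0" by (rule bseq_gap_point [OF witness_bseq [OF x(1)]])
    then have "cl (point z) \<noteq> \<zeta>"
      using cl_eq_iff [OF witness_cau [OF x(1)] cau_point] x(2) by metis
    moreover have "cl (point z) \<in> floyd_compactification S f v"
      using cau_point unfolding compactification_iff by blast
    ultimately have "limitin (floyd_topology S f v) (\<lambda>n. floyd_act S f v (g n) (cl (point z))) b sequentially"
      by (intro limb) simp
    then have "limitin (floyd_topology S f v) (\<lambda>n. cl (point (g n + z))) (cl \<beta>) sequentially"
      by (simp only: floyd_act_cl [OF cau_point] \<beta>(2))
    then have "(\<lambda>n. gap (point (g n + z)) \<beta>) \<longlonglongrightarrow> 0"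
      using limitin_floyd_iff [OF c(2), of "\<lambda>n. point (g n + z)"] cau_point by blast
    then show ?thesis using \<epsilon>(1) by (rule order_tendstoD)
  qed
  have far: "\<forall>\<^sub>F k in sequentially. \<epsilon> \<le> \<delta> (- g n) z (t k)"
    if t: "cau t" and n: "gap (\<lambda>k. g n + t k) \<alpha> < \<epsilon>" "gap (point (g n + z)) \<beta> < \<epsilon>" for n z t
  proof -
    have ct: "cau (\<lambda>k. g n + t k)" by (rule cau_translate [OF t])
    have "gap \<alpha> \<beta> \<le> gap \<alpha> (\<lambda>k. g n + t k) + gap (\<lambda>k. g n + t k) \<beta>"
      by (rule gap_triangle [OF c(1) ct c(2)])
    also have "gap (\<lambda>k. g n + t k) \<beta> \<le> gap (\<lambda>k. g n + t k) (point (g n + z)) + gap (point (g n + z)) \<beta>"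
      by (rule gap_triangle [OF ct cau_point c(2)])
    finally have "\<epsilon> < gap (point (g n + z)) (\<lambda>k. g n + t k)"
      using n \<epsilon> gap_commute [of \<alpha> "\<lambda>k. g n + t k"] gap_commute [of "point (g n + z)" "\<lambda>k. g n + t k"] by linarith
    from order_tendstoD(1) [OF cau_limit [OF cau_point ct] this]
    show ?thesis
    proof (rule eventually_mono)
      fix k assume "\<epsilon> < \<delta> 0 (g n + z) (g n + t k)"
      moreover have "\<delta> 0 (g n + z) (g n + t k) = \<delta> (- g n) z (t k)"
        using \<delta>_translate [of "g n" "- g n" z "t k"] by simp
      ultimately show "\<epsilon> \<le> \<delta> (- g n) z (t k)" by simp
    qed
  qed
  have pair: "conical_pair x y"
    unfolding conical_pair_def
  proof (intro exI conjI allI)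
    show "0 < \<epsilon>" by (rule \<epsilon>(1))
    fix z
    show "\<forall>\<^sub>F n in sequentially. \<forall>\<^sub>F k in sequentially. \<epsilon> \<le> \<delta> (- g n) z (x k) \<and> \<epsilon> \<le> \<delta> (- g n) z (y k)"
      using toa [OF x] toa [OF y] tob [of z]
    proof eventually_elim
      case (elim n)
      show ?case
        by (intro eventually_conj far witness_cau [OF x(1)] witness_cau [OF y(1)] elim)
    qed
  qed
  show ?thesis
    by (rule conical_martin_limit_unique [where bp = bp, OF exp_decay_of_boundary [OF \<alpha>(1) \<beta>(1) ne] pair])
      (use x(1) y(1) in \<open>simp_all add: witness_def bseq_def escaping_iff\<close>)
qed

end

context floyd_walk
begin

text \<open>A Martin point goes to the class of any witnessing sequence, and
  \<open>witness_gap\<close> makes the choice immaterial. Surjectivity is compactness: a sequence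
  tending to a Floyd boundary point has a subsequence with a Martin limit.\<close>

theorem martin_floyd_map:
  "\<exists>\<pi>. continuous_map (martin_topology S \<mu> bp)
           (subtopology (floyd_topology S f v) (floyd_boundary S f v)) \<pi> \<and>
         \<pi> ` martin_boundary S \<mu> bp = floyd_boundary S f v \<and>
         (\<forall>g. \<forall>h\<in>martin_boundary S \<mu> bp.
            \<pi> (martin_act bp g h) = floyd_act S f v g (\<pi> h)) \<and>
         (\<forall>x. \<forall>h\<in>martin_boundary S \<mu> bp. martin_converges \<mu> bp x h \<longrightarrow>
            limitin (floyd_topology S f v) (\<lambda>n. floyd_embed S f v (x n)) (\<pi> h) sequentially) \<and>
         (\<forall>\<zeta>. conical_point S f v \<zeta> \<longrightarrow>
            (\<exists>h. {h' \<in> martin_boundary S \<mu> bp. \<pi> h' = \<zeta>} = {h}))"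
proof -
  let ?MB = "martin_boundary S \<mu> bp"
  let ?D = "floyd_compactification_dist S f v"
  interpret M: Metric_space "floyd_compactification S f v" ?D
    by (rule Metric_space_floyd_compactification [OF gen ff])
  define \<pi> where "\<pi> h = cl (SOME s. witness bp h s)" for h
  have \<pi>: "\<pi> h = cl s" if s: "witness bp h s" for h s
  proof -
    have t: "witness bp h (SOME s. witness bp h s)" by (rule someI [where P = "witness bp h", OF s])
    show ?thesis
      unfolding \<pi>_def cl_eq_iff [OF witness_cau [OF t] witness_cau [OF s]] by (rule witness_gap [OF t s])
  qed
  have MB: "\<exists>s. witness bp h s \<and> \<pi> h = cl s" if "h \<in> ?MB" for h
    using that \<pi> unfolding martin_boundary_iff by blast
  have mem: "\<pi> h \<in> floyd_boundary S f v" if "h \<in> ?MB" for h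
    using MB [OF that] witness_bseq unfolding boundary_iff by blast
  have compact: "floyd_boundary S f v \<subseteq> floyd_compactification S f v"
    by (auto simp: floyd_boundary_def)
  have top: "topspace (martin_topology S \<mu> bp) = ?MB" by (simp add: martin_topology_def)
  have "continuous_map (martin_topology S \<mu> bp) M.mtopology \<pi>"
    unfolding M.continuous_map_to_metric top
  proof (intro ballI allI impI)
    fix h0 and e :: real assume h0: "h0 \<in> ?MB" and e: "0 < e"
    obtain s0 where s0: "witness bp h0 s0" "\<pi> h0 = cl s0" using MB [OF h0] by blast
    obtain K where K: "1 \<le> K" "\<And>s t. cau s \<Longrightarrow> cau t \<Longrightarrow> ?D (cl s) (cl t) \<le> K * gap s t"
      "\<And>s t. cau s \<Longrightarrow> cau t \<Longrightarrow> gap s t \<le> K * ?D (cl s) (cl t)"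
      by (rule compactification_dist_gap [of v]) blast
    have "0 < e / K" using e K by simp
    from witness_continuous [OF s0(1) this] obtain F \<eta> where F: "finite F \<and> 0 < \<eta> \<and>
        (\<forall>h s. witness bp h s \<longrightarrow> (\<forall>z\<in>F. \<bar>h z - h0 z\<bar> < \<eta>) \<longrightarrow> gap s s0 < e / K)"
      by (elim exE)
    then have close: "witness bp h s \<Longrightarrow> (\<forall>z\<in>F. \<bar>h z - h0 z\<bar> < \<eta>) \<Longrightarrow> gap s s0 < e / K" for h s
      by simp
    define W where "W = {h :: 'a \<Rightarrow> real. \<forall>z\<in>F. \<bar>h z - h0 z\<bar> < \<eta>}"
    have "W = (\<Inter>z\<in>F. {h. \<bar>h z - h0 z\<bar> < \<eta>})" by (auto simp: W_def)
    moreover have "open {h :: 'a \<Rightarrow> real. \<bar>h z - h0 z\<bar> < \<eta>}" for z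
      by (intro open_Collect_less continuous_intros continuous_on_product_coordinates)
    ultimately have "open W" using F by (simp add: open_INT)
    then have "openin (martin_topology S \<mu> bp) (?MB \<inter> W)"
      unfolding martin_topology_def by (rule openin_open_Int)
    moreover have "h0 \<in> ?MB \<inter> W" using h0 F by (simp add: W_def)
    moreover have "\<pi> h \<in> M.mball (\<pi> h0) e" if h: "h \<in> ?MB \<inter> W" for h
    proof -
      obtain s where s: "witness bp h s" "\<pi> h = cl s" using MB h by blast
      have "gap s s0 < e / K" using h by (intro close [OF s(1)]) (simp add: W_def)
      then have "K * gap s0 s < e" using K by (simp add: less_divide_eq mult.commute gap_commute [of s0])
      then have "?D (\<pi> h0) (\<pi> h) < e"
        using K(2) [OF witness_cau [OF s0(1)] witness_cau [OF s(1)]] s s0 by simp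
      then show ?thesis using mem compact h h0 by auto
    qed
    ultimately show "\<exists>U. openin (martin_topology S \<mu> bp) U \<and> h0 \<in> U \<and> (\<forall>h\<in>U. \<pi> h \<in> M.mball (\<pi> h0) e)"
      by blast
  qed
  then have cont: "continuous_map (martin_topology S \<mu> bp)
      (subtopology (floyd_topology S f v) (floyd_boundary S f v)) \<pi>"
    unfolding continuous_map_in_subtopology floyd_topology_def top using mem by auto
  have onto: "\<exists>h\<in>?MB. \<pi> h = X" if "X \<in> floyd_boundary S f v" for X
  proof -
    obtain s where s: "bseq s" "X = cl s" using \<open>X \<in> floyd_boundary S f v\<close> unfolding boundary_iff by blast
    obtain h and r :: "nat \<Rightarrow> nat" where r: "strict_mono r" "witness bp h (s \<circ> r)" by (rule witness_exists [OF s(1)]) blast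
    have "h \<in> ?MB" using r(2) unfolding martin_boundary_iff by blast
    moreover have "\<pi> h = X"
      unfolding s(2) \<pi> [OF r(2)] using s(1) r(1) by (simp add: cl_eq_iff cau_subseq bseq_def)
    ultimately show ?thesis by blast
  qed
  then have surj: "\<pi> ` ?MB = floyd_boundary S f v" using mem by blast
  have act: "\<pi> (martin_act bp g h) = floyd_act S f v g (\<pi> h)" if h: "h \<in> ?MB" for g h
  proof -
    obtain s where s: "witness bp h s" "\<pi> h = cl s" using MB [OF h] by blast
    show ?thesis
      unfolding s(2) floyd_act_cl [OF witness_cau [OF s(1)]] by (rule \<pi> [OF witness_act [OF s(1)]])
  qed
  have conv: "limitin (floyd_topology S f v) (\<lambda>n. floyd_embed S f v (x n)) (\<pi> h) sequentially"
    if h: "h \<in> ?MB" and x: "martin_converges \<mu> bp x h" for x h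
  proof -
    obtain s where s: "witness bp h s" "\<pi> h = cl s" using MB [OF h] by blast
    have "(\<lambda>n. gap (point (x n)) s) \<longlonglongrightarrow> 0"
      using x by (intro martin_limit_gap_tendsto [OF _ _ s(1)]) (simp_all add: martin_converges_def escaping_iff)
    then show ?thesis
      unfolding floyd_embed_eq s(2) by (subst limitin_floyd_iff [OF witness_cau [OF s(1)] cau_point])
  qed
  have conical: "\<exists>h. {h' \<in> ?MB. \<pi> h' = \<zeta>} = {h}" if con: "conical_point S f v \<zeta>" for \<zeta>
  proof -
    have "\<zeta> \<in> floyd_boundary S f v" using con unfolding conical_point_def by blast
    then obtain h where h: "h \<in> ?MB" "\<pi> h = \<zeta>" using onto by blast
    obtain x where x: "witness bp h x" "\<pi> h = cl x" using MB [OF h(1)] by blast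
    have "h' \<in> {h' \<in> ?MB. \<pi> h' = \<zeta>} \<longleftrightarrow> h' \<in> {h}" for h'
    proof
      assume "h' \<in> {h' \<in> ?MB. \<pi> h' = \<zeta>}"
      then have h': "h' \<in> ?MB" "\<pi> h' = \<zeta>" by auto
      obtain y where y: "witness bp h' y" "\<pi> h' = cl y" using MB [OF h'(1)] by blast
      have "h' = h"
        by (rule conical_point_unique [OF con y(1) _ x(1)]) (simp_all only: h h' flip: x(2) y(2))
      then show "h' \<in> {h}" by (simp only: singleton_iff)
    next
      assume "h' \<in> {h}"
      then have "h' = h" by (simp only: singleton_iff)
      with h show "h' \<in> {h' \<in> ?MB. \<pi> h' = \<zeta>}" by (simp only: mem_Collect_eq simp_thms)
    qed
    note eq = this
    show ?thesis by (rule exI [of _ h], rule set_eqI, rule eq)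
  qed
  show ?thesis
  proof (rule exI [of _ \<pi>], intro conjI allI ballI impI)
  qed (fact cont surj | erule act | erule (1) conv | erule conical)+
qed

end

lemma finite_support_moment:
  assumes "finite (set_pmf \<mu>)"
  shows "(\<integral>\<^sup>+ s. ennreal (K ^ word_norm S s) \<partial>measure_pmf \<mu>) < \<infinity>"
proof -
  have "(\<Sum>s\<in>set_pmf \<mu>. ennreal (K ^ word_norm S s) * ennreal (pmf \<mu> s)) < \<top>"
    using assms by (simp add: ennreal_mult_less_top)
  then show ?thesis by (simp add: nn_integral_measure_pmf_finite [OF assms])
qed

lemma superexp_moment_imp_moment:
  assumes "superexp_moment S \<mu>" "1 \<le> (K :: real)"
  shows "(\<integral>\<^sup>+ s. ennreal (K ^ word_norm S s) \<partial>measure_pmf \<mu>) < \<infinity>"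
proof -
  \<comment> \<open>\<open>superexp_moment\<close> speaks of bases above 1, while \<open>K\<close>
    may equal 1; hence the base \<open>K + 1\<close>.\<close>
  let ?F = "\<lambda>g. (K + 1) ^ word_norm S g * pmf \<mu> g"
  have "?F summable_on UNIV" using assms unfolding superexp_moment_def by simp
  then have "(\<lambda>g. norm (?F g)) summable_on UNIV" using assms(2) by simp
  then have "integrable (count_space UNIV) ?F"
    unfolding abs_summable_equivalent Infinite_Set_Sum.abs_summable_on_def .
  then have fin: "(\<integral>\<^sup>+ g. ennreal (norm (?F g)) \<partial>count_space UNIV) < \<infinity>"
    unfolding integrable_iff_bounded by blast
  have "(\<integral>\<^sup>+ s. ennreal (K ^ word_norm S s) \<partial>measure_pmf \<mu>) \<le> (\<integral>\<^sup>+ g. ennreal (norm (?F g)) \<partial>count_space UNIV)"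
    unfolding nn_integral_measure_pmf
  proof (rule nn_integral_mono)
    fix g
    have "pmf \<mu> g * K ^ word_norm S g \<le> norm (?F g)"
      using assms(2) mult_left_mono [OF power_mono [of K "K + 1" "word_norm S g"] pmf_nonneg [of \<mu> g]]
      by (simp add: mult.commute)
    then show "ennreal (pmf \<mu> g) * ennreal (K ^ word_norm S g) \<le> ennreal (norm (?F g))"
      using assms(2) by (simp add: ennreal_mult [symmetric] ennreal_leI)
  qed
  then show ?thesis using fin by (rule order_le_less_trans)
qed

theorem theorem1p3:
  fixes S :: "'a::group_add set" and f :: "real \<Rightarrow> real" and \<mu> :: "'a pmf" and bp v :: 'a
  assumes "infinite (UNIV :: 'a set)"
    and "sym_gen_set S"
    and "floyd_function f"
    and "semigroup_generates (set_pmf \<mu>)"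
    and "transient \<mu>"
    and "finite (set_pmf \<mu>) \<or>
         (superexp_moment S \<mu> \<and>
          (\<exists>\<alpha>>0. ((\<lambda>x. x powr (2 + \<alpha>) * f x) \<longlongrightarrow> 0) at_top))"
  shows "\<exists>\<pi>. continuous_map (martin_topology S \<mu> bp)
               (subtopology (floyd_topology S f v) (floyd_boundary S f v)) \<pi> \<and>
             \<pi> ` martin_boundary S \<mu> bp = floyd_boundary S f v \<and>
             (\<forall>g. \<forall>h\<in>martin_boundary S \<mu> bp.
                \<pi> (martin_act bp g h) = floyd_act S f v g (\<pi> h)) \<and>
             (\<forall>x. \<forall>h\<in>martin_boundary S \<mu> bp. martin_converges \<mu> bp x h \<longrightarrow>
                limitin (floyd_topology S f v) (\<lambda>n. floyd_embed S f v (x n)) (\<pi> h) sequentially) \<and>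
             (\<forall>\<zeta>. conical_point S f v \<zeta> \<longrightarrow>
                (\<exists>h. {h' \<in> martin_boundary S \<mu> bp. \<pi> h' = \<zeta>} = {h}))"
proof -
  have "superexp_walk S \<mu>"
  proof (rule superexp_walk.intro)
    fix K :: real assume "1 \<le> K"
    then show "(\<integral>\<^sup>+ s. ennreal (K ^ word_norm S s) \<partial>measure_pmf \<mu>) < \<infinity>"
      using assms(6) finite_support_moment [of \<mu> K S] superexp_moment_imp_moment [of S \<mu> K] by blast
  qed (rule assms)+
  moreover have "floyd S f" using assms by (intro floyd.intro)
  ultimately interpret floyd_walk S \<mu> f by (rule floyd_walk.intro)
  show ?thesis by (rule martin_floyd_map)
qed

end
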